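(* Assume either ($h\ge0$ and $0<\beta<\beta_0$) or ($h=0$ and $0<\beta<\beta_c$). Then for $i=0,1,2$ the limits $$N\cdot U(i)\to\Sigma(i)\qquad\text{as }N\to\infty$$ exist, and the matrices $\Sigma(0),\Sigma(1),\Sigma(2)$ satisfy $$\Sigma(0)-2\Sigma(1)+\Sigma(2)=\Gamma(I-\beta^2\Delta^2\Lambda\Gamma)^{-1}\Lambda^{-1},$$ $$3\Sigma(0)-4\Sigma(1)+\Sigma(2)=\Gamma'(I-\beta^2\Delta^2\Lambda\Gamma')^{-1}\Lambda^{-1}.$$
   Context: Multi-species SK model. $m\ge2$; $\Delta^2=(\Delta^2_{s,t})_{s,t=1}^m$ is a symmetric invertible nonzero real matrix with non-negative entries (not necessarily positive-definite). For each $N$, $\{1,\dots,N\}$ is partitioned into disjoint species $I_1,\dots,I_m$ with $|I_s|=\lambda_sN$, where the ratios $\lambda_s\in(0,1)$ are fixed; $\Lambda=\mathrm{diag}(\lambda_1,\dots,\lambda_m)$. The disorder $(g_{ij})_{1\le i<j\le N}$ consists of independent centered Gaussians with $\mathbb E g_{ij}^2=\Delta^2_{s,t}$ when $i\in I_s$, $j\in I_t$. For $\sigma\in\{-1,1\}^N$, $H_N(\sigma)=\frac{\beta}{\sqrt N}\sum_{i<j}g_{ij}\sigma_i\sigma_j+h\sum_i\sigma_i$, $Z_N=\sum_\sigma e^{H_N(\sigma)}$, and the Gibbs measure is $G_N(\sigma)=e^{H_N(\sigma)}/Z_N$. $\langle\cdot\rangle$ is the average over i.i.d. replicas $\sigma^1,\sigma^2,\dots$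 from $G_N$ and $\nu(\cdot)=\mathbb E\langle\cdot\rangle$. Overlap vectors: $\mathbf R_{\ell\ell'}=(R^{(1)}_{\ell\ell'},\dots,R^{(m)}_{\ell\ell'})^{\top}$, $R^{(s)}_{\ell\ell'}=\frac1{|I_s|}\sum_{i\in I_s}\sigma_i^\ell\sigma_i^{\ell'}$. $\beta_c=\rho(\Delta^2\Lambda)^{-1/2}$ ($\rho$ the spectral radius), $\beta_0=\beta_c/\sqrt{4\alpha}$, $\alpha=1+\mathbf 1\{\Delta^2\text{ is indefinite}\}$. $\mathbf q\in[0,1]^m$ is the unique solution (unique since $\beta<\beta_c$) of $q_s=\mathbb E\tanh^2(\beta\eta\sqrt{(\Delta^2\Lambda\mathbf q)_s}+h)$, $s=1,\dots,m$, $\eta\sim N(0,1)$; $\hat q_s=\mathbb E\tanh^4(\beta\eta\sqrt{(\Delta^2\Lambda\mathbf q)_s}+h)$; $\overline{\mathbf R}_{\ell\ell'}=\mathbf R_{\ell\ell'}-\mathbf q$. $\Gamma,\Gamma'$ are the diagonal matrices with $s$-th diagonal entries $\gamma_s=1-2q_s+\hat q_s$ and $\gamma'_s=1-4q_s+3\hat q_s$. $U(0)=\nu(\overline{\mathbf R}_{12}\overline{\mathbf R}_{34}^{\top})$, $U(1)=\nu(\overline{\mathbf R}_{12}\overline{\mathbf R}_{13}^{\top})$, $U(2)=\nu(\overline{\mathbf R}_{12}\overline{\mathbf R}_{12}^{\top})$ (depending on $N$). *)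

theory Defs
  imports "HOL-Probability.Probability"
begin

section \<open>Matrices\<close>

definition diagonal :: "real^'m \<Rightarrow> real^'m^'m" where
  "diagonal v = (\<chi> s t. if s = t then v $ s else 0)"

definition complex_spectrum :: "real^'m^'m \<Rightarrow> complex set" where
  "complex_spectrum A =
     {z. \<exists>v::complex^'m. v \<noteq> 0 \<and> (\<chi> s t. complex_of_real (A $ s $ t)) *v v = z *s v}"

definition spectral_radius :: "real^'m^'m \<Rightarrow> real" where
  "spectral_radius A = Max (cmod ` complex_spectrum A)"

definition indefinite :: "real^'m^'m \<Rightarrow> bool" where
  "indefinite A \<longleftrightarrow> (\<exists>x. x \<bullet> (A *v x) > 0) \<and> (\<exists>y. y \<bullet> (A *v y) < 0)"


section \<open>Gaussian variables\<close>

text \<open>The centered Gaussian law of variance \<open>v\<close>. It is a push-forward rather than a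
  \<open>normal_density\<close> because \<open>v = 0\<close> is allowed and must give the point mass at \<open>0\<close>.\<close>

definition centered_gaussian :: "real \<Rightarrow> real measure" where
  "centered_gaussian v = distr std_normal_distribution borel (\<lambda>x. sqrt v * x)"

definition gauss_expectation :: "(real \<Rightarrow> real) \<Rightarrow> real" where
  "gauss_expectation f = (\<integral>x. f x \<partial>std_normal_distribution)"


section \<open>Gibbs measure and replicas\<close>

text \<open>The sites are \<open>1, \<dots>, N\<close>; the disorder \<open>g i j\<close> is only read for \<open>1 \<le> i < j \<le> N\<close>.\<close>

definition spin_configs :: "nat \<Rightarrow> (nat \<Rightarrow> real) set" where
  "spin_configs N = {1..N} \<rightarrow>\<^sub>E {-1, 1}"

definition hamiltonian ::
  "real \<Rightarrow> real \<Rightarrow> nat \<Rightarrow> (nat \<Rightarrow> nat \<Rightarrow> real) \<Rightarrow> (nat \<Rightarrow> real) \<Rightarrow> real" where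
  "hamiltonian \<beta> h N g \<sigma> =
     \<beta> / sqrt (real N) * (\<Sum>j\<in>{1..N}. \<Sum>i\<in>{1..<j}. g i j * \<sigma> i * \<sigma> j)
       + h * (\<Sum>i\<in>{1..N}. \<sigma> i)"

definition partition_function ::
  "real \<Rightarrow> real \<Rightarrow> nat \<Rightarrow> (nat \<Rightarrow> nat \<Rightarrow> real) \<Rightarrow> real" where
  "partition_function \<beta> h N g = (\<Sum>\<sigma>\<in>spin_configs N. exp (hamiltonian \<beta> h N g \<sigma>))"

definition gibbs_weight ::
  "real \<Rightarrow> real \<Rightarrow> nat \<Rightarrow> (nat \<Rightarrow> nat \<Rightarrow> real) \<Rightarrow> (nat \<Rightarrow> real) \<Rightarrow> real" where
  "gibbs_weight \<beta> h N g \<sigma> = exp (hamiltonian \<beta> h N g \<sigma>) / partition_function \<beta> h N g"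

text \<open>Average of a function of \<open>n\<close> i.i.d. replicas; replica \<open>l\<close> is \<open>\<tau> l\<close> for \<open>1 \<le> l \<le> n\<close>.\<close>

definition replica_average ::
  "real \<Rightarrow> real \<Rightarrow> nat \<Rightarrow> (nat \<Rightarrow> nat \<Rightarrow> real) \<Rightarrow> nat \<Rightarrow> ((nat \<Rightarrow> nat \<Rightarrow> real) \<Rightarrow> real) \<Rightarrow> real" where
  "replica_average \<beta> h N g n f =
     (\<Sum>\<tau>\<in>{1..n} \<rightarrow>\<^sub>E spin_configs N. (\<Prod>l\<in>{1..n}. gibbs_weight \<beta> h N g (\<tau> l)) * f \<tau>)"

definition nu ::
  "real \<Rightarrow> real \<Rightarrow> nat \<Rightarrow> 'w measure \<Rightarrow> (nat \<Rightarrow> nat \<Rightarrow> 'w \<Rightarrow> real)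
     \<Rightarrow> nat \<Rightarrow> ((nat \<Rightarrow> nat \<Rightarrow> real) \<Rightarrow> real) \<Rightarrow> real" where
  "nu \<beta> h N M g n f = (\<integral>\<omega>. replica_average \<beta> h N (\<lambda>i j. g i j \<omega>) n f \<partial>M)"


section \<open>Overlaps\<close>

definition overlap ::
  "('m \<Rightarrow> nat set) \<Rightarrow> (nat \<Rightarrow> nat \<Rightarrow> real) \<Rightarrow> nat \<Rightarrow> nat \<Rightarrow> real^'m" where
  "overlap I \<tau> l l' = (\<chi> s. (\<Sum>i\<in>I s. \<tau> l i * \<tau> l' i) / real (card (I s)))"

text \<open>\<open>\<nu>(\<R>\<^bsub>12\<^esub> \<R>\<^bsub>kk'\<^esub>\<^sup>T)\<close> for the centered overlaps \<open>\<R> = overlap - q\<close>, with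
  \<open>(k, k') = (3, 4), (1, 3), (1, 2)\<close> for \<open>i = 0, 1, 2\<close>. The index \<open>i\<close> is the number of
  replicas shared by the two overlaps. Four replicas suffice in all three cases.\<close>

definition second_replica_pair :: "nat \<Rightarrow> nat \<times> nat" where
  "second_replica_pair i = (if i = 0 then (3, 4) else if i = 1 then (1, 3) else (1, 2))"

definition U ::
  "real \<Rightarrow> real \<Rightarrow> real^'m \<Rightarrow> nat \<Rightarrow> ('m \<Rightarrow> nat set) \<Rightarrow> 'w measure
     \<Rightarrow> (nat \<Rightarrow> nat \<Rightarrow> 'w \<Rightarrow> real) \<Rightarrow> nat \<Rightarrow> real^'m^'m" where
  "U \<beta> h q N I M g i =
     (let (k, k') = second_replica_pair i in
      \<chi> s t. nu \<beta> h N M g 4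
        (\<lambda>\<tau>. (overlap I \<tau> 1 2 - q) $ s * (overlap I \<tau> k k' - q) $ t))"


section \<open>Multi-species model\<close>

text \<open>Species of exact sizes \<open>\<lambda>\<^sub>s N\<close> exist only for those \<open>N\<close> for which all these numbers
  are integers, so the limit \<open>N \<rightarrow> \<infinity>\<close> runs through these \<open>N\<close>.\<close>

definition system_sizes :: "real^'m \<Rightarrow> nat set" where
  "system_sizes lam = {N. N \<ge> 1 \<and> (\<forall>s. lam $ s * real N \<in> \<nat>)}"

definition species_partition :: "real^'m \<Rightarrow> nat \<Rightarrow> ('m \<Rightarrow> nat set) \<Rightarrow> bool" where
  "species_partition lam N I \<longleftrightarrow>
     (\<Union>s. I s) = {1..N} \<and> disjoint_family I \<and> (\<forall>s. real (card (I s)) = lam $ s * real N)"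

definition gaussian_disorder ::
  "real^'m^'m \<Rightarrow> nat \<Rightarrow> ('m \<Rightarrow> nat set) \<Rightarrow> 'w measure \<Rightarrow> (nat \<Rightarrow> nat \<Rightarrow> 'w \<Rightarrow> real) \<Rightarrow> bool" where
  "gaussian_disorder D N I M g \<longleftrightarrow>
     prob_space M \<and>
     prob_space.indep_vars M (\<lambda>_. borel) (\<lambda>(i, j). g i j) {(i, j). 1 \<le> i \<and> i < j \<and> j \<le> N} \<and>
     (\<forall>s t. \<forall>i\<in>I s. \<forall>j\<in>I t. i < j \<longrightarrow> distr M borel (g i j) = centered_gaussian (D $ s $ t))"

definition beta_c :: "real^'m^'m \<Rightarrow> real^'m \<Rightarrow> real" where
  "beta_c D lam = spectral_radius (D ** diagonal lam) powr (- 1 / 2)"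

definition alpha :: "real^'m^'m \<Rightarrow> real" where
  "alpha D = 1 + of_bool (indefinite D)"

definition beta_0 :: "real^'m^'m \<Rightarrow> real^'m \<Rightarrow> real" where
  "beta_0 D lam = beta_c D lam / sqrt (4 * alpha D)"

definition tanh_moment ::
  "real \<Rightarrow> real \<Rightarrow> real^'m^'m \<Rightarrow> real^'m \<Rightarrow> nat \<Rightarrow> real^'m \<Rightarrow> real^'m" where
  "tanh_moment \<beta> h D lam p q =
     (\<chi> s. gauss_expectation
       (\<lambda>x. tanh (\<beta> * x * sqrt (((D ** diagonal lam) *v q) $ s) + h) ^ p))"

end

theory Submission
  imports Defs "HOL-Real_Asymp.Real_Asymp"
begin

text \<open>
Why the theorem holds. The centered overlap of species \<open>s\<close> is an average over its sites, so the
entry \<open>(s, t)\<close> of \<open>U a\<close> is the average over the sites \<open>i\<close> of species \<open>s\<close> of \<open>\<nu>((\<sigma>\<^sub>1 \<sigma>\<^sub>2 - q\<^sub>s) Rbar\<^sub>t)\<close>, where \<open>\<sigma>\<^sub>1\<close>, \<open>\<sigma>\<^sub>2\<close> are the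
spins at \<open>i\<close> in two replicas and \<open>Rbar\<^sub>t\<close> is a centered overlap of species \<open>t\<close>. The couplings of site \<open>i\<close> are replaced
continuously by an independent Gaussian field of variance \<open>\<beta>\<^sup>2 (D \<Lambda> q)\<^sub>s\<close>. At the decoupled end the spin at \<open>i\<close> has
mean \<open>tanh\<close> of its field, and the equation for \<open>q\<close> makes the leading term vanish. A first-order Taylor
expansion in the path parameter then expresses \<open>U a\<close> linearly through \<open>U 0\<close>, \<open>U 1\<close>, \<open>U 2\<close> with
coefficients \<open>1 - q\<^sup>2\<close>, \<open>q - q\<^sup>2\<close>, \<open>qhat - q\<^sup>2\<close>, plus a diagonal term of order \<open>1/N\<close> that comes from site \<open>i\<close>
itself, and an error bounded by third moments of the overlaps (\<open>site_equation\<close>, \<open>species_equation\<close>).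

The error is \<open>O(N\<^sup>-\<^sup>3\<^sup>/\<^sup>2)\<close> as soon as \<open>N Rbar\<^sup>2\<close> has a bounded second moment. There are two routes to that bound.
With an external field, exponential moments of \<open>N Rbar\<^sup>2\<close> are compared with the ones of
independent spins: along the interpolation the unwanted replica terms are dominated by the diagonal one
because a nondecreasing function of an overlap is positively correlated with it
(\<open>overlap_moment_interpolation\<close>). The terms have both signs; the negative ones can be dropped when the quadratic form of \<open>D\<close> is nonnegative
and cost a factor two otherwise, which is the role of \<open>\<alpha>\<close>. Without a field \<open>q = 0\<close>, the annealed
second moment stays bounded up to \<open>\<beta>\<^sub>c\<close> after normalisation, and a differential inequality shows that \<open>log (Z / E Z)\<close> has a bounded
second moment, so annealed exponential moments control quenched ones (\<open>overlap_second_moment_no_field\<close>).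

In the limit \<open>N U a\<close> satisfies a closed linear system (\<open>overlap_system_limit\<close>). Its combinations
\<open>U 0 - 2 U 1 + U 2\<close> and \<open>3 U 0 - 4 U 1 + U 2\<close> decouple, with the matrices
\<open>I - \<beta>\<^sup>2 \<Gamma> D \<Lambda>\<close> and \<open>I - \<beta>\<^sup>2 \<Gamma>' D \<Lambda>\<close>; given these two, \<open>U 0\<close> solves an equation with the second matrix.
Both matrices are invertible because the entries of \<open>\<Gamma>\<close>, \<open>\<Gamma>'\<close> are at most \<open>1\<close> in absolute value and
\<open>\<beta>\<^sup>2\<close> times the spectral radius of \<open>D \<Lambda>\<close> is below \<open>1\<close> (\<open>invertible_subcritical\<close>).

All interpolations weight the Gaussian variables by \<open>sin t\<close> and \<open>cos t\<close> with \<open>0 \<le> t \<le> \<pi>/2\<close>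
instead of by square roots of a time in \<open>[0, 1]\<close>, so that the paths are smooth at both ends.
\<close>

section \<open>Gaussian calculus\<close>

abbreviation gaussians :: "'k set \<Rightarrow> ('k \<Rightarrow> real) measure" where
  "gaussians K \<equiv> PiM K (\<lambda>_. std_normal_distribution)"

lemma prob_space_std_normal: "prob_space std_normal_distribution"
  by (rule prob_space_normal_density) simp

interpretation std_normal: prob_space std_normal_distribution
  by (rule prob_space_std_normal)

interpretation gaussian_product: product_prob_space "\<lambda>_. std_normal_distribution" J for J
  by unfold_locales

lemma prob_space_gaussians: "prob_space (gaussians K)"
  by (rule prob_space_PiM) (rule prob_space_std_normal)

lemma measurable_gaussians_component[measurable (raw)]:
  "k \<in> K \<Longrightarrow> (\<lambda>x. x k) \<in> borel_measurable (gaussians K)"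
  using measurable_component_singleton[of k K "\<lambda>_. std_normal_distribution"] by simp

lemma integrable_std_normal_linear_growth:
  fixes f :: "real \<Rightarrow> real"
  assumes "f \<in> borel_measurable borel" "\<And>u. \<bar>f u\<bar> \<le> C * (1 + \<bar>u\<bar>)"
  shows "integrable std_normal_distribution f"
    and "integrable std_normal_distribution (\<lambda>u. u * f u)"
proof -
  have 1: "integrable std_normal_distribution (\<lambda>u. \<bar>u\<bar>)"
    using integrable_std_normal_distribution_moment[of 1] by (simp add: integrable_abs)
  have 2: "integrable std_normal_distribution (\<lambda>u. u^2)"
    using integrable_std_normal_distribution_moment[of 2] .
  have C: "C \<ge> 0" using assms(2)[of 0] by simp
  have "integrable std_normal_distribution (\<lambda>u. C * (1 + \<bar>u\<bar>))"
    using 1 by auto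
  then show "integrable std_normal_distribution f"
    by (rule Bochner_Integration.integrable_bound) (use assms in \<open>auto intro!: AE_I2 intro: order_trans[OF _ abs_ge_self]\<close>)
  have "integrable std_normal_distribution (\<lambda>u. C * (\<bar>u\<bar> + u^2))"
    using 1 2 by auto
  then show "integrable std_normal_distribution (\<lambda>u. u * f u)"
  proof (rule Bochner_Integration.integrable_bound)
    show "(\<lambda>u. u * f u) \<in> borel_measurable std_normal_distribution" using assms by simp
    show "AE u in std_normal_distribution. norm (u * f u) \<le> norm (C * (\<bar>u\<bar> + u^2))"
    proof (rule AE_I2)
      fix u :: real
      have "\<bar>u\<bar> * \<bar>f u\<bar> \<le> \<bar>u\<bar> * (C * (1 + \<bar>u\<bar>))" using assms(2) by (intro mult_left_mono) auto
      also have "\<dots> = C * (\<bar>u\<bar> + u^2)" by (simp add: algebra_simps power2_eq_square)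
      finally show "norm (u * f u) \<le> norm (C * (\<bar>u\<bar> + u^2))" using C by (simp add: abs_mult)
    qed
  qed
qed

lemma gaussian_ibp_real:
  fixes f f' :: "real \<Rightarrow> real"
  assumes d: "\<And>u. (f has_real_derivative f' u) (at u)"
    and c: "continuous_on UNIV f'"
    and b: "\<And>u. \<bar>f u\<bar> \<le> C * (1 + \<bar>u\<bar>)" "\<And>u. \<bar>f' u\<bar> \<le> C * (1 + \<bar>u\<bar>)"
  shows "(\<integral>u. u * f u \<partial>std_normal_distribution) = (\<integral>u. f' u \<partial>std_normal_distribution)"
proof -
  have C: "C \<ge> 0" using b(1)[of 0] by simp
  have cf: "continuous_on UNIV f" using d by (auto intro!: continuous_at_imp_continuous_on DERIV_isCont)
  have mf: "f \<in> borel_measurable borel" "f' \<in> borel_measurable borel"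
    using cf c by (auto intro: borel_measurable_continuous_onI)
  have i: "integrable std_normal_distribution (\<lambda>u. u * f u)" "integrable std_normal_distribution f'"
    using integrable_std_normal_linear_growth[OF mf(1) b(1)] integrable_std_normal_linear_growth[OF mf(2) b(2)] by auto
  let ?p = std_normal_density
  have il: "integrable lborel (\<lambda>u. ?p u * (u * f u))" "integrable lborel (\<lambda>u. ?p u * f' u)"
    using i mf by (auto simp: integrable_density)
  have dp: "(?p has_real_derivative (- u * ?p u)) (at u)" for u
    unfolding std_normal_density_def by (auto intro!: derivative_eq_intros simp: field_simps)
  define F where "F = (\<lambda>u. - (?p u * f u))"
  have dF: "(F has_real_derivative (?p u * (u * f u) - ?p u * f' u)) (at u)" for u
    unfolding F_def by (rule derivative_eq_intros dp d refl)+ (simp add: algebra_simps)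
  have lim: "((\<lambda>u. ?p u * (C * (1 + \<bar>u\<bar>))) \<longlongrightarrow> 0) at_top" "((\<lambda>u. ?p u * (C * (1 + \<bar>u\<bar>))) \<longlongrightarrow> 0) at_bot"
  proof -
    have *: "((\<lambda>u::real. exp (- u\<^sup>2 / 2) * (1 + \<bar>u\<bar>)) \<longlongrightarrow> 0) at_top"
    proof (rule Lim_null_comparison)
      show "\<forall>\<^sub>F u in at_top. norm (exp (- u\<^sup>2 / 2) * (1 + \<bar>u\<bar>)) \<le> 4 / u"
      proof (rule eventually_mono[OF eventually_ge_at_top[of 1]])
        fix u :: real assume u: "u \<ge> 1"
        have "1 + u\<^sup>2/2 \<le> exp (u\<^sup>2/2)" by (rule exp_ge_add_one_self)
        then have "u\<^sup>2 \<le> exp (u\<^sup>2/2) * 2" by linarith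
        then have "exp (-u\<^sup>2/2) \<le> 2 / u\<^sup>2" using u by (simp add: exp_minus field_simps)
        then have "exp (-u\<^sup>2/2) * (1 + \<bar>u\<bar>) \<le> 2 / u\<^sup>2 * (2 * u)" using u by (intro mult_mono) auto
        also have "\<dots> = 4 / u" using u by (simp add: field_simps power2_eq_square)
        finally show "norm (exp (- u\<^sup>2 / 2) * (1 + \<bar>u\<bar>)) \<le> 4 / u" using u by simp
      qed
      show "((\<lambda>u::real. 4 / u) \<longlongrightarrow> 0) at_top"
        by (intro tendsto_divide_0[OF tendsto_const] filterlim_at_top_imp_at_infinity filterlim_ident)
    qed
    from tendsto_mult_left[OF this, of "C / sqrt (2*pi)"]
    show 1: "((\<lambda>u. ?p u * (C * (1 + \<bar>u\<bar>))) \<longlongrightarrow> 0) at_top"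
      by (simp add: std_normal_density_def mult_ac)
    then show "((\<lambda>u. ?p u * (C * (1 + \<bar>u\<bar>))) \<longlongrightarrow> 0) at_bot"
      by (subst filterlim_at_bot_mirror) (simp add: std_normal_density_def)
  qed
  have Fb: "norm (F u) \<le> ?p u * (C * (1 + \<bar>u\<bar>))" for u
    unfolding F_def using b(1)[of u] by (simp add: abs_mult mult_left_mono)
  have Ft: "(F \<longlongrightarrow> 0) at_top" "(F \<longlongrightarrow> 0) at_bot"
    by (rule Lim_null_comparison[OF always_eventually lim(1)], use Fb in auto)
       (rule Lim_null_comparison[OF always_eventually lim(2)], use Fb in auto)
  have "(LBINT u=-\<infinity>..\<infinity>. ?p u * (u * f u) - ?p u * f' u) = 0 - 0"
  proof (rule interval_integral_FTC_integrable[where F=F])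
    fix u :: real
    show "(F has_vector_derivative ?p u * (u * f u) - ?p u * f' u) (at u)"
      using dF by (simp add: has_real_derivative_iff_has_vector_derivative)
    have "isCont ?p u" using dp by (rule DERIV_isCont)
    moreover have "isCont f u" "isCont f' u" using cf c by (auto simp: continuous_on_eq_continuous_at)
    ultimately show "isCont (\<lambda>u. ?p u * (u * f u) - ?p u * f' u) u" by (intro continuous_intros)
  next
    show "set_integrable lborel (einterval (-\<infinity>) \<infinity>) (\<lambda>u. ?p u * (u * f u) - ?p u * f' u)"
      using il by (simp add: set_integrable_def)
    show "((F \<circ> real_of_ereal) \<longlongrightarrow> 0) (at_left \<infinity>)" "((F \<circ> real_of_ereal) \<longlongrightarrow> 0) (at_right (-\<infinity>))"
      using Ft by (simp_all add: ereal_tendsto_simps)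
  qed simp
  then have "(\<integral>u. ?p u * (u * f u) - ?p u * f' u \<partial>lborel) = 0"
    by (simp add: interval_lebesgue_integral_def set_lebesgue_integral_def)
  then have "(\<integral>u. ?p u * (u * f u) \<partial>lborel) = (\<integral>u. ?p u * f' u \<partial>lborel)"
    using il by simp
  then show ?thesis using mf by (simp add: integral_density)
qed

lemma integrable_gaussians_component:
  fixes f :: "real \<Rightarrow> real"
  assumes "k \<in> K" "integrable std_normal_distribution f"
  shows "integrable (gaussians K) (\<lambda>x. f (x k))"
proof -
  have "distr (gaussians K) std_normal_distribution (\<lambda>x. x k) = std_normal_distribution"
    using gaussian_product.PiM_component[OF assms(1)] .
  then show ?thesis
    using integrable_distr[of "\<lambda>x. x k" "gaussians K" std_normal_distribution f] assms by simp
qed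

lemma integrable_gaussians_moment:
  assumes "k \<in> K" "finite K"
  shows "integrable (gaussians K) (\<lambda>x. \<bar>x k\<bar>)"
    and "integrable (gaussians K) (\<lambda>x. \<bar>x k\<bar> * (\<Sum>j\<in>K. \<bar>x j\<bar>))"
    and "integrable (gaussians K) (\<lambda>x. (x k)\<^sup>2)"
proof -
  have 1: "integrable std_normal_distribution (\<lambda>u. \<bar>u\<bar>)"
    using integrable_std_normal_distribution_moment[of 1] by (simp add: integrable_abs)
  have 2: "integrable std_normal_distribution (\<lambda>u. u^2)"
    using integrable_std_normal_distribution_moment[of 2] .
  show "integrable (gaussians K) (\<lambda>x. \<bar>x k\<bar>)"
    using integrable_gaussians_component[OF assms(1) 1] .
  have i2: "j \<in> K \<Longrightarrow> integrable (gaussians K) (\<lambda>x. (x j)\<^sup>2)" for j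
    using integrable_gaussians_component[OF _ 2] .
  then show "integrable (gaussians K) (\<lambda>x. (x k)\<^sup>2)" using assms by auto
  have "integrable (gaussians K) (\<lambda>x. \<Sum>j\<in>K. \<bar>x k\<bar> * \<bar>x j\<bar>)"
  proof (rule Bochner_Integration.integrable_sum)
    fix j assume j: "j \<in> K"
    have "integrable (gaussians K) (\<lambda>x. (x k)\<^sup>2 + (x j)\<^sup>2)" using i2 assms j by auto
    then show "integrable (gaussians K) (\<lambda>x. \<bar>x k\<bar> * \<bar>x j\<bar>)"
    proof (rule Bochner_Integration.integrable_bound)
      show "(\<lambda>x. \<bar>x k\<bar> * \<bar>x j\<bar>) \<in> borel_measurable (gaussians K)" using assms j by measurable
      have "\<bar>a\<bar> * \<bar>b\<bar> \<le> a\<^sup>2 + b\<^sup>2" for a b :: real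
      proof -
        have "2 * (\<bar>a\<bar> * \<bar>b\<bar>) \<le> a\<^sup>2 + b\<^sup>2"
          using sum_squares_bound[of "\<bar>a\<bar>" "\<bar>b\<bar>"] by (simp add: mult.assoc)
        moreover have "0 \<le> \<bar>a\<bar> * \<bar>b\<bar>" by simp
        ultimately show ?thesis by linarith
      qed
      then show "AE x in gaussians K. norm (\<bar>x k\<bar> * \<bar>x j\<bar>) \<le> norm ((x k)\<^sup>2 + (x j)\<^sup>2)"
        by (auto simp: abs_mult)
    qed
  qed
  then show "integrable (gaussians K) (\<lambda>x. \<bar>x k\<bar> * (\<Sum>j\<in>K. \<bar>x j\<bar>))" by (simp add: sum_distrib_left)
qed

lemma integrable_gaussians_linear_growth:
  fixes F :: "('k \<Rightarrow> real) \<Rightarrow> real"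
  assumes K: "finite K" and F: "F \<in> borel_measurable (gaussians K)"
    and b: "\<And>x. \<bar>F x\<bar> \<le> C * (1 + (\<Sum>j\<in>K. \<bar>x j\<bar>))"
  shows "integrable (gaussians K) F"
    and "k \<in> K \<Longrightarrow> integrable (gaussians K) (\<lambda>x. x k * F x)"
proof -
  interpret P: prob_space "gaussians K" by (rule prob_space_gaussians)
  have C: "C \<ge> 0" using b[of "\<lambda>_. 0"] by simp
  have "integrable (gaussians K) (\<lambda>x. C * (1 + (\<Sum>j\<in>K. \<bar>x j\<bar>)))"
    using integrable_gaussians_moment(1)[OF _ K] by auto
  then show "integrable (gaussians K) F"
    by (rule Bochner_Integration.integrable_bound) (use F b in \<open>auto intro!: AE_I2 intro: order_trans[OF _ abs_ge_self]\<close>)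
  assume k: "k \<in> K"
  have "integrable (gaussians K) (\<lambda>x. C * (\<bar>x k\<bar> + \<bar>x k\<bar> * (\<Sum>j\<in>K. \<bar>x j\<bar>)))"
    using integrable_gaussians_moment(1,2)[OF k K] by auto
  then show "integrable (gaussians K) (\<lambda>x. x k * F x)"
  proof (rule Bochner_Integration.integrable_bound)
    show "(\<lambda>x. x k * F x) \<in> borel_measurable (gaussians K)" using k F by measurable
    show "AE x in gaussians K. norm (x k * F x) \<le> norm (C * (\<bar>x k\<bar> + \<bar>x k\<bar> * (\<Sum>j\<in>K. \<bar>x j\<bar>)))"
    proof (rule AE_I2)
      fix x :: "'k \<Rightarrow> real"
      have "\<bar>x k\<bar> * \<bar>F x\<bar> \<le> \<bar>x k\<bar> * (C * (1 + (\<Sum>j\<in>K. \<bar>x j\<bar>)))" using b by (intro mult_left_mono) auto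
      also have "\<dots> = C * (\<bar>x k\<bar> + \<bar>x k\<bar> * (\<Sum>j\<in>K. \<bar>x j\<bar>))" by (simp add: algebra_simps)
      finally show "norm (x k * F x) \<le> norm (C * (\<bar>x k\<bar> + \<bar>x k\<bar> * (\<Sum>j\<in>K. \<bar>x j\<bar>)))"
        using C by (simp add: abs_mult sum_nonneg)
    qed
  qed
qed

text \<open>The one-dimensional formula applied to one coordinate and integrated over the others. Linear growth is enough
for integrability and covers both the bounded Gibbs averages and the logarithm of the partition function.\<close>

lemma gaussian_ibp:
  fixes F F' :: "('k \<Rightarrow> real) \<Rightarrow> real"
  assumes K: "finite K" "k \<in> K"
    and m: "F \<in> borel_measurable (gaussians K)" "F' \<in> borel_measurable (gaussians K)"
    and d: "\<And>x u. ((\<lambda>u. F (x(k := u))) has_real_derivative F' (x(k := u))) (at u)"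
    and c: "\<And>x. continuous_on UNIV (\<lambda>u. F' (x(k := u)))"
    and b: "\<And>x. \<bar>F x\<bar> \<le> C * (1 + (\<Sum>j\<in>K. \<bar>x j\<bar>))" "\<And>x. \<bar>F' x\<bar> \<le> C * (1 + (\<Sum>j\<in>K. \<bar>x j\<bar>))"
  shows "(\<integral>x. x k * F x \<partial>gaussians K) = (\<integral>x. F' x \<partial>gaussians K)"
proof -
  define J where "J = K - {k}"
  have J: "finite J" "k \<notin> J" "K = insert k J" using K by (auto simp: J_def)
  have C: "C \<ge> 0" using b(1)[of "\<lambda>_. 0"] by simp
  have i: "integrable (gaussians (insert k J)) (\<lambda>x. x k * F x)" "integrable (gaussians (insert k J)) F'"
    using integrable_gaussians_linear_growth[OF K(1) m(1) b(1)] integrable_gaussians_linear_growth[OF K(1) m(2) b(2)] K J by auto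
  have "(\<integral>u. u * F (x(k := u)) \<partial>std_normal_distribution) = (\<integral>u. F' (x(k := u)) \<partial>std_normal_distribution)" for x
  proof (rule gaussian_ibp_real[OF d c])
    define C' where "C' = C * (1 + (\<Sum>j\<in>J. \<bar>x j\<bar>))"
    have *: "C * (1 + (\<Sum>j\<in>K. \<bar>(x(k := u)) j\<bar>)) \<le> C' * (1 + \<bar>u\<bar>)" for u
    proof -
      have "(\<Sum>j\<in>K. \<bar>(x(k := u)) j\<bar>) = \<bar>u\<bar> + (\<Sum>j\<in>J. \<bar>x j\<bar>)"
        using J by (auto intro!: sum.cong)
      moreover have "1 + (\<bar>u\<bar> + (\<Sum>j\<in>J. \<bar>x j\<bar>)) \<le> (1 + (\<Sum>j\<in>J. \<bar>x j\<bar>)) * (1 + \<bar>u\<bar>)"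
        using mult_nonneg_nonneg[of "\<Sum>j\<in>J. \<bar>x j\<bar>" "\<bar>u\<bar>"] by (simp add: algebra_simps sum_nonneg)
      ultimately show ?thesis unfolding C'_def using C by (simp add: mult_left_mono mult.assoc)
    qed
    show "\<bar>F (x(k := u))\<bar> \<le> C' * (1 + \<bar>u\<bar>)" for u using b(1) * order_trans by blast
    show "\<bar>F' (x(k := u))\<bar> \<le> C' * (1 + \<bar>u\<bar>)" for u using b(2) * order_trans by blast
  qed
  then show ?thesis
    unfolding J(3)
    by (simp add: gaussian_product.product_integral_insert[OF J(1,2)] i)
qed

lemma DERIV_integral:
  fixes F F' :: "real \<Rightarrow> 'a \<Rightarrow> real"
  assumes i: "\<And>t. integrable M (F t)"
    and d: "\<And>t x. x \<in> space M \<Longrightarrow> ((\<lambda>t. F t x) has_real_derivative F' t x) (at t)"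
    and m: "\<And>t. F' t \<in> borel_measurable M"
    and b: "\<And>t x. x \<in> space M \<Longrightarrow> \<bar>F' t x\<bar> \<le> g x" and g: "integrable M g"
  shows "((\<lambda>t. \<integral>x. F t x \<partial>M) has_real_derivative (\<integral>x. F' t x \<partial>M)) (at t)"
  unfolding DERIV_def tendsto_at_iff_sequentially comp_def
proof (intro allI impI)
  fix X :: "nat \<Rightarrow> real"
  assume X: "\<forall>i. X i \<in> UNIV - {0}" "X \<longlonglongrightarrow> 0"
  have "(\<lambda>n. \<integral>x. (F (t + X n) x - F t x) / X n \<partial>M) \<longlonglongrightarrow> (\<integral>x. F' t x \<partial>M)"
  proof (rule integral_dominated_convergence[where w=g])
    show "F' t \<in> borel_measurable M" by fact
    show "(\<lambda>x. (F (t + X n) x - F t x) / X n) \<in> borel_measurable M" for n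
      using i[of "t + X n"] i[of t] by (auto dest!: borel_measurable_integrable)
    show "integrable M g" by fact
    show "AE x in M. (\<lambda>n. (F (t + X n) x - F t x) / X n) \<longlonglongrightarrow> F' t x"
    proof (rule AE_I2)
      fix x assume "x \<in> space M"
      from d[OF this, of t] show "(\<lambda>n. (F (t + X n) x - F t x) / X n) \<longlonglongrightarrow> F' t x"
        unfolding DERIV_def tendsto_at_iff_sequentially comp_def using X by auto
    qed
    show "AE x in M. norm ((F (t + X n) x - F t x) / X n) \<le> g x" for n
    proof (rule AE_I2)
      fix x assume x: "x \<in> space M"
      have "norm (F (t + X n) x - F t x) \<le> g x * norm (t + X n - t)"
        by (rule field_differentiable_bound[where S=UNIV and f'="\<lambda>t. F' t x"]) (use d[OF x] b[OF x] in auto)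
      then show "norm ((F (t + X n) x - F t x) / X n) \<le> g x"
        using X(1) by (simp add: divide_le_eq)
    qed
  qed
  then show "(\<lambda>n. ((\<integral>x. F (t + X n) x \<partial>M) - (\<integral>x. F t x \<partial>M)) / X n) \<longlonglongrightarrow> (\<integral>x. F' t x \<partial>M)"
    using i by simp
qed

lemma std_normal_mgf:
  "has_bochner_integral std_normal_distribution (\<lambda>u. exp (c * u)) (exp (c\<^sup>2 / 2))"
proof -
  have eq: "std_normal_density u * exp (c * u) = exp (c\<^sup>2 / 2) * normal_density c 1 u" for u
    unfolding normal_density_def by (simp add: exp_add[symmetric] field_simps power2_eq_square)
  have "has_bochner_integral lborel (\<lambda>u. exp (c\<^sup>2 / 2) * normal_density c 1 u) (exp (c\<^sup>2 / 2) * 1)"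
    by (intro has_bochner_integral_mult_right) (auto simp: has_bochner_integral_iff)
  then show ?thesis
    by (subst has_bochner_integral_density) (auto simp: eq)
qed

lemma gaussians_mgf:
  assumes "finite K"
  shows "has_bochner_integral (gaussians K) (\<lambda>x. exp (\<Sum>k\<in>K. c k * x k)) (exp ((\<Sum>k\<in>K. (c k)\<^sup>2) / 2))"
proof -
  have i: "integrable std_normal_distribution (\<lambda>u. exp (c k * u))" for k
    using std_normal_mgf[of "c k"] by (simp add: has_bochner_integral_iff)
  have I: "(\<integral>u. exp (c k * u) \<partial>std_normal_distribution) = exp ((c k)\<^sup>2 / 2)" for k
    using std_normal_mgf[of "c k"] by (simp add: has_bochner_integral_iff)
  have "integrable (gaussians K) (\<lambda>x. \<Prod>k\<in>K. exp (c k * x k))"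
    by (rule gaussian_product.product_integrable_prod[OF assms i])
  moreover have "(\<integral>x. (\<Prod>k\<in>K. exp (c k * x k)) \<partial>gaussians K) = (\<Prod>k\<in>K. exp ((c k)\<^sup>2 / 2))"
    using gaussian_product.product_integral_prod[OF assms i] by (simp add: I)
  ultimately show ?thesis
    using assms by (simp add: has_bochner_integral_iff exp_sum sum_divide_distrib)
qed

text \<open>Turns a Gaussian linearisation \<open>exp (c\<^sup>2/2) = E exp (c u)\<close> back into a number once the sites have been integrated out.\<close>

lemma std_normal_exp_square:
  assumes s: "s < 1 / 2"
  shows "has_bochner_integral std_normal_distribution (\<lambda>u. exp (s * u\<^sup>2)) (1 / sqrt (1 - 2 * s))"
proof -
  define \<sigma> where "\<sigma> = 1 / sqrt (1 - 2 * s)"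
  have \<sigma>: "\<sigma> > 0" "\<sigma>\<^sup>2 = 1 / (1 - 2 * s)" using s by (auto simp: \<sigma>_def power_divide)
  have eq: "std_normal_density u * exp (s * u\<^sup>2) = \<sigma> * normal_density 0 \<sigma> u" for u
  proof -
    have "u\<^sup>2 / (2 * \<sigma>\<^sup>2) = u\<^sup>2 / 2 - s * u\<^sup>2" using s by (simp add: \<sigma> field_simps)
    then show ?thesis
      unfolding normal_density_def using \<sigma>(1)
      by (simp add: real_sqrt_mult mult_exp_exp)
  qed
  have "has_bochner_integral lborel (\<lambda>u. \<sigma> * normal_density 0 \<sigma> u) (\<sigma> * 1)"
    using \<sigma> by (intro has_bochner_integral_mult_right) (auto simp: has_bochner_integral_iff)
  then show ?thesis
    by (subst has_bochner_integral_density) (auto simp: eq \<sigma>_def)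
qed

section \<open>Gibbs averages over replicas\<close>

definition gibbs_prob :: "'c set \<Rightarrow> ('c \<Rightarrow> real) \<Rightarrow> 'c \<Rightarrow> real" where
  "gibbs_prob S H \<sigma> = exp (H \<sigma>) / (\<Sum>\<sigma>\<in>S. exp (H \<sigma>))"

definition avg :: "'c set \<Rightarrow> ('c \<Rightarrow> real) \<Rightarrow> ('c \<Rightarrow> real) \<Rightarrow> real" where
  "avg S p f = (\<Sum>\<sigma>\<in>S. p \<sigma> * f \<sigma>)"

text \<open>The average over independent replicas indexed by the finite set \<open>R\<close>. The index set is a parameter, not \<open>{1..n}\<close>,
because differentiating an average brings in fresh replicas.\<close>

definition ravg :: "'c set \<Rightarrow> ('c \<Rightarrow> real) \<Rightarrow> nat set \<Rightarrow> ((nat \<Rightarrow> 'c) \<Rightarrow> real) \<Rightarrow> real" where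
  "ravg S p R f = (\<Sum>\<tau>\<in>R \<rightarrow>\<^sub>E S. (\<Prod>l\<in>R. p (\<tau> l)) * f \<tau>)"

definition depends_on :: "nat set \<Rightarrow> ((nat \<Rightarrow> 'c) \<Rightarrow> real) \<Rightarrow> bool" where
  "depends_on R f \<longleftrightarrow> (\<forall>\<tau> \<tau>'. (\<forall>l\<in>R. \<tau> l = \<tau>' l) \<longrightarrow> f \<tau> = f \<tau>')"

lemma depends_on_upd: "depends_on R f \<Longrightarrow> l \<notin> R \<Longrightarrow> f (\<tau>(l := \<sigma>)) = f \<tau>"
  unfolding depends_on_def by (metis fun_upd_other)

lemma depends_on_mono: "depends_on R f \<Longrightarrow> R \<subseteq> R' \<Longrightarrow> depends_on R' f"
  unfolding depends_on_def by (meson subsetD)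

lemma sum_PiE_insert:
  fixes g :: "(nat \<Rightarrow> 'c) \<Rightarrow> real"
  assumes "l \<notin> R"
  shows "(\<Sum>\<tau>\<in>insert l R \<rightarrow>\<^sub>E S. g \<tau>) = (\<Sum>\<sigma>\<in>S. \<Sum>\<tau>\<in>R \<rightarrow>\<^sub>E S. g (\<tau>(l := \<sigma>)))"
proof -
  have "(\<Sum>\<tau>\<in>insert l R \<rightarrow>\<^sub>E S. g \<tau>) = (\<Sum>(\<sigma>, \<tau>)\<in>S \<times> (R \<rightarrow>\<^sub>E S). g (\<tau>(l := \<sigma>)))"
    unfolding PiE_insert_eq
    by (subst sum.reindex) (use inj_combinator[OF assms] in \<open>auto simp: case_prod_unfold\<close>)
  then show ?thesis by (simp add: sum.cartesian_product)
qed

lemma ravg_empty: "ravg S p {} f = f (\<lambda>_. undefined)"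
  by (simp add: ravg_def)

lemma ravg_insert:
  assumes "finite R" "l \<notin> R"
  shows "ravg S p (insert l R) f = avg S p (\<lambda>\<sigma>. ravg S p R (\<lambda>\<tau>. f (\<tau>(l := \<sigma>))))"
proof -
  have "(\<Prod>l'\<in>R. p ((\<tau>(l := \<sigma>)) l')) = (\<Prod>l'\<in>R. p (\<tau> l'))" for \<tau> \<sigma>
    using assms by (intro prod.cong) auto
  then show ?thesis
    using assms unfolding ravg_def avg_def
    by (simp add: sum_PiE_insert sum_distrib_left mult.assoc cong: prod.cong)
qed

lemma ravg_pick:
  assumes "finite R" "l \<in> R"
  shows "ravg S p R f = avg S p (\<lambda>\<sigma>. ravg S p (R - {l}) (\<lambda>\<tau>. f (\<tau>(l := \<sigma>))))"
  using ravg_insert[of "R - {l}" l S p f] assms by (simp add: insert_absorb)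

lemma avg_add: "avg S p (\<lambda>\<sigma>. f \<sigma> + g \<sigma>) = avg S p f + avg S p g"
  by (simp add: avg_def ring_distribs sum.distrib)
lemma avg_cmult: "avg S p (\<lambda>\<sigma>. c * f \<sigma>) = c * avg S p f"
  by (simp add: avg_def sum_distrib_left mult.left_commute)
lemma avg_multc: "avg S p (\<lambda>\<sigma>. f \<sigma> * c) = avg S p f * c"
  by (simp add: avg_def sum_distrib_right mult.assoc)
lemma avg_cong: "(\<And>\<sigma>. \<sigma> \<in> S \<Longrightarrow> f \<sigma> = g \<sigma>) \<Longrightarrow> avg S p f = avg S p g"
  by (simp add: avg_def)

lemma ravg_add: "ravg S p R (\<lambda>\<tau>. f \<tau> + g \<tau>) = ravg S p R f + ravg S p R g"
  by (simp add: ravg_def ring_distribs sum.distrib)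
lemma ravg_diff: "ravg S p R (\<lambda>\<tau>. f \<tau> - g \<tau>) = ravg S p R f - ravg S p R g"
  by (simp add: ravg_def ring_distribs sum_subtractf)
lemma ravg_cmult: "ravg S p R (\<lambda>\<tau>. c * f \<tau>) = c * ravg S p R f"
  by (simp add: ravg_def sum_distrib_left mult.left_commute)
lemma ravg_multc: "ravg S p R (\<lambda>\<tau>. f \<tau> * c) = ravg S p R f * c"
  by (simp add: ravg_def sum_distrib_right mult.assoc)
lemma ravg_sum: "ravg S p R (\<lambda>\<tau>. \<Sum>k\<in>K. f k \<tau>) = (\<Sum>k\<in>K. ravg S p R (f k))"
  unfolding ravg_def by (subst sum.swap) (simp add: sum_distrib_left)
lemma ravg_cong: "(\<And>\<tau>. \<tau> \<in> R \<rightarrow>\<^sub>E S \<Longrightarrow> f \<tau> = g \<tau>) \<Longrightarrow> ravg S p R f = ravg S p R g"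
  unfolding ravg_def by (rule sum.cong) auto

lemma ravg_mono:
  assumes "\<And>\<sigma>. \<sigma> \<in> S \<Longrightarrow> 0 \<le> p \<sigma>" "\<And>\<tau>. \<tau> \<in> R \<rightarrow>\<^sub>E S \<Longrightarrow> f \<tau> \<le> g \<tau>"
  shows "ravg S p R f \<le> ravg S p R g"
  unfolding ravg_def by (intro sum_mono mult_left_mono prod_nonneg assms) (auto intro!: assms)

lemma avg_mono:
  assumes "\<And>\<sigma>. \<sigma> \<in> S \<Longrightarrow> 0 \<le> p \<sigma>" "\<And>\<sigma>. \<sigma> \<in> S \<Longrightarrow> f \<sigma> \<le> g \<sigma>"
  shows "avg S p f \<le> avg S p g"
  unfolding avg_def by (intro sum_mono mult_left_mono assms)

text \<open>The quadratic form that Gaussian integration by parts produces for \<open>card R\<close> replicas when \<open>B\<close> is the covariance of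
the Hamiltonian; \<open>u\<close> and \<open>v\<close> are fresh replicas that stand for the normalisation of the Gibbs measure.
The coefficients add up to \<open>0\<close>, so constants added to \<open>B\<close> do not matter.\<close>

definition replica_form :: "('c \<Rightarrow> 'c \<Rightarrow> real) \<Rightarrow> nat set \<Rightarrow> nat \<Rightarrow> nat \<Rightarrow> (nat \<Rightarrow> 'c) \<Rightarrow> real" where
  "replica_form B R u v \<tau> =
     (\<Sum>l\<in>R. \<Sum>l'\<in>R. B (\<tau> l) (\<tau> l')) - 2 * real (card R) * (\<Sum>l\<in>R. B (\<tau> l) (\<tau> u))
       + real (card R) * (real (card R) + 1) * B (\<tau> u) (\<tau> v) - real (card R) * B (\<tau> u) (\<tau> u)"

context
  fixes S :: "'c set" and p :: "'c \<Rightarrow> real"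
  assumes S: "finite S" and p1: "(\<Sum>\<sigma>\<in>S. p \<sigma>) = 1"
begin

lemma avg_const: "avg S p (\<lambda>_. c) = c"
  using p1 by (simp add: avg_def sum_distrib_right[symmetric])

lemma ravg_const: "finite R \<Longrightarrow> ravg S p R (\<lambda>_. c) = c"
  by (induction R rule: finite_induct) (simp_all add: ravg_empty ravg_insert avg_const)

lemma ravg_fresh:
  assumes "finite R" "l \<notin> R" "depends_on R f"
  shows "ravg S p (insert l R) (\<lambda>\<tau>. f \<tau> * g (\<tau> l)) = ravg S p R f * avg S p g"
  using assms by (simp add: ravg_insert depends_on_upd ravg_multc avg_cmult)

lemma ravg_marginal:
  assumes "finite R" "finite R'" "R \<subseteq> R'" "depends_on R f"
  shows "ravg S p R' f = ravg S p R f"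
proof -
  have "ravg S p (Q \<union> R) f = ravg S p R f" if "finite Q" for Q
    using that
  proof (induction Q rule: finite_induct)
    case (insert l Q)
    show ?case
    proof (cases "l \<in> R")
      case False
      have "ravg S p (insert l (Q \<union> R)) f = ravg S p (Q \<union> R) f"
        using ravg_fresh[of "Q \<union> R" l f "\<lambda>_. 1"] insert assms False depends_on_mono[of R f "Q \<union> R"]
        by (simp add: avg_const)
      then show ?thesis using insert by simp
    qed (use insert in \<open>simp add: insert_absorb\<close>)
  qed simp
  from this[of R'] show ?thesis using assms by (simp add: Un_absorb2)
qed

lemma ravg_four:
  assumes "finite R" "distinct [i, j, k, l]" "{i, j, k, l} \<subseteq> R"
  shows "ravg S p R (\<lambda>\<tau>. F (\<tau> i) (\<tau> j) (\<tau> k) (\<tau> l))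
    = avg S p (\<lambda>\<sigma>1. avg S p (\<lambda>\<sigma>2. avg S p (\<lambda>\<sigma>3. avg S p (\<lambda>\<sigma>4. F \<sigma>1 \<sigma>2 \<sigma>3 \<sigma>4))))"
proof -
  have "ravg S p R (\<lambda>\<tau>. F (\<tau> i) (\<tau> j) (\<tau> k) (\<tau> l))
    = avg S p (\<lambda>\<sigma>1. avg S p (\<lambda>\<sigma>2. avg S p (\<lambda>\<sigma>3. avg S p (\<lambda>\<sigma>4.
         ravg S p (R - {i} - {j} - {k} - {l}) (\<lambda>\<tau>. F \<sigma>1 \<sigma>2 \<sigma>3 \<sigma>4)))))"
    using assms by (subst ravg_pick[of _ i], simp, simp, subst ravg_pick[of _ j], simp, simp, subst ravg_pick[of _ k], simp, simp,
     subst ravg_pick[of _ l]) auto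
  then show ?thesis using assms by (simp add: ravg_const)
qed

lemma ravg_three:
  assumes "finite R" "distinct [i, j, k]" "{i, j, k} \<subseteq> R"
  shows "ravg S p R (\<lambda>\<tau>. F (\<tau> i) (\<tau> j) (\<tau> k))
    = avg S p (\<lambda>\<sigma>1. avg S p (\<lambda>\<sigma>2. avg S p (\<lambda>\<sigma>3. F \<sigma>1 \<sigma>2 \<sigma>3)))"
proof -
  have "ravg S p R (\<lambda>\<tau>. F (\<tau> i) (\<tau> j) (\<tau> k))
    = avg S p (\<lambda>\<sigma>1. avg S p (\<lambda>\<sigma>2. avg S p (\<lambda>\<sigma>3.
         ravg S p (R - {i} - {j} - {k}) (\<lambda>\<tau>. F \<sigma>1 \<sigma>2 \<sigma>3))))"
    using assms by (subst ravg_pick[of _ i], simp, simp, subst ravg_pick[of _ j], simp, simp, subst ravg_pick[of _ k]) auto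
  then show ?thesis using assms by (simp add: ravg_const)
qed

lemma ravg_two:
  assumes "finite R" "i \<noteq> j" "{i, j} \<subseteq> R"
  shows "ravg S p R (\<lambda>\<tau>. F (\<tau> i) (\<tau> j)) = avg S p (\<lambda>\<sigma>1. avg S p (\<lambda>\<sigma>2. F \<sigma>1 \<sigma>2))"
proof -
  have "ravg S p R (\<lambda>\<tau>. F (\<tau> i) (\<tau> j))
    = avg S p (\<lambda>\<sigma>1. avg S p (\<lambda>\<sigma>2. ravg S p (R - {i} - {j}) (\<lambda>\<tau>. F \<sigma>1 \<sigma>2)))"
    using assms by (subst ravg_pick[of _ i], simp, simp, subst ravg_pick[of _ j]) auto
  then show ?thesis using assms by (simp add: ravg_const)
qed

lemma ravg_abs_le:
  assumes "\<And>\<sigma>. \<sigma> \<in> S \<Longrightarrow> 0 \<le> p \<sigma>" "finite R" "\<And>\<tau>. \<tau> \<in> R \<rightarrow>\<^sub>E S \<Longrightarrow> \<bar>f \<tau>\<bar> \<le> C"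
  shows "\<bar>ravg S p R f\<bar> \<le> C"
  using ravg_mono[of S p R f "\<lambda>_. C"] ravg_mono[of S p R "\<lambda>_. - C" f] assms
  by (simp add: ravg_const abs_le_iff minus_le_iff)

lemma avg_abs_le:
  assumes "\<And>\<sigma>. \<sigma> \<in> S \<Longrightarrow> 0 \<le> p \<sigma>" "\<And>\<sigma>. \<sigma> \<in> S \<Longrightarrow> \<bar>f \<sigma>\<bar> \<le> C"
  shows "\<bar>avg S p f\<bar> \<le> C"
  using avg_mono[of S p f "\<lambda>_. C"] avg_mono[of S p "\<lambda>_. - C" f] assms
  by (simp add: avg_const abs_le_iff minus_le_iff)

text \<open>For a covariance of rank one, averaging out the two fresh replicas completes the square:
this identifies the replica form with the second derivative of a product of Gibbs weights.\<close>

lemma ravg_replica_form: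
  assumes R: "finite R" "u \<notin> R" "v \<notin> R" "u \<noteq> v" and f: "depends_on R f"
  shows "ravg S p (insert u (insert v R)) (\<lambda>\<tau>. f \<tau> * replica_form (\<lambda>\<sigma> \<sigma>'. a \<sigma> * a \<sigma>') R u v \<tau>)
    = ravg S p R (\<lambda>\<tau>. f \<tau> * ((\<Sum>l\<in>R. a (\<tau> l) - avg S p a)\<^sup>2 - real (card R) * (avg S p (\<lambda>\<sigma>. (a \<sigma>)\<^sup>2) - (avg S p a)\<^sup>2)))"
proof -
  define n where "n = real (card R)"
  define m where "m = avg S p a"
  define m2 where "m2 = avg S p (\<lambda>\<sigma>. (a \<sigma>)\<^sup>2)"
  let ?s = "\<lambda>\<tau>. \<Sum>l\<in>R. a (\<tau> l)"
  let ?R = "insert u (insert v R)"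
  have d: "depends_on R (\<lambda>\<tau>. f \<tau> * (?s \<tau>)\<^sup>2)" "depends_on R (\<lambda>\<tau>. f \<tau> * ?s \<tau>)"
    using f unfolding depends_on_def by (metis (no_types, lifting) sum.cong)+
  have dv: "depends_on (insert v R) g" if "depends_on R g" for g
    using depends_on_mono[OF that, of "insert v R"] by auto
  have m1: "ravg S p ?R g = ravg S p R g" if "depends_on R g" for g
    using R by (intro ravg_marginal that) auto
  have mv: "ravg S p (insert v R) g = ravg S p R g" if "depends_on R g" for g
    using R by (intro ravg_marginal that) auto
  have r: "replica_form (\<lambda>\<sigma> \<sigma>'. a \<sigma> * a \<sigma>') R u v \<tau>
     = (?s \<tau>)\<^sup>2 - 2 * n * ?s \<tau> * a (\<tau> u) + n * (n + 1) * (a (\<tau> u) * a (\<tau> v)) - n * (a (\<tau> u))\<^sup>2" for \<tau>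
    by (simp add: replica_form_def n_def power2_eq_square sum_product[symmetric] sum_distrib_right[symmetric])
  have "ravg S p ?R (\<lambda>\<tau>. f \<tau> * replica_form (\<lambda>\<sigma> \<sigma>'. a \<sigma> * a \<sigma>') R u v \<tau>)
    = ravg S p ?R (\<lambda>\<tau>. f \<tau> * (?s \<tau>)\<^sup>2) - 2 * n * ravg S p ?R (\<lambda>\<tau>. (f \<tau> * ?s \<tau>) * a (\<tau> u))
      + n * (n + 1) * ravg S p ?R (\<lambda>\<tau>. (f \<tau> * a (\<tau> v)) * a (\<tau> u)) - n * ravg S p ?R (\<lambda>\<tau>. f \<tau> * (a (\<tau> u))\<^sup>2)"
  proof -
    have "(\<lambda>\<tau>. f \<tau> * replica_form (\<lambda>\<sigma> \<sigma>'. a \<sigma> * a \<sigma>') R u v \<tau>)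
      = (\<lambda>\<tau>. f \<tau> * (?s \<tau>)\<^sup>2 - 2 * n * ((f \<tau> * ?s \<tau>) * a (\<tau> u))
         + n * (n + 1) * ((f \<tau> * a (\<tau> v)) * a (\<tau> u)) - n * (f \<tau> * (a (\<tau> u))\<^sup>2))"
      unfolding r by (simp add: algebra_simps)
    then show ?thesis by (simp only: ravg_add ravg_diff ravg_cmult)
  qed
  also have "ravg S p ?R (\<lambda>\<tau>. f \<tau> * (?s \<tau>)\<^sup>2) = ravg S p R (\<lambda>\<tau>. f \<tau> * (?s \<tau>)\<^sup>2)" by (rule m1) (rule d)
  also have "ravg S p ?R (\<lambda>\<tau>. (f \<tau> * ?s \<tau>) * a (\<tau> u)) = ravg S p R (\<lambda>\<tau>. f \<tau> * ?s \<tau>) * m"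
    unfolding m_def using R dv[OF d(2)] mv[OF d(2)] by (subst ravg_fresh) auto
  also have "ravg S p ?R (\<lambda>\<tau>. (f \<tau> * a (\<tau> v)) * a (\<tau> u)) = ravg S p (insert v R) (\<lambda>\<tau>. f \<tau> * a (\<tau> v)) * m"
    unfolding m_def using R f by (subst ravg_fresh) (auto simp: depends_on_def)
  also have "ravg S p (insert v R) (\<lambda>\<tau>. f \<tau> * a (\<tau> v)) = ravg S p R f * m"
    unfolding m_def using R f by (subst ravg_fresh) auto
  also have "ravg S p ?R (\<lambda>\<tau>. f \<tau> * (a (\<tau> u))\<^sup>2) = ravg S p R f * m2"
    unfolding m2_def using R dv[OF f] mv[OF f] by (subst ravg_fresh[where g="\<lambda>\<sigma>. (a \<sigma>)\<^sup>2"]) auto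
  finally have 1: "ravg S p ?R (\<lambda>\<tau>. f \<tau> * replica_form (\<lambda>\<sigma> \<sigma>'. a \<sigma> * a \<sigma>') R u v \<tau>)
    = ravg S p R (\<lambda>\<tau>. f \<tau> * (?s \<tau>)\<^sup>2) - 2 * n * m * ravg S p R (\<lambda>\<tau>. f \<tau> * ?s \<tau>)
       + (n * (n + 1) * m\<^sup>2 - n * m2) * ravg S p R f"
    by (simp add: algebra_simps power2_eq_square)
  have 2: "(\<Sum>l\<in>R. a (\<tau> l) - m)\<^sup>2 - n * (m2 - m\<^sup>2) = (?s \<tau>)\<^sup>2 - 2 * n * m * ?s \<tau> + (n * (n + 1) * m\<^sup>2 - n * m2)" for \<tau>
    by (simp add: sum_subtractf n_def algebra_simps power2_eq_square)
  have "ravg S p R (\<lambda>\<tau>. f \<tau> * ((\<Sum>l\<in>R. a (\<tau> l) - m)\<^sup>2 - n * (m2 - m\<^sup>2)))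
    = ravg S p R (\<lambda>\<tau>. f \<tau> * (?s \<tau>)\<^sup>2) - 2 * n * m * ravg S p R (\<lambda>\<tau>. f \<tau> * ?s \<tau>)
       + (n * (n + 1) * m\<^sup>2 - n * m2) * ravg S p R f"
  proof -
    have "(\<lambda>\<tau>. f \<tau> * ((\<Sum>l\<in>R. a (\<tau> l) - m)\<^sup>2 - n * (m2 - m\<^sup>2)))
      = (\<lambda>\<tau>. f \<tau> * (?s \<tau>)\<^sup>2 - 2 * n * m * (f \<tau> * ?s \<tau>) + (n * (n + 1) * m\<^sup>2 - n * m2) * f \<tau>)"
      unfolding 2 by (simp add: algebra_simps)
    then show ?thesis by (simp only: ravg_add ravg_diff ravg_cmult)
  qed
  then show ?thesis using 1 by (simp add: m_def m2_def n_def)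
qed

end

lemma gibbs_prob_nonneg: "0 \<le> gibbs_prob S H \<sigma>"
  by (simp add: gibbs_prob_def sum_nonneg)

lemma gibbs_sum_pos: "finite S \<Longrightarrow> S \<noteq> {} \<Longrightarrow> (\<Sum>\<sigma>\<in>S. exp (H \<sigma> :: real)) > 0"
  by (simp add: sum_pos)

lemma gibbs_prob_sum: "finite S \<Longrightarrow> S \<noteq> {} \<Longrightarrow> (\<Sum>\<sigma>\<in>S. gibbs_prob S H \<sigma>) = 1"
  using gibbs_sum_pos[of S H] by (simp add: gibbs_prob_def sum_divide_distrib[symmetric])

lemma DERIV_gibbs_prob:
  assumes S: "finite S" "S \<noteq> {}" and H: "\<And>\<sigma>. ((\<lambda>t. H t \<sigma>) has_real_derivative A \<sigma>) (at t)"
  shows "((\<lambda>t. gibbs_prob S (H t) \<sigma>) has_real_derivative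
    gibbs_prob S (H t) \<sigma> * (A \<sigma> - avg S (gibbs_prob S (H t)) A)) (at t)"
proof -
  let ?Z = "\<Sum>\<sigma>\<in>S. exp (H t \<sigma>)"
  have Z: "?Z \<noteq> 0" using gibbs_sum_pos[OF S, of "H t"] by simp
  have "((\<lambda>t. gibbs_prob S (H t) \<sigma>) has_real_derivative
     ((exp (H t \<sigma>) * A \<sigma>) * ?Z - exp (H t \<sigma>) * (\<Sum>\<sigma>\<in>S. exp (H t \<sigma>) * A \<sigma>)) / (?Z * ?Z)) (at t)"
    unfolding gibbs_prob_def by (intro DERIV_divide DERIV_sum DERIV_fun_exp H Z)
  moreover have "avg S (gibbs_prob S (H t)) A = (\<Sum>\<sigma>\<in>S. exp (H t \<sigma>) * A \<sigma>) / ?Z"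
    by (simp add: avg_def gibbs_prob_def sum_divide_distrib)
  moreover have "((e * a) * Z - e * W) / (Z * Z) = e / Z * (a - W / Z)" if "Z \<noteq> 0" for e a Z W :: real
    using that by (simp add: field_simps)
  ultimately show ?thesis
    using Z by (simp add: gibbs_prob_def[of S "H t" \<sigma>])
qed

lemma DERIV_prod_log:
  assumes "finite R" "\<And>l. l \<in> R \<Longrightarrow> ((\<lambda>t. g t l) has_real_derivative g t0 l * d l) (at t0)"
  shows "((\<lambda>t. \<Prod>l\<in>R. g t l) has_real_derivative (\<Prod>l\<in>R. g t0 l) * (\<Sum>l\<in>R. d l)) (at t0)"
  using assms
proof (induction R rule: finite_induct)
  case (insert l R)
  have "((\<lambda>t. g t l * (\<Prod>l\<in>R. g t l)) has_real_derivative
     g t0 l * d l * (\<Prod>l\<in>R. g t0 l) + (\<Prod>l\<in>R. g t0 l) * (\<Sum>l\<in>R. d l) * g t0 l) (at t0)"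
    by (rule DERIV_mult) (use insert in auto)
  then show ?case using insert by (simp add: algebra_simps)
qed simp

lemma DERIV_avg_gibbs:
  assumes S: "finite S" "S \<noteq> {}" and H: "\<And>\<sigma>. ((\<lambda>t. H t \<sigma>) has_real_derivative A \<sigma>) (at t)"
  shows "((\<lambda>t. avg S (gibbs_prob S (H t)) f) has_real_derivative
    avg S (gibbs_prob S (H t)) (\<lambda>\<sigma>. f \<sigma> * (A \<sigma> - avg S (gibbs_prob S (H t)) A))) (at t)"
proof -
  have "((\<lambda>t. avg S (gibbs_prob S (H t)) f) has_real_derivative
     (\<Sum>\<sigma>\<in>S. gibbs_prob S (H t) \<sigma> * (A \<sigma> - avg S (gibbs_prob S (H t)) A) * f \<sigma>)) (at t)"
    unfolding avg_def[of _ _ f] by (intro DERIV_sum DERIV_cmult_right DERIV_gibbs_prob S H)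
  then show ?thesis by (simp add: avg_def[of _ _ "\<lambda>\<sigma>. f \<sigma> * _ \<sigma>"] mult_ac)
qed

lemma DERIV_ravg_gibbs:
  assumes S: "finite S" "S \<noteq> {}" and R: "finite R"
    and H: "\<And>\<sigma>. ((\<lambda>t. H t \<sigma>) has_real_derivative A \<sigma>) (at t)"
    and f: "\<And>\<tau>. ((\<lambda>t. f t \<tau>) has_real_derivative f' \<tau>) (at t)"
  shows "((\<lambda>t. ravg S (gibbs_prob S (H t)) R (f t)) has_real_derivative
    ravg S (gibbs_prob S (H t)) R (\<lambda>\<tau>. f' \<tau> + f t \<tau> * (\<Sum>l\<in>R. A (\<tau> l) - avg S (gibbs_prob S (H t)) A))) (at t)"
proof -
  let ?p = "\<lambda>t. gibbs_prob S (H t)"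
  have "((\<lambda>t. (\<Prod>l\<in>R. ?p t (\<tau> l)) * f t \<tau>) has_real_derivative
     (\<Prod>l\<in>R. ?p t (\<tau> l)) * (\<Sum>l\<in>R. A (\<tau> l) - avg S (?p t) A) * f t \<tau> + f' \<tau> * (\<Prod>l\<in>R. ?p t (\<tau> l))) (at t)" for \<tau>
    by (intro DERIV_mult DERIV_prod_log R f DERIV_gibbs_prob S H)
  then have "((\<lambda>t. (\<Prod>l\<in>R. ?p t (\<tau> l)) * f t \<tau>) has_real_derivative
     (\<Prod>l\<in>R. ?p t (\<tau> l)) * (f' \<tau> + f t \<tau> * (\<Sum>l\<in>R. A (\<tau> l) - avg S (?p t) A))) (at t)" for \<tau>
    by (simp add: algebra_simps)
  then show ?thesis unfolding ravg_def by (intro DERIV_sum)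
qed

lemma continuous_on_gibbs_prob:
  assumes "finite S" "S \<noteq> {}" "\<And>\<sigma>. continuous_on T (\<lambda>t. H t \<sigma>)"
  shows "continuous_on T (\<lambda>t. gibbs_prob S (H t) \<sigma>)"
  unfolding gibbs_prob_def using gibbs_sum_pos[OF assms(1,2)]
  by (intro continuous_intros assms) (simp add: less_imp_neq[symmetric])

lemma continuous_on_avg_gibbs:
  assumes "finite S" "S \<noteq> {}" "\<And>\<sigma>. continuous_on T (\<lambda>t. H t \<sigma>)" "\<And>\<sigma>. continuous_on T (\<lambda>t. f t \<sigma>)"
  shows "continuous_on T (\<lambda>t. avg S (gibbs_prob S (H t)) (f t))"
  unfolding avg_def by (intro continuous_intros assms continuous_on_gibbs_prob)

lemma continuous_on_ravg_gibbs:
  assumes "finite S" "S \<noteq> {}" "\<And>\<sigma>. continuous_on T (\<lambda>t. H t \<sigma>)" "\<And>\<tau>. continuous_on T (\<lambda>t. f t \<tau>)"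
  shows "continuous_on T (\<lambda>t. ravg S (gibbs_prob S (H t)) R (f t))"
  unfolding ravg_def by (intro continuous_intros assms continuous_on_gibbs_prob)

lemma measurable_gibbs_prob[measurable (raw)]:
  assumes "\<And>\<sigma>. (\<lambda>x. H x \<sigma>) \<in> borel_measurable M"
  shows "(\<lambda>x. gibbs_prob S (H x) \<sigma>) \<in> borel_measurable M"
  unfolding gibbs_prob_def using assms by measurable

lemma measurable_avg[measurable (raw)]:
  assumes "\<And>\<sigma>. (\<lambda>x. p x \<sigma>) \<in> borel_measurable M" "\<And>\<sigma>. (\<lambda>x. f x \<sigma>) \<in> borel_measurable M"
  shows "(\<lambda>x. avg S (p x) (f x)) \<in> borel_measurable M"
  unfolding avg_def using assms by measurable

lemma measurable_ravg[measurable (raw)]: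
  assumes "\<And>\<sigma>. (\<lambda>x. p x \<sigma>) \<in> borel_measurable M" "\<And>\<tau>. (\<lambda>x. f x \<tau>) \<in> borel_measurable M"
  shows "(\<lambda>x. ravg S (p x) R (f x)) \<in> borel_measurable M"
  unfolding ravg_def using assms by measurable

section \<open>Interpolation along a Gaussian path\<close>

text \<open>A Gibbs measure whose energy is linear in independent Gaussians with time-dependent weights \<open>c k\<close>. The condition on
\<open>c k * c' k\<close> says that the squared weight of the \<open>k\<close>-th variable has derivative \<open>2 s k sin t cos t\<close>, so one path can switch
some Gaussians on (\<open>s k = 1\<close>), others off (\<open>s k = -1\<close>) and leave the rest alone (\<open>s k = 0\<close>).\<close>

locale gaussian_path =
  fixes S :: "'c set" and K :: "'k set" and b :: "'c \<Rightarrow> real" and a :: "'k \<Rightarrow> 'c \<Rightarrow> real"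
    and c c' :: "'k \<Rightarrow> real \<Rightarrow> real" and s :: "'k \<Rightarrow> real"
  assumes S: "finite S" "S \<noteq> {}" and K: "finite K"
    and DERIV_c: "\<And>k t. (c k has_real_derivative c' k t) (at t)"
    and c_le: "\<And>k t. \<bar>c k t\<bar> \<le> 1" "\<And>k t. \<bar>c' k t\<bar> \<le> 1"
    and c_c': "\<And>k t. c k t * c' k t = s k * (sin t * cos t)"
begin

definition H :: "real \<Rightarrow> ('k \<Rightarrow> real) \<Rightarrow> 'c \<Rightarrow> real" where
  "H t x \<sigma> = b \<sigma> + (\<Sum>k\<in>K. c k t * x k * a k \<sigma>)"

abbreviation P :: "real \<Rightarrow> ('k \<Rightarrow> real) \<Rightarrow> 'c \<Rightarrow> real" where
  "P t x \<equiv> gibbs_prob S (H t x)"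

definition B :: "'c \<Rightarrow> 'c \<Rightarrow> real" where
  "B \<sigma> \<sigma>' = (\<Sum>k\<in>K. s k * (a k \<sigma> * a k \<sigma>'))"

definition E :: "real \<Rightarrow> nat set \<Rightarrow> ((nat \<Rightarrow> 'c) \<Rightarrow> real) \<Rightarrow> real" where
  "E t R f = (\<integral>x. ravg S (P t x) R f \<partial>gaussians K)"

lemma P_sum: "(\<Sum>\<sigma>\<in>S. P t x \<sigma>) = 1"
  by (rule gibbs_prob_sum[OF S])

lemma DERIV_H: "((\<lambda>t. H t x \<sigma>) has_real_derivative (\<Sum>k\<in>K. c' k t * x k * a k \<sigma>)) (at t)"
  unfolding H_def
  by (rule DERIV_cong[OF DERIV_add[OF DERIV_const DERIV_sum[OF DERIV_cmult_right[OF DERIV_cmult_right[OF DERIV_c]]]]]) simp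

lemma H_upd: "k \<in> K \<Longrightarrow> H t (x(k := u)) \<sigma> = H t (x(k := 0)) \<sigma> + c k t * u * a k \<sigma>"
  unfolding H_def using K by (simp add: sum.remove[of K k])

lemma DERIV_H_component:
  "k \<in> K \<Longrightarrow> ((\<lambda>u. H t (x(k := u)) \<sigma>) has_real_derivative c k t * a k \<sigma>) (at u)"
  by (subst H_upd) (auto intro!: derivative_eq_intros)

lemma continuous_on_H_component: "k \<in> K \<Longrightarrow> continuous_on UNIV (\<lambda>u. H t (x(k := u)) \<sigma>)"
  using DERIV_H_component by (blast intro: continuous_at_imp_continuous_on DERIV_isCont)

lemma measurable_H[measurable]: "(\<lambda>x. H t x \<sigma>) \<in> borel_measurable (gaussians K)"
  unfolding H_def by measurable

lemma finite_configs: "finite R \<Longrightarrow> finite (R \<rightarrow>\<^sub>E S)"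
  using S by (intro finite_PiE) auto

lemma measurable_ravg_P[measurable]: "(\<lambda>x. ravg S (P t x) R f) \<in> borel_measurable (gaussians K)"
  by measurable

lemma config_bounded:
  assumes "finite R"
  shows "\<exists>C\<ge>0. \<forall>\<tau>\<in>R \<rightarrow>\<^sub>E S. \<bar>f \<tau>\<bar> \<le> (C::real)"
  using finite_imageI[OF finite_configs[OF assms], of "\<lambda>\<tau>. \<bar>f \<tau>\<bar>"]
  by (intro exI[of _ "Max (insert 0 ((\<lambda>\<tau>. \<bar>f \<tau>\<bar>) ` (R \<rightarrow>\<^sub>E S)))"]) auto

lemma integrable_ravg:
  assumes R: "finite R"
  shows "integrable (gaussians K) (\<lambda>x. ravg S (P t x) R f)"
proof -
  obtain C where "\<forall>\<tau>\<in>R \<rightarrow>\<^sub>E S. \<bar>f \<tau>\<bar> \<le> C" using config_bounded[OF R] by blast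
  then show ?thesis
    by (intro finite_measure.integrable_const_bound[OF prob_space.finite_measure[OF prob_space_gaussians], where B=C] AE_I2) (auto intro!: ravg_abs_le S P_sum gibbs_prob_nonneg R)
qed

lemma E_add: "finite R \<Longrightarrow> E t R (\<lambda>\<tau>. f \<tau> + g \<tau>) = E t R f + E t R g"
  by (simp add: E_def ravg_add integrable_ravg)
lemma E_diff: "finite R \<Longrightarrow> E t R (\<lambda>\<tau>. f \<tau> - g \<tau>) = E t R f - E t R g"
  by (simp add: E_def ravg_diff integrable_ravg)
lemma E_cmult: "E t R (\<lambda>\<tau>. d * f \<tau>) = d * E t R f"
  by (simp add: E_def ravg_cmult)
lemma E_sum: "finite R \<Longrightarrow> E t R (\<lambda>\<tau>. \<Sum>k\<in>J. f k \<tau>) = (\<Sum>k\<in>J. E t R (f k))"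
  by (simp add: E_def ravg_sum integrable_ravg)
lemma E_cong: "(\<And>\<tau>. \<tau> \<in> R \<rightarrow>\<^sub>E S \<Longrightarrow> f \<tau> = g \<tau>) \<Longrightarrow> E t R f = E t R g"
  unfolding E_def by (simp cong: ravg_cong)
lemma E_mono: "finite R \<Longrightarrow> (\<And>\<tau>. \<tau> \<in> R \<rightarrow>\<^sub>E S \<Longrightarrow> f \<tau> \<le> g \<tau>) \<Longrightarrow> E t R f \<le> E t R g"
  unfolding E_def by (intro integral_mono integrable_ravg ravg_mono gibbs_prob_nonneg)
lemma E_const: "finite R \<Longrightarrow> E t R (\<lambda>_. d) = d"
  by (simp add: E_def ravg_const[OF S(1) P_sum] prob_space.prob_space[OF prob_space_gaussians])
lemma E_abs_le: "finite R \<Longrightarrow> \<bar>E t R f\<bar> \<le> E t R (\<lambda>\<tau>. \<bar>f \<tau>\<bar>)"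
proof -
  assume R: "finite R"
  have "E t R f \<le> E t R (\<lambda>\<tau>. \<bar>f \<tau>\<bar>)" by (rule E_mono[OF R]) simp
  moreover have "E t R (\<lambda>\<tau>. - 1 * \<bar>f \<tau>\<bar>) \<le> E t R f" by (rule E_mono[OF R]) simp
  ultimately show ?thesis unfolding E_cmult by linarith
qed
lemma E_marginal:
  "finite R' \<Longrightarrow> R \<subseteq> R' \<Longrightarrow> depends_on R f \<Longrightarrow> E t R' f = E t R f"
  unfolding E_def by (subst ravg_marginal[OF S(1) P_sum, of R R']) (auto intro: finite_subset)
text \<open>Replicas are exchangeable; these rules also move an average to another set of replicas.\<close>

lemma E_two:
  assumes "finite R" "i \<noteq> j" "{i, j} \<subseteq> R" "finite R'" "i' \<noteq> j'" "{i', j'} \<subseteq> R'"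
  shows "E t R (\<lambda>\<tau>. F (\<tau> i) (\<tau> j)) = E t R' (\<lambda>\<tau>. F (\<tau> i') (\<tau> j'))"
  unfolding E_def by (simp only: ravg_two[OF S(1) P_sum assms(1-3)] ravg_two[OF S(1) P_sum assms(4-6)])
lemma E_three:
  assumes "finite R" "distinct [i, j, k]" "{i, j, k} \<subseteq> R" "finite R'" "distinct [i', j', k']" "{i', j', k'} \<subseteq> R'"
  shows "E t R (\<lambda>\<tau>. F (\<tau> i) (\<tau> j) (\<tau> k)) = E t R' (\<lambda>\<tau>. F (\<tau> i') (\<tau> j') (\<tau> k'))"
  unfolding E_def by (simp only: ravg_three[OF S(1) P_sum assms(1-3)] ravg_three[OF S(1) P_sum assms(4-6)])
lemma E_four:
  assumes "finite R" "distinct [i, j, k, l]" "{i, j, k, l} \<subseteq> R" "finite R'" "distinct [i', j', k', l']" "{i', j', k', l'} \<subseteq> R'"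
  shows "E t R (\<lambda>\<tau>. F (\<tau> i) (\<tau> j) (\<tau> k) (\<tau> l)) = E t R' (\<lambda>\<tau>. F (\<tau> i') (\<tau> j') (\<tau> k') (\<tau> l'))"
  unfolding E_def by (simp only: ravg_four[OF S(1) P_sum assms(1-3)] ravg_four[OF S(1) P_sum assms(4-6)])

definition dev :: "real \<Rightarrow> ('k \<Rightarrow> real) \<Rightarrow> 'k \<Rightarrow> nat set \<Rightarrow> (nat \<Rightarrow> 'c) \<Rightarrow> real" where
  "dev t x k R \<tau> = (\<Sum>l\<in>R. a k (\<tau> l) - avg S (P t x) (a k))"

definition var :: "real \<Rightarrow> ('k \<Rightarrow> real) \<Rightarrow> 'k \<Rightarrow> real" where
  "var t x k = avg S (P t x) (\<lambda>\<sigma>. (a k \<sigma>)\<^sup>2) - (avg S (P t x) (a k))\<^sup>2"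

lemma DERIV_avg_component:
  assumes k: "k \<in> K"
  shows "((\<lambda>u. avg S (P t (x(k := u))) (a k)) has_real_derivative c k t * var t (x(k := u)) k) (at u)"
proof (rule DERIV_cong[OF DERIV_avg_gibbs[OF S DERIV_H_component[OF k]]])
  let ?m = "avg S (P t (x(k := u)))"
  have "?m (\<lambda>\<sigma>. a k \<sigma> * (c k t * a k \<sigma> - ?m (\<lambda>\<sigma>. c k t * a k \<sigma>)))
    = ?m (\<lambda>\<sigma>. c k t * (a k \<sigma>)\<^sup>2 + (- (c k t * ?m (a k))) * a k \<sigma>)"
    unfolding avg_cmult by (rule avg_cong) (simp add: power2_eq_square algebra_simps)
  also have "\<dots> = c k t * var t (x(k := u)) k"
    unfolding avg_add avg_cmult var_def by (simp add: power2_eq_square algebra_simps)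
  finally show "?m (\<lambda>\<sigma>. a k \<sigma> * (c k t * a k \<sigma> - ?m (\<lambda>\<sigma>. c k t * a k \<sigma>))) = c k t * var t (x(k := u)) k" .
qed

lemma a_bounded: "\<exists>C\<ge>0. \<forall>k\<in>K. \<forall>\<sigma>\<in>S. \<bar>a k \<sigma>\<bar> \<le> C"
proof -
  let ?V = "(\<lambda>(k, \<sigma>). \<bar>a k \<sigma>\<bar>) ` (K \<times> S)"
  have "finite (insert 0 ?V)" using S K by auto
  then show ?thesis
    by (intro exI[of _ "Max (insert 0 ?V)"]) (auto intro!: Max_ge)
qed

lemma gaussian_ibp_ravg:
  assumes R: "finite R" and k: "k \<in> K"
  shows "(\<integral>x. x k * ravg S (P t x) R (\<lambda>\<tau>. f \<tau> * dev t x k R \<tau>) \<partial>gaussians K)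
    = (\<integral>x. c k t * ravg S (P t x) R (\<lambda>\<tau>. f \<tau> * ((dev t x k R \<tau>)\<^sup>2 - real (card R) * var t x k)) \<partial>gaussians K)"
    and "integrable (gaussians K) (\<lambda>x. x k * ravg S (P t x) R (\<lambda>\<tau>. f \<tau> * dev t x k R \<tau>))"
    and "\<exists>C. \<forall>t x. \<forall>k\<in>K. \<bar>ravg S (P t x) R (\<lambda>\<tau>. f \<tau> * dev t x k R \<tau>)\<bar> \<le> C"
proof -
  obtain Cf where Cf: "Cf \<ge> 0" "\<forall>\<tau>\<in>R \<rightarrow>\<^sub>E S. \<bar>f \<tau>\<bar> \<le> Cf" using config_bounded[OF R] by blast
  obtain Ca where Ca: "Ca \<ge> 0" "\<forall>k\<in>K. \<forall>\<sigma>\<in>S. \<bar>a k \<sigma>\<bar> \<le> Ca" using a_bounded by blast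
  define n where "n = real (card R)"
  have m_le: "\<bar>avg S (P t x) (a k)\<bar> \<le> Ca" if "k \<in> K" for t x k
    by (rule avg_abs_le[OF S(1) P_sum]) (use Ca that in \<open>auto intro: gibbs_prob_nonneg\<close>)
  have dev_le: "\<bar>dev t x k R \<tau>\<bar> \<le> n * (2 * Ca)" if "\<tau> \<in> R \<rightarrow>\<^sub>E S" "k \<in> K" for t x \<tau> k
  proof -
    have "\<bar>dev t x k R \<tau>\<bar> \<le> (\<Sum>l\<in>R. \<bar>a k (\<tau> l) - avg S (P t x) (a k)\<bar>)" unfolding dev_def by (rule sum_abs)
    also have "\<dots> \<le> (\<Sum>l\<in>R. 2 * Ca)"
    proof (rule sum_mono)
      fix l assume "l \<in> R"
      then have "\<bar>a k (\<tau> l)\<bar> \<le> Ca" using that Ca by auto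
      then show "\<bar>a k (\<tau> l) - avg S (P t x) (a k)\<bar> \<le> 2 * Ca" using m_le[OF that(2), of t x] by linarith
    qed
    finally show ?thesis by (simp add: n_def)
  qed
  have var_le: "\<bar>var t x k\<bar> \<le> 2 * Ca\<^sup>2" for t x
  proof -
    have "\<bar>avg S (P t x) (\<lambda>\<sigma>. (a k \<sigma>)\<^sup>2)\<bar> \<le> Ca\<^sup>2"
      by (rule avg_abs_le[OF S(1) P_sum])
         (use Ca k in \<open>auto intro: gibbs_prob_nonneg simp: abs_le_square_iff[symmetric]\<close>)
    moreover have "\<bar>(avg S (P t x) (a k))\<^sup>2\<bar> \<le> Ca\<^sup>2"
      using m_le[OF k, of t x] Ca by (simp add: abs_le_square_iff[symmetric])
    ultimately show ?thesis unfolding var_def by linarith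
  qed
  define C1 where "C1 = Cf * (n * (2 * Ca))"
  define C2 where "C2 = Cf * ((n * (2 * Ca))\<^sup>2 + n * (2 * Ca\<^sup>2))"
  have n: "n \<ge> 0" by (simp add: n_def)
  have C12: "C1 \<ge> 0" "C2 \<ge> 0" using Cf Ca n by (auto simp: C1_def C2_def)
  have b1: "\<bar>ravg S (P t x) R (\<lambda>\<tau>. f \<tau> * dev t x k R \<tau>)\<bar> \<le> C1" if "k \<in> K" for t x k
    unfolding C1_def
    by (rule ravg_abs_le[OF S(1) P_sum gibbs_prob_nonneg R])
       (use Cf dev_le that in \<open>auto simp: abs_mult intro!: mult_mono\<close>)
  then show "\<exists>C. \<forall>t x. \<forall>k\<in>K. \<bar>ravg S (P t x) R (\<lambda>\<tau>. f \<tau> * dev t x k R \<tau>)\<bar> \<le> C" by blast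
  let ?G = "\<lambda>x \<tau>. f \<tau> * ((dev t x k R \<tau>)\<^sup>2 - n * var t x k)"
  have b2: "\<bar>ravg S (P t x) R (?G x)\<bar> \<le> C2" for x
    unfolding C2_def
  proof (rule ravg_abs_le[OF S(1) P_sum gibbs_prob_nonneg R])
    fix \<tau> assume \<tau>: "\<tau> \<in> R \<rightarrow>\<^sub>E S"
    have "(dev t x k R \<tau>)\<^sup>2 \<le> (n * (2 * Ca))\<^sup>2"
      using dev_le[OF \<tau> k, of t x] Ca n by (simp add: abs_le_square_iff[symmetric])
    moreover have "\<bar>n * var t x k\<bar> \<le> n * (2 * Ca\<^sup>2)"
      using var_le[of t x] n by (simp add: abs_mult mult_left_mono)
    ultimately have "\<bar>(dev t x k R \<tau>)\<^sup>2 - n * var t x k\<bar> \<le> (n * (2 * Ca))\<^sup>2 + n * (2 * Ca\<^sup>2)"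
      using zero_le_power2[of "dev t x k R \<tau>"] by linarith
    then show "\<bar>f \<tau> * ((dev t x k R \<tau>)\<^sup>2 - n * var t x k)\<bar> \<le> Cf * ((n * (2 * Ca))\<^sup>2 + n * (2 * Ca\<^sup>2))"
      unfolding abs_mult using Cf \<tau> by (intro mult_mono) auto
  qed
  have md: "(\<lambda>x. ravg S (P t x) R (\<lambda>\<tau>. f \<tau> * dev t x k R \<tau>)) \<in> borel_measurable (gaussians K)"
    unfolding dev_def by measurable
  have mv: "(\<lambda>x. c k t * ravg S (P t x) R (?G x)) \<in> borel_measurable (gaussians K)"
    unfolding dev_def var_def by measurable
  have lin: "C \<le> (C1 + C2) * (1 + (\<Sum>j\<in>K. \<bar>x j\<bar>))" if "C \<le> C1 + C2" for x C
    using mult_left_mono[of 1 "1 + (\<Sum>j\<in>K. \<bar>x j\<bar>)" "C1 + C2"] that C12 by (simp add: sum_nonneg)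
  have b2': "\<bar>c k t * ravg S (P t x) R (?G x)\<bar> \<le> C2" for x
  proof -
    have "\<bar>c k t\<bar> * \<bar>ravg S (P t x) R (?G x)\<bar> \<le> 1 * C2"
      by (rule mult_mono[OF c_le(1) b2]) auto
    then show ?thesis by (simp add: abs_mult)
  qed
  have dd: "((\<lambda>u. f \<tau> * dev t (x(k := u)) k R \<tau>) has_real_derivative
     f \<tau> * (- (n * (c k t * var t (x(k := u)) k)))) (at u)" for x u \<tau>
    unfolding dev_def
    by (rule DERIV_cong[OF DERIV_cmult[OF DERIV_sum[OF DERIV_diff[OF DERIV_const DERIV_avg_component[OF k]]]]])
       (simp add: n_def)
  show "(\<integral>x. x k * ravg S (P t x) R (\<lambda>\<tau>. f \<tau> * dev t x k R \<tau>) \<partial>gaussians K)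
    = (\<integral>x. c k t * ravg S (P t x) R (\<lambda>\<tau>. f \<tau> * ((dev t x k R \<tau>)\<^sup>2 - real (card R) * var t x k)) \<partial>gaussians K)"
    unfolding n_def[symmetric]
  proof (rule gaussian_ibp[OF K k md mv])
    fix x :: "'k \<Rightarrow> real" and u
    let ?y = "x(k := u)"
    show "((\<lambda>u. ravg S (P t (x(k := u))) R (\<lambda>\<tau>. f \<tau> * dev t (x(k := u)) k R \<tau>)) has_real_derivative
        c k t * ravg S (P t ?y) R (?G ?y)) (at u)"
      by (rule DERIV_cong[OF DERIV_ravg_gibbs[OF S R DERIV_H_component[OF k] dd]], unfold ravg_cmult[symmetric])
         (rule ravg_cong, simp add: avg_cmult right_diff_distrib[symmetric] sum_distrib_left[symmetric] dev_def[symmetric],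
           simp add: algebra_simps power2_eq_square)
    show "continuous_on UNIV (\<lambda>u. c k t * ravg S (P t (x(k := u))) R (?G (x(k := u))))"
      unfolding dev_def var_def
      by (intro continuous_intros continuous_on_ravg_gibbs continuous_on_avg_gibbs S continuous_on_H_component k)
    show "\<bar>ravg S (P t x) R (\<lambda>\<tau>. f \<tau> * dev t x k R \<tau>)\<bar> \<le> (C1 + C2) * (1 + (\<Sum>j\<in>K. \<bar>x j\<bar>))"
      by (rule lin) (use b1[OF k, of t x] C12 in auto)
    show "\<bar>c k t * ravg S (P t x) R (?G x)\<bar> \<le> (C1 + C2) * (1 + (\<Sum>j\<in>K. \<bar>x j\<bar>))"
      by (rule lin) (use b2'[of x] C12 in auto)
  qed
  show "integrable (gaussians K) (\<lambda>x. x k * ravg S (P t x) R (\<lambda>\<tau>. f \<tau> * dev t x k R \<tau>))"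
    by (rule integrable_gaussians_linear_growth(2)[OF K md _ k], rule lin) (use b1[OF k] C12 in \<open>auto intro: add_increasing2\<close>)
qed

text \<open>The basic differentiation formula: the derivative hits the Gibbs weights linearly in the Gaussians, integration by parts
replaces each Gaussian by a second derivative, and the outcome is a replica form with two fresh replicas.\<close>

theorem DERIV_E:
  assumes R: "finite R" "u \<notin> R" "v \<notin> R" "u \<noteq> v"
    and f: "\<And>t. depends_on R (f t)"
    and f': "\<And>t \<tau>. ((\<lambda>t. f t \<tau>) has_real_derivative f' t \<tau>) (at t)"
    and bnd: "\<And>t \<tau>. \<tau> \<in> R \<rightarrow>\<^sub>E S \<Longrightarrow> \<bar>f t \<tau>\<bar> \<le> Cf" "\<And>t \<tau>. \<tau> \<in> R \<rightarrow>\<^sub>E S \<Longrightarrow> \<bar>f' t \<tau>\<bar> \<le> Cf"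
  shows "((\<lambda>t. E t R (f t)) has_real_derivative
     E t R (f' t) + sin t * cos t * E t (insert u (insert v R)) (\<lambda>\<tau>. f t \<tau> * replica_form B R u v \<tau>)) (at t)"
proof -
  obtain Ca where Ca: "Ca \<ge> 0" "\<forall>k\<in>K. \<forall>\<sigma>\<in>S. \<bar>a k \<sigma>\<bar> \<le> Ca" using a_bounded by blast
  define n where "n = real (card R)"
  have m_le: "\<bar>avg S (P t x) (a k)\<bar> \<le> Ca" if "k \<in> K" for t x k
    by (rule avg_abs_le[OF S(1) P_sum]) (use Ca that in \<open>auto intro: gibbs_prob_nonneg\<close>)
  have dev_le: "\<bar>dev t x k R \<tau>\<bar> \<le> n * (2 * Ca)" if "\<tau> \<in> R \<rightarrow>\<^sub>E S" "k \<in> K" for t x \<tau> k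
  proof -
    have "\<bar>dev t x k R \<tau>\<bar> \<le> (\<Sum>l\<in>R. \<bar>a k (\<tau> l) - avg S (P t x) (a k)\<bar>)" unfolding dev_def by (rule sum_abs)
    also have "\<dots> \<le> (\<Sum>l\<in>R. 2 * Ca)"
    proof (rule sum_mono)
      fix l assume "l \<in> R"
      then have "\<bar>a k (\<tau> l)\<bar> \<le> Ca" using that Ca by auto
      then show "\<bar>a k (\<tau> l) - avg S (P t x) (a k)\<bar> \<le> 2 * Ca" using m_le[OF that(2), of t x] by linarith
    qed
    finally show ?thesis by (simp add: n_def)
  qed
  have Cf: "Cf \<ge> 0"
  proof -
    obtain \<sigma> where "\<sigma> \<in> S" using S by auto
    then have "(\<lambda>l\<in>R. \<sigma>) \<in> R \<rightarrow>\<^sub>E S" by auto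
    from bnd(1)[OF this, of t] show ?thesis by linarith
  qed
  define C1 where "C1 = Cf * (n * (2 * Ca))"
  have b1: "\<bar>ravg S (P t x) R (\<lambda>\<tau>. f t \<tau> * dev t x k R \<tau>)\<bar> \<le> C1" if "k \<in> K" for t x k
    unfolding C1_def
    by (rule ravg_abs_le[OF S(1) P_sum gibbs_prob_nonneg R(1)])
       (use Cf bnd dev_le that in \<open>auto simp: abs_mult intro!: mult_mono\<close>)
  let ?D = "\<lambda>t x. ravg S (P t x) R (f' t) + (\<Sum>k\<in>K. c' k t * (x k * ravg S (P t x) R (\<lambda>\<tau>. f t \<tau> * dev t x k R \<tau>)))"
  have D: "((\<lambda>t. ravg S (P t x) R (f t)) has_real_derivative ?D t x) (at t)" for t x
  proof (rule DERIV_cong[OF DERIV_ravg_gibbs[OF S R(1) DERIV_H f']])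
    let ?A = "\<lambda>\<sigma>. \<Sum>k\<in>K. c' k t * x k * a k \<sigma>"
    have "avg S (P t x) ?A = (\<Sum>k\<in>K. c' k t * x k * avg S (P t x) (a k))"
      unfolding avg_def by (simp add: sum_distrib_left mult_ac) (rule sum.swap)
    then have 1: "(\<Sum>l\<in>R. ?A (\<tau> l) - avg S (P t x) ?A) = (\<Sum>k\<in>K. c' k t * x k * dev t x k R \<tau>)" for \<tau>
      unfolding dev_def sum_distrib_left by (subst sum.swap) (simp add: sum_subtractf[symmetric] right_diff_distrib)
    have "ravg S (P t x) R (\<lambda>\<tau>. f' t \<tau> + f t \<tau> * (\<Sum>l\<in>R. ?A (\<tau> l) - avg S (P t x) ?A))
      = ravg S (P t x) R (\<lambda>\<tau>. f' t \<tau> + (\<Sum>k\<in>K. (c' k t * x k) * (f t \<tau> * dev t x k R \<tau>)))"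
      unfolding 1 by (simp add: sum_distrib_left mult_ac)
    then show "ravg S (P t x) R (\<lambda>\<tau>. f' t \<tau> + f t \<tau> * (\<Sum>l\<in>R. ?A (\<tau> l) - avg S (P t x) ?A)) = ?D t x"
      by (simp add: ravg_add ravg_sum ravg_cmult mult.assoc)
  qed
  have i1: "integrable (gaussians K) (\<lambda>x. ravg S (P t x) R (f' t))" for t by (rule integrable_ravg[OF R(1)])
  have "((\<lambda>t. E t R (f t)) has_real_derivative (\<integral>x. ?D t x \<partial>gaussians K)) (at t)"
    unfolding E_def
  proof (rule DERIV_integral[where g="\<lambda>x. Cf + (\<Sum>k\<in>K. \<bar>x k\<bar> * C1)", OF integrable_ravg[OF R(1)] D])
    show "?D t \<in> borel_measurable (gaussians K)" for t unfolding dev_def by measurable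
    show "integrable (gaussians K) (\<lambda>x. Cf + (\<Sum>k\<in>K. \<bar>x k\<bar> * C1))"
      using integrable_gaussians_moment(1)[OF _ K] by auto
    fix t x
    have "\<bar>?D t x\<bar> \<le> \<bar>ravg S (P t x) R (f' t)\<bar> + (\<Sum>k\<in>K. \<bar>c' k t * (x k * ravg S (P t x) R (\<lambda>\<tau>. f t \<tau> * dev t x k R \<tau>))\<bar>)"
      by (rule order_trans[OF abs_triangle_ineq add_left_mono[OF sum_abs]])
    also have "\<dots> \<le> Cf + (\<Sum>k\<in>K. \<bar>x k\<bar> * C1)"
    proof (intro add_mono sum_mono)
      show "\<bar>ravg S (P t x) R (f' t)\<bar> \<le> Cf"
        by (rule ravg_abs_le[OF S(1) P_sum gibbs_prob_nonneg R(1) bnd(2)])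
      fix k assume k: "k \<in> K"
      have "\<bar>c' k t\<bar> * (\<bar>x k\<bar> * \<bar>ravg S (P t x) R (\<lambda>\<tau>. f t \<tau> * dev t x k R \<tau>)\<bar>) \<le> 1 * (\<bar>x k\<bar> * C1)"
        using b1[OF k] c_le(2) by (intro mult_mono) auto
      then show "\<bar>c' k t * (x k * ravg S (P t x) R (\<lambda>\<tau>. f t \<tau> * dev t x k R \<tau>))\<bar> \<le> \<bar>x k\<bar> * C1"
        by (simp add: abs_mult)
    qed
    finally show "\<bar>?D t x\<bar> \<le> Cf + (\<Sum>k\<in>K. \<bar>x k\<bar> * C1)" .
  qed
  moreover have "(\<integral>x. ?D t x \<partial>gaussians K) = E t R (f' t)
     + (\<Sum>k\<in>K. c' k t * (\<integral>x. x k * ravg S (P t x) R (\<lambda>\<tau>. f t \<tau> * dev t x k R \<tau>) \<partial>gaussians K))"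
    unfolding E_def
    by (subst Bochner_Integration.integral_add[OF i1])
       (auto intro!: gaussian_ibp_ravg(2) R simp: integral_sum gaussian_ibp_ravg(2) R)
  moreover have "c' k t * (\<integral>x. x k * ravg S (P t x) R (\<lambda>\<tau>. f t \<tau> * dev t x k R \<tau>) \<partial>gaussians K)
     = sin t * cos t * E t (insert u (insert v R)) (\<lambda>\<tau>. f t \<tau> * (s k * replica_form (\<lambda>\<sigma> \<sigma>'. a k \<sigma> * a k \<sigma>') R u v \<tau>))"
    if k: "k \<in> K" for k
  proof -
    have "(\<integral>x. x k * ravg S (P t x) R (\<lambda>\<tau>. f t \<tau> * dev t x k R \<tau>) \<partial>gaussians K)
      = c k t * E t (insert u (insert v R)) (\<lambda>\<tau>. f t \<tau> * replica_form (\<lambda>\<sigma> \<sigma>'. a k \<sigma> * a k \<sigma>') R u v \<tau>)"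
      unfolding gaussian_ibp_ravg(1)[OF R(1) k]
      by (simp add: E_def ravg_replica_form[OF S(1) P_sum R f] dev_def var_def)
    then show ?thesis
      using c_c'[of k t] by (simp add: E_cmult mult.left_commute[of "f t _"]) (simp add: mult_ac)
  qed
  moreover have "(\<Sum>k\<in>K. E t (insert u (insert v R)) (\<lambda>\<tau>. f t \<tau> * (s k * replica_form (\<lambda>\<sigma> \<sigma>'. a k \<sigma> * a k \<sigma>') R u v \<tau>)))
     = E t (insert u (insert v R)) (\<lambda>\<tau>. f t \<tau> * replica_form B R u v \<tau>)"
  proof -
    have "(\<Sum>k\<in>K. s k * replica_form (\<lambda>\<sigma> \<sigma>'. a k \<sigma> * a k \<sigma>') R u v \<tau>) = replica_form B R u v \<tau>" for \<tau>
    proof -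
      have "(\<Sum>l\<in>R. \<Sum>l'\<in>R. B (\<tau> l) (\<tau> l')) = (\<Sum>k\<in>K. \<Sum>l\<in>R. \<Sum>l'\<in>R. s k * (a k (\<tau> l) * a k (\<tau> l')))"
        unfolding B_def by (rule trans[OF sum.cong[OF refl sum.swap] sum.swap])
      moreover have "(\<Sum>l\<in>R. B (\<tau> l) (\<tau> u)) = (\<Sum>k\<in>K. \<Sum>l\<in>R. s k * (a k (\<tau> l) * a k (\<tau> u)))"
        unfolding B_def by (rule sum.swap)
      moreover have "s k * replica_form (\<lambda>\<sigma> \<sigma>'. a k \<sigma> * a k \<sigma>') R u v \<tau>
        = (\<Sum>l\<in>R. \<Sum>l'\<in>R. s k * (a k (\<tau> l) * a k (\<tau> l'))) - 2 * n * (\<Sum>l\<in>R. s k * (a k (\<tau> l) * a k (\<tau> u)))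
          + n * (n + 1) * (s k * (a k (\<tau> u) * a k (\<tau> v))) - n * (s k * (a k (\<tau> u) * a k (\<tau> u)))" for k
        unfolding replica_form_def n_def[symmetric] sum_distrib_left[symmetric] by (simp add: algebra_simps)
      ultimately show ?thesis
        unfolding replica_form_def n_def[symmetric] B_def[of "\<tau> u"]
        by (simp only: sum.distrib sum_subtractf sum_distrib_left[symmetric])
    qed
    then show ?thesis
      using R by (simp add: E_sum[symmetric] sum_distrib_left[symmetric])
  qed
  ultimately show ?thesis by (simp add: sum_distrib_left[symmetric])
qed

end

section \<open>The spectral radius and subcritical systems\<close>

lemma det_characteristic_poly:
  fixes A :: "complex^'m^'m"
  shows "\<exists>p. \<forall>z. det (A - mat z) = poly p z"
proof -
  have e: "\<exists>p. \<forall>z. (A - mat z) $ i $ j = poly p z" for i j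
    by (rule exI[of _ "if i = j then [:A $ i $ j, -1:] else [:A $ i $ j:]"]) (simp add: mat_def)
  then obtain p where p: "\<And>i j z. (A - mat z) $ i $ j = poly (p i j) z" by metis
  show ?thesis
    by (rule exI[of _ "\<Sum>\<pi>\<in>{\<pi>. \<pi> permutes UNIV}. of_int (sign \<pi>) * (\<Prod>i\<in>UNIV. p i (\<pi> i))"])
       (simp add: det_def poly_sum poly_prod p[symmetric])
qed

text \<open>The spectral radius is a maximum over the spectrum, hence meaningless unless the spectrum is finite. Eigenvalues are roots
of the characteristic polynomial, which does not vanish identically because large numbers are no eigenvalues.\<close>

lemma finite_complex_spectrum: "finite (complex_spectrum (A :: real^'m^'m))"
proof -
  define C :: "complex^'m^'m" where "C = (\<chi> s t. complex_of_real (A $ s $ t))"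
  obtain p where p: "\<And>z. det (C - mat z) = poly p z" using det_characteristic_poly by metis
  have eig: "z \<in> complex_spectrum A \<longleftrightarrow> (\<exists>v. v \<noteq> 0 \<and> (C - mat z) *v v = 0)" for z
  proof -
    have "mat z *v v = z *s v" for v :: "complex^'m"
      by (simp add: vec_eq_iff matrix_vector_mult_def mat_def if_distrib[of "\<lambda>x. x * _"] cong: if_cong)
    then show ?thesis
      unfolding complex_spectrum_def C_def[symmetric] by (simp add: matrix_vector_mult_diff_rdistrib)
  qed
  have sub: "complex_spectrum A \<subseteq> {z. poly p z = 0}"
  proof
    fix z assume "z \<in> complex_spectrum A"
    then obtain v where "v \<noteq> 0" "(C - mat z) *v v = 0" using eig by blast
    then have "\<not> invertible (C - mat z)"
      by (metis invertible_left_inverse matrix_left_invertible_ker)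
    then show "z \<in> {z. poly p z = 0}" using p by (simp add: invertible_det_nz)
  qed
  \<comment> \<open>The number \<open>b\<close> exceeds every row sum, so \<open>C - b\<close> is strictly diagonally dominant.\<close>
  define b where "b = (\<Sum>i\<in>UNIV. \<Sum>j\<in>UNIV. cmod (C $ i $ j)) + 1"
  have "poly p (complex_of_real b) \<noteq> 0"
  proof
    assume "poly p (complex_of_real b) = 0"
    then have "\<not> invertible (C - mat (complex_of_real b))" using p by (simp add: invertible_det_nz)
    then obtain v where v: "v \<noteq> 0" "(C - mat (complex_of_real b)) *v v = 0"
      by (metis invertible_left_inverse matrix_left_invertible_ker)
    have "Max (range (\<lambda>j. cmod (v $ j))) \<in> range (\<lambda>j. cmod (v $ j))" by (rule Max_in) auto
    then obtain i where "Max (range (\<lambda>j. cmod (v $ j))) = cmod (v $ i)" by blast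
    then have i: "cmod (v $ j) \<le> cmod (v $ i)" for j
      using Max_ge[of "range (\<lambda>j. cmod (v $ j))" "cmod (v $ j)"] by simp
    have vi: "cmod (v $ i) > 0"
    proof (rule ccontr)
      assume "\<not> cmod (v $ i) > 0"
      then have "cmod (v $ j) \<le> 0" for j using i[of j] by linarith
      then have "v $ j = 0" for j by simp
      then show False using v(1) by (simp add: vec_eq_iff)
    qed
    have "0 = ((C - mat (complex_of_real b)) *v v) $ i" using v(2) by simp
    also have "\<dots> = (\<Sum>j\<in>UNIV. C $ i $ j * v $ j - (if i = j then complex_of_real b * v $ j else 0))"
      unfolding matrix_vector_mult_def mat_def by (auto intro!: sum.cong simp: left_diff_distrib)
    also have "\<dots> = (\<Sum>j\<in>UNIV. C $ i $ j * v $ j) - complex_of_real b * v $ i"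
      by (simp add: sum_subtractf)
    finally have eq: "complex_of_real b * v $ i = (\<Sum>j\<in>UNIV. C $ i $ j * v $ j)" by simp
    have b0: "b \<ge> 0" by (auto simp: b_def intro!: add_nonneg_nonneg sum_nonneg)
    have "b * cmod (v $ i) = cmod (complex_of_real b * v $ i)" using b0 by (simp add: norm_mult)
    also have "\<dots> \<le> (\<Sum>j\<in>UNIV. cmod (C $ i $ j) * cmod (v $ i))"
      unfolding eq by (rule order_trans[OF norm_sum]) (auto simp: norm_mult intro!: sum_mono mult_left_mono i)
    also have "\<dots> = (\<Sum>j\<in>UNIV. cmod (C $ i $ j)) * cmod (v $ i)" by (simp add: sum_distrib_right)
    finally have "b \<le> (\<Sum>j\<in>UNIV. cmod (C $ i $ j))" using vi by simp
    also have "\<dots> \<le> (\<Sum>i\<in>UNIV. \<Sum>j\<in>UNIV. cmod (C $ i $ j))"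
      by (rule member_le_sum[of i UNIV "\<lambda>i. \<Sum>j\<in>UNIV. cmod (C $ i $ j)"]) (auto intro: sum_nonneg)
    finally show False by (simp add: b_def)
  qed
  then have "p \<noteq> 0" by auto
  then show ?thesis using sub poly_roots_finite finite_subset by blast
qed

lemma norm_le_spectral_radius: "z \<in> complex_spectrum A \<Longrightarrow> cmod z \<le> spectral_radius A"
  unfolding spectral_radius_def using finite_complex_spectrum[of A] by (intro Max_ge) auto

text \<open>The quadratic form attains its maximum on the unit sphere, and a maximiser is an eigenvector.\<close>

lemma symmetric_max_eigenvector:
  fixes A :: "real^'m^'m"
  assumes sym: "\<And>s t. A $ s $ t = A $ t $ s"
  obtains u \<mu> where "norm u = 1" "A *v u = \<mu> *\<^sub>R u" "\<And>x. x \<bullet> (A *v x) \<le> \<mu> * (x \<bullet> x)"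
proof -
  have tr: "transpose A = A" using sym by (simp add: transpose_def vec_eq_iff)
  have sa: "x \<bullet> (A *v y) = y \<bullet> (A *v x)" for x y
  proof -
    have "x \<bullet> (A *v y) = (transpose A *v x) \<bullet> y" by (simp add: dot_lmul_matrix transpose_matrix_vector)
    then show ?thesis by (simp add: tr inner_commute)
  qed
  have "\<exists>u\<in>sphere 0 1. \<forall>x\<in>sphere 0 1. x \<bullet> (A *v x) \<le> u \<bullet> (A *v u)"
  proof (rule continuous_attains_sup)
    show "sphere 0 1 \<noteq> ({} :: (real^'m) set)" by (simp)
    show "continuous_on (sphere 0 1) (\<lambda>x. x \<bullet> (A *v x))"
      by (intro continuous_intros matrix_vector_mult_linear_continuous_on)
  qed simp
  then obtain u where u: "norm u = 1" and mx: "\<And>x. norm x = 1 \<Longrightarrow> x \<bullet> (A *v x) \<le> u \<bullet> (A *v u)"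
    by auto
  define \<mu> where "\<mu> = u \<bullet> (A *v u)"
  have le: "x \<bullet> (A *v x) \<le> \<mu> * (x \<bullet> x)" for x
  proof (cases "x = 0")
    case False
    define y where "y = (1 / norm x) *\<^sub>R x"
    have "norm y = 1" using False by (simp add: y_def)
    then have "y \<bullet> (A *v y) \<le> \<mu>" using mx by (simp add: \<mu>_def)
    moreover have "x = norm x *\<^sub>R y" using False by (simp add: y_def)
    moreover have "(c *\<^sub>R y) \<bullet> (A *v (c *\<^sub>R y)) = c\<^sup>2 * (y \<bullet> (A *v y))" for c
      by (simp add: matrix_vector_mult_scaleR power2_eq_square mult.assoc)
    ultimately have "x \<bullet> (A *v x) = (norm x)\<^sup>2 * (y \<bullet> (A *v y))" and "y \<bullet> (A *v y) \<le> \<mu>" by metis+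
    then have "x \<bullet> (A *v x) \<le> (norm x)\<^sup>2 * \<mu>" by (simp add: mult_left_mono)
    then show ?thesis by (simp add: power2_norm_eq_inner mult.commute)
  qed simp
  \<comment> \<open>The residual \<open>w\<close> is orthogonal to \<open>u\<close>; testing maximality at \<open>u + t w\<close> for small \<open>t\<close> forces it to vanish.\<close>
  define w where "w = A *v u - \<mu> *\<^sub>R u"
  have uu: "u \<bullet> u = 1" using u by (simp add: norm_eq_1)
  have uw: "u \<bullet> w = 0" by (simp add: w_def inner_diff_right uu \<mu>_def)
  have key: "2 * (w \<bullet> w) \<le> t * (\<mu> * (w \<bullet> w) - w \<bullet> (A *v w))" if "t > 0" for t
  proof -
    let ?x = "u + t *\<^sub>R w"
    have "?x \<bullet> (A *v ?x) = \<mu> + 2 * t * (w \<bullet> (A *v u)) + t\<^sup>2 * (w \<bullet> (A *v w))"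
      using sa[of u w] by (simp add: matrix_vector_right_distrib matrix_vector_mult_scaleR inner_add_left inner_add_right \<mu>_def
        power2_eq_square algebra_simps)
    moreover have "?x \<bullet> ?x = 1 + t\<^sup>2 * (w \<bullet> w)"
      using uw by (simp add: inner_add_left inner_add_right uu inner_commute[of w u] power2_eq_square algebra_simps)
    moreover have "w \<bullet> (A *v u) = w \<bullet> w"
    proof -
      have "A *v u = w + \<mu> *\<^sub>R u" by (simp add: w_def)
      then show ?thesis using uw by (simp add: inner_add_right inner_commute[of w u])
    qed
    ultimately have "2 * t * (w \<bullet> w) \<le> t\<^sup>2 * (\<mu> * (w \<bullet> w) - w \<bullet> (A *v w))"
      using le[of ?x] by (simp add: algebra_simps)
    then have "t * (2 * (w \<bullet> w)) \<le> t * (t * (\<mu> * (w \<bullet> w) - w \<bullet> (A *v w)))" by (simp add: power2_eq_square mult_ac)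
    then show ?thesis using that by (simp only: mult_le_cancel_left_pos)
  qed
  have "w \<bullet> w \<le> 0"
  proof (rule ccontr)
    assume w: "\<not> w \<bullet> w \<le> 0"
    define g where "g = \<mu> * (w \<bullet> w) - w \<bullet> (A *v w)"
    have g: "g > 0" using key[of 1] w by (simp add: g_def)
    have "2 * (w \<bullet> w) \<le> (w \<bullet> w) / g * g" using key[of "(w \<bullet> w) / g", folded g_def] w g by (auto simp: not_le)
    then show False using w g by simp
  qed
  then have "w = 0" by (metis inner_ge_zero inner_eq_zero_iff order_antisym)
  then show ?thesis using that[of u \<mu>] u le by (simp add: w_def)
qed

text \<open>The matrix \<open>D \<Lambda>\<close> is similar to the symmetric matrix \<open>\<Lambda>\<^sup>1\<^sup>/\<^sup>2 D \<Lambda>\<^sup>1\<^sup>/\<^sup>2\<close>, whose largest eigenvalue bounds its quadratic form.\<close>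

lemma quadratic_form_le_spectral_radius:
  fixes D :: "real^'m^'m" and lam :: "real^'m"
  assumes sym: "\<And>s t. D $ s $ t = D $ t $ s" and lam: "\<And>s. lam $ s > 0"
  shows "(\<Sum>s\<in>UNIV. \<Sum>t\<in>UNIV. lam $ s * D $ s $ t * lam $ t * r s * r t)
    \<le> spectral_radius (D ** diagonal lam) * (\<Sum>s\<in>UNIV. lam $ s * (r s)\<^sup>2)"
proof -
  define A :: "real^'m^'m" where "A = (\<chi> s t. sqrt (lam $ s) * D $ s $ t * sqrt (lam $ t))"
  have Asym: "A $ s $ t = A $ t $ s" for s t using sym[of s t] by (simp add: A_def mult_ac)
  obtain u \<mu> where u: "norm u = 1" "A *v u = \<mu> *\<^sub>R u" "\<And>x. x \<bullet> (A *v x) \<le> \<mu> * (x \<bullet> x)"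
    using symmetric_max_eigenvector[OF Asym] by metis
  define y :: "real^'m" where "y = (\<chi> s. u $ s / sqrt (lam $ s))"
  have DL: "(D ** diagonal lam) $ s $ t = D $ s $ t * lam $ t" for s t
    by (simp add: matrix_matrix_mult_def diagonal_def if_distrib cong: if_cong)
  have sq: "lam $ s / sqrt (lam $ s) = sqrt (lam $ s)" for s
    using lam[of s] by (simp add: real_div_sqrt)
  have ev: "(\<Sum>t\<in>UNIV. (D ** diagonal lam) $ s $ t * y $ t) = \<mu> * y $ s" for s
  proof -
    have "(A *v u) $ s = \<mu> * u $ s" using u(2) by simp
    then have "(\<Sum>t\<in>UNIV. sqrt (lam $ s) * (D $ s $ t * sqrt (lam $ t) * u $ t)) = \<mu> * u $ s"
      by (simp add: matrix_vector_mult_def A_def mult_ac)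
    then have "sqrt (lam $ s) * (\<Sum>t\<in>UNIV. D $ s $ t * sqrt (lam $ t) * u $ t) = \<mu> * u $ s"
      by (simp add: sum_distrib_left)
    then have "(\<Sum>t\<in>UNIV. D $ s $ t * sqrt (lam $ t) * u $ t) = \<mu> * (u $ s / sqrt (lam $ s))"
      using lam[of s] by (simp add: nonzero_eq_divide_eq mult.commute)
    moreover have "D $ s $ t * lam $ t * (u $ t / sqrt (lam $ t)) = D $ s $ t * sqrt (lam $ t) * u $ t" for t
    proof -
      have "D $ s $ t * lam $ t * (u $ t / sqrt (lam $ t)) = D $ s $ t * (lam $ t / sqrt (lam $ t)) * u $ t" by simp
      then show ?thesis unfolding sq .
    qed
    ultimately show ?thesis by (simp add: DL y_def)
  qed
  have "complex_of_real \<mu> \<in> complex_spectrum (D ** diagonal lam)"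
  proof -
    define v :: "complex^'m" where "v = (\<chi> s. complex_of_real (y $ s))"
    have "u \<noteq> 0" using u(1) by auto
    then obtain s where "u $ s \<noteq> 0" by (auto simp: vec_eq_iff)
    then have "v $ s \<noteq> 0" using lam[of s] by (simp add: v_def y_def)
    then have "v \<noteq> 0" by auto
    moreover have "(\<chi> s t. complex_of_real ((D ** diagonal lam) $ s $ t)) *v v = complex_of_real \<mu> *s v"
      unfolding vec_eq_iff
    proof
      fix s
      have "((\<chi> s t. complex_of_real ((D ** diagonal lam) $ s $ t)) *v v) $ s
        = complex_of_real (\<Sum>t\<in>UNIV. (D ** diagonal lam) $ s $ t * y $ t)"
        by (simp add: matrix_vector_mult_def v_def)
      then show "((\<chi> s t. complex_of_real ((D ** diagonal lam) $ s $ t)) *v v) $ s = (complex_of_real \<mu> *s v) $ s"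
        unfolding ev by (simp add: v_def)
    qed
    ultimately show ?thesis unfolding complex_spectrum_def by blast
  qed
  from norm_le_spectral_radius[OF this] have \<mu>: "\<mu> \<le> spectral_radius (D ** diagonal lam)" by simp
  define x :: "real^'m" where "x = (\<chi> s. sqrt (lam $ s) * r s)"
  have ll: "sqrt (lam $ s) * sqrt (lam $ s) = lam $ s" for s using lam[of s] by simp
  have xx: "x \<bullet> x = (\<Sum>s\<in>UNIV. lam $ s * (r s)\<^sup>2)"
  proof -
    have "(sqrt (lam $ s) * r s) * (sqrt (lam $ s) * r s) = (sqrt (lam $ s) * sqrt (lam $ s)) * (r s * r s)" for s
      by (simp only: mult_ac)
    then have "(sqrt (lam $ s) * r s) * (sqrt (lam $ s) * r s) = lam $ s * (r s)\<^sup>2" for s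
      unfolding ll by (simp only: power2_eq_square)
    then show ?thesis unfolding inner_vec_def x_def by (simp only: vec_lambda_beta inner_real_def)
  qed
  have "x \<bullet> (A *v x) = (\<Sum>s\<in>UNIV. \<Sum>t\<in>UNIV. lam $ s * D $ s $ t * lam $ t * r s * r t)"
  proof -
    have "(sqrt (lam $ s) * r s) * ((sqrt (lam $ s) * D $ s $ t * sqrt (lam $ t)) * (sqrt (lam $ t) * r t))
      = (sqrt (lam $ s) * sqrt (lam $ s)) * D $ s $ t * (sqrt (lam $ t) * sqrt (lam $ t)) * r s * r t" for s t
      by (simp only: mult_ac)
    note e = this[unfolded ll]
    show ?thesis
      unfolding inner_vec_def x_def A_def matrix_vector_mult_def
      by (simp only: vec_lambda_beta inner_real_def sum_distrib_left e)
  qed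
  then show ?thesis
    using u(3)[of x] mult_right_mono[OF \<mu>, of "x \<bullet> x"] unfolding xx[symmetric] by simp
qed

lemma abs_quadratic_form_le_spectral_radius:
  fixes D :: "real^'m^'m" and lam :: "real^'m"
  assumes sym: "\<And>s t. D $ s $ t = D $ t $ s" and lam: "\<And>s. lam $ s > 0" and D: "\<And>s t. D $ s $ t \<ge> 0"
  shows "\<bar>\<Sum>s\<in>UNIV. \<Sum>t\<in>UNIV. lam $ s * D $ s $ t * lam $ t * r s * r t\<bar>
    \<le> spectral_radius (D ** diagonal lam) * (\<Sum>s\<in>UNIV. lam $ s * (r s)\<^sup>2)"
proof -
  have "\<bar>\<Sum>s\<in>UNIV. \<Sum>t\<in>UNIV. lam $ s * D $ s $ t * lam $ t * r s * r t\<bar>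
    \<le> (\<Sum>s\<in>UNIV. \<Sum>t\<in>UNIV. \<bar>lam $ s * D $ s $ t * lam $ t * r s * r t\<bar>)"
    by (rule order_trans[OF sum_abs]) (intro sum_mono sum_abs)
  also have "\<dots> = (\<Sum>s\<in>UNIV. \<Sum>t\<in>UNIV. lam $ s * D $ s $ t * lam $ t * \<bar>r s\<bar> * \<bar>r t\<bar>)"
    using lam D by (simp add: abs_mult less_imp_le abs_of_pos)
  also have "\<dots> \<le> spectral_radius (D ** diagonal lam) * (\<Sum>s\<in>UNIV. lam $ s * (\<bar>r s\<bar>)\<^sup>2)"
    by (rule quadratic_form_le_spectral_radius[OF sym lam])
  finally show ?thesis by simp
qed

text \<open>Pair the inequality with \<open>\<Lambda> |v|\<close>: the weighted norm of \<open>v\<close> is at most \<open>\<kappa>\<close> times the spectral radius times itself.\<close>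

lemma subcritical_vector_zero:
  fixes D :: "real^'m^'m" and lam v :: "real^'m"
  assumes sym: "\<And>s t. D $ s $ t = D $ t $ s" and lam: "\<And>s. lam $ s > 0" and \<kappa>: "\<kappa> \<ge> 0"
    and sub: "\<kappa> * spectral_radius (D ** diagonal lam) < 1"
    and le: "\<And>s. \<bar>v $ s\<bar> \<le> \<kappa> * (\<Sum>t\<in>UNIV. D $ s $ t * lam $ t * \<bar>v $ t\<bar>)"
  shows "v = 0"
proof -
  let ?V = "\<Sum>s\<in>UNIV. lam $ s * (\<bar>v $ s\<bar>)\<^sup>2"
  have "?V \<le> (\<Sum>s\<in>UNIV. lam $ s * \<bar>v $ s\<bar> * (\<kappa> * (\<Sum>t\<in>UNIV. D $ s $ t * lam $ t * \<bar>v $ t\<bar>)))"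
  proof (rule sum_mono)
    fix s
    have "lam $ s * \<bar>v $ s\<bar> * \<bar>v $ s\<bar> \<le> lam $ s * \<bar>v $ s\<bar> * (\<kappa> * (\<Sum>t\<in>UNIV. D $ s $ t * lam $ t * \<bar>v $ t\<bar>))"
      using le[of s] lam[of s] by (intro mult_left_mono) auto
    then show "lam $ s * (\<bar>v $ s\<bar>)\<^sup>2 \<le> lam $ s * \<bar>v $ s\<bar> * (\<kappa> * (\<Sum>t\<in>UNIV. D $ s $ t * lam $ t * \<bar>v $ t\<bar>))"
      by (simp only: power2_eq_square mult.assoc)
  qed
  also have "\<dots> = \<kappa> * (\<Sum>s\<in>UNIV. \<Sum>t\<in>UNIV. lam $ s * D $ s $ t * lam $ t * \<bar>v $ s\<bar> * \<bar>v $ t\<bar>)"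
    by (simp add: sum_distrib_left mult_ac)
  also have "\<dots> \<le> \<kappa> * (spectral_radius (D ** diagonal lam) * ?V)"
    using quadratic_form_le_spectral_radius[OF sym lam, of "\<lambda>s. \<bar>v $ s\<bar>"] \<kappa> by (intro mult_left_mono)
  finally have 1: "?V \<le> (\<kappa> * spectral_radius (D ** diagonal lam)) * ?V" by (simp add: mult.assoc)
  have nn: "\<And>s. 0 \<le> lam $ s * (\<bar>v $ s\<bar>)\<^sup>2" using lam by (simp add: less_imp_le)
  then have "?V \<ge> 0" by (simp add: sum_nonneg)
  moreover have "\<not> ?V > 0"
  proof
    assume "?V > 0"
    then have "(\<kappa> * spectral_radius (D ** diagonal lam)) * ?V < 1 * ?V" using sub by (rule mult_strict_right_mono[rotated])
    then show False using 1 by simp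
  qed
  ultimately have "?V = 0" by linarith
  then have "\<forall>s. lam $ s * (\<bar>v $ s\<bar>)\<^sup>2 = 0" using nn by (subst (asm) sum_nonneg_eq_0_iff) auto
  then show ?thesis using lam by (simp add: vec_eq_iff less_imp_neq[symmetric])
qed

text \<open>A kernel vector would satisfy the hypothesis of \<open>subcritical_vector_zero\<close>, since \<open>|gam| \<le> 1\<close>.\<close>

lemma invertible_subcritical:
  fixes D :: "real^'m^'m" and lam gam :: "real^'m"
  assumes sym: "\<And>s t. D $ s $ t = D $ t $ s" and lam: "\<And>s. lam $ s > 0" and D: "\<And>s t. D $ s $ t \<ge> 0"
    and \<kappa>: "\<kappa> \<ge> 0" and sub: "\<kappa> * spectral_radius (D ** diagonal lam) < 1"
    and gam: "\<And>s. \<bar>gam $ s\<bar> \<le> 1"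
  shows "invertible (mat 1 - \<kappa> *\<^sub>R (D ** diagonal lam ** diagonal gam))"
    and "invertible (mat 1 - \<kappa> *\<^sub>R (diagonal gam ** (D ** diagonal lam)))"
proof -
  have inv: "invertible (mat 1 - \<kappa> *\<^sub>R A)"
    if A: "\<And>s t. \<bar>A $ s $ t\<bar> \<le> D $ s $ t * lam $ t" for A :: "real^'m^'m"
    unfolding invertible_left_inverse matrix_left_invertible_ker
  proof (intro allI impI)
    fix v assume v: "(mat 1 - \<kappa> *\<^sub>R A) *v v = 0"
    then have eq: "v $ s = \<kappa> * (\<Sum>t\<in>UNIV. A $ s $ t * v $ t)" for s
    proof -
      have "v = \<kappa> *\<^sub>R (A *v v)" using v by (simp add: matrix_vector_mult_diff_rdistrib scaleR_matrix_vector_assoc[symmetric])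
      then have "v $ s = (\<kappa> *\<^sub>R (A *v v)) $ s" by simp
      then show ?thesis by (simp add: matrix_vector_mult_def)
    qed
    show "v = 0"
    proof (rule subcritical_vector_zero[OF sym lam \<kappa> sub])
      fix s
      have "\<bar>v $ s\<bar> = \<kappa> * \<bar>\<Sum>t\<in>UNIV. A $ s $ t * v $ t\<bar>" using eq[of s] \<kappa> by (metis abs_mult abs_of_nonneg)
      also have "\<dots> \<le> \<kappa> * (\<Sum>t\<in>UNIV. D $ s $ t * lam $ t * \<bar>v $ t\<bar>)"
        using A \<kappa> by (intro mult_left_mono order_trans[OF sum_abs] sum_mono) (auto simp: abs_mult intro!: mult_right_mono)
      finally show "\<bar>v $ s\<bar> \<le> \<kappa> * (\<Sum>t\<in>UNIV. D $ s $ t * lam $ t * \<bar>v $ t\<bar>)" .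
    qed
  qed
  have e1: "(D ** diagonal lam ** diagonal gam) $ s $ t = D $ s $ t * lam $ t * gam $ t" for s t
    by (simp add: matrix_matrix_mult_def diagonal_def if_distrib cong: if_cong)
  have e2: "(diagonal gam ** (D ** diagonal lam)) $ s $ t = gam $ s * (D $ s $ t * lam $ t)" for s t
    by (simp add: matrix_matrix_mult_def diagonal_def if_distrib[of "\<lambda>x. x * _"] if_distrib[of "\<lambda>x. _ * x"] cong: if_cong)
  have nn: "0 \<le> D $ s $ t * lam $ t" for s t using D lam by (simp add: less_imp_le)
  show "invertible (mat 1 - \<kappa> *\<^sub>R (D ** diagonal lam ** diagonal gam))"
    by (rule inv) (use nn gam in \<open>simp add: e1 abs_mult[of _ "gam $ _"] abs_of_nonneg mult_left_le\<close>)
  show "invertible (mat 1 - \<kappa> *\<^sub>R (diagonal gam ** (D ** diagonal lam)))"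
    by (rule inv) (use nn gam in \<open>simp add: e2 abs_mult[of "gam $ _"] abs_of_nonneg mult_left_le_one_le\<close>)
qed

section \<open>The model as the end of an interpolation path\<close>

lemma sum_PiE_prod:
  fixes g :: "nat \<Rightarrow> 'a \<Rightarrow> real"
  assumes "finite A"
  shows "(\<Sum>\<sigma>\<in>A \<rightarrow>\<^sub>E T. \<Prod>i\<in>A. g i (\<sigma> i)) = (\<Prod>i\<in>A. \<Sum>e\<in>T. g i e)"
  using assms
proof (induction A rule: finite_induct)
  case (insert l A)
  have "(\<Prod>i\<in>A. g i ((\<sigma>(l := e)) i)) = (\<Prod>i\<in>A. g i (\<sigma> i))" for \<sigma> e
    using insert by (intro prod.cong) auto
  then show ?case
    using insert by (simp add: sum_PiE_insert sum_distrib_left[symmetric] sum_distrib_right[symmetric] cong: prod.cong)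
qed simp

text \<open>Hoeffding's lemma for a \<open>\<plusminus>1\<close>-valued variable of mean \<open>q\<close>.\<close>

lemma hoeffding_two_point:
  fixes q w :: real
  assumes "-1 \<le> q" "q \<le> 1"
  shows "exp (- w * q) * (exp w * ((1 + q) / 2) + exp (- w) * ((1 - q) / 2)) \<le> exp (w\<^sup>2 / 2)"
proof -
  have pos: "exp (- w * q) * (exp w * ((1 + q) / 2) + exp (- w) * ((1 - q) / 2)) \<le> exp (w\<^sup>2 / 2)"
    if q: "-1 \<le> q" "q \<le> 1" and w: "w \<ge> 0" for q w :: real
  proof -
    define p where "p = (1 + q) / 2"
    have p: "p \<ge> 0" "p \<le> 1" using q by (auto simp: p_def)
    have "1 \<le> exp (2 * w)" using w by simp
    then have "p * (exp (2 * w) - 1) \<ge> 0" using p by simp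
    then have ps: "1 + p * (exp (2 * w) - 1) > 0" by linarith
    have "- (2 * w) * p + ln (1 + p * (exp (2 * w) - 1)) \<le> (2 * w)\<^sup>2 / 8"
      by (rule Hoeffdings_lemma_aux) (use w p in auto)
    then have "exp (- (2 * w) * p + ln (1 + p * (exp (2 * w) - 1))) \<le> exp (w\<^sup>2 / 2)"
      by (simp add: power2_eq_square)
    then have 1: "exp (- (2 * w) * p) * (1 + p * (exp (2 * w) - 1)) \<le> exp (w\<^sup>2 / 2)"
      using ps by (simp only: exp_add exp_ln)
    have e: "exp (- (2 * w) * p) = exp (- w * q) * exp (- w)" by (simp add: p_def exp_add[symmetric] algebra_simps add_divide_distrib)
    have e2: "exp (- w) * exp (2 * w) = exp w" by (simp add: exp_add[symmetric])
    have "exp (- (2 * w) * p) * (1 + p * (exp (2 * w) - 1))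
      = exp (- w * q) * ((exp (- w) * exp (2 * w)) * p + exp (- w) * (1 - p))"
      unfolding e by (simp add: algebra_simps)
    also have "\<dots> = exp (- w * q) * (exp w * ((1 + q) / 2) + exp (- w) * ((1 - q) / 2))"
    proof -
      have "1 - p = (1 - q) / 2" by (simp add: p_def field_simps)
      then show ?thesis unfolding e2 by (simp add: p_def)
    qed
    finally show ?thesis using 1 by simp
  qed
  show ?thesis
  proof (cases "w \<ge> 0")
    case False
    then show ?thesis using pos[of "- q" "- w"] assms by (simp add: add.commute)
  qed (use pos assms in auto)
qed

context gaussian_path
begin

definition weight :: "real \<Rightarrow> nat set \<Rightarrow> (nat \<Rightarrow> 'c) \<Rightarrow> real" where
  "weight t R \<tau> = (\<integral>x. (\<Prod>l\<in>R. P t x (\<tau> l)) \<partial>gaussians K)"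

lemma E_eq_sum:
  assumes R: "finite R"
  shows "E t R f = (\<Sum>\<tau>\<in>R \<rightarrow>\<^sub>E S. weight t R \<tau> * f \<tau>)"
proof -
  have "integrable (gaussians K) (\<lambda>x. \<Prod>l\<in>R. P t x (\<tau> l))" if \<tau>: "\<tau> \<in> R \<rightarrow>\<^sub>E S" for \<tau>
  proof -
    have "ravg S (P t x) R (\<lambda>\<tau>'. if \<tau>' = \<tau> then 1 else 0) = (\<Prod>l\<in>R. P t x (\<tau> l))" for x
      unfolding ravg_def using \<tau> finite_configs[OF R] by (simp add: if_distrib cong: if_cong)
    then show ?thesis using integrable_ravg[OF R, of t "\<lambda>\<tau>'. if \<tau>' = \<tau> then 1 else 0"] by simp
  qed
  then show ?thesis
    unfolding E_def ravg_def weight_def by (subst Bochner_Integration.integral_sum) auto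
qed

end

definition field_variance :: "real^'m^'m \<Rightarrow> real^'m \<Rightarrow> real^'m \<Rightarrow> 'm \<Rightarrow> real" where
  "field_variance D lam q s = (\<Sum>t\<in>UNIV. D $ s $ t * lam $ t * q $ t)"

text \<open>The model at one system size. The fixed point equation is part of the locale because it is what makes the comparison
system have overlaps centered at \<open>q\<close>.\<close>

locale spin_glass =
  fixes D :: "real^'m^'m" and lam q :: "real^'m" and \<beta> h :: real and N :: nat and I :: "'m \<Rightarrow> nat set"
  assumes D_sym: "\<And>s t. D $ s $ t = D $ t $ s" and D_nonneg: "\<And>s t. 0 \<le> D $ s $ t"
    and lam_pos: "\<And>s. 0 < lam $ s" and beta_pos: "0 < \<beta>" and N: "1 \<le> N"
    and partition: "species_partition lam N I"
    and q_nonneg: "\<And>s. 0 \<le> q $ s" and q_le: "\<And>s. q $ s \<le> 1"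
    and fixpoint: "\<And>s. q $ s = gauss_expectation (\<lambda>x. tanh (\<beta> * x * sqrt (field_variance D lam q s) + h) ^ 2)"
begin

abbreviation v :: "'m \<Rightarrow> real" where "v \<equiv> field_variance D lam q"

lemma v_nonneg: "0 \<le> v s"
  unfolding field_variance_def using D_nonneg lam_pos q_nonneg by (intro sum_nonneg mult_nonneg_nonneg) (auto intro: less_imp_le)

definition species_of :: "nat \<Rightarrow> 'm" where "species_of i = (THE s. i \<in> I s)"

lemma I_Un: "(\<Union>s. I s) = {1..N}" and I_disj: "disjoint_family I" and card_I: "real (card (I s)) = lam $ s * real N"
  using partition by (auto simp: species_partition_def)

lemma finite_I: "finite (I s)"
  using I_Un by (metis UN_upper UNIV_I finite_atLeastAtMost finite_subset)

lemma card_I_pos: "card (I s) > 0"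
proof -
  have "real (card (I s)) > 0" unfolding card_I using lam_pos[of s] N by simp
  then show ?thesis by simp
qed

lemma species_of_eq: "i \<in> I s \<Longrightarrow> species_of i = s"
  unfolding species_of_def using I_disj by (intro the_equality) (auto simp: disjoint_family_on_def)

lemma species_of_mem: "i \<in> {1..N} \<Longrightarrow> i \<in> I (species_of i)"
  using I_Un species_of_eq by (metis UN_E)

lemma I_mem: "i \<in> I s \<Longrightarrow> 1 \<le> i \<and> i \<le> N"
  using I_Un by auto

lemma sum_sites: "(\<Sum>i\<in>{1..N}. f i) = (\<Sum>s\<in>UNIV. \<Sum>i\<in>I s. (f i :: real))"
  unfolding I_Un[symmetric] using I_disj finite_I by (subst sum.UNION_disjoint) (auto simp: disjoint_family_on_def)

text \<open>Index set of the Gaussians: \<open>(i, j)\<close> with \<open>i < j\<close> carries the coupling of two sites, and the diagonal index \<open>(i, i)\<close> the independent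
random field at site \<open>i\<close> that replaces the couplings.\<close>

definition K :: "(nat \<times> nat) set" where "K = {(i, j). 1 \<le> i \<and> i \<le> j \<and> j \<le> N}"
abbreviation S :: "(nat \<Rightarrow> real) set" where "S \<equiv> spin_configs N"
definition bias :: "(nat \<Rightarrow> real) \<Rightarrow> real" where "bias \<sigma> = h * (\<Sum>i\<in>{1..N}. \<sigma> i)"
definition coef :: "nat \<times> nat \<Rightarrow> (nat \<Rightarrow> real) \<Rightarrow> real" where
  "coef k \<sigma> = (if fst k = snd k then \<beta> * sqrt (v (species_of (fst k))) * \<sigma> (fst k)
     else \<beta> / sqrt (real N) * sqrt (D $ species_of (fst k) $ species_of (snd k)) * \<sigma> (fst k) * \<sigma> (snd k))"

lemma finite_S: "finite S"
  unfolding spin_configs_def by (intro finite_PiE) auto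
lemma S_ne: "S \<noteq> {}"
  unfolding spin_configs_def by (auto simp: PiE_eq_empty_iff)
lemma finite_K: "finite K"
  by (rule finite_subset[of _ "{1..N} \<times> {1..N}"]) (auto simp: K_def)

lemma spin_cases: "\<sigma> \<in> S \<Longrightarrow> i \<in> {1..N} \<Longrightarrow> \<sigma> i = 1 \<or> \<sigma> i = -1"
  unfolding spin_configs_def by (drule PiE_mem) auto
lemma spin_sq: "\<sigma> \<in> S \<Longrightarrow> i \<in> {1..N} \<Longrightarrow> \<sigma> i * \<sigma> i = 1"
  using spin_cases by fastforce
lemma spin_abs: "\<sigma> \<in> S \<Longrightarrow> i \<in> {1..N} \<Longrightarrow> \<bar>\<sigma> i\<bar> = 1"
  using spin_cases by fastforce

text \<open>Fields fade out with \<open>cos t\<close> while couplings fade in with \<open>sin t\<close>: independent spins at \<open>t = 0\<close>, the model at \<open>t = \<pi>/2\<close>.\<close>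

definition c_full :: "nat \<times> nat \<Rightarrow> real \<Rightarrow> real" where "c_full k t = (if fst k = snd k then cos t else sin t)"
definition c_full' :: "nat \<times> nat \<Rightarrow> real \<Rightarrow> real" where "c_full' k t = (if fst k = snd k then - sin t else cos t)"
definition s_full :: "nat \<times> nat \<Rightarrow> real" where "s_full k = (if fst k = snd k then -1 else 1)"

sublocale F: gaussian_path S K bias coef c_full c_full' s_full
proof
  show "finite S" "S \<noteq> {}" "finite K" by (fact finite_S S_ne finite_K)+
  fix k t
  show "(c_full k has_real_derivative c_full' k t) (at t)"
    by (cases "fst k = snd k") (auto simp: c_full_def[abs_def] c_full'_def intro!: derivative_eq_intros)
  show "\<bar>c_full k t\<bar> \<le> 1" "\<bar>c_full' k t\<bar> \<le> 1" "c_full k t * c_full' k t = s_full k * (sin t * cos t)"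
    by (auto simp: c_full_def c_full'_def s_full_def)
qed

definition Rbar :: "'m \<Rightarrow> (nat \<Rightarrow> real) \<Rightarrow> (nat \<Rightarrow> real) \<Rightarrow> real" where
  "Rbar s \<sigma> \<tau> = (\<Sum>i\<in>I s. \<sigma> i * \<tau> i) / real (card (I s)) - q $ s"
text \<open>The size \<open>Rbar\<^sup>T \<Lambda> Rbar\<close> of the centered overlap vector and the form \<open>Rbar\<^sup>T \<Lambda> D \<Lambda> Rbar\<close> that governs the interpolation.\<close>

definition Y :: "(nat \<Rightarrow> real) \<Rightarrow> (nat \<Rightarrow> real) \<Rightarrow> real" where
  "Y \<sigma> \<tau> = (\<Sum>s\<in>UNIV. lam $ s * (Rbar s \<sigma> \<tau>)\<^sup>2)"
definition X :: "(nat \<Rightarrow> real) \<Rightarrow> (nat \<Rightarrow> real) \<Rightarrow> real" where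
  "X \<sigma> \<tau> = (\<Sum>s\<in>UNIV. \<Sum>t\<in>UNIV. lam $ s * D $ s $ t * lam $ t * Rbar s \<sigma> \<tau> * Rbar t \<sigma> \<tau>)"

abbreviation \<rho> :: real where "\<rho> \<equiv> spectral_radius (D ** diagonal lam)"

lemma Y_nonneg: "0 \<le> Y \<sigma> \<tau>"
  unfolding Y_def using lam_pos by (intro sum_nonneg mult_nonneg_nonneg) (auto intro: less_imp_le)
lemma X_abs_le: "\<bar>X \<sigma> \<tau>\<bar> \<le> \<rho> * Y \<sigma> \<tau>"
  unfolding X_def Y_def by (rule abs_quadratic_form_le_spectral_radius[OF D_sym lam_pos D_nonneg])
lemma X_le: "X \<sigma> \<tau> \<le> \<rho> * Y \<sigma> \<tau>"
  using X_abs_le[of \<sigma> \<tau>] by linarith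

lemma Y_le:  assumes "\<sigma> \<in> S" "\<tau> \<in> S" shows "Y \<sigma> \<tau> \<le> (\<Sum>s\<in>UNIV. lam $ s * 4)"
proof -
  have "(Rbar s \<sigma> \<tau>)\<^sup>2 \<le> 4" for s
  proof -
    have "\<bar>\<Sum>i\<in>I s. \<sigma> i * \<tau> i\<bar> \<le> (\<Sum>i\<in>I s. 1)"
      by (rule order_trans[OF sum_abs sum_mono]) (use I_mem spin_abs assms in \<open>auto simp: abs_mult\<close>)
    then have "\<bar>(\<Sum>i\<in>I s. \<sigma> i * \<tau> i) / real (card (I s))\<bar> \<le> 1"
      using card_I_pos[of s] by (simp add: abs_divide)
    then have "\<bar>Rbar s \<sigma> \<tau>\<bar> \<le> 2" unfolding Rbar_def using q_nonneg[of s] q_le[of s] by linarith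
    then have "(\<bar>Rbar s \<sigma> \<tau>\<bar>)\<^sup>2 \<le> 2\<^sup>2" by (intro power_mono) auto
    then show ?thesis by simp
  qed
  then show ?thesis unfolding Y_def using lam_pos by (intro sum_mono mult_left_mono) (auto intro: less_imp_le)
qed

lemma spin_sum: "(\<Sum>i\<in>I s. \<sigma> i * \<tau> i) = lam $ s * real N * (Rbar s \<sigma> \<tau> + q $ s)"
  using card_I[of s] lam_pos[of s] N by (simp add: Rbar_def)

lemma sum_symmetric_square:
  fixes g :: "nat \<Rightarrow> nat \<Rightarrow> real"
  assumes "\<And>i j. g i j = g j i"
  shows "(\<Sum>i\<in>{1..N}. \<Sum>j\<in>{1..N}. g i j) = (\<Sum>i\<in>{1..N}. g i i) + 2 * (\<Sum>(i, j)\<in>{(i, j). 1 \<le> i \<and> i < j \<and> j \<le> N}. g i j)"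
proof -
  let ?L = "{(i, j). 1 \<le> i \<and> i < j \<and> j \<le> N}" and ?U = "{(j, i). 1 \<le> i \<and> i < j \<and> j \<le> N}" and ?D = "(\<lambda>i. (i, i)) ` {1..N}"
  have fin: "finite ?L" "finite ?U" by (rule finite_subset[of _ "{1..N} \<times> {1..N}"]; auto)+
  have "{1..N} \<times> {1..N} = ?D \<union> (?L \<union> ?U)" by auto
  then have "(\<Sum>i\<in>{1..N}. \<Sum>j\<in>{1..N}. g i j) = (\<Sum>(i, j)\<in>?D \<union> (?L \<union> ?U). g i j)" by (simp add: sum.cartesian_product)
  also have "\<dots> = (\<Sum>(i, j)\<in>?D. g i j) + ((\<Sum>(i, j)\<in>?L. g i j) + (\<Sum>(i, j)\<in>?U. g i j))"
    using fin by (subst sum.union_disjoint, simp, simp, force, subst sum.union_disjoint) auto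
  also have "(\<Sum>(i, j)\<in>?U. g i j) = (\<Sum>(i, j)\<in>?L. g i j)"
    by (rule sum.reindex_bij_witness[of _ "\<lambda>(i, j). (j, i)" "\<lambda>(i, j). (j, i)"]) (auto simp: assms)
  also have "(\<Sum>(i, j)\<in>?D. g i j) = (\<Sum>i\<in>{1..N}. g i i)"
    by (subst sum.reindex) (auto simp: inj_on_def)
  finally show ?thesis by simp
qed

lemma K_split: "K = {(i, j). 1 \<le> i \<and> i < j \<and> j \<le> N} \<union> (\<lambda>i. (i, i)) ` {1..N}"
  by (auto simp: K_def)

lemma sum_K:
  "(\<Sum>k\<in>K. (f k :: real)) = (\<Sum>(i, j)\<in>{(i, j). 1 \<le> i \<and> i < j \<and> j \<le> N}. f (i, j)) + (\<Sum>i\<in>{1..N}. f (i, i))"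
proof -
  have fin: "finite {(i, j). 1 \<le> i \<and> i < j \<and> j \<le> N}"
    by (rule finite_subset[of _ "{1..N} \<times> {1..N}"]) auto
  show ?thesis
    unfolding K_split using fin by (subst sum.union_disjoint) (auto simp: sum.reindex inj_on_def)
qed

definition b_full :: real where
  "b_full = - (\<beta>\<^sup>2 * real N / 2 * (\<Sum>s\<in>UNIV. lam $ s * q $ s * v s)) - \<beta>\<^sup>2 / (2 * real N) * (\<Sum>i\<in>{1..N}. D $ species_of i $ species_of i)"

lemma field_sum_overlap:
  "(\<Sum>j\<in>{1..N}. D $ s $ species_of j * (\<sigma> j * \<tau> j)) = real N * (\<Sum>t\<in>UNIV. D $ s $ t * lam $ t * Rbar t \<sigma> \<tau>) + real N * v s"
proof -
  have "(\<Sum>j\<in>{1..N}. D $ s $ species_of j * (\<sigma> j * \<tau> j)) = (\<Sum>t\<in>UNIV. D $ s $ t * (\<Sum>j\<in>I t. \<sigma> j * \<tau> j))"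
    unfolding sum_sites sum_distrib_left by (intro sum.cong refl) (simp add: species_of_eq)
  also have "\<dots> = (\<Sum>t\<in>UNIV. real N * (D $ s $ t * lam $ t * Rbar t \<sigma> \<tau>) + real N * (D $ s $ t * lam $ t * q $ t))"
    unfolding spin_sum by (intro sum.cong refl) (simp add: algebra_simps)
  finally show ?thesis by (simp add: sum.distrib sum_distrib_left field_variance_def)
qed

text \<open>Subtracting the variance of the fields from the one of the couplings completes the square around \<open>q\<close>: up to a
constant, the covariance along the path is the quadratic form of the centered overlaps.\<close>

lemma F_B:
  assumes \<sigma>: "\<sigma> \<in> S" and \<tau>: "\<tau> \<in> S"
  shows "F.B \<sigma> \<tau> = \<beta>\<^sup>2 * real N / 2 * X \<sigma> \<tau> + b_full"
proof -
  let ?L = "{(i, j). 1 \<le> i \<and> i < j \<and> j \<le> N}"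
  let ?g = "\<lambda>i j. D $ species_of i $ species_of j * (\<sigma> i * \<tau> i) * (\<sigma> j * \<tau> j)"
  let ?r = "\<lambda>s. Rbar s \<sigma> \<tau>"
  have N0: "real N > 0" using N by simp
  have off: "s_full (i, j) * (coef (i, j) \<sigma> * coef (i, j) \<tau>) = \<beta>\<^sup>2 / real N * ?g i j" if "i < j" for i j
  proof -
    have "coef (i, j) \<sigma> * coef (i, j) \<tau> = (\<beta> / sqrt (real N))\<^sup>2 * (sqrt (D $ species_of i $ species_of j))\<^sup>2 * (\<sigma> i * \<tau> i) * (\<sigma> j * \<tau> j)"
      using that by (simp add: coef_def power2_eq_square)
    then show ?thesis using that D_nonneg N0 by (simp add: s_full_def power_divide)
  qed
  have diag: "s_full (i, i) * (coef (i, i) \<sigma> * coef (i, i) \<tau>) = - (\<beta>\<^sup>2 * (v (species_of i) * (\<sigma> i * \<tau> i)))" for i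
  proof -
    have "coef (i, i) \<sigma> * coef (i, i) \<tau> = \<beta>\<^sup>2 * (sqrt (v (species_of i)))\<^sup>2 * (\<sigma> i * \<tau> i)"
      by (simp add: coef_def power2_eq_square)
    then show ?thesis using v_nonneg by (simp add: s_full_def)
  qed
  have gii: "?g i i = D $ species_of i $ species_of i" if "i \<in> {1..N}" for i
  proof -
    have "?g i i = D $ species_of i $ species_of i * ((\<sigma> i * \<sigma> i) * (\<tau> i * \<tau> i))" by (simp only: mult_ac)
    then show ?thesis using spin_sq[OF \<sigma> that] spin_sq[OF \<tau> that] by simp
  qed
  have sq: "(\<Sum>i\<in>{1..N}. \<Sum>j\<in>{1..N}. ?g i j) = (\<Sum>i\<in>{1..N}. ?g i i) + 2 * (\<Sum>(i, j)\<in>?L. ?g i j)"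
    by (rule sum_symmetric_square) (use D_sym in \<open>simp add: mult_ac\<close>)
  define A where "A = (\<Sum>s\<in>UNIV. lam $ s * ?r s * v s)"
  define Q where "Q = (\<Sum>s\<in>UNIV. lam $ s * q $ s * v s)"
  have A2: "(\<Sum>s\<in>UNIV. lam $ s * q $ s * (\<Sum>t\<in>UNIV. D $ s $ t * lam $ t * ?r t)) = A"
  proof -
    have "(\<Sum>s\<in>UNIV. lam $ s * q $ s * (\<Sum>t\<in>UNIV. D $ s $ t * lam $ t * ?r t))
      = (\<Sum>t\<in>UNIV. \<Sum>s\<in>UNIV. lam $ s * q $ s * (D $ s $ t * lam $ t * ?r t))"
      unfolding sum_distrib_left by (rule sum.swap)
    also have "\<dots> = A"
      unfolding A_def field_variance_def sum_distrib_left
      by (intro sum.cong refl) (simp add: D_sym mult_ac)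
    finally show ?thesis .
  qed
  have wsum: "(\<Sum>i\<in>{1..N}. w (species_of i) * (\<sigma> i * \<tau> i)) = real N * (\<Sum>s\<in>UNIV. lam $ s * ?r s * w s) + real N * (\<Sum>s\<in>UNIV. lam $ s * q $ s * w s)" for w
  proof -
    have "(\<Sum>i\<in>{1..N}. w (species_of i) * (\<sigma> i * \<tau> i)) = (\<Sum>s\<in>UNIV. w s * (\<Sum>i\<in>I s. \<sigma> i * \<tau> i))"
      unfolding sum_sites sum_distrib_left by (intro sum.cong refl) (simp add: species_of_eq)
    also have "\<dots> = (\<Sum>s\<in>UNIV. real N * (lam $ s * ?r s * w s) + real N * (lam $ s * q $ s * w s))"
      unfolding spin_sum by (intro sum.cong refl) (simp add: algebra_simps)
    finally show ?thesis by (simp add: sum.distrib sum_distrib_left)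
  qed
  have full: "(\<Sum>i\<in>{1..N}. \<Sum>j\<in>{1..N}. ?g i j) = (real N)\<^sup>2 * (X \<sigma> \<tau> + 2 * A + Q)"
  proof -
    have "(\<Sum>i\<in>{1..N}. \<Sum>j\<in>{1..N}. ?g i j)
      = (\<Sum>i\<in>{1..N}. (real N * (\<Sum>t\<in>UNIV. D $ species_of i $ t * lam $ t * ?r t) + real N * v (species_of i)) * (\<sigma> i * \<tau> i))"
      unfolding field_sum_overlap[symmetric] sum_distrib_right by (intro sum.cong refl) (simp add: mult_ac)
    also have "\<dots> = real N * (\<Sum>s\<in>UNIV. lam $ s * ?r s * (real N * (\<Sum>t\<in>UNIV. D $ s $ t * lam $ t * ?r t) + real N * v s))
       + real N * (\<Sum>s\<in>UNIV. lam $ s * q $ s * (real N * (\<Sum>t\<in>UNIV. D $ s $ t * lam $ t * ?r t) + real N * v s))"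
      by (rule wsum)
    also have "\<dots> = (real N)\<^sup>2 * ((\<Sum>s\<in>UNIV. lam $ s * ?r s * (\<Sum>t\<in>UNIV. D $ s $ t * lam $ t * ?r t)) + A
        + ((\<Sum>s\<in>UNIV. lam $ s * q $ s * (\<Sum>t\<in>UNIV. D $ s $ t * lam $ t * ?r t)) + Q))"
      unfolding A_def Q_def
      by (simp only: distrib_left sum.distrib sum_distrib_left power2_eq_square mult_ac)
    also have "(\<Sum>s\<in>UNIV. lam $ s * ?r s * (\<Sum>t\<in>UNIV. D $ s $ t * lam $ t * ?r t)) = X \<sigma> \<tau>"
      unfolding X_def by (simp only: sum_distrib_left mult_ac)
    finally show ?thesis unfolding A2 by simp
  qed
  have "F.B \<sigma> \<tau> = (\<Sum>(i, j)\<in>?L. \<beta>\<^sup>2 / real N * ?g i j) + (\<Sum>i\<in>{1..N}. - (\<beta>\<^sup>2 * (v (species_of i) * (\<sigma> i * \<tau> i))))"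
    unfolding F.B_def sum_K by (intro arg_cong2[where f="(+)"] sum.cong refl) (auto simp: off diag)
  also have "\<dots> = \<beta>\<^sup>2 / real N * (\<Sum>(i, j)\<in>?L. ?g i j) - \<beta>\<^sup>2 * (\<Sum>i\<in>{1..N}. v (species_of i) * (\<sigma> i * \<tau> i))"
    by (simp add: sum_distrib_left sum_negf case_prod_unfold)
  also have "(\<Sum>(i, j)\<in>?L. ?g i j) = ((real N)\<^sup>2 * (X \<sigma> \<tau> + 2 * A + Q) - (\<Sum>i\<in>{1..N}. D $ species_of i $ species_of i)) / 2"
    using sq gii unfolding full by simp
  also have "(\<Sum>i\<in>{1..N}. v (species_of i) * (\<sigma> i * \<tau> i)) = real N * A + real N * Q"
    unfolding wsum A_def Q_def ..
  finally show ?thesis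
    unfolding b_full_def Q_def[symmetric] using N0 by (simp add: field_simps power2_eq_square)
qed

end

section \<open>Overlap moments by comparison with independent spins\<close>

lemma borel_measurable_tanh[measurable]: "(tanh :: real \<Rightarrow> real) \<in> borel_measurable borel"
  by (intro borel_measurable_continuous_onI continuous_intros) auto

lemma tanh_sq_le: "(tanh (x::real))\<^sup>2 \<le> 1"
  using tanh_real_bounds[of x] by (auto simp: abs_square_le_1 abs_le_iff)

context spin_glass
begin

definition field :: "(nat \<times> nat \<Rightarrow> real) \<Rightarrow> nat \<Rightarrow> real" where
  "field x i = h + \<beta> * sqrt (v (species_of i)) * x (i, i)"

lemma F_H0: "F.H 0 x \<sigma> = (\<Sum>i\<in>{1..N}. \<sigma> i * field x i)"
proof -
  have "(\<Sum>(i, j)\<in>{(i, j). 1 \<le> i \<and> i < j \<and> j \<le> N}. c_full (i, j) 0 * x (i, j) * coef (i, j) \<sigma>) = 0"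
    by (rule sum.neutral) (auto simp: c_full_def)
  then show ?thesis
    unfolding F.H_def sum_K
    by (simp add: bias_def field_def coef_def c_full_def algebra_simps sum.distrib sum_distrib_left)
qed

text \<open>At \<open>t = 0\<close> the spins are independent given the fields.\<close>

lemma F_P0:
  assumes "\<sigma> \<in> S"
  shows "F.P 0 x \<sigma> = (\<Prod>i\<in>{1..N}. (1 + \<sigma> i * tanh (field x i)) / 2)"
proof -
  have Z: "(\<Sum>\<sigma>\<in>S. exp (F.H 0 x \<sigma>)) = (\<Prod>i\<in>{1..N}. exp (field x i) + exp (- field x i))"
    unfolding F_H0 exp_sum[OF finite_atLeastAtMost] spin_configs_def
    by (subst sum_PiE_prod[of "{1..N}" "\<lambda>i e. exp (e * field x i)"]) (simp_all add: add.commute)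
  have t: "exp (e * y) / (exp y + exp (- y)) = (1 + e * tanh y) / 2" if "e = 1 \<or> e = -1" for e y :: real
  proof -
    have p: "exp y + exp (- y) > 0" by (intro add_pos_pos) auto
    have "tanh y = (exp y - exp (- y)) / (exp y + exp (- y))" by (rule tanh_altdef)
    then have "(exp y + exp (- y)) * tanh y = exp y - exp (- y)" using p by simp
    then have "(1 + e * tanh y) * (exp y + exp (- y)) = 2 * exp (e * y)"
      using that by (auto simp: algebra_simps)
    then show ?thesis using p by (simp add: field_simps)
  qed
  have "F.P 0 x \<sigma> = (\<Prod>i\<in>{1..N}. exp (\<sigma> i * field x i) / (exp (field x i) + exp (- field x i)))"
    unfolding gibbs_prob_def Z by (simp add: F_H0 exp_sum prod_dividef)
  also have "\<dots> = (\<Prod>i\<in>{1..N}. (1 + \<sigma> i * tanh (field x i)) / 2)"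
    by (intro prod.cong refl t) (use spin_cases[OF assms] in auto)
  finally show ?thesis .
qed

lemma fixpoint_field:
  "(\<integral>u. (tanh (h + \<beta> * sqrt (v s) * u))\<^sup>2 \<partial>std_normal_distribution) = q $ s"
  using fixpoint[of s] by (simp add: gauss_expectation_def algebra_simps)

text \<open>Given the fields, \<open>\<tau> 1 i * \<tau> 2 i\<close> has mean \<open>tanh\<^sup>2\<close> of the field at \<open>i\<close>, and the average over the field is \<open>q\<close> by the fixed point
equation. The sites are independent, so Hoeffding's lemma applies to each factor.\<close>

lemma F_site_product_le:
  fixes w :: "nat \<Rightarrow> real"
  shows "F.E 0 {1, 2} (\<lambda>\<tau>. \<Prod>i\<in>{1..N}. exp (w i * (\<tau> 1 i * \<tau> 2 i - q $ species_of i))) \<le> (\<Prod>i\<in>{1..N}. exp ((w i)\<^sup>2 / 2))"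
proof -
  define G where "G = (\<lambda>i u. exp (- w i * q $ species_of i) * (exp (w i) * ((1 + (tanh (h + \<beta> * sqrt (v (species_of i)) * u))\<^sup>2) / 2)
     + exp (- w i) * ((1 - (tanh (h + \<beta> * sqrt (v (species_of i)) * u))\<^sup>2) / 2)))"
  define \<phi> where "\<phi> = (\<lambda>x i e e'. (1 + e * tanh (field x i)) / 2 * ((1 + e' * tanh (field x i)) / 2) * exp (w i * (e * e' - q $ species_of i)))"
  have G: "(\<Sum>e\<in>{-1, 1}. \<Sum>e'\<in>{-1, 1}. \<phi> x i e e') = G i (x (i, i))" for x i
  proof -
    define t a where "t = tanh (field x i)" and "a = exp (- w i * q $ species_of i)"
    have e1: "exp (w i * (1 - q $ species_of i)) = exp (w i) * a" "exp (w i * (- 1 - q $ species_of i)) = exp (- w i) * a"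
      by (simp_all add: a_def exp_add[symmetric] algebra_simps)
    have "(\<Sum>e\<in>{-1, 1}. \<Sum>e'\<in>{-1, 1}. \<phi> x i e e')
      = (1 - t) / 2 * ((1 - t) / 2) * (exp (w i) * a) + (1 - t) / 2 * ((1 + t) / 2) * (exp (- w i) * a)
        + ((1 + t) / 2 * ((1 - t) / 2) * (exp (- w i) * a) + (1 + t) / 2 * ((1 + t) / 2) * (exp (w i) * a))"
      unfolding \<phi>_def t_def[symmetric] using e1 by simp
    also have "\<dots> = a * (exp (w i) * ((1 + t\<^sup>2) / 2) + exp (- w i) * ((1 - t\<^sup>2) / 2))"
      by (simp add: field_simps power2_eq_square)
    finally show ?thesis by (simp add: G_def t_def a_def field_def)
  qed
  have r: "ravg S (F.P 0 x) {1, 2} (\<lambda>\<tau>. \<Prod>i\<in>{1..N}. exp (w i * (\<tau> 1 i * \<tau> 2 i - q $ species_of i))) = (\<Prod>i\<in>{1..N}. G i (x (i, i)))" for x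
  proof -
    have "ravg S (F.P 0 x) {1, 2} (\<lambda>\<tau>. \<Prod>i\<in>{1..N}. exp (w i * (\<tau> 1 i * \<tau> 2 i - q $ species_of i)))
      = (\<Sum>\<sigma>\<in>S. \<Sum>\<tau>\<in>S. \<Prod>i\<in>{1..N}. \<phi> x i (\<sigma> i) (\<tau> i))"
    proof -
      have "ravg S (F.P 0 x) {1, 2} (\<lambda>\<tau>. \<Prod>i\<in>{1..N}. exp (w i * (\<tau> 1 i * \<tau> 2 i - q $ species_of i)))
        = (\<Sum>\<sigma>\<in>S. F.P 0 x \<sigma> * (\<Sum>\<tau>\<in>S. F.P 0 x \<tau> * (\<Prod>i\<in>{1..N}. exp (w i * (\<sigma> i * \<tau> i - q $ species_of i)))))"
        by (subst ravg_two[OF finite_S F.P_sum, of _ 1 2]) (auto simp: avg_def)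
      also have "\<dots> = (\<Sum>\<sigma>\<in>S. \<Sum>\<tau>\<in>S. \<Prod>i\<in>{1..N}. \<phi> x i (\<sigma> i) (\<tau> i))"
        unfolding sum_distrib_left by (intro sum.cong refl) (simp only: F_P0 \<phi>_def prod.distrib mult.assoc)
      finally show ?thesis .
    qed
    also have "\<dots> = (\<Sum>\<sigma>\<in>S. \<Prod>i\<in>{1..N}. \<Sum>e'\<in>{-1, 1}. \<phi> x i (\<sigma> i) e')"
      unfolding spin_configs_def
      by (intro sum.cong refl sum_PiE_prod[of "{1..N}" "\<lambda>i. \<phi> x i (_ i)"]) simp
    also have "\<dots> = (\<Prod>i\<in>{1..N}. \<Sum>e\<in>{-1, 1}. \<Sum>e'\<in>{-1, 1}. \<phi> x i e e')"
      unfolding spin_configs_def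
      by (rule sum_PiE_prod[of "{1..N}" "\<lambda>i e. \<Sum>e'\<in>{-1, 1}. \<phi> x i e e'"]) simp
    finally show ?thesis unfolding G .
  qed
  have it: "integrable std_normal_distribution (\<lambda>u. (tanh (h + \<beta> * sqrt (v s) * u))\<^sup>2)" for s
    by (rule finite_measure.integrable_const_bound[OF prob_space.finite_measure[OF prob_space_std_normal], where B=1])
       (auto simp: tanh_sq_le)
  have iG: "integrable std_normal_distribution (G i)" for i
    unfolding G_def using it[of "species_of i"] by auto
  have EG: "(\<integral>u. G i u \<partial>std_normal_distribution)
     = exp (- w i * q $ species_of i) * (exp (w i) * ((1 + q $ species_of i) / 2) + exp (- w i) * ((1 - q $ species_of i) / 2))" if "i \<in> {1..N}" for i
    unfolding G_def using it[of "species_of i"] fixpoint_field[of "species_of i"] that prob_space.prob_space[OF prob_space_std_normal]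
    by (simp add: K_def)
  define G' where "G' = (\<lambda>k. if fst k = snd k then G (fst k) else (\<lambda>_. 1))"
  have iG': "integrable std_normal_distribution (G' k)" for k
    by (auto simp: G'_def iG)
  have off: "(\<Prod>k\<in>{(i, j). 1 \<le> i \<and> i < j \<and> j \<le> N}. z (G' k) k) = 1" if "\<And>k. z (\<lambda>_. 1) k = (1::real)" for z
    by (rule prod.neutral) (auto simp: G'_def that)
  have fin: "finite {(i, j). 1 \<le> i \<and> i < j \<and> j \<le> N}"
    by (rule finite_subset[of _ "{1..N} \<times> {1..N}"]) auto
  have pK: "(\<Prod>k\<in>K. z (G' k) k) = (\<Prod>i\<in>{1..N}. z (G i) (i, i))" if "\<And>k. z (\<lambda>_. 1) k = (1::real)" for z
    unfolding K_split using fin off[of z, OF that] by (subst prod.union_disjoint) (auto simp: prod.reindex inj_on_def G'_def)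
  have one: "integral\<^sup>L std_normal_distribution (\<lambda>_. 1::real) = 1"
    using prob_space.prob_space[OF prob_space_std_normal] by simp
  have "F.E 0 {1, 2} (\<lambda>\<tau>. \<Prod>i\<in>{1..N}. exp (w i * (\<tau> 1 i * \<tau> 2 i - q $ species_of i))) = (\<integral>x. (\<Prod>k\<in>K. G' k (x k)) \<partial>gaussians K)"
    unfolding F.E_def r by (subst pK[of "\<lambda>g k. g (_ k)"]) auto
  also have "\<dots> = (\<Prod>k\<in>K. integral\<^sup>L std_normal_distribution (G' k))"
    by (rule gaussian_product.product_integral_prod[OF finite_K iG'])
  also have "\<dots> = (\<Prod>i\<in>{1..N}. integral\<^sup>L std_normal_distribution (G i))"
    by (rule pK[of "\<lambda>g k. integral\<^sup>L std_normal_distribution g", OF one])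
  also have "\<dots> \<le> (\<Prod>i\<in>{1..N}. exp ((w i)\<^sup>2 / 2))"
  proof (intro prod_mono conjI)
    fix i assume i: "i \<in> {1..N}"
    have b: "-1 \<le> q $ species_of i" "q $ species_of i \<le> 1" using q_nonneg[of "species_of i"] q_le[of "species_of i"] by auto
    show "integral\<^sup>L std_normal_distribution (G i) \<le> exp ((w i)\<^sup>2 / 2)"
      unfolding EG[OF i] by (rule hoeffding_two_point[OF b])
    show "0 \<le> integral\<^sup>L std_normal_distribution (G i)"
      unfolding EG[OF i] using b by (intro mult_nonneg_nonneg add_nonneg_nonneg) auto
  qed
  finally show ?thesis .
qed

text \<open>Independent spins have Gaussian overlap fluctuations. The square in the exponent is linearised by one Gaussian variable
per species, after which the average factorises over the sites.\<close>

lemma F_exp_overlap_le: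
  assumes s: "0 \<le> s" "s < 1 / 2"
  shows "F.E 0 {1, 2} (\<lambda>\<tau>. exp (s * real N * Y (\<tau> 1) (\<tau> 2))) \<le> (1 / sqrt (1 - 2 * s)) ^ CARD('m)"
proof -
  define n where "n = (\<lambda>t. real (card (I t)))"
  have n: "n t > 0" for t using card_I_pos[of t] by (simp add: n_def)
  \<comment> \<open>For these weights \<open>e \<tau> u\<close> has the Gaussian mean \<open>exp (s N Y)\<close> over \<open>u\<close>.\<close>
  define w where "w = (\<lambda>u i. sqrt (2 * s / n (species_of i)) * u (species_of i))"
  define e where "e = (\<lambda>\<tau> u. \<Prod>i\<in>{1..N}. exp (w u i * (\<tau> (1::nat) i * \<tau> 2 i - q $ species_of i)))"
  have int: "has_bochner_integral (gaussians UNIV) (e \<tau>) (exp (s * real N * Y (\<tau> 1) (\<tau> 2)))" for \<tau>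
  proof -
    define M where "M = (\<lambda>t. \<Sum>i\<in>I t. \<tau> 1 i * \<tau> 2 i - q $ t)"
    define c where "c = (\<lambda>t. sqrt (2 * s / n t) * M t)"
    have "(\<Sum>i\<in>{1..N}. w u i * (\<tau> 1 i * \<tau> 2 i - q $ species_of i)) = (\<Sum>t\<in>UNIV. c t * u t)" for u
      unfolding sum_sites
    proof (intro sum.cong refl)
      fix t
      have "(\<Sum>i\<in>I t. w u i * (\<tau> 1 i * \<tau> 2 i - q $ species_of i)) = (\<Sum>i\<in>I t. sqrt (2 * s / n t) * u t * (\<tau> 1 i * \<tau> 2 i - q $ t))"
        by (intro sum.cong refl) (simp add: w_def species_of_eq)
      then show "(\<Sum>i\<in>I t. w u i * (\<tau> 1 i * \<tau> 2 i - q $ species_of i)) = c t * u t"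
        by (simp add: c_def M_def sum_distrib_left[symmetric])
    qed
    then have 1: "e \<tau> = (\<lambda>u. exp (\<Sum>t\<in>UNIV. c t * u t))" by (simp add: e_def fun_eq_iff exp_sum[symmetric])
    have R: "Rbar t (\<tau> 1) (\<tau> 2) = M t / n t" for t
      using n[of t] by (simp add: Rbar_def M_def n_def sum_subtractf diff_divide_distrib)
    have ln: "real N * lam $ t = n t" for t using card_I[of t] by (simp add: n_def)
    have "(c t)\<^sup>2 / 2 = s * real N * (lam $ t * (Rbar t (\<tau> 1) (\<tau> 2))\<^sup>2)" for t
    proof -
      have "(c t)\<^sup>2 / 2 = s * (M t)\<^sup>2 / n t" using s n[of t] by (simp add: c_def power_mult_distrib)
      also have "\<dots> = s * (real N * lam $ t) * (Rbar t (\<tau> 1) (\<tau> 2))\<^sup>2"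
        unfolding R ln using n[of t] by (simp add: power_divide power2_eq_square)
      finally show ?thesis by simp
    qed
    then have "(\<Sum>t\<in>UNIV. (c t)\<^sup>2) / 2 = s * real N * Y (\<tau> 1) (\<tau> 2)"
      unfolding Y_def sum_distrib_left sum_divide_distrib by simp
    then show ?thesis unfolding 1 using gaussians_mgf[of UNIV c] by simp
  qed
  have sq: "has_bochner_integral (gaussians (UNIV :: 'm set)) (\<lambda>u. \<Prod>i\<in>{1..N}. exp ((w u i)\<^sup>2 / 2)) ((1 / sqrt (1 - 2 * s)) ^ CARD('m))"
  proof -
    have "(\<Sum>i\<in>{1..N}. (w u i)\<^sup>2 / 2) = (\<Sum>t\<in>UNIV. s * (u t)\<^sup>2)" for u
      unfolding sum_sites
    proof (intro sum.cong refl)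
      fix t
      have "(\<Sum>i\<in>I t. (w u i)\<^sup>2 / 2) = (\<Sum>i\<in>I t. s / n t * (u t)\<^sup>2)"
        by (intro sum.cong refl) (use s n[of t] in \<open>simp add: w_def species_of_eq power_mult_distrib\<close>)
      then show "(\<Sum>i\<in>I t. (w u i)\<^sup>2 / 2) = s * (u t)\<^sup>2" using n[of t] by (simp add: n_def)
    qed
    then have e: "(\<lambda>u. \<Prod>i\<in>{1..N}. exp ((w u i)\<^sup>2 / 2)) = (\<lambda>u. \<Prod>t\<in>UNIV. exp (s * (u t)\<^sup>2))"
      by (simp add: exp_sum[symmetric] fun_eq_iff)
    have i: "integrable std_normal_distribution (\<lambda>u. exp (s * u\<^sup>2))"
      and I: "(\<integral>u. exp (s * u\<^sup>2) \<partial>std_normal_distribution) = 1 / sqrt (1 - 2 * s)"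
      using std_normal_exp_square[OF s(2)] by (simp_all add: has_bochner_integral_iff)
    have "integrable (gaussians (UNIV :: 'm set)) (\<lambda>u. \<Prod>t\<in>UNIV. exp (s * (u t)\<^sup>2))"
      by (rule gaussian_product.product_integrable_prod[OF finite i])
    moreover have "(\<integral>u. (\<Prod>t\<in>UNIV. exp (s * (u t)\<^sup>2)) \<partial>gaussians (UNIV :: 'm set)) = (1 / sqrt (1 - 2 * s)) ^ CARD('m)"
      using gaussian_product.product_integral_prod[OF finite i, of "UNIV :: 'm set"] by (simp add: I)
    ultimately show ?thesis unfolding e by (simp add: has_bochner_integral_iff)
  qed
  have fin: "finite {1, 2::nat}" by simp
  let ?T = "{1, 2::nat} \<rightarrow>\<^sub>E S"
  have ie: "integrable (gaussians UNIV) (e \<tau>)" and Ie: "exp (s * real N * Y (\<tau> 1) (\<tau> 2)) = (\<integral>u. e \<tau> u \<partial>gaussians UNIV)" for \<tau>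
    using int[of \<tau>] by (simp_all add: has_bochner_integral_iff)
  have "F.E 0 {1, 2} (\<lambda>\<tau>. exp (s * real N * Y (\<tau> 1) (\<tau> 2))) = (\<Sum>\<tau>\<in>?T. F.weight 0 {1, 2} \<tau> * (\<integral>u. e \<tau> u \<partial>gaussians UNIV))"
    unfolding F.E_eq_sum[OF fin] Ie ..
  also have "\<dots> = (\<integral>u. (\<Sum>\<tau>\<in>?T. F.weight 0 {1, 2} \<tau> * e \<tau> u) \<partial>gaussians UNIV)"
    using ie by simp
  also have "\<dots> \<le> (\<integral>u. (\<Prod>i\<in>{1..N}. exp ((w u i)\<^sup>2 / 2)) \<partial>gaussians (UNIV :: 'm set))"
  proof (rule integral_mono)
    show "integrable (gaussians UNIV) (\<lambda>u. \<Sum>\<tau>\<in>?T. F.weight 0 {1, 2} \<tau> * e \<tau> u)" using ie by simp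
    show "integrable (gaussians (UNIV :: 'm set)) (\<lambda>u. \<Prod>i\<in>{1..N}. exp ((w u i)\<^sup>2 / 2))"
      using sq by (simp add: has_bochner_integral_iff)
    fix u :: "'m \<Rightarrow> real"
    have "(\<Sum>\<tau>\<in>?T. F.weight 0 {1, 2} \<tau> * e \<tau> u) = F.E 0 {1, 2} (\<lambda>\<tau>. \<Prod>i\<in>{1..N}. exp (w u i * (\<tau> 1 i * \<tau> 2 i - q $ species_of i)))"
      unfolding F.E_eq_sum[OF fin] e_def ..
    then show "(\<Sum>\<tau>\<in>?T. F.weight 0 {1, 2} \<tau> * e \<tau> u) \<le> (\<Prod>i\<in>{1..N}. exp ((w u i)\<^sup>2 / 2))"
      using F_site_product_le[of "w u"] by simp
  qed
  also have "\<dots> = (1 / sqrt (1 - 2 * s)) ^ CARD('m)" using sq by (simp add: has_bochner_integral_iff)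
  finally show ?thesis .
qed

lemma Rbar_sym: "Rbar s \<sigma> \<tau> = Rbar s \<tau> \<sigma>" by (simp add: Rbar_def mult.commute)
lemma Y_sym: "Y \<sigma> \<tau> = Y \<tau> \<sigma>" by (simp add: Y_def Rbar_sym[of _ \<sigma>])
lemma X_sym: "X \<sigma> \<tau> = X \<tau> \<sigma>" by (simp add: X_def Rbar_sym[of _ \<sigma>])
lemma Rbar_diag: "\<sigma> \<in> S \<Longrightarrow> Rbar s \<sigma> \<sigma> = 1 - q $ s"
proof -
  assume "\<sigma> \<in> S"
  then have "(\<Sum>i\<in>I s. \<sigma> i * \<sigma> i) = (\<Sum>i\<in>I s. 1)" by (intro sum.cong refl spin_sq) (use I_mem in auto)
  then show ?thesis using card_I_pos[of s] by (simp add: Rbar_def)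
qed
lemma X_diag: "\<sigma> \<in> S \<Longrightarrow> \<tau> \<in> S \<Longrightarrow> X \<sigma> \<sigma> = X \<tau> \<tau>"
  by (simp add: X_def Rbar_diag)

lemma replica_form_two:
  assumes "\<tau> \<in> {1, 2, 3, 4} \<rightarrow>\<^sub>E S"
  shows "replica_form F.B {1, 2} 3 4 \<tau> = \<beta>\<^sup>2 * real N / 2 *
    (2 * X (\<tau> 1) (\<tau> 2) - 4 * X (\<tau> 1) (\<tau> 3) - 4 * X (\<tau> 2) (\<tau> 3) + 6 * X (\<tau> 3) (\<tau> 4))"
proof -
  have t: "\<tau> 1 \<in> S" "\<tau> 2 \<in> S" "\<tau> 3 \<in> S" "\<tau> 4 \<in> S" using assms by auto
  show ?thesis
    unfolding replica_form_def
    using t X_sym[of "\<tau> 2" "\<tau> 1"] X_diag[of "\<tau> 1" "\<tau> 3"] X_diag[of "\<tau> 2" "\<tau> 3"] by (simp add: F_B algebra_simps)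
qed

text \<open>Chebyshev's association inequality. Exchanging the two pairs of replicas leaves the average unchanged, and
\<open>(g a - g b) (a - b) \<ge> 0\<close>.\<close>

lemma chebyshev_pairs:
  fixes g :: "real \<Rightarrow> real"
  assumes g: "\<And>a b. 0 \<le> a \<Longrightarrow> a \<le> b \<Longrightarrow> g a \<le> g b"
  defines "R \<equiv> {3, 4, 1, 2 :: nat}"
  shows "F.E t R (\<lambda>\<tau>. g (Y (\<tau> 1) (\<tau> 2)) * Y (\<tau> 3) (\<tau> 4)) \<le> F.E t R (\<lambda>\<tau>. g (Y (\<tau> 1) (\<tau> 2)) * Y (\<tau> 1) (\<tau> 2))"
    and "F.E t R (\<lambda>\<tau>. g (Y (\<tau> 1) (\<tau> 2)) * Y (\<tau> 1) (\<tau> 3)) \<le> F.E t R (\<lambda>\<tau>. g (Y (\<tau> 1) (\<tau> 2)) * Y (\<tau> 1) (\<tau> 2))"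
    and "F.E t R (\<lambda>\<tau>. g (Y (\<tau> 1) (\<tau> 2)) * Y (\<tau> 2) (\<tau> 3)) \<le> F.E t R (\<lambda>\<tau>. g (Y (\<tau> 1) (\<tau> 2)) * Y (\<tau> 1) (\<tau> 2))"
proof -
  have R: "finite R" by (simp add: R_def)
  have ab: "g a * b + g b * a \<le> g a * a + g b * b" if "0 \<le> a" "0 \<le> b" for a b
  proof -
    have "0 \<le> (g a - g b) * (a - b)"
      using g[of a b] g[of b a] that by (cases "a \<le> b") (auto intro: mult_nonpos_nonpos mult_nonneg_nonneg)
    then show ?thesis by (simp add: algebra_simps)
  qed
  have main: "F.E t R (\<lambda>\<tau>. g (Y (\<tau> 1) (\<tau> 2)) * Y (\<tau> i) (\<tau> j)) \<le> F.E t R (\<lambda>\<tau>. g (Y (\<tau> 1) (\<tau> 2)) * Y (\<tau> 1) (\<tau> 2))"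
    if sw: "F.E t R (\<lambda>\<tau>. g (Y (\<tau> i) (\<tau> j)) * Y (\<tau> 1) (\<tau> 2)) = F.E t R (\<lambda>\<tau>. g (Y (\<tau> 1) (\<tau> 2)) * Y (\<tau> i) (\<tau> j))"
      and ij: "i \<noteq> j" "{i, j} \<subseteq> R" for i j
  proof -
    have "F.E t R (\<lambda>\<tau>. g (Y (\<tau> 1) (\<tau> 2)) * Y (\<tau> i) (\<tau> j) + g (Y (\<tau> i) (\<tau> j)) * Y (\<tau> 1) (\<tau> 2))
      \<le> F.E t R (\<lambda>\<tau>. g (Y (\<tau> 1) (\<tau> 2)) * Y (\<tau> 1) (\<tau> 2) + g (Y (\<tau> i) (\<tau> j)) * Y (\<tau> i) (\<tau> j))"
      by (rule F.E_mono[OF R]) (rule ab[OF Y_nonneg Y_nonneg])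
    moreover have "F.E t R (\<lambda>\<tau>. g (Y (\<tau> i) (\<tau> j)) * Y (\<tau> i) (\<tau> j)) = F.E t R (\<lambda>\<tau>. g (Y (\<tau> 1) (\<tau> 2)) * Y (\<tau> 1) (\<tau> 2))"
      by (rule F.E_two[where F="\<lambda>\<sigma> \<tau>. g (Y \<sigma> \<tau>) * Y \<sigma> \<tau>", OF R ij R]) (auto simp: R_def)
    ultimately show ?thesis using sw by (simp add: F.E_add[OF R])
  qed
  show "F.E t R (\<lambda>\<tau>. g (Y (\<tau> 1) (\<tau> 2)) * Y (\<tau> 3) (\<tau> 4)) \<le> F.E t R (\<lambda>\<tau>. g (Y (\<tau> 1) (\<tau> 2)) * Y (\<tau> 1) (\<tau> 2))"
    by (rule main, rule F.E_four[where F="\<lambda>a b c d. g (Y a b) * Y c d", OF R _ _ R]) (auto simp: R_def)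
  show "F.E t R (\<lambda>\<tau>. g (Y (\<tau> 1) (\<tau> 2)) * Y (\<tau> 1) (\<tau> 3)) \<le> F.E t R (\<lambda>\<tau>. g (Y (\<tau> 1) (\<tau> 2)) * Y (\<tau> 1) (\<tau> 2))"
    by (rule main, rule F.E_three[where F="\<lambda>a b c. g (Y a b) * Y a c", OF R _ _ R]) (auto simp: R_def)
  have "F.E t R (\<lambda>\<tau>. g (Y (\<tau> 2) (\<tau> 3)) * Y (\<tau> 2) (\<tau> 1)) = F.E t R (\<lambda>\<tau>. g (Y (\<tau> 2) (\<tau> 1)) * Y (\<tau> 2) (\<tau> 3))"
    by (rule F.E_three[where F="\<lambda>a b c. g (Y a b) * Y a c", OF R _ _ R]) (auto simp: R_def)
  then show "F.E t R (\<lambda>\<tau>. g (Y (\<tau> 1) (\<tau> 2)) * Y (\<tau> 2) (\<tau> 3)) \<le> F.E t R (\<lambda>\<tau>. g (Y (\<tau> 1) (\<tau> 2)) * Y (\<tau> 1) (\<tau> 2))"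
    unfolding Y_sym[of "\<tau> 2" "\<tau> 1" for \<tau> :: "nat \<Rightarrow> nat \<Rightarrow> real"] by (rule main) (auto simp: R_def)
qed

lemma rho_nonneg: "0 \<le> \<rho>"
proof -
  have "0 \<le> \<rho> * Y (\<lambda>_. 2) (\<lambda>_. 2)" using X_abs_le[of "\<lambda>_. 2" "\<lambda>_. 2"] by linarith
  moreover have "Y (\<lambda>_. 2) (\<lambda>_. 2) > 0"
    unfolding Y_def
  proof (intro sum_pos mult_pos_pos lam_pos)
    fix s
    have "Rbar s (\<lambda>_. 2) (\<lambda>_. 2) = 4 - q $ s" using card_I_pos[of s] by (simp add: Rbar_def)
    then show "0 < (Rbar s (\<lambda>_. 2) (\<lambda>_. 2))\<^sup>2" using q_le[of s] by simp
  qed auto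
  ultimately show ?thesis by (simp add: zero_le_mult_iff)
qed

text \<open>The exponent decreases along the path at the rate \<open>\<kappa>\<close>. This pays for the replica form, all of whose terms are
reduced by \<open>chebyshev_pairs\<close> to the overlap that already stands in the exponent.\<close>

theorem overlap_moment_interpolation:
  assumes \<kappa>: "2 * \<beta>\<^sup>2 * \<rho> \<le> \<kappa>" "0 \<le> \<kappa>" "\<kappa> < 1 / 2"
    and neg: "(\<forall>\<sigma> \<tau>. 0 \<le> X \<sigma> \<tau>) \<or> 4 * \<beta>\<^sup>2 * \<rho> \<le> \<kappa>"
  defines "\<delta> \<equiv> (1 / 2 - \<kappa>) / 2"
  shows "F.E (pi / 2) {1, 2} (\<lambda>\<tau>. exp (\<delta> * real N * Y (\<tau> 1) (\<tau> 2))) \<le> (1 / sqrt (2 * \<delta>)) ^ CARD('m)"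
proof -
  \<comment> \<open>The exponent is \<open>s < 1/2\<close> at the start, where spins are independent, and \<open>s - \<kappa> = \<delta> > 0\<close> at the end.\<close>
  define s where "s = \<kappa> + \<delta>"
  have \<delta>: "\<delta> > 0" and s: "0 \<le> s" "s < 1 / 2" "1 - 2 * s = 2 * \<delta>"
    using \<kappa> by (auto simp: s_def \<delta>_def field_simps)
  define g where "g = (\<lambda>t y. exp ((s - \<kappa> * (sin t)\<^sup>2) * real N * y))"
  define g' where "g' = (\<lambda>t y. - 2 * \<kappa> * sin t * cos t * real N * (g t y * y))"
  define f where "f = (\<lambda>t \<tau>. g t (Y (\<tau> (1::nat)) (\<tau> 2)))"
  define f' where "f' = (\<lambda>t \<tau>. g' t (Y (\<tau> (1::nat)) (\<tau> 2)))"
  let ?R = "{3, 4, 1, 2 :: nat}"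
  have R: "finite {1, 2::nat}" "finite ?R" by auto
  have expo: "0 \<le> s - \<kappa> * (sin t)\<^sup>2" "s - \<kappa> * (sin t)\<^sup>2 \<le> s" for t
  proof -
    have "\<kappa> * (sin t)\<^sup>2 \<le> \<kappa> * 1" using \<kappa> by (intro mult_left_mono) (auto simp: abs_square_le_1)
    then show "0 \<le> s - \<kappa> * (sin t)\<^sup>2" using \<delta> by (simp add: s_def)
    show "s - \<kappa> * (sin t)\<^sup>2 \<le> s" using \<kappa> by simp
  qed
  have gmono: "g t a \<le> g t b" if "0 \<le> a" "a \<le> b" for t a b
    unfolding g_def using expo[of t] that by (auto intro!: mult_left_mono)
  have gpos: "g t a > 0" for t a by (simp add: g_def)
  have dg: "((\<lambda>t. g t y) has_real_derivative g' t y) (at t)" for t y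
    unfolding g_def g'_def by (auto intro!: derivative_eq_intros simp: algebra_simps)
  define L where "L = (\<Sum>s\<in>UNIV. lam $ s * 4)"
  have YL: "0 \<le> Y (\<tau> 1) (\<tau> 2)" "Y (\<tau> 1) (\<tau> 2) \<le> L" if "\<tau> \<in> {1, 2} \<rightarrow>\<^sub>E S" for \<tau> :: "nat \<Rightarrow> nat \<Rightarrow> real"
    using that Y_nonneg Y_le[of "\<tau> 1" "\<tau> 2"] by (auto simp: L_def)
  define C where "C = exp (s * real N * L) * (1 + 2 * \<kappa> * real N * L)"
  have D: "((\<lambda>t. F.E t {1, 2} (f t)) has_real_derivative
     F.E t {1, 2} (f' t) + sin t * cos t * F.E t ?R (\<lambda>\<tau>. f t \<tau> * replica_form F.B {1, 2} 3 4 \<tau>)) (at t)" for t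
  proof (rule F.DERIV_E[where Cf=C, OF R(1)])
    show "depends_on {1, 2} (f t)" for t by (simp add: depends_on_def f_def)
    show "((\<lambda>t. f t \<tau>) has_real_derivative f' t \<tau>) (at t)" for t \<tau> unfolding f_def f'_def by (rule dg)
    fix t and \<tau> :: "nat \<Rightarrow> nat \<Rightarrow> real" assume \<tau>: "\<tau> \<in> {1, 2} \<rightarrow>\<^sub>E S"
    let ?y = "Y (\<tau> 1) (\<tau> 2)"
    have L: "0 \<le> L" using YL[OF \<tau>] by linarith
    have gle: "g t ?y \<le> exp (s * real N * L)"
      unfolding g_def using YL[OF \<tau>] expo[of t] L s(1) by (auto intro!: mult_mono)
    have k: "0 \<le> 2 * \<kappa> * real N * L" using \<kappa> L by simp
    then have "exp (s * real N * L) * 1 \<le> C" unfolding C_def by (intro mult_left_mono) auto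
    then show "\<bar>f t \<tau>\<bar> \<le> C" using gle gpos[of t ?y] by (simp add: f_def)
    have sc: "\<bar>sin t * cos t\<bar> \<le> 1" using mult_mono[of "\<bar>sin t\<bar>" 1 "\<bar>cos t\<bar>" 1] by (simp add: abs_mult)
    have "\<bar>f' t \<tau>\<bar> = 2 * \<kappa> * real N * (\<bar>sin t * cos t\<bar> * (g t ?y * ?y))"
      using \<kappa> YL(1)[OF \<tau>] gpos[of t ?y] by (simp add: f'_def g'_def abs_mult mult_ac)
    also have "\<dots> \<le> 2 * \<kappa> * real N * (1 * (exp (s * real N * L) * L))"
      using \<kappa> sc gle YL[OF \<tau>] gpos[of t ?y] by (intro mult_left_mono mult_mono) (auto intro: less_imp_le)
    also have "\<dots> \<le> C" unfolding C_def by (simp add: distrib_left mult_ac)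
    finally show "\<bar>f' t \<tau>\<bar> \<le> C" .
  qed auto
  have "F.E (pi / 2) {1, 2} (f (pi / 2)) \<le> F.E 0 {1, 2} (f 0)"
  proof (rule DERIV_nonpos_imp_nonincreasing[where f="\<lambda>t. F.E t {1, 2} (f t)"])
    fix t :: real assume t: "0 \<le> t" "t \<le> pi / 2"
    have sc: "0 \<le> sin t * cos t" using t sin_ge_zero[of t] cos_ge_zero[of t] pi_gt_zero by (intro mult_nonneg_nonneg) auto
    define e where "e = F.E t ?R (\<lambda>\<tau>. f t \<tau> * Y (\<tau> 1) (\<tau> 2))"
    have e0: "0 \<le> e"
    proof -
      have "F.E t ?R (\<lambda>_. 0) \<le> e"
        unfolding e_def by (rule F.E_mono[OF R(2)]) (use gpos Y_nonneg in \<open>auto simp: f_def less_imp_le intro!: mult_nonneg_nonneg\<close>)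
      then show ?thesis unfolding F.E_const[OF R(2)] .
    qed
    have ch: "F.E t ?R (\<lambda>\<tau>. f t \<tau> * Y (\<tau> 3) (\<tau> 4)) \<le> e" "F.E t ?R (\<lambda>\<tau>. f t \<tau> * Y (\<tau> 1) (\<tau> 3)) \<le> e"
      "F.E t ?R (\<lambda>\<tau>. f t \<tau> * Y (\<tau> 2) (\<tau> 3)) \<le> e"
      unfolding e_def f_def by (rule chebyshev_pairs; rule gmono; assumption)+
    \<comment> \<open>The form \<open>X\<close> enters with negative coefficients too; they are harmless if \<open>X \<ge> 0\<close> and cost another \<open>\<rho>\<close> otherwise.\<close>
    obtain \<epsilon> where \<epsilon>: "\<epsilon> \<ge> 0" "\<And>\<sigma> \<tau>. - X \<sigma> \<tau> \<le> \<epsilon> * Y \<sigma> \<tau>" "4 * \<beta>\<^sup>2 * \<rho> + 4 * \<beta>\<^sup>2 * \<epsilon> \<le> 2 * \<kappa>"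
    proof (cases "\<forall>\<sigma> \<tau>. 0 \<le> X \<sigma> \<tau>")
      case True
      then show ?thesis using that[of 0] \<kappa> by (simp add: mult_ac)
    next
      case False
      have "- X \<sigma> \<tau> \<le> \<rho> * Y \<sigma> \<tau>" for \<sigma> \<tau> using X_abs_le[of \<sigma> \<tau>] by linarith
      then show ?thesis using that[of \<rho>] rho_nonneg neg False by (auto simp: algebra_simps)
    qed
    define c where "c = \<beta>\<^sup>2 * real N / 2"
    have c: "c \<ge> 0" by (simp add: c_def)
    have "F.E t ?R (\<lambda>\<tau>. f t \<tau> * replica_form F.B {1, 2} 3 4 \<tau>)
      \<le> F.E t ?R (\<lambda>\<tau>. c * (2 * \<rho> * (f t \<tau> * Y (\<tau> 1) (\<tau> 2)) + 4 * \<epsilon> * (f t \<tau> * Y (\<tau> 1) (\<tau> 3))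
         + 4 * \<epsilon> * (f t \<tau> * Y (\<tau> 2) (\<tau> 3)) + 6 * \<rho> * (f t \<tau> * Y (\<tau> 3) (\<tau> 4))))"
    proof (rule F.E_mono[OF R(2)])
      fix \<tau> :: "nat \<Rightarrow> nat \<Rightarrow> real" assume "\<tau> \<in> ?R \<rightarrow>\<^sub>E S"
      then have \<tau>: "\<tau> \<in> {1, 2, 3, 4} \<rightarrow>\<^sub>E S" by (simp add: insert_commute)
      have f0: "0 \<le> f t \<tau>" using gpos by (simp add: f_def less_imp_le)
      have "2 * X (\<tau> 1) (\<tau> 2) - 4 * X (\<tau> 1) (\<tau> 3) - 4 * X (\<tau> 2) (\<tau> 3) + 6 * X (\<tau> 3) (\<tau> 4)
        \<le> 2 * (\<rho> * Y (\<tau> 1) (\<tau> 2)) + 4 * (\<epsilon> * Y (\<tau> 1) (\<tau> 3)) + 4 * (\<epsilon> * Y (\<tau> 2) (\<tau> 3)) + 6 * (\<rho> * Y (\<tau> 3) (\<tau> 4))"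
        using X_le[of "\<tau> 1" "\<tau> 2"] X_le[of "\<tau> 3" "\<tau> 4"] \<epsilon>(2)[of "\<tau> 1" "\<tau> 3"] \<epsilon>(2)[of "\<tau> 2" "\<tau> 3"] by linarith
      then have "f t \<tau> * (c * (2 * X (\<tau> 1) (\<tau> 2) - 4 * X (\<tau> 1) (\<tau> 3) - 4 * X (\<tau> 2) (\<tau> 3) + 6 * X (\<tau> 3) (\<tau> 4)))
        \<le> f t \<tau> * (c * (2 * (\<rho> * Y (\<tau> 1) (\<tau> 2)) + 4 * (\<epsilon> * Y (\<tau> 1) (\<tau> 3)) + 4 * (\<epsilon> * Y (\<tau> 2) (\<tau> 3)) + 6 * (\<rho> * Y (\<tau> 3) (\<tau> 4))))"
        using c f0 by (intro mult_left_mono) auto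
      then show "f t \<tau> * replica_form F.B {1, 2} 3 4 \<tau> \<le> c * (2 * \<rho> * (f t \<tau> * Y (\<tau> 1) (\<tau> 2)) + 4 * \<epsilon> * (f t \<tau> * Y (\<tau> 1) (\<tau> 3))
         + 4 * \<epsilon> * (f t \<tau> * Y (\<tau> 2) (\<tau> 3)) + 6 * \<rho> * (f t \<tau> * Y (\<tau> 3) (\<tau> 4)))"
        unfolding replica_form_two[OF \<tau>] c_def[symmetric] by (simp add: algebra_simps)
    qed
    also have "\<dots> = c * (2 * \<rho> * e + 4 * \<epsilon> * F.E t ?R (\<lambda>\<tau>. f t \<tau> * Y (\<tau> 1) (\<tau> 3))
         + 4 * \<epsilon> * F.E t ?R (\<lambda>\<tau>. f t \<tau> * Y (\<tau> 2) (\<tau> 3)) + 6 * \<rho> * F.E t ?R (\<lambda>\<tau>. f t \<tau> * Y (\<tau> 3) (\<tau> 4)))"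
      by (simp only: F.E_cmult F.E_add[OF R(2)] e_def)
    also have "\<dots> \<le> c * (2 * \<rho> * e + 4 * \<epsilon> * e + 4 * \<epsilon> * e + 6 * \<rho> * e)"
      using c \<epsilon>(1) rho_nonneg by (intro mult_left_mono add_mono order_refl ch) auto
    also have "\<dots> = (4 * \<beta>\<^sup>2 * \<rho> + 4 * \<beta>\<^sup>2 * \<epsilon>) * real N * e" by (simp add: c_def algebra_simps)
    also have "\<dots> \<le> 2 * \<kappa> * real N * e" using \<epsilon>(3) e0 by (intro mult_right_mono) auto
    finally have 1: "F.E t ?R (\<lambda>\<tau>. f t \<tau> * replica_form F.B {1, 2} 3 4 \<tau>) \<le> 2 * \<kappa> * real N * e" .
    have "F.E t {1, 2} (f' t) = - 2 * \<kappa> * sin t * cos t * real N * F.E t {1, 2} (\<lambda>\<tau>. f t \<tau> * Y (\<tau> 1) (\<tau> 2))"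
      unfolding f'_def g'_def f_def by (rule F.E_cmult)
    also have "F.E t {1, 2} (\<lambda>\<tau>. f t \<tau> * Y (\<tau> 1) (\<tau> 2)) = e"
      unfolding e_def by (rule F.E_marginal[symmetric]) (auto simp: depends_on_def f_def)
    finally have 2: "F.E t {1, 2} (f' t) = - (sin t * cos t * (2 * \<kappa> * real N * e))" by simp
    show "\<exists>y. ((\<lambda>t. F.E t {1, 2} (f t)) has_real_derivative y) (at t) \<and> y \<le> 0"
      using D[of t] mult_left_mono[OF 1 sc] unfolding 2 by (intro exI conjI) auto
  qed simp
  also have "F.E 0 {1, 2} (f 0) \<le> (1 / sqrt (1 - 2 * s)) ^ CARD('m)"
    using F_exp_overlap_le[OF s(1,2)] by (simp add: f_def g_def)
  finally show ?thesis unfolding s(3) by (simp add: f_def g_def s_def)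
qed

end

section \<open>Overlap moments without external field\<close>

lemma integrable_gaussians_quadratic:
  assumes "finite K"
  shows "integrable (gaussians K) (\<lambda>x. (1 + (\<Sum>j\<in>K. \<bar>x j\<bar>))\<^sup>2)"
proof -
  interpret P: prob_space "gaussians K" by (rule prob_space_gaussians)
  have "(1 + (\<Sum>j\<in>K. \<bar>x j\<bar>))\<^sup>2 = 1 + 2 * (\<Sum>j\<in>K. \<bar>x j\<bar>) + (\<Sum>k\<in>K. \<bar>x k\<bar> * (\<Sum>j\<in>K. \<bar>x j\<bar>))" for x :: "'a \<Rightarrow> real"
    by (simp add: power2_eq_square algebra_simps sum_distrib_right[symmetric])
  then show ?thesis using integrable_gaussians_moment(1,2)[OF _ assms] by simp
qed

lemma gronwall_derivative:
  fixes \<phi> \<phi>' :: "real \<Rightarrow> real"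
  assumes d: "\<And>t. (\<phi> has_real_derivative \<phi>' t) (at t)"
    and le: "\<And>t. 0 \<le> t \<Longrightarrow> t \<le> T \<Longrightarrow> \<phi>' t \<le> A * \<phi> t" and T: "0 \<le> T"
  shows "\<phi> T \<le> \<phi> 0 * exp (A * T)"
proof -
  have "\<phi> T * exp (- A * T) \<le> \<phi> 0 * exp (- A * 0)"
  proof (rule DERIV_nonpos_imp_nonincreasing[OF T])
    fix t assume t: "0 \<le> t" "t \<le> T"
    have "((\<lambda>t. \<phi> t * exp (- A * t)) has_real_derivative (\<phi>' t - A * \<phi> t) * exp (- A * t)) (at t)"
      by (rule derivative_eq_intros d refl)+ (simp add: algebra_simps)
    moreover have "(\<phi>' t - A * \<phi> t) * exp (- A * t) \<le> 0"
      using le[OF t] by (intro mult_nonpos_nonneg) auto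
    ultimately show "\<exists>y. ((\<lambda>t. \<phi> t * exp (- A * t)) has_real_derivative y) (at t) \<and> y \<le> 0" by blast
  qed
  then have "\<phi> T * exp (- A * T) * exp (A * T) \<le> \<phi> 0 * exp (A * T)" by (intro mult_right_mono) auto
  then show ?thesis by (simp add: mult.assoc exp_add[symmetric])
qed

lemma square_le_exp: "0 \<le> x \<Longrightarrow> x\<^sup>2 \<le> 2 * exp (x::real)"
  using exp_lower_Taylor_quadratic[of x] by simp

context spin_glass
begin

context
  assumes h0: "h = 0" and q0: "\<And>s. q $ s = 0"
begin

lemma v0: "v s = 0" by (simp add: field_variance_def q0)

lemma coef_diag0: "fst k = snd k \<Longrightarrow> coef k \<sigma> = 0" by (simp add: coef_def v0)

lemma bias0: "bias \<sigma> = 0" using bias_def[of \<sigma>] h0 by simp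

definition coupling_variance :: "nat \<times> nat \<Rightarrow> real" where
  "coupling_variance k = (if fst k = snd k then 0 else \<beta>\<^sup>2 / real N * D $ species_of (fst k) $ species_of (snd k))"

lemma coef_sq:
  assumes "k \<in> K" "\<sigma> \<in> S"
  shows "(coef k \<sigma>)\<^sup>2 = coupling_variance k"
proof (cases "fst k = snd k")
  case False
  have s: "fst k \<in> {1..N}" "snd k \<in> {1..N}" using assms(1) by (auto simp: K_def)
  have "(coef k \<sigma>)\<^sup>2 = (\<beta> / sqrt (real N))\<^sup>2 * (sqrt (D $ species_of (fst k) $ species_of (snd k)))\<^sup>2 * (\<sigma> (fst k) * \<sigma> (fst k)) * (\<sigma> (snd k) * \<sigma> (snd k))"
    using False by (simp add: coef_def power2_eq_square)
  then show ?thesis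
    using False D_nonneg spin_sq[OF assms(2) s(1)] spin_sq[OF assms(2) s(2)] by (simp add: coupling_variance_def power_divide)
qed (simp add: coef_diag0 coupling_variance_def)

definition c0 :: real where "c0 = (\<Sum>k\<in>K. coupling_variance k)"

lemma c0_nonneg: "0 \<le> c0"
  unfolding c0_def coupling_variance_def using D_nonneg by (intro sum_nonneg) auto

text \<open>The logarithm of the partition function divided by its expectation \<open>2\<^sup>N exp (sin\<^sup>2 t * c0 / 2)\<close>.\<close>

definition logZ :: "real \<Rightarrow> (nat \<times> nat \<Rightarrow> real) \<Rightarrow> real" where
  "logZ t x = ln (\<Sum>\<sigma>\<in>S. exp (F.H t x \<sigma>)) - real N * ln 2 - (sin t)\<^sup>2 * c0 / 2"

definition mean :: "nat \<times> nat \<Rightarrow> real \<Rightarrow> (nat \<times> nat \<Rightarrow> real) \<Rightarrow> real" where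
  "mean k t x = avg S (F.P t x) (coef k)"

definition mean_square :: "real \<Rightarrow> (nat \<times> nat \<Rightarrow> real) \<Rightarrow> real" where
  "mean_square t x = (\<Sum>k\<in>K. (mean k t x)\<^sup>2)"

lemma Z_pos: "(\<Sum>\<sigma>\<in>S. exp (F.H t x \<sigma>)) > 0"
  by (rule gibbs_sum_pos[OF finite_S S_ne])

lemma card_S: "real (card S) = 2 ^ N"
  unfolding spin_configs_def by (simp add: card_PiE)

lemma measurable_logZ[measurable]: "logZ t \<in> borel_measurable (gaussians K)"
  unfolding logZ_def by measurable
lemma measurable_mean[measurable]: "mean k t \<in> borel_measurable (gaussians K)"
  unfolding mean_def by measurable
lemma measurable_mean_square[measurable]: "mean_square t \<in> borel_measurable (gaussians K)"
  unfolding mean_square_def by measurable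

lemma mean_diag0: "fst k = snd k \<Longrightarrow> mean k t x = 0"
  by (simp add: mean_def avg_def coef_diag0)

lemma c_mean: "c_full k t * mean k t x = sin t * mean k t x" "c_full' k t * mean k t x = cos t * mean k t x"
  using mean_diag0[of k t x] by (auto simp: c_full_def c_full'_def)

lemma var_eq: "k \<in> K \<Longrightarrow> F.var t x k = coupling_variance k - (mean k t x)\<^sup>2"
proof -
  assume k: "k \<in> K"
  have "avg S (F.P t x) (\<lambda>\<sigma>. (coef k \<sigma>)\<^sup>2) = avg S (F.P t x) (\<lambda>\<sigma>. coupling_variance k)"
    by (rule avg_cong) (rule coef_sq[OF k])
  then show ?thesis by (simp add: F.var_def mean_def avg_const[OF finite_S F.P_sum])
qed

lemma DERIV_lnZ:
  assumes "\<And>\<sigma>. ((\<lambda>u. G u \<sigma>) has_real_derivative A \<sigma>) (at u)"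
  shows "((\<lambda>u. ln (\<Sum>\<sigma>\<in>S. exp (G u \<sigma>))) has_real_derivative avg S (gibbs_prob S (G u)) A) (at u)"
proof -
  have "((\<lambda>u. ln (\<Sum>\<sigma>\<in>S. exp (G u \<sigma>))) has_real_derivative (\<Sum>\<sigma>\<in>S. exp (G u \<sigma>) * A \<sigma>) / (\<Sum>\<sigma>\<in>S. exp (G u \<sigma>))) (at u)"
    using DERIV_chain2[OF DERIV_ln_divide[OF gibbs_sum_pos[OF finite_S S_ne, of "G u"]] DERIV_sum[OF DERIV_fun_exp[OF assms]]]
    by simp
  then show ?thesis by (simp add: avg_def gibbs_prob_def sum_divide_distrib)
qed

lemma logZ_component:
  "k \<in> K \<Longrightarrow> ((\<lambda>u. logZ t (x(k := u))) has_real_derivative sin t * mean k t (x(k := u))) (at u)"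
  unfolding logZ_def
  by (rule DERIV_cong[OF DERIV_diff[OF DERIV_diff[OF DERIV_lnZ[OF F.DERIV_H_component] DERIV_const] DERIV_const]])
     (simp_all add: avg_cmult mean_def[symmetric] c_mean)

lemma logZ_path:
  "((\<lambda>t. logZ t x) has_real_derivative (\<Sum>k\<in>K. cos t * (x k * mean k t x)) - sin t * cos t * c0) (at t)"
proof -
  have "avg S (F.P t x) (\<lambda>\<sigma>. \<Sum>k\<in>K. c_full' k t * x k * coef k \<sigma>) = (\<Sum>k\<in>K. x k * (c_full' k t * mean k t x))"
    unfolding avg_def mean_def sum_distrib_left by (subst sum.swap) (intro sum.cong refl, simp only: mult_ac)
  then have *: "avg S (F.P t x) (\<lambda>\<sigma>. \<Sum>k\<in>K. c_full' k t * x k * coef k \<sigma>) = (\<Sum>k\<in>K. cos t * (x k * mean k t x))"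
    unfolding c_mean by (simp add: mult_ac)
  have s: "((\<lambda>t. (sin t)\<^sup>2 * c0 / 2) has_real_derivative sin t * cos t * c0) (at t)"
    by (auto intro!: derivative_eq_intros)
  show ?thesis
    unfolding logZ_def
    by (rule DERIV_cong[OF DERIV_diff[OF DERIV_diff[OF DERIV_lnZ[OF F.DERIV_H] DERIV_const] s]]) (simp add: *)
qed

lemma logZ_bound:
  obtains C where "C \<ge> 0" "\<And>t x. \<bar>logZ t x\<bar> \<le> C * (1 + (\<Sum>j\<in>K. \<bar>x j\<bar>))"
    "\<And>k t x. k \<in> K \<Longrightarrow> \<bar>mean k t x\<bar> \<le> C" "\<And>k t x. k \<in> K \<Longrightarrow> \<bar>F.var t x k\<bar> \<le> C"
proof -
  obtain Ca where Ca: "Ca \<ge> 0" "\<forall>k\<in>K. \<forall>\<sigma>\<in>S. \<bar>coef k \<sigma>\<bar> \<le> Ca" using F.a_bounded by blast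
  have m: "\<bar>mean k t x\<bar> \<le> Ca" if "k \<in> K" for t x k
    unfolding mean_def by (rule avg_abs_le[OF finite_S F.P_sum]) (use Ca that in \<open>auto intro: gibbs_prob_nonneg\<close>)
  have wt_nn: "0 \<le> coupling_variance k" for k using D_nonneg by (simp add: coupling_variance_def)
  have wt_le: "coupling_variance k \<le> c0" if "k \<in> K" for k
    unfolding c0_def by (rule member_le_sum[OF that wt_nn finite_K])
  have v: "\<bar>F.var t x k\<bar> \<le> c0 + Ca\<^sup>2" if k: "k \<in> K" for t x k
  proof -
    have "(mean k t x)\<^sup>2 \<le> Ca\<^sup>2" using m[OF k, of t x] Ca by (simp add: abs_le_square_iff[symmetric])
    then show ?thesis unfolding var_eq[OF k] using wt_nn[of k] wt_le[OF k] zero_le_power2[of "mean k t x"] by linarith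
  qed
  have H: "\<bar>F.H t x \<sigma>\<bar> \<le> Ca * (\<Sum>j\<in>K. \<bar>x j\<bar>)" if "\<sigma> \<in> S" for t x \<sigma>
    unfolding F.H_def bias0 sum_distrib_left add_0
  proof (rule order_trans[OF sum_abs sum_mono])
    fix k assume "k \<in> K"
    then have "\<bar>c_full k t\<bar> * (\<bar>coef k \<sigma>\<bar> * \<bar>x k\<bar>) \<le> 1 * (Ca * \<bar>x k\<bar>)"
      using Ca that F.c_le(1)[of k t] by (intro mult_mono mult_right_mono) auto
    then show "\<bar>c_full k t * x k * coef k \<sigma>\<bar> \<le> Ca * \<bar>x k\<bar>" by (simp add: abs_mult mult_ac)
  qed
  have "\<bar>logZ t x\<bar> \<le> Ca * (\<Sum>j\<in>K. \<bar>x j\<bar>) + c0" for t x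
  proof -
    let ?M = "Ca * (\<Sum>j\<in>K. \<bar>x j\<bar>)" and ?Z = "\<Sum>\<sigma>\<in>S. exp (F.H t x \<sigma>)"
    have "?Z \<le> (\<Sum>\<sigma>\<in>S. exp ?M)"
    proof (rule sum_mono)
      fix \<sigma> assume "\<sigma> \<in> S"
      from H[OF this, of t x] show "exp (F.H t x \<sigma>) \<le> exp ?M" by (subst exp_le_cancel_iff) linarith
    qed
    then have u: "?Z \<le> 2 ^ N * exp ?M" by (simp add: card_S)
    have "(\<Sum>\<sigma>\<in>S. exp (- ?M)) \<le> ?Z"
    proof (rule sum_mono)
      fix \<sigma> assume "\<sigma> \<in> S"
      from H[OF this, of t x] show "exp (- ?M) \<le> exp (F.H t x \<sigma>)" by (subst exp_le_cancel_iff) linarith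
    qed
    then have l: "2 ^ N * exp (- ?M) \<le> ?Z" by (simp add: card_S)
    have "ln ?Z \<le> ln (2 ^ N * exp ?M)" using u Z_pos[of t x] by (subst ln_le_cancel_iff) auto
    then have u': "ln ?Z \<le> real N * ln 2 + ?M" by (simp add: ln_mult ln_realpow)
    have "ln (2 ^ N * exp (- ?M)) \<le> ln ?Z" using l Z_pos[of t x] by (subst ln_le_cancel_iff) auto
    then have l': "real N * ln 2 - ?M \<le> ln ?Z" by (simp add: ln_mult ln_realpow)
    have "(sin t)\<^sup>2 * c0 \<le> 1 * c0" using c0_nonneg by (intro mult_right_mono) (auto simp: abs_square_le_1)
    moreover have "0 \<le> (sin t)\<^sup>2 * c0" using c0_nonneg by simp
    ultimately show ?thesis unfolding logZ_def using u' l' by (auto simp: abs_le_iff)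
  qed
  moreover have "Ca * (\<Sum>j\<in>K. \<bar>x j\<bar>) + c0 \<le> (Ca + c0 + Ca\<^sup>2) * (1 + (\<Sum>j\<in>K. \<bar>x j\<bar>))" for x :: "nat \<times> nat \<Rightarrow> real"
  proof -
    have "0 \<le> (\<Sum>j\<in>K. \<bar>x j\<bar>)" by (simp add: sum_nonneg)
    then have "0 \<le> Ca + Ca\<^sup>2 + (c0 + Ca\<^sup>2) * (\<Sum>j\<in>K. \<bar>x j\<bar>)" using Ca c0_nonneg by (intro add_nonneg_nonneg mult_nonneg_nonneg) auto
    then show ?thesis by (simp add: algebra_simps)
  qed
  ultimately have "\<bar>logZ t x\<bar> \<le> (Ca + c0 + Ca\<^sup>2) * (1 + (\<Sum>j\<in>K. \<bar>x j\<bar>))" for t x by (meson order_trans)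
  moreover have "Ca \<le> Ca + c0 + Ca\<^sup>2" "c0 + Ca\<^sup>2 \<le> Ca + c0 + Ca\<^sup>2" "0 \<le> Ca + c0 + Ca\<^sup>2" using Ca c0_nonneg by auto
  ultimately show ?thesis using that[of "Ca + c0 + Ca\<^sup>2"] m v by (meson order_trans)
qed

definition logZ_moment :: "real \<Rightarrow> real" where
  "logZ_moment t = (\<integral>x. (logZ t x)\<^sup>2 \<partial>gaussians K)"

lemma integrable_growth:
  assumes m: "f \<in> borel_measurable (gaussians K)" and b: "\<And>x. \<bar>f x\<bar> \<le> C * (1 + (\<Sum>j\<in>K. \<bar>x j\<bar>))\<^sup>2"
  shows "integrable (gaussians K) f"
proof (rule Bochner_Integration.integrable_bound[OF _ m])
  show "integrable (gaussians K) (\<lambda>x. C * (1 + (\<Sum>j\<in>K. \<bar>x j\<bar>))\<^sup>2)"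
    using integrable_gaussians_quadratic[OF finite_K] by simp
  show "AE x in gaussians K. norm (f x) \<le> norm (C * (1 + (\<Sum>j\<in>K. \<bar>x j\<bar>))\<^sup>2)"
    using b by (auto intro!: AE_I2 intro: order_trans[OF _ abs_ge_self])
qed

lemma integrable_logZ_sq: "integrable (gaussians K) (\<lambda>x. (logZ t x)\<^sup>2)"
proof -
  obtain C where C: "C \<ge> 0" "\<And>t x. \<bar>logZ t x\<bar> \<le> C * (1 + (\<Sum>j\<in>K. \<bar>x j\<bar>))" by (rule logZ_bound) blast
  show ?thesis
  proof (rule integrable_growth)
    fix x
    have "(\<bar>logZ t x\<bar>)\<^sup>2 \<le> (C * (1 + (\<Sum>j\<in>K. \<bar>x j\<bar>)))\<^sup>2" using C by (intro power_mono) auto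
    then show "\<bar>(logZ t x)\<^sup>2\<bar> \<le> C\<^sup>2 * (1 + (\<Sum>j\<in>K. \<bar>x j\<bar>))\<^sup>2" by (simp add: power_mult_distrib)
  qed simp
qed

text \<open>Integration by parts; the variance terms cancel against the normalisation by the expectation, and only the squared Gibbs
means of the coupling terms remain.\<close>

lemma DERIV_logZ_moment:
  "(logZ_moment has_real_derivative 2 * sin t * cos t * (\<integral>x. (1 - logZ t x) * mean_square t x \<partial>gaussians K)) (at t)"
proof -
  obtain C where C: "C \<ge> 0" "\<And>t x. \<bar>logZ t x\<bar> \<le> C * (1 + (\<Sum>j\<in>K. \<bar>x j\<bar>))"
    "\<And>k t x. k \<in> K \<Longrightarrow> \<bar>mean k t x\<bar> \<le> C" "\<And>k t x. k \<in> K \<Longrightarrow> \<bar>F.var t x k\<bar> \<le> C" by (rule logZ_bound) blast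
  let ?n = "\<lambda>x. 1 + (\<Sum>j\<in>K. \<bar>x j\<bar>)"
  have n1: "1 \<le> ?n x" for x :: "nat \<times> nat \<Rightarrow> real" by (simp add: sum_nonneg)
  let ?d = "\<lambda>t x. (\<Sum>k\<in>K. cos t * (x k * mean k t x)) - sin t * cos t * c0"
  have dle: "\<bar>?d t x\<bar> \<le> (C + c0) * ?n x" for t x
  proof -
    have "\<bar>\<Sum>k\<in>K. cos t * (x k * mean k t x)\<bar> \<le> (\<Sum>k\<in>K. C * \<bar>x k\<bar>)"
    proof (rule order_trans[OF sum_abs sum_mono])
      fix k assume "k \<in> K"
      then have "\<bar>cos t\<bar> * (\<bar>mean k t x\<bar> * \<bar>x k\<bar>) \<le> 1 * (C * \<bar>x k\<bar>)" using C by (intro mult_mono mult_right_mono) auto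
      then show "\<bar>cos t * (x k * mean k t x)\<bar> \<le> C * \<bar>x k\<bar>" by (simp add: abs_mult mult_ac)
    qed
    moreover have "\<bar>sin t * cos t * c0\<bar> \<le> c0"
      using mult_mono[of "\<bar>sin t\<bar>" 1 "\<bar>cos t\<bar>" 1] c0_nonneg by (simp add: abs_mult mult_left_le_one_le)
    ultimately have "\<bar>?d t x\<bar> \<le> C * (\<Sum>k\<in>K. \<bar>x k\<bar>) + c0" unfolding sum_distrib_left by linarith
    also have "\<dots> \<le> (C + c0) * ?n x"
      using C c0_nonneg by (simp add: algebra_simps sum_nonneg mult_nonneg_nonneg)
    finally show ?thesis .
  qed
  have D: "(logZ_moment has_real_derivative (\<integral>x. 2 * logZ t x * ?d t x \<partial>gaussians K)) (at t)"
    unfolding logZ_moment_def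
  proof (rule DERIV_integral[where g="\<lambda>x. 2 * C * (C + c0) * (?n x)\<^sup>2", OF integrable_logZ_sq])
    show "((\<lambda>t. (logZ t x)\<^sup>2) has_real_derivative 2 * logZ t x * ?d t x) (at t)" for t x
      by (rule DERIV_cong[OF DERIV_power[OF logZ_path]]) simp
    show "(\<lambda>x. 2 * logZ t x * ?d t x) \<in> borel_measurable (gaussians K)" for t by measurable
    show "integrable (gaussians K) (\<lambda>x. 2 * C * (C + c0) * (?n x)\<^sup>2)"
      using integrable_gaussians_quadratic[OF finite_K] by simp
    fix t x
    have "\<bar>logZ t x\<bar> * \<bar>?d t x\<bar> \<le> (C * ?n x) * ((C + c0) * ?n x)"
      using C(1) C(2)[of t x] dle[of t x] n1[of x] by (intro mult_mono) auto
    then have "2 * (\<bar>logZ t x\<bar> * \<bar>?d t x\<bar>) \<le> 2 * ((C * ?n x) * ((C + c0) * ?n x))" by (rule mult_left_mono) simp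
    moreover have "\<bar>2 * a * b\<bar> = 2 * (\<bar>a\<bar> * \<bar>b\<bar>)" for a b :: real by (simp add: abs_mult)
    moreover have "2 * ((C * y) * ((C + c0) * y)) = 2 * C * (C + c0) * y\<^sup>2" for y by (simp only: power2_eq_square mult_ac)
    ultimately show "\<bar>2 * logZ t x * ?d t x\<bar> \<le> 2 * C * (C + c0) * (?n x)\<^sup>2" by simp
  qed
  have lm: "\<bar>logZ t x * mean k t x\<bar> \<le> C * C * ?n x" if "k \<in> K" for k x
  proof -
    have "\<bar>logZ t x\<bar> * \<bar>mean k t x\<bar> \<le> (C * ?n x) * C" using C that n1[of x] by (intro mult_mono) auto
    then show ?thesis by (simp add: abs_mult mult_ac)
  qed
  have ilm: "integrable (gaussians K) (\<lambda>x. x k * (logZ t x * mean k t x))" if "k \<in> K" for k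
    by (rule integrable_gaussians_linear_growth(2)[OF finite_K _ lm that]) (use that in measurable)
  let ?F' = "\<lambda>k x. sin t * ((mean k t x)\<^sup>2 + logZ t x * F.var t x k)"
  have mF': "?F' k \<in> borel_measurable (gaussians K)" for k unfolding F.var_def by measurable
  have F'le: "\<bar>?F' k x\<bar> \<le> (2 * (C * C)) * ?n x" if "k \<in> K" for k x
  proof -
    have "\<bar>mean k t x\<bar> * \<bar>mean k t x\<bar> \<le> C * C" using C that by (intro mult_mono) auto
    moreover have "\<bar>logZ t x\<bar> * \<bar>F.var t x k\<bar> \<le> (C * ?n x) * C" using C that n1[of x] by (intro mult_mono) auto
    moreover have "C * C * 1 \<le> C * C * ?n x" using n1[of x] C by (intro mult_left_mono) auto
    ultimately have "\<bar>(mean k t x)\<^sup>2\<bar> + \<bar>logZ t x * F.var t x k\<bar> \<le> (2 * (C * C)) * ?n x"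
      by (simp add: abs_mult power2_eq_square algebra_simps)
    then have "\<bar>(mean k t x)\<^sup>2 + logZ t x * F.var t x k\<bar> \<le> (2 * (C * C)) * ?n x" by linarith
    then show ?thesis using mult_mono[of "\<bar>sin t\<bar>" 1 "\<bar>(mean k t x)\<^sup>2 + logZ t x * F.var t x k\<bar>" "(2 * (C * C)) * ?n x"]
      by (simp add: abs_mult)
  qed
  have ibp: "(\<integral>x. x k * (logZ t x * mean k t x) \<partial>gaussians K) = (\<integral>x. ?F' k x \<partial>gaussians K)" if k: "k \<in> K" for k
  proof (rule gaussian_ibp[OF finite_K k _ mF'])
    show "(\<lambda>x. logZ t x * mean k t x) \<in> borel_measurable (gaussians K)" by measurable
    fix x :: "nat \<times> nat \<Rightarrow> real" and u
    have dm: "((\<lambda>u. mean k t (x(k := u))) has_real_derivative c_full k t * F.var t (x(k := u)) k) (at u)" for u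
      unfolding mean_def by (rule F.DERIV_avg_component[OF k])
    have spin_cov: "c_full k t * F.var t (x(k := u)) k = sin t * F.var t (x(k := u)) k" for u
      using var_eq[OF k, of t "x(k := u)"] mean_diag0[of k t "x(k := u)"]
      by (cases "fst k = snd k") (auto simp: c_full_def coupling_variance_def)
    show "((\<lambda>u. logZ t (x(k := u)) * mean k t (x(k := u))) has_real_derivative ?F' k (x(k := u))) (at u)"
      by (rule DERIV_cong[OF DERIV_mult[OF logZ_component[OF k] dm[unfolded spin_cov]]])
         (simp add: power2_eq_square algebra_simps)
    have "continuous_on UNIV (\<lambda>u. logZ t (x(k := u)))"
      by (rule continuous_at_imp_continuous_on) (use logZ_component[OF k] in \<open>blast intro: DERIV_isCont\<close>)
    moreover have "continuous_on UNIV (\<lambda>u. mean k t (x(k := u)))"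
      by (rule continuous_at_imp_continuous_on) (use dm in \<open>blast intro: DERIV_isCont\<close>)
    ultimately show "continuous_on UNIV (\<lambda>u. ?F' k (x(k := u)))"
      unfolding var_eq[OF k] by (intro continuous_intros)
    have "C * C * ?n x \<le> (2 * (C * C)) * ?n x" using C n1[of x] by (intro mult_right_mono) auto
    then show "\<bar>logZ t x * mean k t x\<bar> \<le> (2 * (C * C)) * ?n x" using lm[OF k, of x] by linarith
    show "\<bar>?F' k x\<bar> \<le> (2 * (C * C)) * ?n x" by (rule F'le[OF k])
  qed
  have iF': "integrable (gaussians K) (?F' k)" if "k \<in> K" for k
    by (rule integrable_gaussians_linear_growth(1)[OF finite_K mF' F'le[OF that]])
  have iL: "integrable (gaussians K) (logZ t)"
    by (rule integrable_gaussians_linear_growth(1)[OF finite_K _ C(2)]) measurable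
  have "(\<integral>x. 2 * logZ t x * ?d t x \<partial>gaussians K)
    = (\<integral>x. (\<Sum>k\<in>K. 2 * cos t * (x k * (logZ t x * mean k t x))) - 2 * sin t * cos t * c0 * logZ t x \<partial>gaussians K)"
    by (rule Bochner_Integration.integral_cong[OF refl]) (simp add: sum_distrib_left algebra_simps)
  also have "\<dots> = (\<Sum>k\<in>K. 2 * cos t * (\<integral>x. x k * (logZ t x * mean k t x) \<partial>gaussians K)) - 2 * sin t * cos t * c0 * (\<integral>x. logZ t x \<partial>gaussians K)"
    using ilm iL by (simp add: integral_sum)
  also have "\<dots> = (\<Sum>k\<in>K. 2 * cos t * (\<integral>x. ?F' k x \<partial>gaussians K)) - 2 * sin t * cos t * c0 * (\<integral>x. logZ t x \<partial>gaussians K)"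
    using ibp by simp
  also have "\<dots> = (\<integral>x. (\<Sum>k\<in>K. 2 * cos t * ?F' k x) - 2 * sin t * cos t * c0 * logZ t x \<partial>gaussians K)"
    using iF' iL by (simp add: integral_sum)
  also have "\<dots> = (\<integral>x. 2 * sin t * cos t * ((1 - logZ t x) * mean_square t x) \<partial>gaussians K)"
  proof (rule Bochner_Integration.integral_cong[OF refl])
    fix x
    have "(\<Sum>k\<in>K. 2 * cos t * ?F' k x) = (\<Sum>k\<in>K. 2 * sin t * cos t * ((1 - logZ t x) * (mean k t x)\<^sup>2) + 2 * sin t * cos t * logZ t x * coupling_variance k)"
      by (intro sum.cong refl) (simp add: var_eq algebra_simps)
    also have "\<dots> = 2 * sin t * cos t * ((1 - logZ t x) * mean_square t x) + 2 * sin t * cos t * logZ t x * c0"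
      unfolding mean_square_def c0_def by (simp add: sum.distrib sum_distrib_left)
    finally show "(\<Sum>k\<in>K. 2 * cos t * ?F' k x) - 2 * sin t * cos t * c0 * logZ t x = 2 * sin t * cos t * ((1 - logZ t x) * mean_square t x)"
      by simp
  qed
  finally show ?thesis using D by (simp only: integral_mult_right_zero)
qed

lemma sum_coef_product:
  shows "(\<Sum>k\<in>K. coef k \<sigma> * coef k \<tau>) = F.B \<sigma> \<tau>"
  unfolding F.B_def by (intro sum.cong refl) (auto simp: s_full_def coef_diag0)

lemma F_B_le:
  assumes "\<sigma> \<in> S" "\<tau> \<in> S"
  shows "F.B \<sigma> \<tau> \<le> \<beta>\<^sup>2 * \<rho> / 2 * (real N * Y \<sigma> \<tau>)"
proof -
  have "b_full \<le> 0" unfolding b_full_def q0 using D_nonneg by (simp add: sum_nonneg)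
  moreover have "\<beta>\<^sup>2 * real N / 2 * X \<sigma> \<tau> \<le> \<beta>\<^sup>2 * real N / 2 * (\<rho> * Y \<sigma> \<tau>)"
    by (rule mult_left_mono[OF X_le]) simp
  moreover have "\<beta>\<^sup>2 * real N / 2 * (\<rho> * Y \<sigma> \<tau>) = \<beta>\<^sup>2 * \<rho> / 2 * (real N * Y \<sigma> \<tau>)" by simp
  ultimately show ?thesis unfolding F_B[OF assms] by linarith
qed

text \<open>The squared Gibbs means are two-replica averages of the covariance, hence bounded by the overlap.\<close>

lemma mean_square_le:
  "mean_square t x \<le> \<beta>\<^sup>2 * \<rho> / 2 * ravg S (F.P t x) {1, 2} (\<lambda>\<tau>. real N * Y (\<tau> 1) (\<tau> 2))"
proof -
  have "(mean k t x)\<^sup>2 = ravg S (F.P t x) {1, 2} (\<lambda>\<tau>. coef k (\<tau> 1) * coef k (\<tau> 2))" for k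
    by (subst ravg_two[OF finite_S F.P_sum, of _ 1 2]) (auto simp: avg_cmult avg_multc mean_def power2_eq_square)
  then have "mean_square t x = ravg S (F.P t x) {1, 2} (\<lambda>\<tau>. F.B (\<tau> 1) (\<tau> 2))"
    unfolding mean_square_def sum_coef_product[symmetric] ravg_sum by simp
  also have "\<dots> \<le> ravg S (F.P t x) {1, 2} (\<lambda>\<tau>. \<beta>\<^sup>2 * \<rho> / 2 * (real N * Y (\<tau> 1) (\<tau> 2)))"
    by (rule ravg_mono[OF gibbs_prob_nonneg]) (rule F_B_le; auto)
  finally show ?thesis unfolding ravg_cmult .
qed

lemma F_P0_uniform: "\<sigma> \<in> S \<Longrightarrow> F.P 0 x \<sigma> = (1 / 2) ^ N"
proof -
  assume "\<sigma> \<in> S"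
  moreover have "field x i = 0" for i unfolding field_def v0 using h0 by simp
  ultimately show ?thesis by (simp add: F_P0)
qed

lemma exp_pair_mgf:
  assumes "\<sigma> \<in> S" "\<tau> \<in> S"
  shows "has_bochner_integral (gaussians K) (\<lambda>x. exp (F.H t x \<sigma> + F.H t x \<tau>)) (exp ((sin t)\<^sup>2 * c0 + (sin t)\<^sup>2 * F.B \<sigma> \<tau>))"
proof -
  let ?c = "\<lambda>k. sin t * (coef k \<sigma> + coef k \<tau>)"
  have c: "c_full k t * coef k \<sigma> = sin t * coef k \<sigma>" for k \<sigma>
    using coef_diag0[of k \<sigma>] by (auto simp: c_full_def)
  have "F.H t x \<sigma> + F.H t x \<tau> = (\<Sum>k\<in>K. (c_full k t * coef k \<sigma> + c_full k t * coef k \<tau>) * x k)" for x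
    unfolding F.H_def bias0 by (simp add: sum.distrib[symmetric] algebra_simps)
  then have 1: "F.H t x \<sigma> + F.H t x \<tau> = (\<Sum>k\<in>K. ?c k * x k)" for x
    unfolding c by (simp add: distrib_left)
  have "(\<Sum>k\<in>K. (?c k)\<^sup>2) = (\<Sum>k\<in>K. 2 * (sin t)\<^sup>2 * coupling_variance k + 2 * (sin t)\<^sup>2 * (coef k \<sigma> * coef k \<tau>))"
  proof (intro sum.cong refl)
    fix k assume k: "k \<in> K"
    have "(?c k)\<^sup>2 = (sin t)\<^sup>2 * ((coef k \<sigma>)\<^sup>2 + (coef k \<tau>)\<^sup>2) + 2 * (sin t)\<^sup>2 * (coef k \<sigma> * coef k \<tau>)"
      by (simp add: power2_eq_square algebra_simps)
    then show "(?c k)\<^sup>2 = 2 * (sin t)\<^sup>2 * coupling_variance k + 2 * (sin t)\<^sup>2 * (coef k \<sigma> * coef k \<tau>)"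
      unfolding coef_sq[OF k assms(1)] coef_sq[OF k assms(2)] by simp
  qed
  also have "\<dots> = 2 * ((sin t)\<^sup>2 * c0 + (sin t)\<^sup>2 * F.B \<sigma> \<tau>)"
    unfolding sum_coef_product[symmetric] c0_def by (simp add: sum.distrib sum_distrib_left distrib_left mult.assoc)
  finally have e: "(\<Sum>k\<in>K. (?c k)\<^sup>2) = 2 * ((sin t)\<^sup>2 * c0 + (sin t)\<^sup>2 * F.B \<sigma> \<tau>)" .
  have "2 * z / 2 = z" for z :: real by simp
  then have 2: "(\<Sum>k\<in>K. (?c k)\<^sup>2) / 2 = (sin t)\<^sup>2 * c0 + (sin t)\<^sup>2 * F.B \<sigma> \<tau>" unfolding e .
  show ?thesis unfolding 1 using gaussians_mgf[OF finite_K, of ?c] unfolding 2 .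
qed

text \<open>Multiplying by the squared partition function removes the Gibbs normalisation, which makes the expectation over the couplings
explicit (an annealed average).\<close>

lemma exp_logZ_pair:
  fixes G :: "(nat \<Rightarrow> real) \<Rightarrow> (nat \<Rightarrow> real) \<Rightarrow> real"
  shows "exp (2 * logZ t x) * ravg S (F.P t x) {1, 2} (\<lambda>\<tau>. G (\<tau> 1) (\<tau> 2))
    = (\<Sum>\<sigma>\<in>S. \<Sum>\<tau>\<in>S. ((1 / 2) ^ N * (1 / 2) ^ N * exp (- ((sin t)\<^sup>2 * c0)) * G \<sigma> \<tau>) * exp (F.H t x \<sigma> + F.H t x \<tau>))"
proof -
  define Z where "Z = (\<Sum>\<sigma>\<in>S. exp (F.H t x \<sigma>))"
  have Z: "Z > 0" using Z_pos by (simp add: Z_def)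
  have "2 * logZ t x = (ln Z + ln Z) + (- (real N * ln 2) + - (real N * ln 2) + - ((sin t)\<^sup>2 * c0))"
    unfolding logZ_def Z_def by simp
  moreover have "exp (- (real N * ln 2)) = (1 / 2) ^ N"
    by (simp add: exp_minus exp_of_nat_mult power_one_over inverse_eq_divide)
  ultimately have e: "exp (2 * logZ t x) = Z * Z * ((1 / 2) ^ N * (1 / 2) ^ N * exp (- ((sin t)\<^sup>2 * c0)))"
    using Z by (simp only: exp_add exp_ln)
  have P: "F.P t x \<sigma> = exp (F.H t x \<sigma>) / Z" for \<sigma> by (simp add: gibbs_prob_def Z_def)
  have r: "ravg S (F.P t x) {1, 2} (\<lambda>\<tau>. G (\<tau> 1) (\<tau> 2)) = (\<Sum>\<sigma>\<in>S. \<Sum>\<tau>\<in>S. F.P t x \<sigma> * (F.P t x \<tau> * G \<sigma> \<tau>))"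
    by (subst ravg_two[OF finite_S F.P_sum, of _ 1 2]) (auto simp: avg_def sum_distrib_left)
  show ?thesis
    unfolding r e unfolding P sum_distrib_left
    by (intro sum.cong refl) (use Z in \<open>simp add: exp_add\<close>)
qed

text \<open>Let \<open>W = l N Y / 2\<close>, let \<open>L\<close> be the logarithm of the quenched exponential moment of \<open>W\<close> and \<open>G = L + 2 logZ\<close> its annealed
counterpart. The expectation of \<open>exp G\<close> is bounded uniformly in \<open>N\<close> since \<open>\<beta>\<^sup>2 \<rho> < 1\<close>. As \<open>L = G - 2 logZ\<close>, the squares of \<open>L\<close> and hence the squared Gibbs
means are controlled by \<open>logZ\<close> itself, so that the derivative of the second moment of \<open>logZ\<close> is bounded by a multiple of one plus that moment.
Gronwall's inequality bounds it uniformly in \<open>N\<close>, and then \<open>L\<close> controls \<open>W\<close>.\<close>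

theorem overlap_second_moment_no_field:
  assumes sub: "\<beta>\<^sup>2 * \<rho> < 1"
  defines "l \<equiv> (1 - \<beta>\<^sup>2 * \<rho>) / 2"
  defines "C0 \<equiv> (1 / sqrt l) ^ CARD('m)"
  defines "A \<equiv> \<beta>\<^sup>2 * \<rho> / l * (18 + 8 * C0)"
  shows "F.E (pi / 2) {1, 2} (\<lambda>\<tau>. (real N * Y (\<tau> 1) (\<tau> 2))\<^sup>2) \<le> (2 / l)\<^sup>2 * (4 + 8 * C0 + 16 * exp (A * (pi / 2)))"
proof -
  define r where "r = \<beta>\<^sup>2 * \<rho>"
  have r: "0 \<le> r" "r < 1" using sub rho_nonneg by (auto simp: r_def)
  have l: "0 < l" using sub by (simp add: l_def)
  \<comment> \<open>The annealed exponent at the end of the path is \<open>l/2 + r/2 = s\<close>, still below \<open>1/2\<close>.\<close>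
  define s where "s = (l + r) / 2"
  have s: "0 \<le> s" "s < 1 / 2" "1 - 2 * s = l" using r by (auto simp: s_def l_def r_def field_simps)
  define W where "W = (\<lambda>\<sigma> \<tau>. l / 2 * (real N * Y \<sigma> \<tau>))"
  have W: "0 \<le> W \<sigma> \<tau>" for \<sigma> \<tau> using l Y_nonneg by (simp add: W_def)
  let ?A = "\<lambda>t x. ravg S (F.P t x) {1, 2}"
  define eL where "eL = (\<lambda>t x. ?A t x (\<lambda>\<tau>. exp (W (\<tau> 1) (\<tau> 2))))"
  define L where "L = (\<lambda>t x. ln (eL t x))"
  define eG where "eG = (\<lambda>t x. exp (2 * logZ t x) * eL t x)"
  have c1: "?A t x (\<lambda>\<tau>. c) = c" for t x c by (rule ravg_const[OF finite_S F.P_sum]) simp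
  have amono: "?A t x f \<le> ?A t x g" if "\<And>\<tau>. f \<tau> \<le> g \<tau>" for t x f g
    by (rule ravg_mono[OF gibbs_prob_nonneg that])
  have eL1: "1 \<le> eL t x" for t x
  proof -
    have "?A t x (\<lambda>_. 1) \<le> eL t x" unfolding eL_def by (rule amono) (simp add: W)
    then show ?thesis unfolding c1 .
  qed
  have eL0: "0 < eL t x" for t x by (rule less_le_trans[OF zero_less_one eL1])
  have L0: "0 \<le> L t x" and expL: "exp (L t x) = eL t x" for t x
    using eL1[of t x] eL0[of t x] by (auto simp: L_def)
  \<comment> \<open>The weight \<open>exp (W - L)\<close> has mean one; comparing \<open>W\<close> with it bounds the first two Gibbs moments of \<open>W\<close> by those of \<open>L\<close>.\<close>
  have WL: "?A t x (\<lambda>\<tau>. exp (W (\<tau> 1) (\<tau> 2) - L t x)) = 1" for t x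
    unfolding exp_diff expL divide_inverse ravg_multc using eL1[of t x] by (simp add: eL_def)
  have W1: "?A t x (\<lambda>\<tau>. W (\<tau> 1) (\<tau> 2)) \<le> 1 + L t x" for t x
  proof -
    have "w \<le> exp (w - L t x) + L t x" for w using exp_ge_add_one_self[of "w - L t x"] by linarith
    then have "?A t x (\<lambda>\<tau>. W (\<tau> 1) (\<tau> 2)) \<le> ?A t x (\<lambda>\<tau>. exp (W (\<tau> 1) (\<tau> 2) - L t x) + L t x)" by (intro amono)
    then show ?thesis unfolding ravg_add WL c1 .
  qed
  have W2: "?A t x (\<lambda>\<tau>. (W (\<tau> 1) (\<tau> 2))\<^sup>2) \<le> 4 + 2 * (L t x)\<^sup>2" for t x
  proof -
    have "w\<^sup>2 \<le> 4 * exp (w - L t x) + 2 * (L t x)\<^sup>2" if "0 \<le> w" for w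
    proof (cases "w \<le> L t x")
      case True
      then have "w\<^sup>2 \<le> (L t x)\<^sup>2" using that by (intro power_mono)
      then show ?thesis using exp_gt_zero[of "w - L t x"] zero_le_power2[of "L t x"] by linarith
    next
      case False
      then have "(w - L t x)\<^sup>2 \<le> 2 * exp (w - L t x)" by (intro square_le_exp) simp
      moreover have "w\<^sup>2 \<le> 2 * (w - L t x)\<^sup>2 + 2 * (L t x)\<^sup>2"
        using sum_squares_ge_zero[of "w - 2 * L t x" 0] by (simp add: power2_eq_square algebra_simps)
      ultimately show ?thesis by linarith
    qed
    then have "(W (\<tau> (1::nat)) (\<tau> 2))\<^sup>2 \<le> 4 * exp (W (\<tau> 1) (\<tau> 2) - L t x) + 2 * (L t x)\<^sup>2" for \<tau> using W by blast
    then have "?A t x (\<lambda>\<tau>. (W (\<tau> 1) (\<tau> 2))\<^sup>2) \<le> ?A t x (\<lambda>\<tau>. 4 * exp (W (\<tau> 1) (\<tau> 2) - L t x) + 2 * (L t x)\<^sup>2)"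
      by (intro amono)
    then show ?thesis unfolding ravg_add ravg_cmult WL c1 by simp
  qed
  have eG: "integrable (gaussians K) (eG t)" "(\<integral>x. eG t x \<partial>gaussians K) \<le> C0" for t
  proof -
    let ?k = "\<lambda>\<sigma> \<tau>. (1 / 2) ^ N * (1 / 2) ^ N * exp (- ((sin t)\<^sup>2 * c0)) * exp (W \<sigma> \<tau>)"
    have eq: "eG t x = (\<Sum>\<sigma>\<in>S. \<Sum>\<tau>\<in>S. ?k \<sigma> \<tau> * exp (F.H t x \<sigma> + F.H t x \<tau>))" for x
      unfolding eG_def eL_def by (rule exp_logZ_pair[where G="\<lambda>\<sigma> \<tau>. exp (W \<sigma> \<tau>)"])
    have hb: "has_bochner_integral (gaussians K) (eG t) (\<Sum>\<sigma>\<in>S. \<Sum>\<tau>\<in>S. ?k \<sigma> \<tau> * exp ((sin t)\<^sup>2 * c0 + (sin t)\<^sup>2 * F.B \<sigma> \<tau>))"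
      unfolding eq[abs_def] by (intro has_bochner_integral_sum has_bochner_integral_mult_right exp_pair_mgf)
    then show "integrable (gaussians K) (eG t)" by (simp add: has_bochner_integral_iff)
    have "(\<integral>x. eG t x \<partial>gaussians K) = (\<Sum>\<sigma>\<in>S. \<Sum>\<tau>\<in>S. ?k \<sigma> \<tau> * exp ((sin t)\<^sup>2 * c0 + (sin t)\<^sup>2 * F.B \<sigma> \<tau>))"
      using hb by (simp add: has_bochner_integral_iff)
    also have "\<dots> \<le> (\<Sum>\<sigma>\<in>S. \<Sum>\<tau>\<in>S. (1 / 2) ^ N * ((1 / 2) ^ N * exp (s * real N * Y \<sigma> \<tau>)))"
    proof (intro sum_mono)
      fix \<sigma> \<tau> assume \<sigma>\<tau>: "\<sigma> \<in> S" "\<tau> \<in> S"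
      have M: "0 \<le> r / 2 * (real N * Y \<sigma> \<tau>)" using r Y_nonneg by simp
      have "(sin t)\<^sup>2 * F.B \<sigma> \<tau> \<le> (sin t)\<^sup>2 * (r / 2 * (real N * Y \<sigma> \<tau>))"
        using F_B_le[OF \<sigma>\<tau>] by (intro mult_left_mono) (auto simp: r_def)
      also have "\<dots> \<le> 1 * (r / 2 * (real N * Y \<sigma> \<tau>))" using M by (intro mult_right_mono) (auto simp: abs_square_le_1)
      finally have "W \<sigma> \<tau> + (sin t)\<^sup>2 * F.B \<sigma> \<tau> \<le> s * real N * Y \<sigma> \<tau>"
        by (simp add: W_def s_def field_simps)
      then have "exp (- ((sin t)\<^sup>2 * c0)) * exp (W \<sigma> \<tau>) * exp ((sin t)\<^sup>2 * c0 + (sin t)\<^sup>2 * F.B \<sigma> \<tau>) \<le> exp (s * real N * Y \<sigma> \<tau>)"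
        unfolding exp_add[symmetric] by simp
      then have "(1 / 2) ^ N * ((1 / 2) ^ N * (exp (- ((sin t)\<^sup>2 * c0)) * exp (W \<sigma> \<tau>) * exp ((sin t)\<^sup>2 * c0 + (sin t)\<^sup>2 * F.B \<sigma> \<tau>)))
         \<le> (1 / 2) ^ N * ((1 / 2) ^ N * exp (s * real N * Y \<sigma> \<tau>))"
        by (intro mult_left_mono) auto
      then show "?k \<sigma> \<tau> * exp ((sin t)\<^sup>2 * c0 + (sin t)\<^sup>2 * F.B \<sigma> \<tau>) \<le> (1 / 2) ^ N * ((1 / 2) ^ N * exp (s * real N * Y \<sigma> \<tau>))"
        by (simp only: mult.assoc)
    qed
    also have "\<dots> = F.E 0 {1, 2} (\<lambda>\<tau>. exp (s * real N * Y (\<tau> 1) (\<tau> 2)))"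
    proof -
      have "?A 0 x (\<lambda>\<tau>. exp (s * real N * Y (\<tau> 1) (\<tau> 2))) = (\<Sum>\<sigma>\<in>S. \<Sum>\<tau>\<in>S. (1 / 2) ^ N * ((1 / 2) ^ N * exp (s * real N * Y \<sigma> \<tau>)))" for x
        by (subst ravg_two[OF finite_S F.P_sum, of _ 1 2]) (auto simp: avg_def sum_distrib_left F_P0_uniform intro!: sum.cong)
      then show ?thesis unfolding F.E_def by (simp add: prob_space.prob_space[OF prob_space_gaussians])
    qed
    also have "\<dots> \<le> C0" using F_exp_overlap_le[OF s(1,2)] unfolding s(3) C0_def .
    finally show "(\<integral>x. eG t x \<partial>gaussians K) \<le> C0" .
  qed
  have eGpos: "0 < eG t x" for t x using eL0[of t x] by (simp add: eG_def)
  \<comment> \<open>Since \<open>L \<ge> 0\<close>, a negative \<open>G\<close> forces \<open>L \<le> - 2 logZ\<close>.\<close>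
  have Lsq: "(L t x)\<^sup>2 \<le> 4 * eG t x + 8 * (logZ t x)\<^sup>2" for t x
  proof -
    define G where "G = ln (eG t x)"
    have "ln (eG t x) = 2 * logZ t x + L t x"
      unfolding eG_def L_def using eL1[of t x] by (subst ln_mult) auto
    then have G: "L t x = G - 2 * logZ t x" by (simp add: G_def)
    have "0 \<le> L t x" by (rule L0)
    show ?thesis
    proof (cases "0 \<le> G")
      case True
      have "(L t x)\<^sup>2 \<le> 2 * G\<^sup>2 + 8 * (logZ t x)\<^sup>2"
        unfolding G using sum_squares_ge_zero[of "G + 2 * logZ t x" 0] by (simp add: power2_eq_square algebra_simps)
      moreover have "G\<^sup>2 \<le> 2 * eG t x" using square_le_exp[OF True] eGpos[of t x] by (simp add: G_def)
      ultimately show ?thesis by linarith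
    next
      case False
      have "(L t x)\<^sup>2 \<le> (- 2 * logZ t x)\<^sup>2" using False G L0[of t x] by (intro power_mono) auto
      moreover have "(- 2 * logZ t x)\<^sup>2 = 4 * (logZ t x)\<^sup>2" by (simp add: power_mult_distrib)
      ultimately show ?thesis using eGpos[of t x] zero_le_power2[of "logZ t x"] by linarith
    qed
  qed
  define K1 where "K1 = r / l"
  have K1: "0 \<le> K1" using r l by (simp add: K1_def)
  have mean_square_L: "mean_square t x \<le> K1 * (1 + L t x)" for t x
  proof -
    have "mean_square t x \<le> r / 2 * ?A t x (\<lambda>\<tau>. real N * Y (\<tau> 1) (\<tau> 2))" using mean_square_le[of t x] by (simp add: r_def)
    also have "(\<lambda>\<tau>. real N * Y (\<tau> (1::nat)) (\<tau> 2)) = (\<lambda>\<tau>. 2 / l * W (\<tau> 1) (\<tau> 2))" using l by (simp add: W_def)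
    also have "r / 2 * ?A t x (\<lambda>\<tau>. 2 / l * W (\<tau> 1) (\<tau> 2)) = K1 * ?A t x (\<lambda>\<tau>. W (\<tau> 1) (\<tau> 2))"
      unfolding ravg_cmult by (simp add: K1_def)
    also have "\<dots> \<le> K1 * (1 + L t x)" by (rule mult_left_mono[OF W1 K1])
    finally show ?thesis .
  qed
  have Gam0: "0 \<le> mean_square t x" for t x unfolding mean_square_def by (intro sum_nonneg) simp
  have pt: "(1 - logZ t x) * mean_square t x \<le> K1 * (3 + 9 * (logZ t x)\<^sup>2 + 4 * eG t x)" for t x
  proof -
    let ?f = "logZ t x"
    have "(1 - ?f) * mean_square t x \<le> (1 + \<bar>?f\<bar>) * mean_square t x" using Gam0[of t x] by (intro mult_right_mono) auto
    also have "\<dots> \<le> (1 + \<bar>?f\<bar>) * (K1 * (1 + L t x))" using mean_square_L by (intro mult_left_mono) auto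
    also have "\<dots> = K1 * ((1 + \<bar>?f\<bar>) * (1 + L t x))" by (simp only: mult_ac)
    also have "\<dots> \<le> K1 * (3 + 9 * ?f\<^sup>2 + 4 * eG t x)"
    proof (rule mult_left_mono[OF _ K1])
      have "2 * ((1 + \<bar>?f\<bar>) * (1 + L t x)) \<le> (1 + \<bar>?f\<bar>)\<^sup>2 + (1 + L t x)\<^sup>2"
        using sum_squares_bound[of "1 + \<bar>?f\<bar>" "1 + L t x"] by (simp only: mult.assoc)
      moreover have "(1 + \<bar>?f\<bar>)\<^sup>2 \<le> 2 + 2 * ?f\<^sup>2"
        using sum_squares_bound[of 1 "\<bar>?f\<bar>"] by (simp add: power2_eq_square algebra_simps)
      moreover have "(1 + L t x)\<^sup>2 \<le> 2 + 2 * (L t x)\<^sup>2"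
        using sum_squares_bound[of 1 "L t x"] by (simp add: power2_eq_square algebra_simps)
      moreover have "(L t x)\<^sup>2 \<le> 4 * eG t x + 8 * ?f\<^sup>2" by (rule Lsq)
      ultimately show "(1 + \<bar>?f\<bar>) * (1 + L t x) \<le> 3 + 9 * ?f\<^sup>2 + 4 * eG t x" using zero_le_power2[of ?f] by linarith
    qed
    finally show ?thesis .
  qed
  have C0: "0 \<le> C0" using l by (simp add: C0_def)
  have P0: "0 \<le> logZ_moment t" for t unfolding logZ_moment_def by (intro integral_nonneg_AE AE_I2) simp
  have one: "integral\<^sup>L (gaussians K) (\<lambda>_. c) = c" for c :: real
    by (simp add: prob_space.prob_space[OF prob_space_gaussians])
  interpret pg: prob_space "gaussians K" by (rule prob_space_gaussians)
  have ic: "integrable (gaussians K) (\<lambda>_. c)" for c :: real by simp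
  have lin: "(\<integral>x. a + b * (logZ t x)\<^sup>2 + d * eG t x \<partial>gaussians K) = a + b * logZ_moment t + d * (\<integral>x. eG t x \<partial>gaussians K)"
    and ilin: "integrable (gaussians K) (\<lambda>x. a + b * (logZ t x)\<^sup>2 + d * eG t x)" for a b d t
    using integrable_logZ_sq[of t] eG(1)[of t] ic[of a] by (simp_all add: logZ_moment_def prob_space.prob_space[OF prob_space_gaussians])
  have main: "(\<integral>x. (1 - logZ t x) * mean_square t x \<partial>gaussians K) \<le> K1 * (3 + 9 * logZ_moment t + 4 * C0)" for t
  proof -
    have "(\<integral>x. (1 - logZ t x) * mean_square t x \<partial>gaussians K) \<le> (\<integral>x. K1 * (3 + 9 * (logZ t x)\<^sup>2 + 4 * eG t x) \<partial>gaussians K)"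
    proof (rule integral_mono'[OF integrable_mult_right[OF ilin] pt])
      show "0 \<le> K1 * (3 + 9 * (logZ t x)\<^sup>2 + 4 * eG t x)" for x
        using K1 eGpos[of t x] by (intro mult_nonneg_nonneg add_nonneg_nonneg) auto
    qed
    also have "\<dots> = K1 * (3 + 9 * logZ_moment t + 4 * (\<integral>x. eG t x \<partial>gaussians K))" by (simp only: integral_mult_right_zero lin)
    also have "\<dots> \<le> K1 * (3 + 9 * logZ_moment t + 4 * C0)" using eG(2)[of t] K1 by (intro mult_left_mono) auto
    finally show ?thesis .
  qed
  have "1 + logZ_moment (pi / 2) \<le> (1 + logZ_moment 0) * exp (A * (pi / 2))"
  proof (rule gronwall_derivative)
    show "((\<lambda>t. 1 + logZ_moment t) has_real_derivative 0 + 2 * sin t * cos t * (\<integral>x. (1 - logZ t x) * mean_square t x \<partial>gaussians K)) (at t)" for t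
      by (rule DERIV_add[OF DERIV_const DERIV_logZ_moment])
    fix t :: real assume t: "0 \<le> t" "t \<le> pi / 2"
    have sc: "0 \<le> sin t * cos t" using t sin_ge_zero[of t] cos_ge_zero[of t] pi_gt_zero by (intro mult_nonneg_nonneg) auto
    have sc1: "sin t * cos t \<le> 1" using mult_mono[of "\<bar>sin t\<bar>" 1 "\<bar>cos t\<bar>" 1] by (simp add: abs_mult[symmetric])
    let ?J = "K1 * (3 + 9 * logZ_moment t + 4 * C0)"
    have J: "0 \<le> ?J" using K1 P0[of t] C0 by simp
    have "sin t * cos t * (\<integral>x. (1 - logZ t x) * mean_square t x \<partial>gaussians K) \<le> sin t * cos t * ?J"
      by (rule mult_left_mono[OF main sc])
    also have "\<dots> \<le> 1 * ?J" by (rule mult_right_mono[OF sc1 J])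
    finally have "0 + 2 * sin t * cos t * (\<integral>x. (1 - logZ t x) * mean_square t x \<partial>gaussians K) \<le> K1 * (6 + 18 * logZ_moment t + 8 * C0)"
      by (simp add: algebra_simps)
    also have "\<dots> \<le> K1 * ((18 + 8 * C0) * (1 + logZ_moment t))"
      using K1 P0[of t] C0 by (intro mult_left_mono) (auto simp: algebra_simps)
    also have "\<dots> = A * (1 + logZ_moment t)" by (simp add: A_def K1_def r_def)
    finally show "0 + 2 * sin t * cos t * (\<integral>x. (1 - logZ t x) * mean_square t x \<partial>gaussians K) \<le> A * (1 + logZ_moment t)" .
  qed simp
  moreover have "logZ_moment 0 = 0"
  proof -
    have "field x i = 0" for x i unfolding field_def v0 using h0 by simp
    then have "F.H 0 x \<sigma> = 0" for x \<sigma> unfolding F_H0 by simp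
    then have "logZ 0 x = 0" for x by (simp add: logZ_def card_S ln_realpow)
    then show ?thesis by (simp add: logZ_moment_def)
  qed
  ultimately have Phi1: "logZ_moment (pi / 2) \<le> exp (A * (pi / 2))" by simp
  have "F.E (pi / 2) {1, 2} (\<lambda>\<tau>. (W (\<tau> 1) (\<tau> 2))\<^sup>2) \<le> (\<integral>x. 4 + 16 * (logZ (pi / 2) x)\<^sup>2 + 8 * eG (pi / 2) x \<partial>gaussians K)"
    unfolding F.E_def
  proof (rule integral_mono[OF F.integrable_ravg ilin])
    fix x
    show "?A (pi / 2) x (\<lambda>\<tau>. (W (\<tau> 1) (\<tau> 2))\<^sup>2) \<le> 4 + 16 * (logZ (pi / 2) x)\<^sup>2 + 8 * eG (pi / 2) x"
      using W2[of "pi / 2" x] Lsq[of "pi / 2" x] by linarith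
  qed simp
  also have "\<dots> \<le> 4 + 8 * C0 + 16 * exp (A * (pi / 2))"
    unfolding lin using Phi1 eG(2)[of "pi / 2"] by linarith
  finally have 1: "F.E (pi / 2) {1, 2} (\<lambda>\<tau>. (W (\<tau> 1) (\<tau> 2))\<^sup>2) \<le> 4 + 8 * C0 + 16 * exp (A * (pi / 2))" .
  have "(\<lambda>\<tau>. (real N * Y (\<tau> (1::nat)) (\<tau> 2))\<^sup>2) = (\<lambda>\<tau>. (2 / l)\<^sup>2 * (W (\<tau> 1) (\<tau> 2))\<^sup>2)"
    using l by (simp add: W_def power_mult_distrib[symmetric])
  then show ?thesis
    using mult_left_mono[OF 1, of "(2 / l)\<^sup>2"] by (simp only: F.E_cmult zero_le_power2)
qed

end

end

section \<open>Decoupling one site\<close>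

lemma (in gaussian_path) integral_independent_component:
  fixes g :: "real \<Rightarrow> real" and \<Phi> :: "('k \<Rightarrow> real) \<Rightarrow> real"
  assumes k: "k \<in> K" and g: "g \<in> borel_measurable borel" "\<And>u. \<bar>g u\<bar> \<le> Cg"
    and m: "\<Phi> \<in> borel_measurable (gaussians K)" "\<And>x. \<bar>\<Phi> x\<bar> \<le> C" and ind: "\<And>x u. \<Phi> (x(k := u)) = \<Phi> (x(k := 0))"
  shows "(\<integral>x. g (x k) * \<Phi> x \<partial>gaussians K) = (\<integral>u. g u \<partial>std_normal_distribution) * (\<integral>x. \<Phi> x \<partial>gaussians K)"
proof -
  define J where "J = K - {k}"
  have J: "finite J" "k \<notin> J" "K = insert k J" using K k by (auto simp: J_def)
  have i1: "integrable (gaussians (insert k J)) \<Phi>"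
    unfolding J(3)[symmetric]
    by (rule finite_measure.integrable_const_bound[OF prob_space.finite_measure[OF prob_space_gaussians], where B=C]) (use m in auto)
  have i2: "integrable (gaussians (insert k J)) (\<lambda>x. g (x k) * \<Phi> x)"
    unfolding J(3)[symmetric]
  proof (rule finite_measure.integrable_const_bound[OF prob_space.finite_measure[OF prob_space_gaussians], where B="Cg * C"])
    show "AE x in gaussians K. norm (g (x k) * \<Phi> x) \<le> Cg * C"
      using g(2) m(2) by (auto simp: abs_mult intro!: AE_I2 mult_mono order_trans[OF abs_ge_zero g(2)])
    show "(\<lambda>x. g (x k) * \<Phi> x) \<in> borel_measurable (gaussians K)" using k g(1) m(1) by measurable
  qed
  have one: "integral\<^sup>L std_normal_distribution (\<lambda>_. c) = c" for c :: real
    using prob_space.prob_space[OF prob_space_std_normal] by simp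
  have "(\<integral>x. g (x k) * \<Phi> x \<partial>gaussians K) = (\<integral>x. (\<integral>u. g u * \<Phi> (x(k := u)) \<partial>std_normal_distribution) \<partial>gaussians J)"
    unfolding J(3) by (subst gaussian_product.product_integral_insert[OF J(1,2) i2]) simp
  also have "\<dots> = (\<integral>x. (\<integral>u. g u \<partial>std_normal_distribution) * \<Phi> (x(k := 0)) \<partial>gaussians J)"
    by (subst ind) simp
  also have "\<dots> = (\<integral>u. g u \<partial>std_normal_distribution) * (\<integral>x. \<Phi> (x(k := 0)) \<partial>gaussians J)" by simp
  also have "(\<integral>x. \<Phi> (x(k := 0)) \<partial>gaussians J) = (\<integral>x. \<Phi> x \<partial>gaussians K)"
    unfolding J(3) by (subst gaussian_product.product_integral_insert[OF J(1,2) i1], subst (2) ind) (simp only: one)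
  finally show ?thesis .
qed

locale cavity = spin_glass +
  fixes i0 :: nat
  assumes i0: "i0 \<in> {1..N}"
begin

abbreviation s0 :: 'a where "s0 \<equiv> species_of i0"

text \<open>Only the Gaussians attached to site \<open>i0\<close> are interpolated: its couplings fade in, its random field fades out. All other couplings
keep full strength and no other site carries a random field.\<close>

definition c_cav :: "nat \<times> nat \<Rightarrow> real \<Rightarrow> real" where
  "c_cav k t = (if fst k = snd k then (if fst k = i0 then cos t else 0)
     else if fst k = i0 \<or> snd k = i0 then sin t else 1)"
definition c_cav' :: "nat \<times> nat \<Rightarrow> real \<Rightarrow> real" where
  "c_cav' k t = (if fst k = snd k then (if fst k = i0 then - sin t else 0)
     else if fst k = i0 \<or> snd k = i0 then cos t else 0)"
definition s_cav :: "nat \<times> nat \<Rightarrow> real" where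
  "s_cav k = (if fst k = snd k then (if fst k = i0 then -1 else 0)
     else if fst k = i0 \<or> snd k = i0 then 1 else 0)"

sublocale C: gaussian_path S K bias coef c_cav c_cav' s_cav
proof
  show "finite S" "S \<noteq> {}" "finite K" by (fact finite_S S_ne finite_K)+
  fix k t
  show "(c_cav k has_real_derivative c_cav' k t) (at t)"
    by (cases "fst k = snd k"; cases "fst k = i0"; cases "snd k = i0")
       (auto simp: c_cav_def[abs_def] c_cav'_def intro!: derivative_eq_intros)
  show "\<bar>c_cav k t\<bar> \<le> 1" "\<bar>c_cav' k t\<bar> \<le> 1" "c_cav k t * c_cav' k t = s_cav k * (sin t * cos t)"
    by (auto simp: c_cav_def c_cav'_def s_cav_def)
qed

lemma C_E_end: "C.E (pi / 2) R f = F.E (pi / 2) R f"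
proof -
  have "c_cav k (pi / 2) = c_full k (pi / 2)" for k by (simp add: c_cav_def c_full_def)
  then have "C.H (pi / 2) x = F.H (pi / 2) x" for x by (simp add: C.H_def F.H_def fun_eq_iff)
  then show ?thesis by (simp add: C.E_def F.E_def)
qed

text \<open>The centered covariance of the fields that the other sites exert on \<open>i0\<close>, and below the overlap of a species with site \<open>i0\<close> left out.
Neither depends on the spin at \<open>i0\<close>.\<close>

definition W :: "(nat \<Rightarrow> real) \<Rightarrow> (nat \<Rightarrow> real) \<Rightarrow> real" where
  "W \<sigma> \<tau> = (\<Sum>j\<in>{1..N} - {i0}. D $ s0 $ species_of j * (\<sigma> j * \<tau> j)) / real N - v s0"

definition Rcav :: "'a \<Rightarrow> (nat \<Rightarrow> real) \<Rightarrow> (nat \<Rightarrow> real) \<Rightarrow> real" where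
  "Rcav t \<sigma> \<tau> = (\<Sum>i\<in>I t - {i0}. \<sigma> i * \<tau> i) / real (card (I t)) - q $ t"

lemma C_B:
  assumes "\<sigma> \<in> S" "\<tau> \<in> S"
  shows "C.B \<sigma> \<tau> = \<beta>\<^sup>2 * (\<sigma> i0 * \<tau> i0 * W \<sigma> \<tau>)"
proof -
  let ?L = "{(i, j). 1 \<le> i \<and> i < j \<and> j \<le> N}"
  let ?g = "\<lambda>i j. D $ species_of i $ species_of j * (\<sigma> i * \<tau> i) * (\<sigma> j * \<tau> j)"
  let ?g' = "\<lambda>i j. if (i = i0) \<noteq> (j = i0) then ?g i j else 0"
  let ?T = "\<Sum>j\<in>{1..N} - {i0}. ?g i0 j"
  have N0: "real N > 0" using N by simp
  have gs: "?g i j = ?g j i" for i j using D_sym[of "species_of i" "species_of j"] by (simp add: mult_ac)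
  have off: "s_cav (i, j) * (coef (i, j) \<sigma> * coef (i, j) \<tau>) = \<beta>\<^sup>2 / real N * ?g' i j" if "i < j" for i j
  proof -
    have "coef (i, j) \<sigma> * coef (i, j) \<tau> = (\<beta> / sqrt (real N))\<^sup>2 * (sqrt (D $ species_of i $ species_of j))\<^sup>2 * (\<sigma> i * \<tau> i) * (\<sigma> j * \<tau> j)"
      using that by (simp add: coef_def power2_eq_square)
    then show ?thesis using that D_nonneg N0 by (auto simp: s_cav_def power_divide)
  qed
  have diag: "s_cav (i, i) * (coef (i, i) \<sigma> * coef (i, i) \<tau>) = (if i = i0 then - (\<beta>\<^sup>2 * (v s0 * (\<sigma> i0 * \<tau> i0))) else 0)" for i
  proof -
    have "coef (i, i) \<sigma> * coef (i, i) \<tau> = \<beta>\<^sup>2 * (sqrt (v (species_of i)))\<^sup>2 * (\<sigma> i * \<tau> i)"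
      by (simp add: coef_def power2_eq_square)
    then show ?thesis using v_nonneg by (simp add: s_cav_def)
  qed
  have "(\<Sum>i\<in>{1..N}. \<Sum>j\<in>{1..N}. ?g' i j) = (\<Sum>i\<in>{1..N}. ?g' i i) + 2 * (\<Sum>(i, j)\<in>?L. ?g' i j)"
    by (rule sum_symmetric_square) (use gs in auto)
  moreover have "(\<Sum>i\<in>{1..N}. \<Sum>j\<in>{1..N}. ?g' i j) = 2 * ?T"
  proof -
    have "(\<Sum>i\<in>{1..N}. \<Sum>j\<in>{1..N}. ?g' i j) = (\<Sum>j\<in>{1..N}. ?g' i0 j) + (\<Sum>i\<in>{1..N} - {i0}. \<Sum>j\<in>{1..N}. ?g' i j)"
      using i0 by (subst sum.remove[of _ i0]) auto
    also have "(\<Sum>j\<in>{1..N}. ?g' i0 j) = ?T"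
      using i0 by (subst sum.remove[of _ i0]) auto
    also have "(\<Sum>i\<in>{1..N} - {i0}. \<Sum>j\<in>{1..N}. ?g' i j) = (\<Sum>i\<in>{1..N} - {i0}. ?g i i0)"
    proof (intro sum.cong refl)
      fix i assume "i \<in> {1..N} - {i0}"
      then have "?g' i j = (if j = i0 then ?g i i0 else 0)" for j by auto
      then show "(\<Sum>j\<in>{1..N}. ?g' i j) = ?g i i0" using i0 by simp
    qed
    also have "\<dots> = ?T" by (intro sum.cong refl gs)
    finally show ?thesis by simp
  qed
  moreover have "(\<Sum>i\<in>{1..N}. ?g' i i) = 0" by (intro sum.neutral) auto
  ultimately have L: "(\<Sum>(i, j)\<in>?L. ?g' i j) = ?T" by simp
  have "C.B \<sigma> \<tau> = (\<Sum>(i, j)\<in>?L. \<beta>\<^sup>2 / real N * ?g' i j) + (\<Sum>i\<in>{1..N}. if i = i0 then - (\<beta>\<^sup>2 * (v s0 * (\<sigma> i0 * \<tau> i0))) else 0)"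
    unfolding C.B_def sum_K diag by (intro arg_cong2[where f="(+)"] sum.cong refl) (auto simp: off)
  also have "(\<Sum>(i, j)\<in>?L. \<beta>\<^sup>2 / real N * ?g' i j) = \<beta>\<^sup>2 / real N * (\<Sum>(i, j)\<in>?L. ?g' i j)"
    unfolding sum_distrib_left by (intro sum.cong refl) auto
  also have "\<dots> = \<beta>\<^sup>2 / real N * ?T" unfolding L ..
  also have "?T = \<sigma> i0 * \<tau> i0 * (\<Sum>j\<in>{1..N} - {i0}. D $ s0 $ species_of j * (\<sigma> j * \<tau> j))"
    unfolding sum_distrib_left by (intro sum.cong refl) (simp only: mult_ac)
  also have "(\<Sum>i\<in>{1..N}. if i = i0 then - (\<beta>\<^sup>2 * (v s0 * (\<sigma> i0 * \<tau> i0))) else 0) = - (\<beta>\<^sup>2 * (v s0 * (\<sigma> i0 * \<tau> i0)))"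
    using i0 by simp
  finally show ?thesis unfolding W_def by (simp add: algebra_simps)
qed

lemma C_B_diag: "\<sigma> \<in> S \<Longrightarrow> \<tau> \<in> S \<Longrightarrow> C.B \<sigma> \<sigma> = C.B \<tau> \<tau>"
proof -
  have "C.B \<sigma> \<sigma> = \<beta>\<^sup>2 * (1 * ((\<Sum>j\<in>{1..N} - {i0}. D $ s0 $ species_of j * 1) / real N - v s0))" if "\<sigma> \<in> S" for \<sigma>
    unfolding C_B[OF that that] W_def using spin_sq[OF that] i0 by simp
  then show "\<sigma> \<in> S \<Longrightarrow> \<tau> \<in> S \<Longrightarrow> C.B \<sigma> \<sigma> = C.B \<tau> \<tau>" by simp
qed

lemma W_eq:
  assumes "\<sigma> \<in> S" "\<tau> \<in> S"
  shows "W \<sigma> \<tau> = (\<Sum>u\<in>UNIV. D $ s0 $ u * lam $ u * Rbar u \<sigma> \<tau>) - D $ s0 $ s0 * (\<sigma> i0 * \<tau> i0) / real N"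
proof -
  have "(\<Sum>j\<in>{1..N} - {i0}. D $ s0 $ species_of j * (\<sigma> j * \<tau> j))
    = (\<Sum>j\<in>{1..N}. D $ s0 $ species_of j * (\<sigma> j * \<tau> j)) - D $ s0 $ s0 * (\<sigma> i0 * \<tau> i0)"
    using i0 by (subst sum.remove[of "{1..N}" i0]) auto
  then show ?thesis unfolding W_def field_sum_overlap using N by (simp add: field_simps)
qed

lemma Rcav_eq: "Rcav t \<sigma> \<tau> = Rbar t \<sigma> \<tau> - (if t = s0 then \<sigma> i0 * \<tau> i0 / real (card (I t)) else 0)"
proof (cases "t = s0")
  case True
  have "i0 \<in> I t" using species_of_mem[OF i0] True by simp
  then have "(\<Sum>i\<in>I t. \<sigma> i * \<tau> i) = \<sigma> i0 * \<tau> i0 + (\<Sum>i\<in>I t - {i0}. \<sigma> i * \<tau> i)"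
    using finite_I by (subst sum.remove[of _ i0]) auto
  then show ?thesis using True by (simp add: Rcav_def Rbar_def add_divide_distrib)
next
  case False
  then have "i0 \<notin> I t" using species_of_eq by blast
  then show ?thesis using False by (simp add: Rcav_def Rbar_def)
qed

definition flip :: "(nat \<Rightarrow> real) \<Rightarrow> nat \<Rightarrow> real" where "flip \<sigma> = \<sigma>(i0 := - \<sigma> i0)"

lemma flip_S: "\<sigma> \<in> S \<Longrightarrow> flip \<sigma> \<in> S"
  unfolding flip_def spin_configs_def using i0 by (auto simp: PiE_iff extensional_def)

lemma flip_flip: "flip (flip \<sigma>) = \<sigma>" by (simp add: flip_def)

lemma flip_at: "flip \<sigma> i0 = - \<sigma> i0" by (simp add: flip_def)

lemma W_flip: "W (flip \<sigma>) \<tau> = W \<sigma> \<tau>" "W \<sigma> (flip \<tau>) = W \<sigma> \<tau>"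
  unfolding W_def flip_def by (simp_all cong: sum.cong_simp)

lemma Rcav_flip: "Rcav t (flip \<sigma>) \<tau> = Rcav t \<sigma> \<tau>" "Rcav t \<sigma> (flip \<tau>) = Rcav t \<sigma> \<tau>"
  unfolding Rcav_def flip_def by (simp_all cong: sum.cong_simp)

lemma C_H0_flip: "C.H 0 x (flip \<sigma>) = C.H 0 x \<sigma> - 2 * \<sigma> i0 * field x i0"
proof -
  have b: "bias (flip \<sigma>) = bias \<sigma> - 2 * h * \<sigma> i0"
  proof -
    have "(\<Sum>i\<in>{1..N}. flip \<sigma> i) = flip \<sigma> i0 + (\<Sum>i\<in>{1..N} - {i0}. flip \<sigma> i)"
      using i0 by (subst sum.remove[of _ i0]) auto
    also have "(\<Sum>i\<in>{1..N} - {i0}. flip \<sigma> i) = (\<Sum>i\<in>{1..N} - {i0}. \<sigma> i)"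
      by (intro sum.cong refl) (auto simp: flip_def)
    also have "(\<Sum>i\<in>{1..N} - {i0}. \<sigma> i) = (\<Sum>i\<in>{1..N}. \<sigma> i) - \<sigma> i0"
      using i0 by (subst (2) sum.remove[of _ i0]) auto
    finally have e: "(\<Sum>i\<in>{1..N}. flip \<sigma> i) = (\<Sum>i\<in>{1..N}. \<sigma> i) - 2 * \<sigma> i0" by (simp add: flip_at)
    show ?thesis unfolding bias_def e by (simp add: algebra_simps)
  qed
  have k: "c_cav k 0 * x k * coef k (flip \<sigma>) = c_cav k 0 * x k * coef k \<sigma> - (if k = (i0, i0) then 2 * \<beta> * sqrt (v s0) * \<sigma> i0 * x k else 0)" for k
    by (cases k) (auto simp: c_cav_def coef_def flip_def)
  have "(i0, i0) \<in> K" using i0 by (auto simp: K_def)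
  then have "(\<Sum>k\<in>K. c_cav k 0 * x k * coef k (flip \<sigma>)) = (\<Sum>k\<in>K. c_cav k 0 * x k * coef k \<sigma>) - 2 * \<beta> * sqrt (v s0) * \<sigma> i0 * x (i0, i0)"
    unfolding k using finite_K by (simp add: sum_subtractf)
  then show ?thesis unfolding C.H_def b by (simp add: field_def algebra_simps)
qed

text \<open>With the couplings of \<open>i0\<close> switched off, its spin is independent of the others and has mean \<open>tanh\<close> of its field. The proof
pairs every configuration with the one in which the spin at \<open>i0\<close> is flipped.\<close>

lemma avg_cavity_spin:
  assumes G: "\<And>\<sigma>. \<sigma> \<in> S \<Longrightarrow> G (flip \<sigma>) = G \<sigma>"
  shows "avg S (C.P 0 x) (\<lambda>\<sigma>. \<sigma> i0 * G \<sigma>) = tanh (field x i0) * avg S (C.P 0 x) G"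
proof -
  define y t where "y = field x i0" and "t = tanh y"
  have p: "exp y + exp (- y) > 0" by (intro add_pos_pos) auto
  have "t = (exp y - exp (- y)) / (exp y + exp (- y))" unfolding t_def by (rule tanh_altdef)
  then have t: "(exp y + exp (- y)) * t = exp y - exp (- y)" using p by simp
  \<comment> \<open>For \<open>e = \<plusminus>1\<close>: a configuration and its flip contribute opposite amounts to the mean of the spin minus \<open>tanh y\<close>.\<close>
  have e: "(e - t) + exp (- (2 * e * y)) * (- e - t) = 0" if "e = 1 \<or> e = -1" for e
  proof -
    have "exp (e * y) * ((e - t) + exp (- (2 * e * y)) * (- e - t)) = exp (e * y) * (e - t) + exp (- (e * y)) * (- e - t)"
      by (simp add: distrib_left mult.assoc[symmetric] exp_add[symmetric])
    also have "\<dots> = 0" using that t by (auto simp: algebra_simps)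
    finally show ?thesis by simp
  qed
  let ?F = "\<lambda>\<sigma>. C.P 0 x \<sigma> * ((\<sigma> i0 - t) * G \<sigma>)"
  have P: "C.P 0 x (flip \<sigma>) = C.P 0 x \<sigma> * exp (- (2 * \<sigma> i0 * y))" for \<sigma>
    unfolding gibbs_prob_def C_H0_flip y_def by (simp add: exp_diff exp_minus divide_inverse)
  have "(\<Sum>\<sigma>\<in>S. ?F \<sigma>) = (\<Sum>\<sigma>\<in>S. ?F (flip \<sigma>))"
    by (rule sum.reindex_bij_witness[of _ flip flip]) (auto simp: flip_flip flip_S)
  then have "2 * (\<Sum>\<sigma>\<in>S. ?F \<sigma>) = (\<Sum>\<sigma>\<in>S. ?F \<sigma> + ?F (flip \<sigma>))" by (simp add: sum.distrib)
  also have "\<dots> = (\<Sum>\<sigma>\<in>S. 0)"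
  proof (intro sum.cong refl)
    fix \<sigma> assume s: "\<sigma> \<in> S"
    have "?F \<sigma> + ?F (flip \<sigma>) = C.P 0 x \<sigma> * G \<sigma> * ((\<sigma> i0 - t) + exp (- (2 * \<sigma> i0 * y)) * (- \<sigma> i0 - t))"
      unfolding P G[OF s] flip_at by (simp add: algebra_simps)
    then show "?F \<sigma> + ?F (flip \<sigma>) = 0" using e[OF spin_cases[OF s i0]] by simp
  qed
  finally have "(\<Sum>\<sigma>\<in>S. ?F \<sigma>) = 0" by simp
  then show ?thesis
    unfolding avg_def y_def[symmetric] t_def[symmetric] by (simp add: algebra_simps sum_subtractf sum_distrib_left)
qed

text \<open>The function \<open>f\<close> of the replicas does not see the spin at \<open>i0\<close> in replica \<open>l\<close>.\<close>

definition blind :: "nat \<Rightarrow> ((nat \<Rightarrow> nat \<Rightarrow> real) \<Rightarrow> real) \<Rightarrow> bool" where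
  "blind l f \<longleftrightarrow> (\<forall>\<tau>. f (\<tau>(l := flip (\<tau> l))) = f \<tau>)"

lemma ravg_spin_blind:
  assumes R: "finite R" "l \<in> R" and f: "blind l f"
  shows "ravg S (C.P 0 x) R (\<lambda>\<tau>. \<tau> l i0 * f \<tau>) = tanh (field x i0) * ravg S (C.P 0 x) R f"
proof -
  have f': "f (\<tau>(l := flip \<sigma>)) = f (\<tau>(l := \<sigma>))" for \<tau> \<sigma>
    using f[unfolded blind_def, rule_format, of "\<tau>(l := \<sigma>)"] by simp
  have "ravg S (C.P 0 x) R (\<lambda>\<tau>. \<tau> l i0 * f \<tau>)
    = avg S (C.P 0 x) (\<lambda>\<sigma>. \<sigma> i0 * ravg S (C.P 0 x) (R - {l}) (\<lambda>\<tau>. f (\<tau>(l := \<sigma>))))"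
    by (subst ravg_pick[OF R]) (simp add: ravg_cmult)
  also have "\<dots> = tanh (field x i0) * avg S (C.P 0 x) (\<lambda>\<sigma>. ravg S (C.P 0 x) (R - {l}) (\<lambda>\<tau>. f (\<tau>(l := \<sigma>))))"
    by (rule avg_cavity_spin) (simp add: f')
  finally show ?thesis by (simp add: ravg_pick[OF R])
qed

text \<open>At the decoupled end the field at \<open>i0\<close> only acts on the spin at \<open>i0\<close>, so averages of blind functions do not depend on it. This
gives the independence needed to integrate powers of \<open>tanh\<close> separately.\<close>

lemma ravg_blind_component:
  assumes R: "finite R" and f: "\<And>l. l \<in> R \<Longrightarrow> blind l f"
  shows "ravg S (C.P 0 (x((i0, i0) := u))) R f = ravg S (C.P 0 (x((i0, i0) := 0))) R f"
proof -
  let ?k = "(i0, i0)"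
  have k: "?k \<in> K" using i0 by (auto simp: K_def)
  have "((\<lambda>u. ravg S (C.P 0 (x(?k := u))) R f) has_real_derivative 0) (at u)" for u
  proof (rule DERIV_cong[OF DERIV_ravg_gibbs[OF C.S R C.DERIV_H_component[OF k] DERIV_const]])
    let ?P = "C.P 0 (x(?k := u))" and ?T = "tanh (field (x(?k := u)) i0)"
    define a where "a = \<beta> * sqrt (v s0)"
    have c: "c_cav ?k 0 * coef ?k \<sigma> = a * \<sigma> i0" for \<sigma> by (simp add: c_cav_def coef_def a_def)
    have m: "avg S ?P (\<lambda>\<sigma>. \<sigma> i0) = ?T"
      using avg_cavity_spin[of "\<lambda>_. 1" "x(?k := u)"] by (simp add: avg_const[OF finite_S C.P_sum])
    have "ravg S ?P R (\<lambda>\<tau>. 0 + f \<tau> * (\<Sum>l\<in>R. a * \<tau> l i0 - avg S ?P (\<lambda>\<sigma>. a * \<sigma> i0)))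
      = ravg S ?P R (\<lambda>\<tau>. \<Sum>l\<in>R. a * (\<tau> l i0 * f \<tau>) - a * ?T * f \<tau>)"
      unfolding avg_cmult m by (simp add: sum_distrib_left algebra_simps)
    also have "\<dots> = (\<Sum>l\<in>R. a * ravg S ?P R (\<lambda>\<tau>. \<tau> l i0 * f \<tau>) - a * ?T * ravg S ?P R f)"
      unfolding ravg_sum ravg_diff ravg_cmult ..
    also have "\<dots> = 0"
      by (intro sum.neutral ballI) (simp add: ravg_spin_blind[OF R _ f])
    finally show "ravg S ?P R (\<lambda>\<tau>. 0 + f \<tau> * (\<Sum>l\<in>R. c_cav ?k 0 * coef ?k (\<tau> l) - avg S ?P (\<lambda>\<sigma>. c_cav ?k 0 * coef ?k \<sigma>))) = 0"
      unfolding c .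
  qed
  then show ?thesis using DERIV_isconst_all by blast
qed

definition tanh_mom :: "nat \<Rightarrow> real" where
  "tanh_mom p = (\<integral>u. tanh (h + \<beta> * sqrt (v s0) * u) ^ p \<partial>std_normal_distribution)"
lemma tanh_mom_2: "tanh_mom 2 = q $ s0"
  unfolding tanh_mom_def by (rule fixpoint_field)

lemma C_E0_tanh:
  assumes R: "finite R" and f: "\<And>l. l \<in> R \<Longrightarrow> blind l f"
  shows "(\<integral>x. tanh (field x i0) ^ p * ravg S (C.P 0 x) R f \<partial>gaussians K) = tanh_mom p * C.E 0 R f"
proof -
  obtain Cf where Cf: "\<forall>\<tau>\<in>R \<rightarrow>\<^sub>E S. \<bar>f \<tau>\<bar> \<le> Cf" using C.config_bounded[OF R] by blast
  have t1: "\<bar>tanh y ^ p\<bar> \<le> 1" for y :: real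
    using tanh_real_bounds[of y] by (simp add: power_abs power_le_one abs_le_iff)
  show ?thesis
    unfolding tanh_mom_def C.E_def field_def
  proof (rule C.integral_independent_component[where g="\<lambda>u. tanh (h + \<beta> * sqrt (v s0) * u) ^ p" and Cg=1 and C=Cf])
    show "(i0, i0) \<in> K" using i0 by (auto simp: K_def)
    show "\<bar>ravg S (C.P 0 x) R f\<bar> \<le> Cf" for x
      by (rule ravg_abs_le[OF finite_S C.P_sum gibbs_prob_nonneg R]) (use Cf in auto)
    show "ravg S (C.P 0 (x((i0, i0) := u))) R f = ravg S (C.P 0 (x((i0, i0) := 0))) R f" for x u
      by (rule ravg_blind_component[OF R f])
  qed (use t1 in auto)
qed

lemma blind_mult: "blind l f \<Longrightarrow> blind l g \<Longrightarrow> blind l (\<lambda>\<tau>. f \<tau> * g \<tau>)"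
  by (simp add: blind_def)
lemma blind_spin: "l \<noteq> l' \<Longrightarrow> blind l (\<lambda>\<tau>. \<tau> l' i0)"
  by (simp add: blind_def)

lemma C_E0_spins:
  assumes R: "finite R" and f: "\<And>l. l \<in> R \<Longrightarrow> blind l f"
  shows "a \<in> R \<Longrightarrow> b \<in> R \<Longrightarrow> a \<noteq> b \<Longrightarrow> C.E 0 R (\<lambda>\<tau>. \<tau> a i0 * (\<tau> b i0 * f \<tau>)) = tanh_mom 2 * C.E 0 R f"
    and "{a, b, c, d} \<subseteq> R \<Longrightarrow> distinct [a, b, c, d] \<Longrightarrow>
      C.E 0 R (\<lambda>\<tau>. \<tau> a i0 * (\<tau> b i0 * (\<tau> c i0 * (\<tau> d i0 * f \<tau>)))) = tanh_mom 4 * C.E 0 R f"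
proof -
  assume ab: "a \<in> R" "b \<in> R" "a \<noteq> b"
  have "ravg S (C.P 0 x) R (\<lambda>\<tau>. \<tau> a i0 * (\<tau> b i0 * f \<tau>)) = tanh (field x i0) ^ 2 * ravg S (C.P 0 x) R f" for x
    using ab by (simp add: ravg_spin_blind[OF R] blind_mult blind_spin f power2_eq_square)
  then show "C.E 0 R (\<lambda>\<tau>. \<tau> a i0 * (\<tau> b i0 * f \<tau>)) = tanh_mom 2 * C.E 0 R f"
    using C_E0_tanh[OF R f, of 2] by (simp add: C.E_def)
next
  assume ab: "{a, b, c, d} \<subseteq> R" "distinct [a, b, c, d]"
  have "ravg S (C.P 0 x) R (\<lambda>\<tau>. \<tau> a i0 * (\<tau> b i0 * (\<tau> c i0 * (\<tau> d i0 * f \<tau>)))) = tanh (field x i0) ^ 4 * ravg S (C.P 0 x) R f" for x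
    using ab by (simp add: ravg_spin_blind[OF R] blind_mult blind_spin f power4_eq_xxxx)
  then show "C.E 0 R (\<lambda>\<tau>. \<tau> a i0 * (\<tau> b i0 * (\<tau> c i0 * (\<tau> d i0 * f \<tau>)))) = tanh_mom 4 * C.E 0 R f"
    using C_E0_tanh[OF R f, of 4] by (simp add: C.E_def)
qed

text \<open>The covariance at the decoupled end of the products of two spins at \<open>i0\<close> when the two pairs of replicas share \<open>m\<close> members.\<close>

definition site_cov :: "nat \<Rightarrow> real" where
  "site_cov m = (if m = 2 then 1 else if m = 1 then q $ s0 else tanh_mom 4) - (q $ s0)\<^sup>2"

text \<open>Spins at \<open>i0\<close> that occur twice square to \<open>1\<close>; each other one contributes \<open>tanh\<close> of the common field.\<close>

lemma C_E0_cov: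
  assumes R: "finite R" "{1, 2, l, l'} \<subseteq> R" "l \<noteq> l'" and f: "\<And>l. l \<in> R \<Longrightarrow> blind l f"
  shows "C.E 0 R (\<lambda>\<tau>. (\<tau> 1 i0 * \<tau> 2 i0 - q $ s0) * (\<tau> l i0 * \<tau> l' i0) * f \<tau>)
    = site_cov (card ({1, 2} \<inter> {l, l'})) * C.E 0 R f"
proof -
  note sq = spin_sq[OF _ i0]
  have "C.E 0 R (\<lambda>\<tau>. (\<tau> 1 i0 * \<tau> 2 i0 - q $ s0) * (\<tau> l i0 * \<tau> l' i0) * f \<tau>)
    = C.E 0 R (\<lambda>\<tau>. \<tau> 1 i0 * (\<tau> 2 i0 * (\<tau> l i0 * (\<tau> l' i0 * f \<tau>))) - q $ s0 * (\<tau> l i0 * (\<tau> l' i0 * f \<tau>)))"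
    by (rule C.E_cong) (simp add: algebra_simps)
  also have "\<dots> = C.E 0 R (\<lambda>\<tau>. \<tau> 1 i0 * (\<tau> 2 i0 * (\<tau> l i0 * (\<tau> l' i0 * f \<tau>)))) - (q $ s0)\<^sup>2 * C.E 0 R f"
    using R by (simp add: C.E_diff C.E_cmult C_E0_spins(1)[OF R(1) f] tanh_mom_2 power2_eq_square)
  also have "C.E 0 R (\<lambda>\<tau>. \<tau> 1 i0 * (\<tau> 2 i0 * (\<tau> l i0 * (\<tau> l' i0 * f \<tau>))))
    = (if card ({1, 2} \<inter> {l, l'}) = 2 then 1 else if card ({1, 2} \<inter> {l, l'}) = 1 then q $ s0 else tanh_mom 4) * C.E 0 R f"
  proof -
    have c2: "C.E 0 R (\<lambda>\<tau>. \<tau> 1 i0 * (\<tau> 2 i0 * (\<tau> l i0 * (\<tau> l' i0 * f \<tau>)))) = C.E 0 R g"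
      if "\<And>\<tau>. \<tau> \<in> R \<rightarrow>\<^sub>E S \<Longrightarrow> \<tau> 1 i0 * \<tau> 1 i0 = 1 \<Longrightarrow> \<tau> 2 i0 * \<tau> 2 i0 = 1 \<Longrightarrow> \<tau> 1 i0 * (\<tau> 2 i0 * (\<tau> l i0 * (\<tau> l' i0 * f \<tau>))) = g \<tau>" for g
      by (rule C.E_cong, rule that) (use R sq in \<open>auto simp: PiE_iff\<close>)
    have x1: "a * (b * (a * (c * z))) = b * (c * z)" "a * (b * (c * (a * z))) = b * (c * z)" "b * (a * (a * (c * z))) = b * (c * z)"
       "b * (a * (c * (a * z))) = b * (c * z)" if "a * a = 1" for a b c z :: real
    proof -
      have "a * (b * (a * (c * z))) = (a * a) * (b * (c * z))" by (simp only: mult_ac)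
      then show "a * (b * (a * (c * z))) = b * (c * z)" using that by simp
      then show "a * (b * (c * (a * z))) = b * (c * z)" "b * (a * (a * (c * z))) = b * (c * z)" "b * (a * (c * (a * z))) = b * (c * z)"
        by (simp_all only: mult_ac)
    qed
    have x2: "a * (b * (a * (b * z))) = z" "a * (b * (b * (a * z))) = z" if "a * a = 1" "b * b = 1" for a b z :: real
    proof -
      have "a * (b * (a * (b * z))) = (a * a) * ((b * b) * z)" by (simp only: mult_ac)
      then show "a * (b * (a * (b * z))) = z" using that by simp
      then show "a * (b * (b * (a * z))) = z" by (simp only: mult_ac)
    qed
    consider "l = 1" "l' = 2" | "l = 2" "l' = 1" | "l = 1" "l' \<noteq> 2" | "l = 2" "l' \<noteq> 1" | "l' = 1" "l \<noteq> 2" | "l' = 2" "l \<noteq> 1" | "{1, 2} \<inter> {l, l'} = {}"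
      by blast
    then show ?thesis
    proof cases
      case 1
      then have "C.E 0 R (\<lambda>\<tau>. \<tau> 1 i0 * (\<tau> 2 i0 * (\<tau> l i0 * (\<tau> l' i0 * f \<tau>)))) = C.E 0 R f"
        by (intro c2) (simp add: x2)
      then show ?thesis using 1 by simp
    next
      case 2
      then have "C.E 0 R (\<lambda>\<tau>. \<tau> 1 i0 * (\<tau> 2 i0 * (\<tau> l i0 * (\<tau> l' i0 * f \<tau>)))) = C.E 0 R f"
        by (intro c2) (simp add: x2)
      then show ?thesis using 2 by (simp add: insert_commute)
    next
      case 3
      then have "C.E 0 R (\<lambda>\<tau>. \<tau> 1 i0 * (\<tau> 2 i0 * (\<tau> l i0 * (\<tau> l' i0 * f \<tau>)))) = C.E 0 R (\<lambda>\<tau>. \<tau> 2 i0 * (\<tau> l' i0 * f \<tau>))"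
        by (intro c2) (simp add: x1)
      then show ?thesis using 3 R C_E0_spins(1)[OF R(1) f, of 2 l'] by (simp add: tanh_mom_2)
    next
      case 4
      then have "C.E 0 R (\<lambda>\<tau>. \<tau> 1 i0 * (\<tau> 2 i0 * (\<tau> l i0 * (\<tau> l' i0 * f \<tau>)))) = C.E 0 R (\<lambda>\<tau>. \<tau> 1 i0 * (\<tau> l' i0 * f \<tau>))"
        by (intro c2) (simp add: x1)
      then show ?thesis using 4 R C_E0_spins(1)[OF R(1) f, of 1 l'] by (simp add: tanh_mom_2)
    next
      case 5
      then have "C.E 0 R (\<lambda>\<tau>. \<tau> 1 i0 * (\<tau> 2 i0 * (\<tau> l i0 * (\<tau> l' i0 * f \<tau>)))) = C.E 0 R (\<lambda>\<tau>. \<tau> 2 i0 * (\<tau> l i0 * f \<tau>))"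
        by (intro c2) (simp add: x1)
      then show ?thesis using 5 R C_E0_spins(1)[OF R(1) f, of 2 l] by (simp add: tanh_mom_2)
    next
      case 6
      then have "C.E 0 R (\<lambda>\<tau>. \<tau> 1 i0 * (\<tau> 2 i0 * (\<tau> l i0 * (\<tau> l' i0 * f \<tau>)))) = C.E 0 R (\<lambda>\<tau>. \<tau> 1 i0 * (\<tau> l i0 * f \<tau>))"
        by (intro c2) (simp add: x1)
      then show ?thesis using 6 R C_E0_spins(1)[OF R(1) f, of 1 l] by (simp add: tanh_mom_2)
    next
      case 7
      then show ?thesis using R C_E0_spins(2)[OF R(1) f, of 1 2 l l'] by simp
    qed
  qed
  finally show ?thesis by (simp add: site_cov_def left_diff_distrib)
qed

end

section \<open>Expansion along the cavity path\<close>

text \<open>First-order Taylor expansion in the variable \<open>sin\<^sup>2 t\<close>.\<close>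

lemma sin_cos_taylor:
  fixes \<psi> d :: "real \<Rightarrow> real"
  assumes D: "\<And>t. (\<psi> has_real_derivative 2 * (sin t * cos t) * d t) (at t)"
    and le: "\<And>t. 0 \<le> t \<Longrightarrow> t \<le> pi / 2 \<Longrightarrow> \<bar>d t - d0\<bar> \<le> \<epsilon>"
    and T: "0 \<le> T" "T \<le> pi / 2"
  shows "\<bar>\<psi> T - \<psi> 0 - d0 * (sin T)\<^sup>2\<bar> \<le> \<epsilon>"
proof -
  have e: "0 \<le> \<epsilon>" using le[of 0] pi_gt_zero by force
  have Dg: "((\<lambda>t. \<psi> t - c * (sin t)\<^sup>2) has_real_derivative 2 * (sin t * cos t) * (d t - c)) (at t)" for c t
    by (rule derivative_eq_intros D refl)+ (simp add: algebra_simps)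
  have sc: "0 \<le> 2 * (sin t * cos t)" if "0 \<le> t" "t \<le> T" for t
    using that T sin_ge_zero[of t] cos_ge_zero[of t] pi_gt_zero by (intro mult_nonneg_nonneg) auto
  have "\<psi> T - (d0 + \<epsilon>) * (sin T)\<^sup>2 \<le> \<psi> 0 - (d0 + \<epsilon>) * (sin 0)\<^sup>2"
  proof (rule DERIV_nonpos_imp_nonincreasing[where f="\<lambda>t. \<psi> t - (d0 + \<epsilon>) * (sin t)\<^sup>2", OF T(1)])
    fix t assume t: "0 \<le> t" "t \<le> T"
    then have "d t - (d0 + \<epsilon>) \<le> 0" using le[of t] T by linarith
    then show "\<exists>y. ((\<lambda>t. \<psi> t - (d0 + \<epsilon>) * (sin t)\<^sup>2) has_real_derivative y) (at t) \<and> y \<le> 0"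
      using Dg[of "d0 + \<epsilon>" t] sc[OF t] by (blast intro: mult_nonneg_nonpos)
  qed
  moreover have "\<psi> 0 - (d0 - \<epsilon>) * (sin 0)\<^sup>2 \<le> \<psi> T - (d0 - \<epsilon>) * (sin T)\<^sup>2"
  proof (rule DERIV_nonneg_imp_nondecreasing[where f="\<lambda>t. \<psi> t - (d0 - \<epsilon>) * (sin t)\<^sup>2", OF T(1)])
    fix t assume t: "0 \<le> t" "t \<le> T"
    then have "0 \<le> d t - (d0 - \<epsilon>)" using le[of t] T by linarith
    then show "\<exists>y. ((\<lambda>t. \<psi> t - (d0 - \<epsilon>) * (sin t)\<^sup>2) has_real_derivative y) (at t) \<and> 0 \<le> y"
      using Dg[of "d0 - \<epsilon>" t] sc[OF t] by (blast intro: mult_nonneg_nonneg)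
  qed
  moreover have "\<epsilon> * (sin T)\<^sup>2 \<le> \<epsilon> * 1" using e by (intro mult_left_mono) (auto simp: abs_square_le_1)
  ultimately show ?thesis by (simp add: abs_le_iff algebra_simps)
qed

lemma prod_three_le_cubes:
  fixes x y z :: real
  assumes "0 \<le> x" "0 \<le> y" "0 \<le> z"
  shows "x * y * z \<le> x ^ 3 + y ^ 3 + z ^ 3"
proof -
  define m where "m = max x (max y z)"
  have "x * y * z \<le> m * m * m" using assms by (intro mult_mono) (auto simp: m_def)
  also have "m * m * m = m ^ 3" by (simp add: power3_eq_cube)
  also have "m ^ 3 \<le> x ^ 3 + y ^ 3 + z ^ 3"
    using assms by (auto simp: m_def max_def add_nonneg_nonneg)
  finally show ?thesis .
qed

context spin_glass
begin

text \<open>One constant, independent of \<open>N\<close>, that is large enough for the estimates of overlaps and cavity fields at scale \<open>1 / sqrt N\<close>.\<close>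

definition c_ov :: real where
  "c_ov = 1 + (\<Sum>s\<in>UNIV. 1 / sqrt (lam $ s)) + (\<Sum>s\<in>UNIV. 1 / lam $ s)
     + (\<Sum>s\<in>UNIV. \<Sum>t\<in>UNIV. D $ s $ t * lam $ t * (1 / sqrt (lam $ t))) + (\<Sum>s\<in>UNIV. \<Sum>t\<in>UNIV. D $ s $ t)"

definition c_W :: real where
  "c_W = (\<Sum>s\<in>UNIV. \<Sum>t\<in>UNIV. D $ s $ t * (2 * lam $ t + 1))"

lemma c_ov:
  shows "1 \<le> c_ov" "1 / sqrt (lam $ s) \<le> c_ov" "1 / lam $ s \<le> c_ov"
    "(\<Sum>t\<in>UNIV. D $ s $ t * lam $ t * (1 / sqrt (lam $ t))) \<le> c_ov" "D $ s $ t \<le> c_ov"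
proof -
  let ?a = "\<Sum>s\<in>UNIV. 1 / sqrt (lam $ s)" and ?b = "\<Sum>s\<in>UNIV. 1 / lam $ s"
    and ?f = "\<lambda>s. \<Sum>t\<in>UNIV. D $ s $ t * lam $ t * (1 / sqrt (lam $ t))" and ?g = "\<lambda>s. \<Sum>t\<in>UNIV. D $ s $ t"
  have l: "0 \<le> lam $ s" for s using lam_pos less_imp_le by blast
  have f0: "0 \<le> ?f s" and g0: "0 \<le> ?g s" for s using l D_nonneg by (auto intro!: sum_nonneg)
  have nn: "0 \<le> ?a" "0 \<le> ?b" "0 \<le> (\<Sum>s\<in>UNIV. ?f s)" "0 \<le> (\<Sum>s\<in>UNIV. ?g s)"
    using l by (simp add: sum_nonneg, simp add: sum_nonneg l, intro sum_nonneg f0, intro sum_nonneg g0)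
  have m: "1 / sqrt (lam $ s) \<le> ?a" "1 / lam $ s \<le> ?b" "?f s \<le> (\<Sum>s\<in>UNIV. ?f s)" "?g s \<le> (\<Sum>s\<in>UNIV. ?g s)" "D $ s $ t \<le> ?g s"
    by (rule member_le_sum; use l f0 g0 D_nonneg in auto)+
  show "1 \<le> c_ov" "1 / sqrt (lam $ s) \<le> c_ov" "1 / lam $ s \<le> c_ov" "?f s \<le> c_ov" "D $ s $ t \<le> c_ov"
    unfolding c_ov_def using nn m by linarith+
qed

lemma Rbar_abs_le:  assumes "\<sigma> \<in> S" "\<tau> \<in> S" shows "\<bar>Rbar s \<sigma> \<tau>\<bar> \<le> 2"
proof -
  have "\<bar>\<Sum>i\<in>I s. \<sigma> i * \<tau> i\<bar> \<le> (\<Sum>i\<in>I s. 1)"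
    by (rule order_trans[OF sum_abs sum_mono]) (use I_mem spin_abs assms in \<open>auto simp: abs_mult\<close>)
  then have "\<bar>(\<Sum>i\<in>I s. \<sigma> i * \<tau> i) / real (card (I s))\<bar> \<le> 1"
    using card_I_pos[of s] by (simp add: abs_divide)
  then show ?thesis unfolding Rbar_def using q_nonneg[of s] q_le[of s] by linarith
qed

definition overlap_size :: "(nat \<Rightarrow> real) \<Rightarrow> (nat \<Rightarrow> real) \<Rightarrow> real" where "overlap_size \<sigma> \<tau> = sqrt (real N * Y \<sigma> \<tau>)"

lemma overlap_size_nonneg: "0 \<le> overlap_size \<sigma> \<tau>" by (simp add: overlap_size_def Y_nonneg)
lemma overlap_size_pow4: "(overlap_size \<sigma> \<tau>) ^ 4 = (real N * Y \<sigma> \<tau>)\<^sup>2"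
proof -
  have "(overlap_size \<sigma> \<tau>) ^ 4 = ((overlap_size \<sigma> \<tau>)\<^sup>2)\<^sup>2" by (simp add: power_mult[symmetric])
  then show ?thesis by (simp add: overlap_size_def Y_nonneg)
qed

lemma Rbar_scaled: "sqrt (real N) * \<bar>Rbar s \<sigma> \<tau>\<bar> \<le> 1 / sqrt (lam $ s) * overlap_size \<sigma> \<tau>"
proof -
  have "lam $ s * (Rbar s \<sigma> \<tau>)\<^sup>2 \<le> Y \<sigma> \<tau>"
    unfolding Y_def by (rule member_le_sum[of s UNIV "\<lambda>s. lam $ s * (Rbar s \<sigma> \<tau>)\<^sup>2"]) (use lam_pos in \<open>auto simp: less_imp_le\<close>)
  then have "real N * (Rbar s \<sigma> \<tau>)\<^sup>2 \<le> real N * Y \<sigma> \<tau> / lam $ s"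
    using lam_pos[of s] by (simp add: le_divide_eq mult_left_mono mult_ac)
  then have "sqrt (real N * (Rbar s \<sigma> \<tau>)\<^sup>2) \<le> sqrt (real N * Y \<sigma> \<tau> / lam $ s)" by simp
  then show ?thesis by (simp add: real_sqrt_mult real_sqrt_divide overlap_size_def)
qed

lemma sqrt_N: "1 \<le> sqrt (real N)" "sqrt (real N) * sqrt (real N) = real N"
  using N by auto

definition eta :: real where "eta = 1 / (real N * sqrt (real N))"

lemma eta_pos: "0 < eta" using N by (simp add: eta_def)

definition overlap_moment :: "nat \<Rightarrow> 'm \<Rightarrow> 'm \<Rightarrow> real" where
  "overlap_moment a u t = F.E (pi / 2) {1, 2, 3, 4} (\<lambda>\<tau>. Rbar u (\<tau> 1) (\<tau> 2) * Rbar t (\<tau> (fst (second_replica_pair a))) (\<tau> (snd (second_replica_pair a))))"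

text \<open>Replicas are exchangeable and overlaps symmetric, so only the number of common replicas matters.\<close>

lemma overlap_moment_pairs:
  assumes R: "finite R" "{l, l', k, k'} \<subseteq> R" "l \<noteq> l'" "k \<noteq> k'"
  shows "F.E (pi / 2) R (\<lambda>\<tau>. Rbar u (\<tau> l) (\<tau> l') * Rbar t (\<tau> k) (\<tau> k')) = overlap_moment (card ({k, k'} \<inter> {l, l'})) u t"
proof -
  let ?R = "{1, 2, 3, 4 :: nat}"
  note Rs = Rbar_sym
  have two: "F.E (pi / 2) R (\<lambda>\<tau>. Rbar u (\<tau> a) (\<tau> b) * Rbar t (\<tau> a) (\<tau> b)) = overlap_moment 2 u t" if "a \<noteq> b" "{a, b} \<subseteq> R" for a b
    unfolding overlap_moment_def second_replica_pair_def using that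
    by (simp, intro F.E_two[where F="\<lambda>a b. Rbar u a b * Rbar t a b"] R) auto
  have three: "F.E (pi / 2) R (\<lambda>\<tau>. Rbar u (\<tau> a) (\<tau> b) * Rbar t (\<tau> a) (\<tau> c)) = overlap_moment 1 u t" if "distinct [a, b, c]" "{a, b, c} \<subseteq> R" for a b c
    unfolding overlap_moment_def second_replica_pair_def using that
    by (simp, intro F.E_three[where F="\<lambda>a b c. Rbar u a b * Rbar t a c"] R) auto
  have four: "F.E (pi / 2) R (\<lambda>\<tau>. Rbar u (\<tau> a) (\<tau> b) * Rbar t (\<tau> c) (\<tau> d)) = overlap_moment 0 u t" if "distinct [a, b, c, d]" "{a, b, c, d} \<subseteq> R" for a b c d
    unfolding overlap_moment_def second_replica_pair_def using that
    by (simp, intro F.E_four[where F="\<lambda>a b c d. Rbar u a b * Rbar t c d"] R) auto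
  consider "k = l" "k' = l'" | "k = l'" "k' = l" | "k = l" "k' \<noteq> l'" | "k = l'" "k' \<noteq> l" | "k' = l" "k \<noteq> l'" | "k' = l'" "k \<noteq> l"
    | "k \<noteq> l" "k \<noteq> l'" "k' \<noteq> l" "k' \<noteq> l'" by blast
  then show ?thesis
  proof cases
    case 1
    then have "card ({k, k'} \<inter> {l, l'}) = 2" using R by simp
    then show ?thesis using 1 two[of l l'] R by (simp add: numeral_2_eq_2)
  next
    case 2
    then have "card ({k, k'} \<inter> {l, l'}) = 2" using R by (simp add: insert_commute)
    then show ?thesis using 2 two[of l l'] R Rs[of t "_ l'" "_ l"] by (simp add: numeral_2_eq_2)
  next
    case 3
    then have "{k, k'} \<inter> {l, l'} = {l}" using R by auto
    then show ?thesis using 3 three[of l l' k'] R by simp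
  next
    case 4
    then have "{k, k'} \<inter> {l, l'} = {l'}" using R by auto
    then show ?thesis using 4 three[of l' l k'] R Rs[of u "_ l'" "_ l"] by simp
  next
    case 5
    then have "{k, k'} \<inter> {l, l'} = {l}" using R by auto
    then show ?thesis using 5 three[of l l' k] R Rs[of t "_ l" "_ k"] by simp
  next
    case 6
    then have "{k, k'} \<inter> {l, l'} = {l'}" using R by auto
    then show ?thesis using 6 three[of l' l k] R Rs[of t "_ l'" "_ k"] Rs[of u "_ l'" "_ l"] by simp
  next
    case 7
    then have "{k, k'} \<inter> {l, l'} = {}" by auto
    then show ?thesis using 7 four[of l l' k k'] R by simp
  qed
qed

end

context cavity
begin

lemma C_DERIV:
  assumes R: "finite R" "u \<notin> R" "w \<notin> R" "u \<noteq> w" and f: "depends_on R f"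
  shows "((\<lambda>t. C.E t R f) has_real_derivative
     sin t * cos t * C.E t (insert u (insert w R)) (\<lambda>\<tau>. f \<tau> * replica_form C.B R u w \<tau>)) (at t)"
proof -
  obtain Cf where Cf: "Cf \<ge> 0" "\<forall>\<tau>\<in>R \<rightarrow>\<^sub>E S. \<bar>f \<tau>\<bar> \<le> Cf" using C.config_bounded[OF R(1)] by blast
  have "((\<lambda>t. C.E t R f) has_real_derivative
     C.E t R (\<lambda>_. 0) + sin t * cos t * C.E t (insert u (insert w R)) (\<lambda>\<tau>. f \<tau> * replica_form C.B R u w \<tau>)) (at t)"
    by (rule C.DERIV_E[where f="\<lambda>_. f" and f'="\<lambda>_ _. 0" and Cf=Cf, OF R f DERIV_const]) (use Cf in auto)
  then show ?thesis by (simp add: C.E_const[OF R(1)])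
qed

definition spin_field :: "(nat \<Rightarrow> nat \<Rightarrow> real) \<Rightarrow> nat \<Rightarrow> nat \<Rightarrow> real" where
  "spin_field \<tau> l l' = \<tau> l i0 * \<tau> l' i0 * W (\<tau> l) (\<tau> l')"

text \<open>The diagonal terms of the replica form cancel, as the squared spin at \<open>i0\<close> is \<open>1\<close> and the covariance of a configuration with itself is the
same for all configurations; what is left are sums over pairs of different replicas.\<close>

lemma C_replica_form:
  assumes R: "finite R" "u \<notin> R" and \<tau>: "\<tau> \<in> insert u (insert w R) \<rightarrow>\<^sub>E S"
  shows "replica_form C.B R u w \<tau> = \<beta>\<^sup>2 * ((\<Sum>l\<in>R. \<Sum>l'\<in>R - {l}. spin_field \<tau> l l')
     - 2 * real (card R) * (\<Sum>l\<in>R. spin_field \<tau> l u) + real (card R) * (real (card R) + 1) * spin_field \<tau> u w)"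
proof -
  have t: "\<tau> l \<in> S" if "l \<in> insert u (insert w R)" for l using \<tau> that by auto
  have B: "C.B (\<tau> l) (\<tau> l') = \<beta>\<^sup>2 * spin_field \<tau> l l'" if "l \<in> insert u (insert w R)" "l' \<in> insert u (insert w R)" for l l'
    using C_B[OF t[OF that(1)] t[OF that(2)]] by (simp add: spin_field_def)
  have "(\<Sum>l'\<in>R. C.B (\<tau> l) (\<tau> l')) = C.B (\<tau> u) (\<tau> u) + (\<Sum>l'\<in>R - {l}. \<beta>\<^sup>2 * spin_field \<tau> l l')" if l: "l \<in> R" for l
  proof -
    have "(\<Sum>l'\<in>R. C.B (\<tau> l) (\<tau> l')) = C.B (\<tau> l) (\<tau> l) + (\<Sum>l'\<in>R - {l}. C.B (\<tau> l) (\<tau> l'))"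
      using R l by (simp add: sum.remove)
    also have "C.B (\<tau> l) (\<tau> l) = C.B (\<tau> u) (\<tau> u)" by (rule C_B_diag) (use t l in auto)
    also have "(\<Sum>l'\<in>R - {l}. C.B (\<tau> l) (\<tau> l')) = (\<Sum>l'\<in>R - {l}. \<beta>\<^sup>2 * spin_field \<tau> l l')"
      by (intro sum.cong refl B) (use l in auto)
    finally show ?thesis .
  qed
  then have 1: "(\<Sum>l\<in>R. \<Sum>l'\<in>R. C.B (\<tau> l) (\<tau> l')) = real (card R) * C.B (\<tau> u) (\<tau> u) + (\<Sum>l\<in>R. \<Sum>l'\<in>R - {l}. \<beta>\<^sup>2 * spin_field \<tau> l l')"
    by (simp add: sum.distrib)
  have 2: "(\<Sum>l\<in>R. C.B (\<tau> l) (\<tau> u)) = (\<Sum>l\<in>R. \<beta>\<^sup>2 * spin_field \<tau> l u)" by (intro sum.cong refl B) auto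
  have 3: "C.B (\<tau> u) (\<tau> w) = \<beta>\<^sup>2 * spin_field \<tau> u w" by (rule B) auto
  show ?thesis unfolding replica_form_def 1 2 3 sum_distrib_left[symmetric] by (simp add: algebra_simps)
qed

lemma spin_field_abs: "\<tau> l \<in> S \<Longrightarrow> \<tau> l' \<in> S \<Longrightarrow> \<bar>spin_field \<tau> l l'\<bar> = \<bar>W (\<tau> l) (\<tau> l')\<bar>"
  by (simp add: spin_field_def abs_mult spin_abs[OF _ i0])

lemma C_E_pairs:
  fixes f :: "(nat \<Rightarrow> nat \<Rightarrow> real) \<Rightarrow> real"
  assumes R: "finite R" "u \<notin> R" "w \<notin> R" "u \<noteq> w"
  defines "R' \<equiv> insert u (insert w R)"
  shows "C.E t R' (\<lambda>\<tau>. f \<tau> * replica_form C.B R u w \<tau>) = \<beta>\<^sup>2 * ((\<Sum>l\<in>R. \<Sum>l'\<in>R - {l}. C.E t R' (\<lambda>\<tau>. f \<tau> * spin_field \<tau> l l'))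
     - 2 * real (card R) * (\<Sum>l\<in>R. C.E t R' (\<lambda>\<tau>. f \<tau> * spin_field \<tau> l u)) + real (card R) * (real (card R) + 1) * C.E t R' (\<lambda>\<tau>. f \<tau> * spin_field \<tau> u w))"
proof -
  have R': "finite R'" using R by (simp add: R'_def)
  have "C.E t R' (\<lambda>\<tau>. f \<tau> * replica_form C.B R u w \<tau>) = C.E t R' (\<lambda>\<tau>. \<beta>\<^sup>2 * ((\<Sum>l\<in>R. \<Sum>l'\<in>R - {l}. f \<tau> * spin_field \<tau> l l')
     - 2 * real (card R) * (\<Sum>l\<in>R. f \<tau> * spin_field \<tau> l u) + real (card R) * (real (card R) + 1) * (f \<tau> * spin_field \<tau> u w)))"
    by (rule C.E_cong, subst C_replica_form[OF R(1,2)]) (simp_all add: R'_def sum_distrib_left[symmetric] algebra_simps)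
  then show ?thesis by (simp only: C.E_cmult C.E_add[OF R'] C.E_diff[OF R'] C.E_sum[OF R'])
qed

text \<open>For \<open>n\<close> replicas the derivative has \<open>n (n - 1) + 2 n\<^sup>2 + n (n + 1) = 4 n\<^sup>2\<close> terms counted with the size of their coefficients, and
\<open>sin t * cos t\<close> integrates to at most \<open>1/2\<close>.\<close>

lemma C_E_change:
  assumes R: "finite R" "u \<notin> R" "w \<notin> R" "u \<noteq> w" and f: "depends_on R f"
    and le: "\<And>t a b. 0 \<le> t \<Longrightarrow> t \<le> pi / 2 \<Longrightarrow> a \<in> insert u (insert w R) \<Longrightarrow> b \<in> insert u (insert w R) \<Longrightarrow> a \<noteq> b \<Longrightarrow>
      C.E t (insert u (insert w R)) (\<lambda>\<tau>. \<bar>f \<tau>\<bar> * \<bar>W (\<tau> a) (\<tau> b)\<bar>) \<le> \<epsilon>"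
    and T: "0 \<le> T" "T \<le> pi / 2"
  shows "\<bar>C.E T R f - C.E 0 R f\<bar> \<le> 2 * \<beta>\<^sup>2 * (real (card R) * (real (card R) + 1)) * \<epsilon>"
proof -
  let ?R = "insert u (insert w R)" and ?n = "real (card R)"
  have R': "finite ?R" using R by simp
  let ?G = "\<lambda>t. C.E t ?R (\<lambda>\<tau>. f \<tau> * replica_form C.B R u w \<tau>)"
  let ?K = "2 * \<beta>\<^sup>2 * (?n * (?n + 1)) * \<epsilon>"
  have D: "((\<lambda>t. C.E t R f) has_real_derivative 2 * (sin t * cos t) * (?G t / 2)) (at t)" for t
    by (rule DERIV_cong[OF C_DERIV[OF R f]]) simp
  have pb: "\<bar>C.E t ?R (\<lambda>\<tau>. f \<tau> * spin_field \<tau> a b)\<bar> \<le> \<epsilon>" if "0 \<le> t" "t \<le> pi / 2" "a \<in> ?R" "b \<in> ?R" "a \<noteq> b" for t a b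
  proof -
    have "\<bar>C.E t ?R (\<lambda>\<tau>. f \<tau> * spin_field \<tau> a b)\<bar> \<le> C.E t ?R (\<lambda>\<tau>. \<bar>f \<tau> * spin_field \<tau> a b\<bar>)" by (rule C.E_abs_le[OF R'])
    also have "\<dots> = C.E t ?R (\<lambda>\<tau>. \<bar>f \<tau>\<bar> * \<bar>W (\<tau> a) (\<tau> b)\<bar>)"
    proof (rule C.E_cong)
      fix \<tau> assume "\<tau> \<in> ?R \<rightarrow>\<^sub>E S"
      then have "\<tau> a \<in> S" "\<tau> b \<in> S" using that by (metis PiE_mem)+
      then show "\<bar>f \<tau> * spin_field \<tau> a b\<bar> = \<bar>f \<tau>\<bar> * \<bar>W (\<tau> a) (\<tau> b)\<bar>" by (simp add: abs_mult spin_field_abs)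
    qed
    also have "\<dots> \<le> \<epsilon>" by (rule le[OF that])
    finally show ?thesis .
  qed
  have e0: "0 \<le> \<epsilon>" using pb[of 0 u w] R(4) pi_gt_zero by force
  have "\<bar>C.E T R f - C.E 0 R f - 0 * (sin T)\<^sup>2\<bar> \<le> ?K"
  proof (rule sin_cos_taylor[OF D _ T])
    fix t :: real assume t: "0 \<le> t" "t \<le> pi / 2"
    have 1: "\<bar>\<Sum>l\<in>R. \<Sum>l'\<in>R - {l}. C.E t ?R (\<lambda>\<tau>. f \<tau> * spin_field \<tau> l l')\<bar> \<le> (\<Sum>l\<in>R. \<Sum>l'\<in>R - {l}. \<epsilon>)"
      by (intro order_trans[OF sum_abs] sum_mono pb[OF t]) auto
    have "(\<Sum>l\<in>R. \<Sum>l'\<in>R - {l}. \<epsilon>) \<le> (\<Sum>l\<in>R. \<Sum>l'\<in>R. \<epsilon>)"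
      using R(1) e0 by (intro sum_mono sum_mono2) auto
    then have 1: "\<bar>\<Sum>l\<in>R. \<Sum>l'\<in>R - {l}. C.E t ?R (\<lambda>\<tau>. f \<tau> * spin_field \<tau> l l')\<bar> \<le> ?n * ?n * \<epsilon>"
      using 1 by simp
    have 2: "\<bar>\<Sum>l\<in>R. C.E t ?R (\<lambda>\<tau>. f \<tau> * spin_field \<tau> l u)\<bar> \<le> ?n * \<epsilon>"
    proof -
      have "\<bar>\<Sum>l\<in>R. C.E t ?R (\<lambda>\<tau>. f \<tau> * spin_field \<tau> l u)\<bar> \<le> (\<Sum>l\<in>R. \<epsilon>)"
        by (intro order_trans[OF sum_abs] sum_mono pb[OF t]) (use R in auto)
      then show ?thesis by simp
    qed
    have 3: "\<bar>C.E t ?R (\<lambda>\<tau>. f \<tau> * spin_field \<tau> u w)\<bar> \<le> \<epsilon>" by (rule pb[OF t]) (use R in auto)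
    have h2: "\<bar>2 * ?n * (\<Sum>l\<in>R. C.E t ?R (\<lambda>\<tau>. f \<tau> * spin_field \<tau> l u))\<bar> \<le> 2 * ?n * (?n * \<epsilon>)"
      unfolding abs_mult using 2 by (intro mult_mono) auto
    have h3: "\<bar>?n * (?n + 1) * C.E t ?R (\<lambda>\<tau>. f \<tau> * spin_field \<tau> u w)\<bar> \<le> ?n * (?n + 1) * \<epsilon>"
      unfolding abs_mult using 3 by (intro mult_mono) auto
    have 4: "?n * ?n * \<epsilon> + 2 * ?n * (?n * \<epsilon>) + ?n * (?n + 1) * \<epsilon> \<le> 4 * (?n * (?n + 1)) * \<epsilon>"
      using e0 by (simp add: algebra_simps)
    have "\<bar>?G t\<bar> \<le> \<beta>\<^sup>2 * (4 * (?n * (?n + 1)) * \<epsilon>)"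
    proof -
      have "\<bar>\<beta>\<^sup>2 * z\<bar> \<le> \<beta>\<^sup>2 * K" if "\<bar>z\<bar> \<le> K" for z K using that by (simp add: abs_mult mult_left_mono)
      then show ?thesis unfolding C_E_pairs[OF R] using 1 h2 h3 4 by (smt (verit))
    qed
    then show "\<bar>?G t / 2 - 0\<bar> \<le> ?K" by simp
  qed
  then show ?thesis by simp
qed

end

section \<open>Third moments along the cavity path\<close>

lemma abs_combination_le:
  fixes K :: real
  assumes "\<bar>a\<bar> \<le> K" "\<bar>b\<bar> \<le> K" "\<bar>c\<bar> \<le> K" "\<bar>d\<bar> \<le> K" "\<bar>e\<bar> \<le> K" "\<bar>f\<bar> \<le> K" "\<bar>g\<bar> \<le> K" "\<bar>h\<bar> \<le> K"
  shows "\<bar>(a + b + (c + d)) - 4 * (e + f) + 6 * g - 2 * h\<bar> \<le> 20 * K"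
proof -
  have 1: "a + b + (c + d) \<le> 4 * K" "- (4 * K) \<le> a + b + (c + d)"
    using assms(1-4) by (simp_all only: abs_le_iff) linarith+
  have "e + f \<le> 2 * K" "- (2 * K) \<le> e + f"
    using assms(5,6) by (simp_all only: abs_le_iff) linarith+
  then have 2: "4 * (e + f) \<le> 8 * K" "- (8 * K) \<le> 4 * (e + f)" by simp_all
  have 3: "6 * g - 2 * h \<le> 8 * K" "- (8 * K) \<le> 6 * g - 2 * h"
    using assms(7,8) by (simp_all only: abs_le_iff) linarith+
  show ?thesis
  proof (rule abs_leI)
    define x y z where "x = a + b + (c + d)" and "y = 4 * (e + f)" and "z = 6 * g - 2 * h"
    have "x - y + z \<le> 20 * K" "- (x - y + z) \<le> 20 * K"
      using 1 2 3 unfolding x_def[symmetric] y_def[symmetric] z_def[symmetric] by linarith+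
    then show "(a + b + (c + d)) - 4 * (e + f) + 6 * g - 2 * h \<le> 20 * K"
      "- ((a + b + (c + d)) - 4 * (e + f) + 6 * g - 2 * h) \<le> 20 * K" by (simp_all add: x_def y_def z_def)
  qed
qed

context cavity
begin

lemma lam_nonneg: "0 \<le> lam $ t" using lam_pos less_imp_le by blast

lemma W_abs_le:
  assumes "\<sigma> \<in> S" "\<tau> \<in> S" shows "\<bar>W \<sigma> \<tau>\<bar> \<le> c_W"
proof -
  have "\<bar>\<Sum>u\<in>UNIV. D $ s0 $ u * lam $ u * Rbar u \<sigma> \<tau>\<bar> \<le> (\<Sum>u\<in>UNIV. D $ s0 $ u * (2 * lam $ u))"
  proof (rule order_trans[OF sum_abs sum_mono])
    fix u
    have "D $ s0 $ u * lam $ u * \<bar>Rbar u \<sigma> \<tau>\<bar> \<le> D $ s0 $ u * lam $ u * 2"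
      using D_nonneg lam_nonneg Rbar_abs_le[OF assms] by (intro mult_left_mono) auto
    then show "\<bar>D $ s0 $ u * lam $ u * Rbar u \<sigma> \<tau>\<bar> \<le> D $ s0 $ u * (2 * lam $ u)"
      using D_nonneg lam_nonneg by (simp add: abs_mult mult_ac)
  qed
  moreover have "\<bar>D $ s0 $ s0 * (\<sigma> i0 * \<tau> i0) / real N\<bar> \<le> D $ s0 $ s0"
  proof -
    have "\<bar>D $ s0 $ s0 * (\<sigma> i0 * \<tau> i0) / real N\<bar> = D $ s0 $ s0 / real N"
      using D_nonneg spin_abs[OF assms(1) i0] spin_abs[OF assms(2) i0] by (simp add: abs_mult abs_divide)
    also have "\<dots> \<le> D $ s0 $ s0" using mult_left_mono[of 1 "real N" "D $ s0 $ s0"] N D_nonneg by (simp add: divide_le_eq)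
    finally show ?thesis .
  qed
  moreover have "D $ s0 $ s0 \<le> (\<Sum>u\<in>UNIV. D $ s0 $ u)"
    by (rule member_le_sum[of s0 UNIV "\<lambda>u. D $ s0 $ u"]) (use D_nonneg in auto)
  ultimately have "\<bar>W \<sigma> \<tau>\<bar> \<le> (\<Sum>u\<in>UNIV. D $ s0 $ u * (2 * lam $ u)) + (\<Sum>u\<in>UNIV. D $ s0 $ u)"
    unfolding W_eq[OF assms] by linarith
  also have "\<dots> = (\<Sum>u\<in>UNIV. D $ s0 $ u * (2 * lam $ u + 1))" by (simp add: sum.distrib[symmetric] algebra_simps)
  also have "\<dots> \<le> c_W" unfolding c_W_def
    by (rule member_le_sum[of s0 UNIV "\<lambda>s. \<Sum>u\<in>UNIV. D $ s $ u * (2 * lam $ u + 1)"])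
       (use D_nonneg lam_nonneg in \<open>auto intro!: sum_nonneg mult_nonneg_nonneg add_nonneg_nonneg\<close>)
  finally show ?thesis .
qed

definition c_growth :: real where "c_growth = 20 * \<beta>\<^sup>2 * c_W"

lemma c_W_nonneg: "0 \<le> c_W"
  unfolding c_W_def using D_nonneg lam_nonneg by (intro sum_nonneg mult_nonneg_nonneg add_nonneg_nonneg) auto

text \<open>The path only touches the \<open>N\<close> couplings at one site, each of variance \<open>O(1/N)\<close>. The replica form is therefore bounded uniformly in \<open>N\<close>, and
Gronwall's inequality, run backwards from the end of the path, transfers moment bounds of the model to the whole path.\<close>

lemma C_E_growth:
  assumes g: "\<And>\<sigma> \<tau>. \<sigma> \<in> S \<Longrightarrow> \<tau> \<in> S \<Longrightarrow> 0 \<le> g \<sigma> \<tau>" and t: "0 \<le> t" "t \<le> pi / 2"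
  shows "C.E t {1, 2} (\<lambda>\<tau>. g (\<tau> 1) (\<tau> 2)) \<le> exp (c_growth * (pi / 2)) * C.E (pi / 2) {1, 2} (\<lambda>\<tau>. g (\<tau> 1) (\<tau> 2))"
proof -
  let ?f = "\<lambda>\<tau>. g (\<tau> (1::nat)) (\<tau> 2)" and ?R = "{3, 4, 1, 2::nat}"
  have R: "finite {1, 2::nat}" "finite ?R" by auto
  have dep: "depends_on {1, 2} ?f" by (simp add: depends_on_def)
  define \<phi> where "\<phi> = (\<lambda>s. C.E (pi / 2 - s) {1, 2} ?f)"
  define \<phi>' where "\<phi>' = (\<lambda>s. sin (pi / 2 - s) * cos (pi / 2 - s) * C.E (pi / 2 - s) ?R (\<lambda>\<tau>. ?f \<tau> * replica_form C.B {1, 2} 3 4 \<tau>) * (- 1))"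
  have d: "(\<phi> has_real_derivative \<phi>' s) (at s)" for s
    unfolding \<phi>_def \<phi>'_def
    by (rule DERIV_chain2[where f="\<lambda>t. C.E t {1, 2} ?f" and g="\<lambda>s. pi / 2 - s", OF C_DERIV[OF R(1) _ _ _ dep]])
       (auto intro!: derivative_eq_intros)
  have E0: "0 \<le> C.E t {1, 2} ?f" for t
  proof -
    have "C.E t {1, 2} (\<lambda>_. 0) \<le> C.E t {1, 2} ?f" by (rule C.E_mono[OF R(1)]) (rule g; auto)
    then show ?thesis unfolding C.E_const[OF R(1)] .
  qed
  have rf: "\<bar>replica_form C.B {1, 2} 3 4 \<tau>\<bar> \<le> c_growth" if "\<tau> \<in> ?R \<rightarrow>\<^sub>E S" for \<tau>
  proof -
    have t: "\<tau> 1 \<in> S" "\<tau> 2 \<in> S" "\<tau> 3 \<in> S" "\<tau> 4 \<in> S" by (rule PiE_mem[OF that], simp)+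
    have B: "\<bar>C.B \<sigma> \<sigma>'\<bar> \<le> \<beta>\<^sup>2 * c_W" if s: "\<sigma> \<in> S" "\<sigma>' \<in> S" for \<sigma> \<sigma>'
      unfolding C_B[OF s] using W_abs_le[OF s] spin_abs[OF s(1) i0] spin_abs[OF s(2) i0]
      by (simp add: abs_mult mult_left_mono)
    have e: "replica_form C.B {1, 2} 3 4 \<tau> = (C.B (\<tau> 1) (\<tau> 1) + C.B (\<tau> 1) (\<tau> 2) + (C.B (\<tau> 2) (\<tau> 1) + C.B (\<tau> 2) (\<tau> 2)))
      - 4 * (C.B (\<tau> 1) (\<tau> 3) + C.B (\<tau> 2) (\<tau> 3)) + 6 * C.B (\<tau> 3) (\<tau> 4) - 2 * C.B (\<tau> 3) (\<tau> 3)"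
      by (simp add: replica_form_def)
    show ?thesis
      unfolding c_growth_def mult.assoc e by (rule abs_combination_le) (rule B; rule t)+
  qed
  have "\<phi> (pi / 2 - t) \<le> \<phi> 0 * exp (c_growth * (pi / 2 - t))"
  proof (rule gronwall_derivative[OF d])
    fix s assume s: "0 \<le> s" "s \<le> pi / 2 - t"
    let ?t = "pi / 2 - s"
    have "\<bar>C.E ?t ?R (\<lambda>\<tau>. ?f \<tau> * replica_form C.B {1, 2} 3 4 \<tau>)\<bar> \<le> C.E ?t ?R (\<lambda>\<tau>. \<bar>?f \<tau> * replica_form C.B {1, 2} 3 4 \<tau>\<bar>)"
      by (rule C.E_abs_le[OF R(2)])
    also have "\<dots> \<le> C.E ?t ?R (\<lambda>\<tau>. c_growth * ?f \<tau>)"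
    proof (rule C.E_mono[OF R(2)])
      fix \<tau> assume \<tau>: "\<tau> \<in> ?R \<rightarrow>\<^sub>E S"
      then have f0: "0 \<le> ?f \<tau>" by (intro g) auto
      show "\<bar>?f \<tau> * replica_form C.B {1, 2} 3 4 \<tau>\<bar> \<le> c_growth * ?f \<tau>"
        using mult_left_mono[OF rf[OF \<tau>] f0] f0 by (simp add: abs_mult mult.commute)
    qed
    also have "\<dots> = c_growth * C.E ?t {1, 2} ?f"
      unfolding C.E_cmult by (subst C.E_marginal[OF R(2) _ dep]) auto
    finally have 1: "\<bar>C.E ?t ?R (\<lambda>\<tau>. ?f \<tau> * replica_form C.B {1, 2} 3 4 \<tau>)\<bar> \<le> c_growth * \<phi> s" by (simp only: \<phi>_def)
    have sc: "\<bar>sin ?t * cos ?t\<bar> \<le> 1" using mult_mono[of "\<bar>sin ?t\<bar>" 1 "\<bar>cos ?t\<bar>" 1] by (simp add: abs_mult)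
    have "\<bar>sin ?t * cos ?t\<bar> * \<bar>C.E ?t ?R (\<lambda>\<tau>. ?f \<tau> * replica_form C.B {1, 2} 3 4 \<tau>)\<bar> \<le> 1 * (c_growth * \<phi> s)"
      by (rule mult_mono[OF sc 1]) auto
    then have "\<bar>\<phi>' s\<bar> \<le> c_growth * \<phi> s" unfolding \<phi>'_def abs_mult by simp
    then show "\<phi>' s \<le> c_growth * \<phi> s" by linarith
  qed (use t in simp)
  also have "\<dots> \<le> \<phi> 0 * exp (c_growth * (pi / 2))"
  proof (rule mult_left_mono)
    have "c_growth * (pi / 2 - t) \<le> c_growth * (pi / 2)"
      using t c_W_nonneg by (intro mult_left_mono) (auto simp: c_growth_def)
    then show "exp (c_growth * (pi / 2 - t)) \<le> exp (c_growth * (pi / 2))" by simp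
    show "0 \<le> \<phi> 0" unfolding \<phi>_def by (rule E0)
  qed
  finally show ?thesis by (simp add: \<phi>_def mult.commute)
qed

lemma W_scaled:
  assumes "\<sigma> \<in> S" "\<tau> \<in> S" shows "sqrt (real N) * \<bar>W \<sigma> \<tau>\<bar> \<le> c_ov * (overlap_size \<sigma> \<tau> + 1)"
proof -
  have "sqrt (real N) * \<bar>\<Sum>u\<in>UNIV. D $ s0 $ u * lam $ u * Rbar u \<sigma> \<tau>\<bar> \<le> (\<Sum>u\<in>UNIV. D $ s0 $ u * lam $ u * (1 / sqrt (lam $ u))) * overlap_size \<sigma> \<tau>"
  proof -
    have "sqrt (real N) * \<bar>\<Sum>u\<in>UNIV. D $ s0 $ u * lam $ u * Rbar u \<sigma> \<tau>\<bar> \<le> sqrt (real N) * (\<Sum>u\<in>UNIV. \<bar>D $ s0 $ u * lam $ u * Rbar u \<sigma> \<tau>\<bar>)"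
      by (intro mult_left_mono sum_abs) simp
    also have "\<dots> = (\<Sum>u\<in>UNIV. D $ s0 $ u * lam $ u * (sqrt (real N) * \<bar>Rbar u \<sigma> \<tau>\<bar>))"
      unfolding sum_distrib_left using D_nonneg lam_nonneg by (intro sum.cong refl) (simp add: abs_mult)
    also have "\<dots> \<le> (\<Sum>u\<in>UNIV. D $ s0 $ u * lam $ u * (1 / sqrt (lam $ u) * overlap_size \<sigma> \<tau>))"
      using D_nonneg lam_nonneg by (intro sum_mono mult_left_mono Rbar_scaled) auto
    also have "\<dots> = (\<Sum>u\<in>UNIV. D $ s0 $ u * lam $ u * (1 / sqrt (lam $ u))) * overlap_size \<sigma> \<tau>"
      unfolding sum_distrib_right by (intro sum.cong refl) simp
    finally show ?thesis .
  qed
  also have "\<dots> \<le> c_ov * overlap_size \<sigma> \<tau>" by (rule mult_right_mono[OF c_ov(4) overlap_size_nonneg])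
  finally have 1: "sqrt (real N) * \<bar>\<Sum>u\<in>UNIV. D $ s0 $ u * lam $ u * Rbar u \<sigma> \<tau>\<bar> \<le> c_ov * overlap_size \<sigma> \<tau>" .
  have "sqrt (real N) * \<bar>D $ s0 $ s0 * (\<sigma> i0 * \<tau> i0) / real N\<bar> = D $ s0 $ s0 * (sqrt (real N) / real N)"
    using D_nonneg spin_abs[OF assms(1) i0] spin_abs[OF assms(2) i0] by (simp add: abs_mult abs_divide)
  also have "\<dots> \<le> D $ s0 $ s0 * 1"
  proof (rule mult_left_mono[OF _ D_nonneg])
    have "sqrt (real N) * 1 \<le> sqrt (real N) * sqrt (real N)" using sqrt_N(1) by (intro mult_left_mono) auto
    then show "sqrt (real N) / real N \<le> 1" unfolding sqrt_N(2) using N by simp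
  qed
  also have "\<dots> \<le> c_ov" using c_ov(5)[of s0 s0] by simp
  finally have 2: "sqrt (real N) * \<bar>D $ s0 $ s0 * (\<sigma> i0 * \<tau> i0) / real N\<bar> \<le> c_ov" .
  have "\<bar>W \<sigma> \<tau>\<bar> \<le> \<bar>\<Sum>u\<in>UNIV. D $ s0 $ u * lam $ u * Rbar u \<sigma> \<tau>\<bar> + \<bar>D $ s0 $ s0 * (\<sigma> i0 * \<tau> i0) / real N\<bar>"
    unfolding W_eq[OF assms] by linarith
  then have "sqrt (real N) * \<bar>W \<sigma> \<tau>\<bar> \<le> sqrt (real N) * (\<bar>\<Sum>u\<in>UNIV. D $ s0 $ u * lam $ u * Rbar u \<sigma> \<tau>\<bar> + \<bar>D $ s0 $ s0 * (\<sigma> i0 * \<tau> i0) / real N\<bar>)"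
    by (rule mult_left_mono) simp
  then show ?thesis using 1 2 by (simp only: distrib_left mult_1_right)
qed

lemma Rbar_scaled': "sqrt (real N) * \<bar>Rbar t \<sigma> \<tau>\<bar> \<le> c_ov * overlap_size \<sigma> \<tau>"
  using Rbar_scaled[of t \<sigma> \<tau>] mult_right_mono[OF c_ov(2)[of t] overlap_size_nonneg[of \<sigma> \<tau>]] by linarith

lemma Rcav_diff:
  assumes "\<sigma> \<in> S" "\<tau> \<in> S" shows "\<bar>Rcav t \<sigma> \<tau> - Rbar t \<sigma> \<tau>\<bar> \<le> c_ov / real N"
proof -
  have "\<bar>\<sigma> i0 * \<tau> i0 / real (card (I t))\<bar> = (1 / lam $ t) / real N"
    using spin_abs[OF assms(1) i0] spin_abs[OF assms(2) i0] by (simp add: abs_mult abs_divide card_I lam_nonneg)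
  also have "\<dots> \<le> c_ov / real N" using c_ov(3)[of t] by (intro divide_right_mono) auto
  finally have "\<bar>\<sigma> i0 * \<tau> i0 / real (card (I t))\<bar> \<le> c_ov / real N" .
  then show ?thesis unfolding Rcav_eq using c_ov(1) by auto
qed

lemma Rcav_scaled:
  assumes "\<sigma> \<in> S" "\<tau> \<in> S" shows "sqrt (real N) * \<bar>Rcav t \<sigma> \<tau>\<bar> \<le> c_ov * (overlap_size \<sigma> \<tau> + 1)"
proof -
  have "sqrt (real N) * \<bar>Rcav t \<sigma> \<tau> - Rbar t \<sigma> \<tau>\<bar> \<le> sqrt (real N) * (c_ov / real N)"
    by (rule mult_left_mono[OF Rcav_diff[OF assms]]) simp
  also have "\<dots> = c_ov / sqrt (real N)"
  proof -
    have "sqrt (real N) * (c_ov / (sqrt (real N) * sqrt (real N))) = c_ov / sqrt (real N)" using sqrt_N(1) by (simp del: real_sqrt_mult_self)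
    then show ?thesis unfolding sqrt_N(2) .
  qed
  also have "\<dots> \<le> c_ov" using mult_left_mono[OF sqrt_N(1), of c_ov] sqrt_N(1) c_ov(1) by (simp add: divide_le_eq)
  finally have 1: "sqrt (real N) * \<bar>Rcav t \<sigma> \<tau> - Rbar t \<sigma> \<tau>\<bar> \<le> c_ov" .
  have "sqrt (real N) * \<bar>Rcav t \<sigma> \<tau>\<bar> \<le> sqrt (real N) * (\<bar>Rcav t \<sigma> \<tau> - Rbar t \<sigma> \<tau>\<bar> + \<bar>Rbar t \<sigma> \<tau>\<bar>)"
    by (rule mult_left_mono) auto
  then show ?thesis using 1 Rbar_scaled'[of t \<sigma> \<tau>] by (simp only: distrib_left mult_1_right)
qed

lemma cube_bound:
  assumes "sqrt (real N) * \<bar>z\<bar> \<le> c_ov * (y + 1)" "0 \<le> y"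
  shows "\<bar>z\<bar> ^ 3 \<le> 8 * c_ov ^ 3 * eta * (1 + y ^ 4)"
proof -
  have c: "0 \<le> c_ov" using c_ov(1) by linarith
  have "(sqrt (real N) * \<bar>z\<bar>) ^ 3 \<le> (c_ov * (y + 1)) ^ 3" by (rule power_mono[OF assms(1)]) simp
  moreover have "(sqrt (real N)) ^ 3 = real N * sqrt (real N)" using sqrt_N(2) by (simp add: power3_eq_cube)
  ultimately have 1: "(real N * sqrt (real N)) * \<bar>z\<bar> ^ 3 \<le> c_ov ^ 3 * (y + 1) ^ 3" by (simp add: power_mult_distrib)
  have "(y + 1) ^ 3 \<le> 8 * (1 + y ^ 4)"
  proof (cases "y \<le> 1")
    case True
    then have "(y + 1) ^ 3 \<le> 2 ^ 3" using assms(2) by (intro power_mono) auto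
    then have "(y + 1) ^ 3 \<le> 8" by simp
    also have "8 \<le> 8 * (1 + y ^ 4)" using assms(2) by simp
    finally show ?thesis .
  next
    case False
    then have "(y + 1) ^ 3 \<le> (2 * y) ^ 3" using assms(2) by (intro power_mono) auto
    also have "\<dots> = 8 * y ^ 3" by (simp add: power_mult_distrib)
    also have "y ^ 3 \<le> y ^ 4" using False by (intro power_increasing) auto
    finally show ?thesis by simp
  qed
  then have "c_ov ^ 3 * (y + 1) ^ 3 \<le> c_ov ^ 3 * (8 * (1 + y ^ 4))" using c by (intro mult_left_mono) auto
  then have "(real N * sqrt (real N)) * \<bar>z\<bar> ^ 3 \<le> c_ov ^ 3 * (8 * (1 + y ^ 4))" by (rule order_trans[OF 1])
  then have "(real N * sqrt (real N)) * \<bar>z\<bar> ^ 3 \<le> 8 * c_ov ^ 3 * (1 + y ^ 4)" by (simp only: mult_ac)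
  moreover have "0 < real N * sqrt (real N)" using N by simp
  ultimately have "\<bar>z\<bar> ^ 3 \<le> 8 * c_ov ^ 3 * (1 + y ^ 4) / (real N * sqrt (real N))" by (simp add: le_divide_eq mult.commute)
  then show ?thesis by (simp add: eta_def)
qed

end

text \<open>The bound \<open>C4\<close> is the only input from the overlap moments; \<open>C3\<close> is the resulting bound for third moments along the path.\<close>

locale cavity_moment = cavity +
  fixes C4 :: real
  assumes C4: "F.E (pi / 2) {1, 2} (\<lambda>\<tau>. (real N * Y (\<tau> 1) (\<tau> 2))\<^sup>2) \<le> C4"
begin

definition C3 :: real where "C3 = exp (c_growth * (pi / 2)) * (8 * c_ov ^ 3 * (1 + C4))"

lemma C4_nonneg: "0 \<le> C4"
proof -
  have "F.E (pi / 2) {1, 2::nat} (\<lambda>_. 0) \<le> F.E (pi / 2) {1, 2} (\<lambda>\<tau>. (real N * Y (\<tau> 1) (\<tau> 2))\<^sup>2)"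
    by (rule F.E_mono) auto
  moreover have "F.E (pi / 2) {1, 2::nat} (\<lambda>_. 0) = 0" by (rule F.E_const) simp
  ultimately show ?thesis using C4 by linarith
qed

lemma C3_nonneg: "0 \<le> C3"
  unfolding C3_def using C4_nonneg c_ov(1) by (intro mult_nonneg_nonneg) auto

text \<open>A quantity bounded by the overlap at scale \<open>1 / sqrt N\<close> has third absolute moment of order \<open>N\<^sup>-\<^sup>3\<^sup>/\<^sup>2\<close>.\<close>

lemma third_moment:
  assumes g: "\<And>\<sigma> \<tau>. \<sigma> \<in> S \<Longrightarrow> \<tau> \<in> S \<Longrightarrow> sqrt (real N) * \<bar>g \<sigma> \<tau>\<bar> \<le> c_ov * (overlap_size \<sigma> \<tau> + 1)"
    and t: "0 \<le> t" "t \<le> pi / 2" and R: "finite R" "a \<in> R" "b \<in> R" "a \<noteq> b"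
  shows "C.E t R (\<lambda>\<tau>. \<bar>g (\<tau> a) (\<tau> b)\<bar> ^ 3) \<le> C3 * eta"
proof -
  have R2: "finite {1, 2::nat}" by simp
  have "C.E t R (\<lambda>\<tau>. \<bar>g (\<tau> a) (\<tau> b)\<bar> ^ 3) = C.E t {1, 2} (\<lambda>\<tau>. \<bar>g (\<tau> 1) (\<tau> 2)\<bar> ^ 3)"
    by (rule C.E_two[where F="\<lambda>\<sigma> \<tau>. \<bar>g \<sigma> \<tau>\<bar> ^ 3"]) (use R in auto)
  also have "\<dots> \<le> exp (c_growth * (pi / 2)) * C.E (pi / 2) {1, 2} (\<lambda>\<tau>. \<bar>g (\<tau> 1) (\<tau> 2)\<bar> ^ 3)"
    by (rule C_E_growth[OF _ t]) simp
  also have "\<dots> \<le> exp (c_growth * (pi / 2)) * (8 * c_ov ^ 3 * eta * (1 + C4))"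
  proof (rule mult_left_mono)
    have "C.E (pi / 2) {1, 2} (\<lambda>\<tau>. \<bar>g (\<tau> 1) (\<tau> 2)\<bar> ^ 3)
      \<le> C.E (pi / 2) {1, 2} (\<lambda>\<tau>. 8 * c_ov ^ 3 * eta * (1 + (real N * Y (\<tau> 1) (\<tau> 2))\<^sup>2))"
    proof (rule C.E_mono[OF R2])
      fix \<tau> assume "\<tau> \<in> {1, 2::nat} \<rightarrow>\<^sub>E S"
      then have "\<tau> 1 \<in> S" "\<tau> 2 \<in> S" by auto
      from cube_bound[OF g[OF this] overlap_size_nonneg]
      show "\<bar>g (\<tau> 1) (\<tau> 2)\<bar> ^ 3 \<le> 8 * c_ov ^ 3 * eta * (1 + (real N * Y (\<tau> 1) (\<tau> 2))\<^sup>2)" unfolding overlap_size_pow4 .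
    qed
    also have "\<dots> = 8 * c_ov ^ 3 * eta * (1 + F.E (pi / 2) {1, 2} (\<lambda>\<tau>. (real N * Y (\<tau> 1) (\<tau> 2))\<^sup>2))"
      by (simp only: C.E_cmult C.E_add[OF R2] C.E_const[OF R2] C_E_end)
    also have "\<dots> \<le> 8 * c_ov ^ 3 * eta * (1 + C4)"
      using C4 c_ov(1) eta_pos by (intro mult_left_mono) auto
    finally show "C.E (pi / 2) {1, 2} (\<lambda>\<tau>. \<bar>g (\<tau> 1) (\<tau> 2)\<bar> ^ 3) \<le> 8 * c_ov ^ 3 * eta * (1 + C4)" .
  qed simp
  also have "\<dots> = C3 * eta" by (simp add: C3_def)
  finally show ?thesis .
qed

lemma W_third:
  assumes "0 \<le> t" "t \<le> pi / 2" "finite R" "a \<in> R" "b \<in> R" "a \<noteq> b"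
  shows "C.E t R (\<lambda>\<tau>. \<bar>W (\<tau> a) (\<tau> b)\<bar> ^ 3) \<le> C3 * eta"
  by (rule third_moment[where g=W, OF _ assms], rule W_scaled)

lemma Rcav_third:
  assumes "0 \<le> t" "t \<le> pi / 2" "finite R" "a \<in> R" "b \<in> R" "a \<noteq> b"
  shows "C.E t R (\<lambda>\<tau>. \<bar>Rcav s (\<tau> a) (\<tau> b)\<bar> ^ 3) \<le> C3 * eta"
  by (rule third_moment[where g="Rcav s", OF _ assms], rule Rcav_scaled)

lemma W_first:
  assumes t: "0 \<le> t" "t \<le> pi / 2" and R: "finite R" "a \<in> R" "b \<in> R" "a \<noteq> b"
  shows "C.E t R (\<lambda>\<tau>. \<bar>W (\<tau> a) (\<tau> b)\<bar>) \<le> (1 + C3) / sqrt (real N)"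
proof -
  let ?z = "1 / sqrt (real N)"
  have z: "0 < ?z" using N by simp
  have first: "w \<le> ?z + real N * w ^ 3" if w: "0 \<le> w" for w
  proof (cases "w \<le> ?z")
    case True
    moreover have "0 \<le> real N * w ^ 3" using w by simp
    ultimately show ?thesis by linarith
  next
    case False
    then have "1 \<le> sqrt (real N) * w" using z by (simp add: field_simps)
    then have "1 * 1 \<le> (sqrt (real N) * w) * (sqrt (real N) * w)" by (intro mult_mono) auto
    also have "\<dots> = real N * w\<^sup>2" using sqrt_N(2) by (simp add: power2_eq_square mult_ac)
    finally have "1 * w \<le> real N * w\<^sup>2 * w" using w by (intro mult_right_mono) auto
    also have "\<dots> = real N * w ^ 3" by (simp add: power2_eq_square power3_eq_cube)
    finally show ?thesis using z by linarith
  qed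
  have "C.E t R (\<lambda>\<tau>. \<bar>W (\<tau> a) (\<tau> b)\<bar>) \<le> C.E t R (\<lambda>\<tau>. ?z + real N * \<bar>W (\<tau> a) (\<tau> b)\<bar> ^ 3)"
    by (rule C.E_mono[OF R(1) first]) simp
  also have "\<dots> = ?z + real N * C.E t R (\<lambda>\<tau>. \<bar>W (\<tau> a) (\<tau> b)\<bar> ^ 3)"
    by (simp only: C.E_cmult C.E_add[OF R(1)] C.E_const[OF R(1)])
  also have "\<dots> \<le> ?z + real N * (C3 * eta)"
    using W_third[OF t R] by (intro add_left_mono mult_left_mono) auto
  also have "\<dots> = (1 + C3) / sqrt (real N)" using N by (simp add: eta_def add_divide_distrib)
  finally show ?thesis .
qed

lemma triple_bound:
  fixes f :: "(nat \<Rightarrow> nat \<Rightarrow> real) \<Rightarrow> real"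
  assumes t: "0 \<le> t" "t \<le> pi / 2" and R: "finite R" "{k, k', l, l', a, b} \<subseteq> R" "k \<noteq> k'" "l \<noteq> l'" "a \<noteq> b" and M: "0 \<le> M"
    and f: "\<And>\<tau>. \<tau> \<in> R \<rightarrow>\<^sub>E S \<Longrightarrow> \<bar>f \<tau>\<bar> \<le> M * (\<bar>Rcav s (\<tau> k) (\<tau> k')\<bar> * \<bar>W (\<tau> l) (\<tau> l')\<bar>)"
  shows "C.E t R (\<lambda>\<tau>. \<bar>f \<tau>\<bar> * \<bar>W (\<tau> a) (\<tau> b)\<bar>) \<le> 3 * M * C3 * eta"
proof -
  have "C.E t R (\<lambda>\<tau>. \<bar>f \<tau>\<bar> * \<bar>W (\<tau> a) (\<tau> b)\<bar>)
    \<le> C.E t R (\<lambda>\<tau>. M * (\<bar>Rcav s (\<tau> k) (\<tau> k')\<bar> ^ 3 + \<bar>W (\<tau> l) (\<tau> l')\<bar> ^ 3 + \<bar>W (\<tau> a) (\<tau> b)\<bar> ^ 3))"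
  proof (rule C.E_mono[OF R(1)])
    fix \<tau> assume "\<tau> \<in> R \<rightarrow>\<^sub>E S"
    then have "\<bar>f \<tau>\<bar> * \<bar>W (\<tau> a) (\<tau> b)\<bar> \<le> M * (\<bar>Rcav s (\<tau> k) (\<tau> k')\<bar> * \<bar>W (\<tau> l) (\<tau> l')\<bar>) * \<bar>W (\<tau> a) (\<tau> b)\<bar>"
      by (intro mult_right_mono f) auto
    also have "\<dots> = M * (\<bar>Rcav s (\<tau> k) (\<tau> k')\<bar> * \<bar>W (\<tau> l) (\<tau> l')\<bar> * \<bar>W (\<tau> a) (\<tau> b)\<bar>)" by (simp only: mult.assoc)
    also have "\<dots> \<le> M * (\<bar>Rcav s (\<tau> k) (\<tau> k')\<bar> ^ 3 + \<bar>W (\<tau> l) (\<tau> l')\<bar> ^ 3 + \<bar>W (\<tau> a) (\<tau> b)\<bar> ^ 3)"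
      by (intro mult_left_mono prod_three_le_cubes M) auto
    finally show "\<bar>f \<tau>\<bar> * \<bar>W (\<tau> a) (\<tau> b)\<bar> \<le> M * (\<bar>Rcav s (\<tau> k) (\<tau> k')\<bar> ^ 3 + \<bar>W (\<tau> l) (\<tau> l')\<bar> ^ 3 + \<bar>W (\<tau> a) (\<tau> b)\<bar> ^ 3)" .
  qed
  also have "\<dots> = M * (C.E t R (\<lambda>\<tau>. \<bar>Rcav s (\<tau> k) (\<tau> k')\<bar> ^ 3) + C.E t R (\<lambda>\<tau>. \<bar>W (\<tau> l) (\<tau> l')\<bar> ^ 3) + C.E t R (\<lambda>\<tau>. \<bar>W (\<tau> a) (\<tau> b)\<bar> ^ 3))"
    by (simp only: C.E_cmult C.E_add[OF R(1)])
  also have "\<dots> \<le> M * (C3 * eta + C3 * eta + C3 * eta)"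
  proof (rule mult_left_mono[OF _ M], intro add_mono)
    show "C.E t R (\<lambda>\<tau>. \<bar>Rcav s (\<tau> k) (\<tau> k')\<bar> ^ 3) \<le> C3 * eta" by (rule Rcav_third[OF t]) (use R in auto)
    show "C.E t R (\<lambda>\<tau>. \<bar>W (\<tau> l) (\<tau> l')\<bar> ^ 3) \<le> C3 * eta" by (rule W_third[OF t]) (use R in auto)
    show "C.E t R (\<lambda>\<tau>. \<bar>W (\<tau> a) (\<tau> b)\<bar> ^ 3) \<le> C3 * eta" by (rule W_third[OF t]) (use R in auto)
  qed
  finally show ?thesis by (simp add: algebra_simps)
qed

end

section \<open>The cavity equation at one site\<close>

context cavity_moment
begin

text \<open>Three sources of error: moving along the path, replacing cavity quantities by overlaps of the full system, and the
contribution of site \<open>i0\<close> to the overlap of its own species.\<close>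

definition e1 :: real where "e1 = 504 * \<beta>\<^sup>2 * C3 * eta"
definition e2 :: real where "e2 = c_ov\<^sup>2 * (3 + 2 * C4) * eta"
definition e3 :: real where "e3 = 80 * \<beta>\<^sup>2 * (1 + C3) * c_ov * eta"

lemma e_nonneg: "0 \<le> e1" "0 \<le> e2" "0 \<le> e3"
  unfolding e1_def e2_def e3_def using C3_nonneg C4_nonneg c_ov(1) eta_pos by (auto intro!: mult_nonneg_nonneg less_imp_le)

text \<open>Four replicas enter \<open>overlap_moment\<close>; differentiation adds two fresh ones. The order matches the insertion of \<open>5\<close> and \<open>6\<close> into the first four.\<close>

abbreviation six_replicas :: "nat set" where "six_replicas \<equiv> {5, 6, 1, 2, 3, 4}"

definition field_cov :: "'a \<Rightarrow> nat \<Rightarrow> real" where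
  "field_cov t m = (\<Sum>u\<in>UNIV. D $ s0 $ u * lam $ u * overlap_moment m u t)"

lemma tanh_mom_4_bounds: "0 \<le> tanh_mom 4" "tanh_mom 4 \<le> 1"
proof -
  have b: "0 \<le> tanh y ^ 4" "tanh y ^ 4 \<le> 1" for y :: real
  proof -
    have e: "tanh y ^ 4 = ((tanh y)\<^sup>2)\<^sup>2" by (simp add: power_mult[symmetric])
    show "0 \<le> tanh y ^ 4" unfolding e by simp
    show "tanh y ^ 4 \<le> 1" unfolding e by (rule power_le_one) (simp, rule tanh_sq_le)
  qed
  show "0 \<le> tanh_mom 4" unfolding tanh_mom_def by (intro integral_nonneg_AE AE_I2 b)
  have "tanh_mom 4 \<le> (\<integral>u. 1 \<partial>std_normal_distribution)"
    unfolding tanh_mom_def by (rule integral_mono') (use b in auto)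
  also have "\<dots> = 1" using prob_space.prob_space[OF prob_space_std_normal] by simp
  finally show "tanh_mom 4 \<le> 1" .
qed

lemma site_cov_abs: "\<bar>site_cov m\<bar> \<le> 2"
proof -
  define z where "z = (q $ s0)\<^sup>2"
  have "0 \<le> z" "z \<le> 1" using q_nonneg[of s0] q_le[of s0] by (simp_all add: z_def abs_square_le_1)
  then show ?thesis
    unfolding site_cov_def z_def[symmetric] using tanh_mom_4_bounds q_nonneg[of s0] q_le[of s0] by (auto simp: abs_le_iff)
qed

lemma pair_config: "\<tau> \<in> R \<rightarrow>\<^sub>E S \<Longrightarrow> a \<in> R \<Longrightarrow> \<tau> a \<in> S" by (rule PiE_mem)

lemma spin_factor_abs:
  assumes "\<tau> \<in> R \<rightarrow>\<^sub>E S" "{1, 2, l, l'} \<subseteq> R"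
  shows "\<bar>(\<tau> 1 i0 * \<tau> 2 i0 - q $ s0) * (\<tau> l i0 * \<tau> l' i0)\<bar> \<le> 2"
proof -
  have a: "\<bar>\<tau> k i0\<bar> = 1" if "k \<in> {1, 2, l, l'}" for k
    by (rule spin_abs[OF pair_config[OF assms(1)] i0]) (use that assms(2) in blast)
  have "\<bar>\<tau> 1 i0 * \<tau> 2 i0\<bar> = 1" using a[of 1] a[of 2] by (simp add: abs_mult)
  then have "\<bar>\<tau> 1 i0 * \<tau> 2 i0 - q $ s0\<bar> \<le> 2" using q_nonneg[of s0] q_le[of s0] by linarith
  then show ?thesis using a[of l] a[of l'] by (simp add: abs_mult)
qed

text \<open>Cavity quantities differ from those of the full system by \<open>O(1/N)\<close>, and each product keeps one factor of order \<open>1 / sqrt N\<close>.\<close>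

lemma cavity_product_replace:
  assumes R: "{k, k', l, l'} \<subseteq> six_replicas" "k \<noteq> k'" "l \<noteq> l'"
  shows "\<bar>C.E (pi / 2) six_replicas (\<lambda>\<tau>. Rcav t (\<tau> k) (\<tau> k') * W (\<tau> l) (\<tau> l')) - field_cov t (card ({k, k'} \<inter> {l, l'}))\<bar> \<le> e2"
proof -
  have six_replicas: "finite six_replicas" by simp
  let ?lin = "\<lambda>\<tau>. \<Sum>u\<in>UNIV. D $ s0 $ u * lam $ u * Rbar u (\<tau> l) (\<tau> l')"
  have field_cov: "field_cov t (card ({k, k'} \<inter> {l, l'})) = C.E (pi / 2) six_replicas (\<lambda>\<tau>. Rbar t (\<tau> k) (\<tau> k') * ?lin \<tau>)"
  proof -
    have "C.E (pi / 2) six_replicas (\<lambda>\<tau>. Rbar t (\<tau> k) (\<tau> k') * ?lin \<tau>)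
      = C.E (pi / 2) six_replicas (\<lambda>\<tau>. \<Sum>u\<in>UNIV. (D $ s0 $ u * lam $ u) * (Rbar u (\<tau> l) (\<tau> l') * Rbar t (\<tau> k) (\<tau> k')))"
      by (rule C.E_cong) (simp add: sum_distrib_left mult_ac)
    also have "\<dots> = (\<Sum>u\<in>UNIV. (D $ s0 $ u * lam $ u) * F.E (pi / 2) six_replicas (\<lambda>\<tau>. Rbar u (\<tau> l) (\<tau> l') * Rbar t (\<tau> k) (\<tau> k')))"
      by (simp only: C.E_sum[OF six_replicas] C.E_cmult C_E_end)
    also have "\<dots> = field_cov t (card ({k, k'} \<inter> {l, l'}))"
      unfolding field_cov_def by (intro sum.cong refl, subst overlap_moment_pairs[OF six_replicas]) (use R in auto)
    finally show ?thesis by simp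
  qed
  have c0: "0 \<le> c_ov" using c_ov(1) by linarith
  have pt: "\<bar>Rcav t (\<tau> k) (\<tau> k') * W (\<tau> l) (\<tau> l') - Rbar t (\<tau> k) (\<tau> k') * ?lin \<tau>\<bar>
     \<le> c_ov\<^sup>2 * eta * (3 + ((real N * Y (\<tau> k) (\<tau> k'))\<^sup>2 + (real N * Y (\<tau> l) (\<tau> l'))\<^sup>2))" if \<tau>: "\<tau> \<in> six_replicas \<rightarrow>\<^sub>E S" for \<tau>
  proof -
    have S: "\<tau> k \<in> S" "\<tau> k' \<in> S" "\<tau> l \<in> S" "\<tau> l' \<in> S" by (rule pair_config[OF \<tau>], use R in blast)+
    let ?y = "overlap_size (\<tau> k) (\<tau> k')" and ?y' = "overlap_size (\<tau> l) (\<tau> l')" and ?n = "sqrt (real N)"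
    have n0: "0 < ?n" using sqrt_N(1) by linarith
    have w: "\<bar>W (\<tau> l) (\<tau> l')\<bar> \<le> c_ov * (?y' + 1) / ?n" using W_scaled[OF S(3,4)] n0 by (simp add: le_divide_eq mult.commute)
    have r: "\<bar>Rbar t (\<tau> k) (\<tau> k')\<bar> \<le> c_ov * ?y / ?n" using Rbar_scaled'[of t "\<tau> k" "\<tau> k'"] n0 by (simp add: le_divide_eq mult.commute)
    have "\<bar>W (\<tau> l) (\<tau> l') - ?lin \<tau>\<bar> = D $ s0 $ s0 / real N"
      unfolding W_eq[OF S(3,4)] using spin_abs[OF S(3) i0] spin_abs[OF S(4) i0] D_nonneg by (simp add: abs_mult abs_divide)
    then have d: "\<bar>W (\<tau> l) (\<tau> l') - ?lin \<tau>\<bar> \<le> c_ov / real N" using c_ov(5)[of s0 s0] by (simp add: divide_right_mono)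
    have "Rcav t (\<tau> k) (\<tau> k') * W (\<tau> l) (\<tau> l') - Rbar t (\<tau> k) (\<tau> k') * ?lin \<tau>
      = Rbar t (\<tau> k) (\<tau> k') * (W (\<tau> l) (\<tau> l') - ?lin \<tau>) + (Rcav t (\<tau> k) (\<tau> k') - Rbar t (\<tau> k) (\<tau> k')) * W (\<tau> l) (\<tau> l')"
      by (simp add: algebra_simps)
    then have "\<bar>Rcav t (\<tau> k) (\<tau> k') * W (\<tau> l) (\<tau> l') - Rbar t (\<tau> k) (\<tau> k') * ?lin \<tau>\<bar>
      \<le> \<bar>Rbar t (\<tau> k) (\<tau> k')\<bar> * \<bar>W (\<tau> l) (\<tau> l') - ?lin \<tau>\<bar> + \<bar>Rcav t (\<tau> k) (\<tau> k') - Rbar t (\<tau> k) (\<tau> k')\<bar> * \<bar>W (\<tau> l) (\<tau> l')\<bar>"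
      unfolding abs_mult[symmetric] by (simp only: abs_triangle_ineq)
    also have "\<dots> \<le> c_ov * ?y / ?n * (c_ov / real N) + c_ov / real N * (c_ov * (?y' + 1) / ?n)"
      by (intro add_mono mult_mono r d w Rcav_diff[OF S(1,2)]) (use c0 overlap_size_nonneg n0 in auto)
    also have "\<dots> = c_ov\<^sup>2 * eta * (?y + ?y' + 1)"
      unfolding eta_def by (simp add: power2_eq_square add_divide_distrib distrib_left mult_ac)
    also have "\<dots> \<le> c_ov\<^sup>2 * eta * (3 + ((real N * Y (\<tau> k) (\<tau> k'))\<^sup>2 + (real N * Y (\<tau> l) (\<tau> l'))\<^sup>2))"
    proof (rule mult_left_mono)
      have "z \<le> 1 + z ^ 4" if z: "0 \<le> z" for z :: real
      proof (cases "z \<le> 1")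
        case True
        then show ?thesis using zero_le_power[OF z, of 4] by linarith
      next
        case False
        then have "z ^ 1 \<le> z ^ 4" by (intro power_increasing) auto
        then show ?thesis by simp
      qed
      from this[OF overlap_size_nonneg[of "\<tau> k" "\<tau> k'"]] this[OF overlap_size_nonneg[of "\<tau> l" "\<tau> l'"]]
      show "?y + ?y' + 1 \<le> 3 + ((real N * Y (\<tau> k) (\<tau> k'))\<^sup>2 + (real N * Y (\<tau> l) (\<tau> l'))\<^sup>2)"
        unfolding overlap_size_pow4 by linarith
      show "0 \<le> c_ov\<^sup>2 * eta" using eta_pos by simp
    qed
    finally show ?thesis .
  qed
  have mom: "F.E (pi / 2) six_replicas (\<lambda>\<tau>. (real N * Y (\<tau> a) (\<tau> b))\<^sup>2) \<le> C4" if "{a, b} \<subseteq> six_replicas" "a \<noteq> b" for a b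
  proof -
    have "F.E (pi / 2) six_replicas (\<lambda>\<tau>. (real N * Y (\<tau> a) (\<tau> b))\<^sup>2) = F.E (pi / 2) {1, 2} (\<lambda>\<tau>. (real N * Y (\<tau> 1) (\<tau> 2))\<^sup>2)"
      by (rule F.E_two[where F="\<lambda>\<sigma> \<tau>. (real N * Y \<sigma> \<tau>)\<^sup>2", OF six_replicas]) (use that in auto)
    then show ?thesis using C4 by simp
  qed
  have "\<bar>C.E (pi / 2) six_replicas (\<lambda>\<tau>. Rcav t (\<tau> k) (\<tau> k') * W (\<tau> l) (\<tau> l')) - field_cov t (card ({k, k'} \<inter> {l, l'}))\<bar>
    = \<bar>C.E (pi / 2) six_replicas (\<lambda>\<tau>. Rcav t (\<tau> k) (\<tau> k') * W (\<tau> l) (\<tau> l') - Rbar t (\<tau> k) (\<tau> k') * ?lin \<tau>)\<bar>"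
    unfolding field_cov C.E_diff[OF six_replicas] ..
  also have "\<dots> \<le> C.E (pi / 2) six_replicas (\<lambda>\<tau>. \<bar>Rcav t (\<tau> k) (\<tau> k') * W (\<tau> l) (\<tau> l') - Rbar t (\<tau> k) (\<tau> k') * ?lin \<tau>\<bar>)"
    by (rule C.E_abs_le[OF six_replicas])
  also have "\<dots> \<le> C.E (pi / 2) six_replicas (\<lambda>\<tau>. c_ov\<^sup>2 * eta * (3 + ((real N * Y (\<tau> k) (\<tau> k'))\<^sup>2 + (real N * Y (\<tau> l) (\<tau> l'))\<^sup>2)))"
    by (rule C.E_mono[OF six_replicas pt])
  also have "\<dots> = c_ov\<^sup>2 * eta * (3 + (F.E (pi / 2) six_replicas (\<lambda>\<tau>. (real N * Y (\<tau> k) (\<tau> k'))\<^sup>2) + F.E (pi / 2) six_replicas (\<lambda>\<tau>. (real N * Y (\<tau> l) (\<tau> l'))\<^sup>2)))"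
    by (simp only: C.E_cmult C.E_add[OF six_replicas] C.E_const[OF six_replicas] C_E_end)
  also have "\<dots> \<le> c_ov\<^sup>2 * eta * (3 + (C4 + C4))"
    using R eta_pos by (intro mult_left_mono add_mono mom order_refl) auto
  also have "\<dots> = e2" by (simp add: e2_def mult_ac)
  finally show ?thesis .
qed

lemma depends_on_cavity_product:
  "{k, k', l, l'} \<subseteq> R \<Longrightarrow> depends_on R (\<lambda>\<tau>. Rcav t (\<tau> k) (\<tau> k') * W (\<tau> l) (\<tau> l'))"
  by (simp add: depends_on_def)

text \<open>A term of the derivative contains two small factors. Moving it along the path produces a third one, hence an error of order
\<open>N\<^sup>-\<^sup>3\<^sup>/\<^sup>2\<close>; at the decoupled end the spins at \<open>i0\<close> split off.\<close>

lemma pair_term: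
  assumes R: "{k, k', l, l'} \<subseteq> six_replicas" "k \<noteq> k'" "l \<noteq> l'" and T: "0 \<le> T" "T \<le> pi / 2"
  shows "\<bar>C.E T six_replicas (\<lambda>\<tau>. (\<tau> 1 i0 * \<tau> 2 i0 - q $ s0) * Rcav t (\<tau> k) (\<tau> k') * spin_field \<tau> l l')
      - C.E 0 six_replicas (\<lambda>\<tau>. (\<tau> 1 i0 * \<tau> 2 i0 - q $ s0) * Rcav t (\<tau> k) (\<tau> k') * spin_field \<tau> l l')\<bar> \<le> e1"
    and "\<bar>C.E 0 six_replicas (\<lambda>\<tau>. (\<tau> 1 i0 * \<tau> 2 i0 - q $ s0) * Rcav t (\<tau> k) (\<tau> k') * spin_field \<tau> l l')
      - site_cov (card ({1, 2} \<inter> {l, l'})) * field_cov t (card ({k, k'} \<inter> {l, l'}))\<bar> \<le> 2 * (e1 + e2)"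
proof -
  have six_replicas: "finite six_replicas" "7 \<notin> six_replicas" "8 \<notin> six_replicas" "7 \<noteq> (8::nat)" "card six_replicas = 6" by auto
  let ?g = "\<lambda>\<tau>. (\<tau> 1 i0 * \<tau> 2 i0 - q $ s0) * Rcav t (\<tau> k) (\<tau> k') * spin_field \<tau> l l'"
  let ?h = "\<lambda>\<tau>. Rcav t (\<tau> k) (\<tau> k') * W (\<tau> l) (\<tau> l')"
  let ?R8 = "insert 7 (insert 8 six_replicas)"
  have R8: "finite ?R8" by simp
  have sub: "six_replicas \<subseteq> ?R8" by auto
  have m6: "k \<in> six_replicas \<and> k' \<in> six_replicas \<and> l \<in> six_replicas \<and> l' \<in> six_replicas" using R(1) by (simp only: insert_subset)
  have one: "1 \<in> six_replicas \<and> 2 \<in> six_replicas" by simp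
  have s12: "{1, 2, l, l'} \<subseteq> six_replicas" using m6 one by (simp only: insert_subset empty_subsetI)
  have sub8: "{k, k', l, l', a, b} \<subseteq> ?R8" if "a \<in> ?R8" "b \<in> ?R8" for a b
    using subset_trans[OF R(1) sub] that by (simp only: insert_subset empty_subsetI)
  have geq: "?g = (\<lambda>\<tau>. (\<tau> 1 i0 * \<tau> 2 i0 - q $ s0) * (\<tau> l i0 * \<tau> l' i0) * ?h \<tau>)"
    by (simp add: spin_field_def fun_eq_iff mult_ac)
  have tri: "C.E T ?R8 (\<lambda>\<tau>. \<bar>f \<tau>\<bar> * \<bar>W (\<tau> a) (\<tau> b)\<bar>) \<le> 6 * C3 * eta"
    if "0 \<le> T" "T \<le> pi / 2" "a \<in> ?R8" "b \<in> ?R8" "a \<noteq> b"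
      and f: "\<And>\<tau>. \<tau> \<in> ?R8 \<rightarrow>\<^sub>E S \<Longrightarrow> \<bar>f \<tau>\<bar> \<le> 2 * (\<bar>Rcav t (\<tau> k) (\<tau> k')\<bar> * \<bar>W (\<tau> l) (\<tau> l')\<bar>)" for T a b f
  proof -
    have "C.E T ?R8 (\<lambda>\<tau>. \<bar>f \<tau>\<bar> * \<bar>W (\<tau> a) (\<tau> b)\<bar>) \<le> 3 * 2 * C3 * eta"
      by (rule triple_bound[where s=t, OF that(1,2) R8 sub8[OF that(3,4)] R(2,3) that(5) _ f]) simp_all
    then show ?thesis by simp
  qed
  have change: "\<bar>C.E T six_replicas f - C.E 0 six_replicas f\<bar> \<le> e1"
    if "depends_on six_replicas f" "\<And>\<tau>. \<tau> \<in> ?R8 \<rightarrow>\<^sub>E S \<Longrightarrow> \<bar>f \<tau>\<bar> \<le> 2 * (\<bar>Rcav t (\<tau> k) (\<tau> k')\<bar> * \<bar>W (\<tau> l) (\<tau> l')\<bar>)" "0 \<le> T" "T \<le> pi / 2" for f T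
  proof -
    have "\<bar>C.E T six_replicas f - C.E 0 six_replicas f\<bar> \<le> 2 * \<beta>\<^sup>2 * (real (card six_replicas) * (real (card six_replicas) + 1)) * (6 * C3 * eta)"
      by (rule C_E_change[OF six_replicas(1-4) that(1) _ that(3,4)], rule tri[OF _ _ _ _ _ that(2)])
    then show ?thesis unfolding six_replicas(5) e1_def by simp
  qed
  have dg: "depends_on six_replicas ?g"
    unfolding depends_on_def
  proof (intro allI impI)
    fix \<tau> \<tau>' :: "nat \<Rightarrow> nat \<Rightarrow> real" assume "\<forall>l\<in>six_replicas. \<tau> l = \<tau>' l"
    then have "\<tau> j = \<tau>' j" if "j \<in> six_replicas" for j using that by blast
    moreover have "1 \<in> six_replicas" "2 \<in> six_replicas" "k \<in> six_replicas" "k' \<in> six_replicas" "l \<in> six_replicas" "l' \<in> six_replicas" using m6 one by blast+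
    ultimately show "?g \<tau> = ?g \<tau>'" by (simp only: spin_field_def)
  qed
  have bg: "\<bar>?g \<tau>\<bar> \<le> 2 * (\<bar>Rcav t (\<tau> k) (\<tau> k')\<bar> * \<bar>W (\<tau> l) (\<tau> l')\<bar>)" if "\<tau> \<in> ?R8 \<rightarrow>\<^sub>E S" for \<tau>
  proof -
    have "\<bar>?g \<tau>\<bar> = \<bar>(\<tau> 1 i0 * \<tau> 2 i0 - q $ s0) * (\<tau> l i0 * \<tau> l' i0)\<bar> * \<bar>?h \<tau>\<bar>"
      unfolding abs_mult[symmetric] spin_field_def by (simp only: mult_ac)
    also have "\<dots> \<le> 2 * \<bar>?h \<tau>\<bar>"
      by (rule mult_right_mono[OF spin_factor_abs[OF that subset_trans[OF s12 sub]]]) simp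
    finally show ?thesis by (simp only: abs_mult)
  qed
  show "\<bar>C.E T six_replicas ?g - C.E 0 six_replicas ?g\<bar> \<le> e1" by (rule change[OF dg bg T])
  have h1: "\<bar>C.E (pi / 2) six_replicas ?h - C.E 0 six_replicas ?h\<bar> \<le> e1"
  proof (rule change[OF depends_on_cavity_product[OF R(1)]])
    fix \<tau> assume "\<tau> \<in> ?R8 \<rightarrow>\<^sub>E S"
    have "0 \<le> \<bar>Rcav t (\<tau> k) (\<tau> k')\<bar> * \<bar>W (\<tau> l) (\<tau> l')\<bar>" by simp
    then show "\<bar>?h \<tau>\<bar> \<le> 2 * (\<bar>Rcav t (\<tau> k) (\<tau> k')\<bar> * \<bar>W (\<tau> l) (\<tau> l')\<bar>)" unfolding abs_mult by linarith
  qed auto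
  have h2: "\<bar>C.E (pi / 2) six_replicas ?h - field_cov t (card ({k, k'} \<inter> {l, l'}))\<bar> \<le> e2" by (rule cavity_product_replace[OF R])
  have bl: "blind j ?h" for j
    unfolding blind_def by (simp add: W_flip Rcav_flip)
  have "C.E 0 six_replicas ?g = site_cov (card ({1, 2} \<inter> {l, l'})) * C.E 0 six_replicas ?h"
    unfolding geq by (rule C_E0_cov[OF six_replicas(1) s12 R(3) bl])
  then have "\<bar>C.E 0 six_replicas ?g - site_cov (card ({1, 2} \<inter> {l, l'})) * field_cov t (card ({k, k'} \<inter> {l, l'}))\<bar>
    = \<bar>site_cov (card ({1, 2} \<inter> {l, l'}))\<bar> * \<bar>C.E 0 six_replicas ?h - field_cov t (card ({k, k'} \<inter> {l, l'}))\<bar>"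
    by (simp only: abs_mult[symmetric] right_diff_distrib)
  also have "\<dots> \<le> 2 * (e1 + e2)"
    by (rule mult_mono[OF site_cov_abs]) (use h1 h2 in \<open>linarith | simp\<close>)+
  finally show "\<bar>C.E 0 six_replicas ?g - site_cov (card ({1, 2} \<inter> {l, l'})) * field_cov t (card ({k, k'} \<inter> {l, l'}))\<bar> \<le> 2 * (e1 + e2)" .
qed

text \<open>The value of the derivative at the decoupled end up to the errors: one covariance at \<open>i0\<close> times one covariance of overlaps for every
pair of replicas, with the coefficients of the replica form for four replicas (\<open>8 = 2 * 4\<close>, \<open>20 = 4 * 5\<close>).\<close>

definition pair_sum :: "'a \<Rightarrow> nat \<Rightarrow> nat \<Rightarrow> real" where
  "pair_sum t k k' = (\<Sum>l\<in>{1, 2, 3, 4}. \<Sum>l'\<in>{1, 2, 3, 4} - {l}. site_cov (card ({1, 2} \<inter> {l, l'})) * field_cov t (card ({k, k'} \<inter> {l, l'})))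
     - 8 * (\<Sum>l\<in>{1, 2, 3, 4}. site_cov (card ({1, 2} \<inter> {l, 5})) * field_cov t (card ({k, k'} \<inter> {l, 5})))
     + 20 * (site_cov (card ({1, 2} \<inter> {5, 6::nat})) * field_cov t (card ({k, k'} \<inter> {5, 6::nat})))"

text \<open>There are \<open>12 + 8 * 4 + 20 = 64\<close> terms counted with the size of their coefficients.\<close>

lemma pair_sum_perturb:
  fixes x y :: "nat \<Rightarrow> nat \<Rightarrow> real"
  assumes "\<And>l l'. l \<in> six_replicas \<Longrightarrow> l' \<in> six_replicas \<Longrightarrow> l \<noteq> l' \<Longrightarrow> \<bar>x l l' - y l l'\<bar> \<le> \<epsilon>"
  shows "\<bar>((\<Sum>l\<in>{1, 2, 3, 4}. \<Sum>l'\<in>{1, 2, 3, 4} - {l}. x l l') - 8 * (\<Sum>l\<in>{1, 2, 3, 4}. x l 5) + 20 * x 5 6)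
    - ((\<Sum>l\<in>{1, 2, 3, 4}. \<Sum>l'\<in>{1, 2, 3, 4} - {l}. y l l') - 8 * (\<Sum>l\<in>{1, 2, 3, 4}. y l 5) + 20 * y 5 6)\<bar> \<le> 64 * \<epsilon>"
proof -
  let ?R = "{1, 2, 3, 4 :: nat}" and ?z = "\<lambda>l l'. x l l' - y l l'"
  have 1: "\<bar>\<Sum>l\<in>?R. \<Sum>l'\<in>?R - {l}. ?z l l'\<bar> \<le> 12 * \<epsilon>"
  proof -
    have "\<bar>\<Sum>l\<in>?R. \<Sum>l'\<in>?R - {l}. ?z l l'\<bar> \<le> (\<Sum>l\<in>?R. \<Sum>l'\<in>?R - {l}. \<epsilon>)"
      by (intro order_trans[OF sum_abs] sum_mono assms) auto
    also have "\<dots> = (\<Sum>l\<in>?R. 3 * \<epsilon>)" by (intro sum.cong refl) (simp add: card_Diff_singleton)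
    finally show ?thesis by simp
  qed
  have 2: "\<bar>\<Sum>l\<in>?R. ?z l 5\<bar> \<le> 4 * \<epsilon>"
  proof -
    have "\<bar>\<Sum>l\<in>?R. ?z l 5\<bar> \<le> (\<Sum>l\<in>?R. \<epsilon>)" by (intro order_trans[OF sum_abs] sum_mono assms) auto
    then show ?thesis by simp
  qed
  have 3: "\<bar>?z 5 6\<bar> \<le> \<epsilon>" by (rule assms) auto
  define a b c where "a = (\<Sum>l\<in>?R. \<Sum>l'\<in>?R - {l}. ?z l l')" and "b = (\<Sum>l\<in>?R. ?z l 5)" and "c = ?z 5 6"
  have "((\<Sum>l\<in>?R. \<Sum>l'\<in>?R - {l}. x l l') - 8 * (\<Sum>l\<in>?R. x l 5) + 20 * x 5 6)
    - ((\<Sum>l\<in>?R. \<Sum>l'\<in>?R - {l}. y l l') - 8 * (\<Sum>l\<in>?R. y l 5) + 20 * y 5 6) = a - 8 * b + 20 * c"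
    unfolding a_def b_def c_def sum_subtractf by (simp only: right_diff_distrib)
  moreover have "\<bar>a - 8 * b + 20 * c\<bar> \<le> 64 * \<epsilon>"
    using 1 2 3 unfolding a_def[symmetric] b_def[symmetric] c_def[symmetric] by linarith
  ultimately show ?thesis by simp
qed

text \<open>Expand along the cavity path with the overlap restricted to the other sites. At the decoupled end the expectation vanishes because
\<open>\<tau> 1 i0 * \<tau> 2 i0\<close> has mean \<open>q\<close>; the derivative there is \<open>pair_sum\<close>, and the second-order remainder contains three small
factors.\<close>

theorem site_equation:
  assumes kk: "k \<in> {1, 2, 3, 4}" "k' \<in> {1, 2, 3, 4}" "k \<noteq> k'"
  shows "\<bar>F.E (pi / 2) {1, 2, 3, 4} (\<lambda>\<tau>. (\<tau> 1 i0 * \<tau> 2 i0 - q $ s0) * Rbar t (\<tau> k) (\<tau> k'))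
    - ((if t = s0 then site_cov (card ({1, 2} \<inter> {k, k'})) / real (card (I t)) else 0) + \<beta>\<^sup>2 / 2 * pair_sum t k k')\<bar>
    \<le> e3 + 32 * \<beta>\<^sup>2 * e1 + 64 * \<beta>\<^sup>2 * (e1 + e2)"
proof -
  let ?R = "{1, 2, 3, 4 :: nat}"
  have R: "finite ?R" "5 \<notin> ?R" "6 \<notin> ?R" "5 \<noteq> (6::nat)" "card ?R = 4" by auto
  let ?f = "\<lambda>\<tau>. (\<tau> 1 i0 * \<tau> 2 i0 - q $ s0) * Rcav t (\<tau> k) (\<tau> k')"
  let ?f2 = "\<lambda>\<tau>. (\<tau> 1 i0 * \<tau> 2 i0 - q $ s0) * (\<tau> k i0 * \<tau> k' i0)"
  let ?m = "card ({1, 2} \<inter> {k, k'})"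
  have kR: "{1, 2, k, k'} \<subseteq> ?R" using kk by blast
  have agree: "\<tau> 1 = \<tau>' 1 \<and> \<tau> 2 = \<tau>' 2 \<and> \<tau> k = \<tau>' k \<and> \<tau> k' = \<tau>' k'" if "\<forall>l\<in>?R. \<tau> l = \<tau>' l"
    for \<tau> \<tau>' :: "nat \<Rightarrow> nat \<Rightarrow> real" using that kR by blast
  have dep: "depends_on ?R ?f" "depends_on ?R ?f2"
    unfolding depends_on_def using agree by metis+
  have split: "F.E (pi / 2) ?R (\<lambda>\<tau>. (\<tau> 1 i0 * \<tau> 2 i0 - q $ s0) * Rbar t (\<tau> k) (\<tau> k'))
    = C.E (pi / 2) ?R ?f + (if t = s0 then C.E (pi / 2) ?R ?f2 / real (card (I t)) else 0)"
  proof (cases "t = s0")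
    case True
    have "(\<lambda>\<tau>. (\<tau> 1 i0 * \<tau> 2 i0 - q $ s0) * Rbar t (\<tau> k) (\<tau> k')) = (\<lambda>\<tau>. ?f \<tau> + 1 / real (card (I t)) * ?f2 \<tau>)"
      using True by (simp add: Rcav_eq fun_eq_iff algebra_simps)
    then show ?thesis using True by (simp only: C.E_add[OF R(1)] C.E_cmult C_E_end[symmetric]) simp
  next
    case False
    then show ?thesis by (simp add: Rcav_eq C_E_end)
  qed
  \<comment> \<open>Site \<open>i0\<close> itself contributes to the overlap of its own species; this term is of order \<open>1/N\<close>, so its value at time 0 suffices.\<close>
  have diag: "\<bar>(if t = s0 then C.E (pi / 2) ?R ?f2 / real (card (I t)) else 0) - (if t = s0 then site_cov ?m / real (card (I t)) else 0)\<bar> \<le> e3"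
  proof -
    have c: "C.E 0 ?R ?f2 = site_cov ?m"
      using C_E0_cov[OF R(1) kR kk(3), of "\<lambda>_. 1"] by (simp add: blind_def C.E_const)
    have "\<bar>C.E (pi / 2) ?R ?f2 - C.E 0 ?R ?f2\<bar> \<le> 2 * \<beta>\<^sup>2 * (real (card ?R) * (real (card ?R) + 1)) * (2 * ((1 + C3) / sqrt (real N)))"
    proof (rule C_E_change[OF R(1-4) dep(2)])
      fix T :: real and a b :: nat assume T: "0 \<le> T" "T \<le> pi / 2" and ab: "a \<in> six_replicas" "b \<in> six_replicas" "a \<noteq> b"
      have six_replicas: "finite six_replicas" by simp
      have "C.E T six_replicas (\<lambda>\<tau>. \<bar>?f2 \<tau>\<bar> * \<bar>W (\<tau> a) (\<tau> b)\<bar>) \<le> C.E T six_replicas (\<lambda>\<tau>. 2 * \<bar>W (\<tau> a) (\<tau> b)\<bar>)"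
      proof (rule C.E_mono[OF six_replicas])
        fix \<tau> assume \<tau>: "\<tau> \<in> six_replicas \<rightarrow>\<^sub>E S"
        show "\<bar>?f2 \<tau>\<bar> * \<bar>W (\<tau> a) (\<tau> b)\<bar> \<le> 2 * \<bar>W (\<tau> a) (\<tau> b)\<bar>"
          by (rule mult_right_mono[OF spin_factor_abs[OF \<tau>]]) (use kR in auto)
      qed
      also have "\<dots> = 2 * C.E T six_replicas (\<lambda>\<tau>. \<bar>W (\<tau> a) (\<tau> b)\<bar>)" by (rule C.E_cmult)
      also have "\<dots> \<le> 2 * ((1 + C3) / sqrt (real N))" by (rule mult_left_mono[OF W_first[OF T six_replicas ab]]) simp
      finally show "C.E T six_replicas (\<lambda>\<tau>. \<bar>?f2 \<tau>\<bar> * \<bar>W (\<tau> a) (\<tau> b)\<bar>) \<le> 2 * ((1 + C3) / sqrt (real N))" .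
    qed auto
    then have b: "\<bar>C.E (pi / 2) ?R ?f2 - site_cov ?m\<bar> \<le> 80 * \<beta>\<^sup>2 * (1 + C3) / sqrt (real N)" unfolding c R(5) by (simp add: distrib_left add_divide_distrib)
    show ?thesis
    proof (cases "t = s0")
      case True
      have ci: "1 / real (card (I t)) \<le> c_ov / real N"
        using divide_right_mono[OF c_ov(3)[of t], of "real N"] by (simp add: card_I)
      have "\<bar>C.E (pi / 2) ?R ?f2 / real (card (I t)) - site_cov ?m / real (card (I t))\<bar> = \<bar>C.E (pi / 2) ?R ?f2 - site_cov ?m\<bar> * (1 / real (card (I t)))"
        by (simp add: diff_divide_distrib[symmetric] abs_divide)
      also have "\<dots> \<le> (80 * \<beta>\<^sup>2 * (1 + C3) / sqrt (real N)) * (c_ov / real N)"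
        by (rule mult_mono[OF b ci]) (use C3_nonneg in auto)
      also have "\<dots> = e3" by (simp add: e3_def eta_def)
      finally show ?thesis using True by simp
    qed (use e_nonneg in simp)
  qed
  have zero: "C.E 0 ?R ?f = 0"
  proof -
    have bl: "blind l (\<lambda>\<tau>. Rcav t (\<tau> k) (\<tau> k'))" for l unfolding blind_def by (simp add: Rcav_flip)
    have "C.E 0 ?R ?f = C.E 0 ?R (\<lambda>\<tau>. \<tau> 1 i0 * (\<tau> 2 i0 * Rcav t (\<tau> k) (\<tau> k')) - q $ s0 * Rcav t (\<tau> k) (\<tau> k'))"
      by (rule C.E_cong) (simp add: algebra_simps)
    also have "\<dots> = tanh_mom 2 * C.E 0 ?R (\<lambda>\<tau>. Rcav t (\<tau> k) (\<tau> k')) - q $ s0 * C.E 0 ?R (\<lambda>\<tau>. Rcav t (\<tau> k) (\<tau> k'))"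
      unfolding C.E_diff[OF R(1)] C.E_cmult by (subst C_E0_spins(1)[OF R(1) bl]) auto
    finally show ?thesis by (simp add: tanh_mom_2)
  qed
  let ?x = "\<lambda>T l l'. C.E T six_replicas (\<lambda>\<tau>. ?f \<tau> * spin_field \<tau> l l')"
  let ?S = "\<lambda>x :: nat \<Rightarrow> nat \<Rightarrow> real. (\<Sum>l\<in>?R. \<Sum>l'\<in>?R - {l}. x l l') - 8 * (\<Sum>l\<in>?R. x l 5) + 20 * x 5 6"
  define d where "d = (\<lambda>T. \<beta>\<^sup>2 / 2 * ?S (?x T))"
  have D: "((\<lambda>t. C.E t ?R ?f) has_real_derivative 2 * (sin T * cos T) * d T) (at T)" for T
  proof (rule DERIV_cong[OF C_DERIV[OF R(1-4) dep(1)]])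
    have "C.E T six_replicas (\<lambda>\<tau>. ?f \<tau> * replica_form C.B ?R 5 6 \<tau>) = \<beta>\<^sup>2 * ?S (?x T)"
      unfolding C_E_pairs[OF R(1-4)] R(5) by simp
    then show "sin T * cos T * C.E T six_replicas (\<lambda>\<tau>. ?f \<tau> * replica_form C.B ?R 5 6 \<tau>) = 2 * (sin T * cos T) * d T"
      unfolding d_def by simp
  qed
  have kR6: "{k, k', l, l'} \<subseteq> six_replicas" if "l \<in> six_replicas" "l' \<in> six_replicas" for l l' using kk that by blast
  have scale: "\<bar>\<beta>\<^sup>2 / 2 * z\<bar> \<le> \<beta>\<^sup>2 / 2 * K" if "\<bar>z\<bar> \<le> K" for z K
    using mult_left_mono[OF that, of "\<beta>\<^sup>2 / 2"] by (simp add: abs_mult)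
  have dclose: "\<bar>d T - d 0\<bar> \<le> 32 * \<beta>\<^sup>2 * e1" if T: "0 \<le> T" "T \<le> pi / 2" for T
  proof -
    have "\<bar>?S (?x T) - ?S (?x 0)\<bar> \<le> 64 * e1"
      by (rule pair_sum_perturb) (rule pair_term(1)[OF kR6 kk(3) _ T])
    from scale[OF this] show ?thesis unfolding d_def right_diff_distrib[symmetric] by (rule order_trans) simp
  qed
  have "\<bar>C.E (pi / 2) ?R ?f - C.E 0 ?R ?f - d 0 * (sin (pi / 2))\<^sup>2\<bar> \<le> 32 * \<beta>\<^sup>2 * e1"
    by (rule sin_cos_taylor[OF D dclose]) auto
  then have main: "\<bar>C.E (pi / 2) ?R ?f - d 0\<bar> \<le> 32 * \<beta>\<^sup>2 * e1" unfolding zero by simp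
  have d0: "\<bar>d 0 - \<beta>\<^sup>2 / 2 * pair_sum t k k'\<bar> \<le> 64 * \<beta>\<^sup>2 * (e1 + e2)"
  proof -
    have "\<bar>?S (?x 0) - pair_sum t k k'\<bar> \<le> 64 * (2 * (e1 + e2))"
      unfolding pair_sum_def
      by (rule pair_sum_perturb[where y="\<lambda>l l'. site_cov (card ({1, 2} \<inter> {l, l'})) * field_cov t (card ({k, k'} \<inter> {l, l'}))"])
         (rule pair_term(2)[OF kR6 kk(3), of _ _ 0], auto)
    from scale[OF this] show ?thesis unfolding d_def right_diff_distrib[symmetric] by (rule order_trans) (simp add: algebra_simps)
  qed
  show ?thesis unfolding split using diag main d0 by linarith
qed

definition c_err :: real where
  "c_err = 80 * \<beta>\<^sup>2 * (1 + C3) * c_ov + 96 * \<beta>\<^sup>2 * (504 * \<beta>\<^sup>2 * C3) + 64 * \<beta>\<^sup>2 * (c_ov\<^sup>2 * (3 + 2 * C4))"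

lemma c_err: "e3 + 32 * \<beta>\<^sup>2 * e1 + 64 * \<beta>\<^sup>2 * (e1 + e2) = c_err * eta"
  unfolding c_err_def e1_def e2_def e3_def by (simp add: algebra_simps)

text \<open>Counting the pairs of replicas by the numbers of members they share with \<open>{1, 2}\<close> and with \<open>{k, k'}\<close>.\<close>

lemma pair_sum_2: "pair_sum t 1 2 / 2 = site_cov 2 * field_cov t 2 - 4 * site_cov 1 * field_cov t 1 + 3 * site_cov 0 * field_cov t 0"
  and pair_sum_1: "pair_sum t 1 3 / 2 = site_cov 2 * field_cov t 1 + site_cov 1 * field_cov t 2 - 2 * site_cov 1 * field_cov t 1 - 3 * site_cov 1 * field_cov t 0 - 3 * site_cov 0 * field_cov t 1 + 6 * site_cov 0 * field_cov t 0"
  and pair_sum_0: "pair_sum t 3 4 / 2 = site_cov 2 * field_cov t 0 + 4 * site_cov 1 * field_cov t 1 + site_cov 0 * field_cov t 2 - 8 * site_cov 1 * field_cov t 0 - 8 * site_cov 0 * field_cov t 1 + 10 * site_cov 0 * field_cov t 0"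
proof -
  have D: "{Suc 0, 2, 3, 4} - {Suc 0} = {2, 3, 4}" "{Suc 0, 2, 3, 4} - {2} = {Suc 0, 3, 4}" "{Suc 0, 2, 3, 4} - {3} = {Suc 0, 2, 4}" "{Suc 0, 2, 3, 4} - {4} = {Suc 0, 2, 3}" by auto
  have s: "(\<Sum>l\<in>{1, 2, 3, 4}. \<Sum>l'\<in>{1, 2, 3, 4} - {l}. f l l') = f 1 2 + f 1 3 + f 1 4 + (f 2 1 + f 2 3 + f 2 4) + (f 3 1 + f 3 2 + f 3 4) + (f 4 1 + f 4 2 + f (4::nat) (3::nat))" for f :: "nat \<Rightarrow> nat \<Rightarrow> real"
    by (simp add: D add.assoc)
  have s1: "(\<Sum>l\<in>{1, 2, 3, 4}. f l) = f 1 + f 2 + f 3 + f (4::nat)" for f :: "nat \<Rightarrow> real" by (simp add: add.assoc)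
  show "pair_sum t 1 2 / 2 = site_cov 2 * field_cov t 2 - 4 * site_cov 1 * field_cov t 1 + 3 * site_cov 0 * field_cov t 0"
    unfolding pair_sum_def s s1 by (simp add: numeral_2_eq_2[symmetric])
  show "pair_sum t 1 3 / 2 = site_cov 2 * field_cov t 1 + site_cov 1 * field_cov t 2 - 2 * site_cov 1 * field_cov t 1 - 3 * site_cov 1 * field_cov t 0 - 3 * site_cov 0 * field_cov t 1 + 6 * site_cov 0 * field_cov t 0"
    unfolding pair_sum_def s s1 by (simp add: numeral_2_eq_2[symmetric])
  show "pair_sum t 3 4 / 2 = site_cov 2 * field_cov t 0 + 4 * site_cov 1 * field_cov t 1 + site_cov 0 * field_cov t 2 - 8 * site_cov 1 * field_cov t 0 - 8 * site_cov 0 * field_cov t 1 + 10 * site_cov 0 * field_cov t 0"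
    unfolding pair_sum_def s s1 by (simp add: numeral_2_eq_2[symmetric])
qed

end

section \<open>Averaging over the sites and realising the disorder\<close>

lemma (in cavity) tanh_mom_4:
  "tanh_mom 4 = gauss_expectation (\<lambda>x. tanh (\<beta> * x * sqrt (v s0) + h) ^ 4)"
  by (simp add: tanh_mom_def gauss_expectation_def algebra_simps)

locale spin_glass_moment = spin_glass +
  fixes C4 :: real and qh :: "real^'a"
  assumes C4: "F.E (pi / 2) {1, 2} (\<lambda>\<tau>. (real N * Y (\<tau> 1) (\<tau> 2))\<^sup>2) \<le> C4"
    and qh: "\<And>s. qh $ s = gauss_expectation (\<lambda>x. tanh (\<beta> * x * sqrt (v s) + h) ^ 4)"
begin

text \<open>The value of \<open>site_cov\<close> for a site of species \<open>s\<close>; it is the same for all these sites.\<close>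

definition spin_cov :: "'a \<Rightarrow> nat \<Rightarrow> real" where
  "spin_cov s m = (if m = 2 then 1 else if m = 1 then q $ s else qh $ s) - (q $ s)\<^sup>2"

definition species_field_cov :: "'a \<Rightarrow> 'a \<Rightarrow> nat \<Rightarrow> real" where
  "species_field_cov s t m = (\<Sum>u\<in>UNIV. D $ s $ u * lam $ u * overlap_moment m u t)"

definition pair_combination :: "nat \<Rightarrow> 'a \<Rightarrow> 'a \<Rightarrow> real" where
  "pair_combination a s t = (if a = 2 then spin_cov s 2 * species_field_cov s t 2 - 4 * spin_cov s 1 * species_field_cov s t 1 + 3 * spin_cov s 0 * species_field_cov s t 0
     else if a = 1 then spin_cov s 2 * species_field_cov s t 1 + spin_cov s 1 * species_field_cov s t 2 - 2 * spin_cov s 1 * species_field_cov s t 1 - 3 * spin_cov s 1 * species_field_cov s t 0 - 3 * spin_cov s 0 * species_field_cov s t 1 + 6 * spin_cov s 0 * species_field_cov s t 0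
     else spin_cov s 2 * species_field_cov s t 0 + 4 * spin_cov s 1 * species_field_cov s t 1 + spin_cov s 0 * species_field_cov s t 2 - 8 * spin_cov s 1 * species_field_cov s t 0 - 8 * spin_cov s 0 * species_field_cov s t 1 + 10 * spin_cov s 0 * species_field_cov s t 0)"

lemma site_average:
  assumes a: "a \<in> {0, 1, 2}" and i: "i \<in> I s"
  shows "\<bar>F.E (pi / 2) {1, 2, 3, 4} (\<lambda>\<tau>. (\<tau> 1 i * \<tau> 2 i - q $ s) * Rbar t (\<tau> (fst (second_replica_pair a))) (\<tau> (snd (second_replica_pair a))))
     - ((if t = s then spin_cov s a / real (card (I t)) else 0) + \<beta>\<^sup>2 * pair_combination a s t)\<bar> \<le> cavity_moment.c_err D lam \<beta> C4 * eta"
proof -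
  have iN: "i \<in> {1..N}" using I_mem[OF i] by simp
  interpret c: cavity_moment D lam q \<beta> h N I i C4
    by unfold_locales (use iN C4 in auto)
  have s: "species_of i = s" by (rule species_of_eq[OF i])
  have spin_cov: "c.site_cov m = spin_cov s m" for m
    unfolding c.site_cov_def spin_cov_def c.tanh_mom_4 qh s by simp
  have field_cov: "c.field_cov t m = species_field_cov s t m" for m unfolding c.field_cov_def species_field_cov_def s ..
  define k k' where "k = fst (second_replica_pair a)" and "k' = snd (second_replica_pair a)"
  have kk: "k \<in> {1, 2, 3, 4}" "k' \<in> {1, 2, 3, 4}" "k \<noteq> k'" and card: "card ({1, 2} \<inter> {k, k'}) = a"
    using a by (auto simp: k_def k'_def second_replica_pair_def)
  have "c.pair_sum t k k' / 2 = pair_combination a s t"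
    using a c.pair_sum_0[of t] c.pair_sum_1[of t] c.pair_sum_2[of t] unfolding spin_cov field_cov
    by (auto simp: k_def k'_def second_replica_pair_def pair_combination_def)
  then have ps: "\<beta>\<^sup>2 / 2 * c.pair_sum t k k' = \<beta>\<^sup>2 * pair_combination a s t" by (simp add: algebra_simps)
  show ?thesis
    using c.site_equation[OF kk, of t] unfolding k_def[symmetric] k'_def[symmetric] card spin_cov s ps c.c_err unfolding k_def k'_def .
qed

text \<open>The equations of single sites averaged over a species, since the centered overlap of a species is the average of
\<open>\<tau> 1 i * \<tau> 2 i - q\<close> over its sites.\<close>

theorem species_equation:
  assumes a: "a \<in> {0, 1, 2}"
  shows "\<bar>overlap_moment a s t - ((if t = s then spin_cov s a / real (card (I t)) else 0) + \<beta>\<^sup>2 * pair_combination a s t)\<bar>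
    \<le> cavity_moment.c_err D lam \<beta> C4 * eta"
proof -
  let ?k = "fst (second_replica_pair a)" and ?k' = "snd (second_replica_pair a)"
  let ?n = "real (card (I s))"
  define T where "T = (if t = s then spin_cov s a / real (card (I t)) else 0) + \<beta>\<^sup>2 * pair_combination a s t"
  define x where "x = (\<lambda>i. F.E (pi / 2) {1, 2, 3, 4} (\<lambda>\<tau>. (\<tau> 1 i * \<tau> 2 i - q $ s) * Rbar t (\<tau> ?k) (\<tau> ?k')))"
  have x: "\<bar>x i - T\<bar> \<le> cavity_moment.c_err D lam \<beta> C4 * eta" if "i \<in> I s" for i
    unfolding x_def T_def by (rule site_average[OF a that])
  have n: "0 < ?n" using card_I_pos by simp
  have R: "Rbar s \<sigma> \<tau> = 1 / ?n * (\<Sum>i\<in>I s. \<sigma> i * \<tau> i - q $ s)" for \<sigma> \<tau>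
    using n by (simp add: Rbar_def sum_subtractf diff_divide_distrib)
  have "overlap_moment a s t = F.E (pi / 2) {1, 2, 3, 4} (\<lambda>\<tau>. 1 / ?n * (\<Sum>i\<in>I s. (\<tau> 1 i * \<tau> 2 i - q $ s) * Rbar t (\<tau> ?k) (\<tau> ?k')))"
    unfolding overlap_moment_def by (rule F.E_cong) (simp only: R[of "_ 1"] sum_distrib_right mult.assoc)
  also have "\<dots> = 1 / ?n * (\<Sum>i\<in>I s. x i)"
    unfolding x_def F.E_cmult by (subst F.E_sum) auto
  finally have "overlap_moment a s t - T = 1 / ?n * (\<Sum>i\<in>I s. x i - T)"
    using n by (simp add: sum_subtractf diff_divide_distrib)
  then have "\<bar>overlap_moment a s t - T\<bar> = 1 / ?n * \<bar>\<Sum>i\<in>I s. x i - T\<bar>" using n by (simp add: abs_mult)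
  also have "\<dots> \<le> 1 / ?n * (\<Sum>i\<in>I s. cavity_moment.c_err D lam \<beta> C4 * eta)"
    using n by (intro mult_left_mono order_trans[OF sum_abs] sum_mono x) auto
  also have "\<dots> = cavity_moment.c_err D lam \<beta> C4 * eta" using n by simp
  finally show ?thesis unfolding T_def .
qed

end

text \<open>The disorder enters only through its joint law, a product of centered Gaussians, which can be realised on the coordinates of a
standard Gaussian vector. With at least two sites the family of couplings is nonempty.\<close>

lemma (in spin_glass) distr_gaussian_couplings:
  assumes M: "gaussian_disorder D N I M g" and N2: "2 \<le> N"
  defines "L \<equiv> {(i, j). 1 \<le> i \<and> i < j \<and> j \<le> N}"
  shows "distr M (PiM L (\<lambda>_. borel)) (\<lambda>\<omega>. \<lambda>k\<in>L. g (fst k) (snd k) \<omega>)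
    = distr (gaussians K) (PiM L (\<lambda>_. borel)) (\<lambda>x. \<lambda>k\<in>L. sqrt (D $ species_of (fst k) $ species_of (snd k)) * x k)"
    and "\<And>k. k \<in> L \<Longrightarrow> g (fst k) (snd k) \<in> borel_measurable M"
proof -
  have "(1, 2) \<in> L" using N2 by (simp add: L_def)
  then have L0: "L \<noteq> {}" by blast
  have LK: "L \<subseteq> K" by (auto simp: L_def K_def)
  have finL: "finite L" using LK finite_K finite_subset by blast
  interpret M: prob_space M using M by (simp add: gaussian_disorder_def)
  have ind: "M.indep_vars (\<lambda>_. borel) (\<lambda>k. g (fst k) (snd k)) L"
    using M by (simp add: gaussian_disorder_def L_def case_prod_unfold)
  then show rv: "\<And>k. k \<in> L \<Longrightarrow> g (fst k) (snd k) \<in> borel_measurable M"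
    by (auto simp: M.indep_vars_def)
  have law: "distr M borel (g (fst k) (snd k)) = centered_gaussian (D $ species_of (fst k) $ species_of (snd k))" if "k \<in> L" for k
    using M that species_of_mem by (auto simp: gaussian_disorder_def L_def)
  have 1: "distr M (PiM L (\<lambda>_. borel)) (\<lambda>\<omega>. \<lambda>k\<in>L. g (fst k) (snd k) \<omega>) = PiM L (\<lambda>k. centered_gaussian (D $ species_of (fst k) $ species_of (snd k)))"
    using M.indep_vars_iff_distr_eq_PiM'[OF L0 rv, THEN iffD1, OF _ ind] law by (simp cong: PiM_cong)
  have comp: "distr (gaussians K) std_normal_distribution (\<lambda>x. x k) = std_normal_distribution" if "k \<in> L" for k
    using gaussian_product.PiM_component[of k K] that LK by blast
  have "distr (gaussians K) (PiM L (\<lambda>_. std_normal_distribution)) (\<lambda>x. \<lambda>k\<in>L. x k) = PiM L (\<lambda>k. distr (gaussians K) std_normal_distribution (\<lambda>x. x k))"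
    using gaussian_product.distr_PiM_restrict_finite[OF finL LK] comp
    by (simp add: restrict_def cong: PiM_cong)
  then have "prob_space.indep_vars (gaussians K) (\<lambda>_. std_normal_distribution) (\<lambda>k x. x k) L"
    by (subst prob_space.indep_vars_iff_distr_eq_PiM'[OF prob_space_gaussians L0]) (use LK in auto)
  then have ind2: "prob_space.indep_vars (gaussians K) (\<lambda>_. borel) (\<lambda>k x. sqrt (D $ species_of (fst k) $ species_of (snd k)) * x k) L"
    by (rule prob_space.indep_vars_compose2[OF prob_space_gaussians]) simp
  have rv2: "(\<lambda>x. sqrt (D $ species_of (fst k) $ species_of (snd k)) * x k) \<in> borel_measurable (gaussians K)" if "k \<in> L" for k
    using that LK by (intro borel_measurable_times borel_measurable_const measurable_gaussians_component) auto
  have law2: "distr (gaussians K) borel (\<lambda>x. sqrt (D $ species_of (fst k) $ species_of (snd k)) * x k) = centered_gaussian (D $ species_of (fst k) $ species_of (snd k))"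
    if "k \<in> L" for k
  proof -
    have "distr (distr (gaussians K) std_normal_distribution (\<lambda>x. x k)) borel (\<lambda>u. sqrt (D $ species_of (fst k) $ species_of (snd k)) * u)
      = distr (gaussians K) borel ((\<lambda>u. sqrt (D $ species_of (fst k) $ species_of (snd k)) * u) \<circ> (\<lambda>x. x k))"
      by (rule distr_distr) (use that LK in auto)
    then show ?thesis unfolding comp[OF that] by (simp add: centered_gaussian_def comp_def)
  qed
  have 2: "distr (gaussians K) (PiM L (\<lambda>_. borel)) (\<lambda>x. \<lambda>k\<in>L. sqrt (D $ species_of (fst k) $ species_of (snd k)) * x k) = PiM L (\<lambda>k. centered_gaussian (D $ species_of (fst k) $ species_of (snd k)))"
    using prob_space.indep_vars_iff_distr_eq_PiM'[OF prob_space_gaussians L0 rv2, THEN iffD1, OF _ ind2] law2 by (simp cong: PiM_cong)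
  show "distr M (PiM L (\<lambda>_. borel)) (\<lambda>\<omega>. \<lambda>k\<in>L. g (fst k) (snd k) \<omega>)
    = distr (gaussians K) (PiM L (\<lambda>_. borel)) (\<lambda>x. \<lambda>k\<in>L. sqrt (D $ species_of (fst k) $ species_of (snd k)) * x k)"
    unfolding 1 2 ..
qed

lemma (in spin_glass) nu_eq:
  assumes M: "gaussian_disorder D N I M g" and N2: "2 \<le> N"
  shows "nu \<beta> h N M g n f = F.E (pi / 2) {1..n} f"
proof -
  define L where "L = {(i, j). 1 \<le> i \<and> i < j \<and> j \<le> N}"
  have LK: "L \<subseteq> K" by (auto simp: L_def K_def)
  have finL: "finite L" using LK finite_K finite_subset by blast
  define Hy where "Hy = (\<lambda>y \<sigma>. h * (\<Sum>i\<in>{1..N}. \<sigma> i) + \<beta> / sqrt (real N) * (\<Sum>k\<in>L. y k * \<sigma> (fst k) * \<sigma> (snd k)))"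
  define \<Phi> where "\<Phi> = (\<lambda>y. ravg S (gibbs_prob S (Hy y)) {1..n} f)"
  have Hy_restrict: "Hy (\<lambda>k\<in>L. y k) = Hy y" for y unfolding Hy_def by (auto intro!: ext sum.cong)
  have m: "\<Phi> \<in> borel_measurable (PiM L (\<lambda>_. borel))"
    unfolding \<Phi>_def Hy_def by measurable
  have dsum: "(\<Sum>j\<in>{1..N}. \<Sum>i\<in>{1..<j}. F i j) = (\<Sum>k\<in>L. F (fst k) (snd k))" for F :: "nat \<Rightarrow> nat \<Rightarrow> real"
    unfolding L_def
    by (subst sum.Sigma) (auto intro!: sum.reindex_bij_witness[of _ "\<lambda>(i, j). (j, i)" "\<lambda>(j, i). (i, j)"])
  have ham: "hamiltonian \<beta> h N (\<lambda>i j. g i j \<omega>) \<sigma> = Hy (\<lambda>k. g (fst k) (snd k) \<omega>) \<sigma>" for \<omega> \<sigma>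
    unfolding hamiltonian_def Hy_def dsum by simp
  have rep: "replica_average \<beta> h N (\<lambda>i j. g i j \<omega>) n f = \<Phi> (\<lambda>k\<in>L. g (fst k) (snd k) \<omega>)" for \<omega>
  proof -
    have "gibbs_weight \<beta> h N (\<lambda>i j. g i j \<omega>) \<sigma> = gibbs_prob S (Hy (\<lambda>k. g (fst k) (snd k) \<omega>)) \<sigma>" for \<sigma>
      by (simp add: gibbs_weight_def partition_function_def gibbs_prob_def ham)
    then show ?thesis unfolding \<Phi>_def Hy_restrict by (simp add: replica_average_def ravg_def)
  qed
  have HF: "Hy (\<lambda>k\<in>L. sqrt (D $ species_of (fst k) $ species_of (snd k)) * x k) = F.H (pi / 2) x" for x
  proof
    fix \<sigma>
    have "F.H (pi / 2) x \<sigma> = bias \<sigma> + (\<Sum>k\<in>L. c_full k (pi / 2) * x k * coef k \<sigma>) + (\<Sum>i\<in>{1..N}. c_full (i, i) (pi / 2) * x (i, i) * coef (i, i) \<sigma>)"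
      unfolding F.H_def sum_K L_def by (simp add: case_prod_unfold)
    also have "(\<Sum>i\<in>{1..N}. c_full (i, i) (pi / 2) * x (i, i) * coef (i, i) \<sigma>) = 0" by (simp add: c_full_def)
    also have "(\<Sum>k\<in>L. c_full k (pi / 2) * x k * coef k \<sigma>) = (\<Sum>k\<in>L. \<beta> / sqrt (real N) * (sqrt (D $ species_of (fst k) $ species_of (snd k)) * x k * \<sigma> (fst k) * \<sigma> (snd k)))"
      by (intro sum.cong refl) (auto simp: c_full_def coef_def L_def)
    also have "bias \<sigma> + (\<Sum>k\<in>L. \<beta> / sqrt (real N) * (sqrt (D $ species_of (fst k) $ species_of (snd k)) * x k * \<sigma> (fst k) * \<sigma> (snd k))) + 0
      = Hy (\<lambda>k\<in>L. sqrt (D $ species_of (fst k) $ species_of (snd k)) * x k) \<sigma>"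
      unfolding Hy_restrict by (simp add: Hy_def bias_def sum_distrib_left)
    finally show "Hy (\<lambda>k\<in>L. sqrt (D $ species_of (fst k) $ species_of (snd k)) * x k) \<sigma> = F.H (pi / 2) x \<sigma>" ..
  qed
  note d = distr_gaussian_couplings[OF M N2, folded L_def]
  have mg: "(\<lambda>\<omega>. \<lambda>k\<in>L. g (fst k) (snd k) \<omega>) \<in> measurable M (PiM L (\<lambda>_. borel))"
    by (rule measurable_restrict) (rule d(2))
  have mx: "(\<lambda>x. \<lambda>k\<in>L. sqrt (D $ species_of (fst k) $ species_of (snd k)) * x k) \<in> measurable (gaussians K) (PiM L (\<lambda>_. borel))"
    by (rule measurable_restrict) (use LK in \<open>auto intro!: borel_measurable_times measurable_gaussians_component\<close>)
  have "nu \<beta> h N M g n f = (\<integral>y. \<Phi> y \<partial>distr M (PiM L (\<lambda>_. borel)) (\<lambda>\<omega>. \<lambda>k\<in>L. g (fst k) (snd k) \<omega>))"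
    unfolding nu_def rep by (rule integral_distr[OF mg m, symmetric])
  also have "\<dots> = (\<integral>x. \<Phi> (\<lambda>k\<in>L. sqrt (D $ species_of (fst k) $ species_of (snd k)) * x k) \<partial>gaussians K)"
    unfolding d(1) by (rule integral_distr[OF mx m])
  also have "\<dots> = F.E (pi / 2) {1..n} f" unfolding \<Phi>_def HF F.E_def ..
  finally show ?thesis .
qed

lemma (in spin_glass) U_eq_overlap_moment:
  assumes M: "gaussian_disorder D N I M g" and N2: "2 \<le> N"
  shows "U \<beta> h q N I M g a $ s $ t = overlap_moment a s t"
proof -
  have R4: "{1..4} = {1, 2, 3, 4::nat}" by auto
  have o: "(overlap I \<tau> k k' - q) $ s = Rbar s (\<tau> k) (\<tau> k')" for \<tau> k k' s
    by (simp add: overlap_def Rbar_def)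
  show ?thesis
    unfolding U_def overlap_moment_def by (simp only: split_beta Let_def vec_lambda_beta nu_eq[OF M N2] R4 o)
qed

section \<open>Solving the limiting linear system\<close>

lemma bounded_bilinear_matrix_mult:
  "bounded_bilinear ((**) :: real^'n^'m \<Rightarrow> real^'p^'n \<Rightarrow> real^'p^'m)"
  unfolding bilinear_conv_bounded_bilinear[symmetric] bilinear_def
  by (auto intro!: linearI simp: vec_eq_iff matrix_matrix_mult_def sum.distrib sum_distrib_left algebra_simps)

interpretation matrix_mult: bounded_bilinear "(**) :: real^'n^'m \<Rightarrow> real^'p^'n \<Rightarrow> real^'p^'m"
  by (rule bounded_bilinear_matrix_mult)

lemmas matrix_mult_simps = matrix_mult.add_left matrix_mult.add_right matrix_mult.diff_left
  matrix_mult.diff_right matrix_mult.scaleR_left matrix_mult.scaleR_right matrix_mul_assoc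

lemma matrix_inv:
  assumes "invertible (A :: real^'m^'m)"
  shows "A ** matrix_inv A = mat 1" "matrix_inv A ** A = mat 1"
  using someI_ex[OF assms[unfolded invertible_def]] by (auto simp: matrix_inv_def)

lemma tendsto_invertible_system:
  fixes T :: "real^'m^'m" and X :: "'b \<Rightarrow> real^'m^'m"
  assumes "invertible T" and "((\<lambda>x. T ** X x) \<longlongrightarrow> L) F"
  shows "(X \<longlongrightarrow> matrix_inv T ** L) F"
proof -
  have "((\<lambda>x. matrix_inv T ** (T ** X x)) \<longlongrightarrow> matrix_inv T ** L) F"
    by (rule matrix_mult.tendsto[OF tendsto_const assms(2)])
  then show ?thesis by (simp add: matrix_mul_assoc matrix_inv(2)[OF assms(1)])
qed

text \<open>Both sides arise from \<open>(I - b G B) G = G (I - b B G)\<close>.\<close>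

lemma matrix_inv_push_through:
  fixes G B :: "real^'m^'m"
  assumes "invertible (mat 1 - b *\<^sub>R (G ** B))" and "invertible (mat 1 - b *\<^sub>R (B ** G))"
  shows "matrix_inv (mat 1 - b *\<^sub>R (G ** B)) ** G = G ** matrix_inv (mat 1 - b *\<^sub>R (B ** G))"
    (is "matrix_inv ?T ** G = G ** matrix_inv ?T'")
proof -
  have "?T ** G = G ** ?T'" by (simp add: matrix_mult_simps)
  then have "matrix_inv ?T ** (?T ** G) ** matrix_inv ?T' = matrix_inv ?T ** (G ** ?T') ** matrix_inv ?T'" by simp
  also have "\<dots> = matrix_inv ?T ** G ** (?T' ** matrix_inv ?T')" by (simp only: matrix_mul_assoc)
  finally show ?thesis by (simp add: matrix_mul_assoc matrix_inv[OF assms(1)] matrix_inv[OF assms(2)])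
qed

text \<open>The combinations \<open>x = u0 - 2 u1 + u2\<close> and \<open>y = 3 u0 - 4 u1 + u2\<close> satisfy separate equations, because the three equations combine
with the same weights as the coefficients in \<open>G\<close> and \<open>G'\<close>. Once \<open>x\<close> and \<open>y\<close> converge,
\<open>u1\<close> and \<open>u2\<close> are \<open>u0\<close> plus known terms, and the equation for \<open>u0\<close> has the matrix of \<open>y\<close>.\<close>

theorem overlap_system_limit:
  fixes u0 u1 u2 :: "'b \<Rightarrow> real^'m^'m" and A0 A1 A2 B L G G' :: "real^'m^'m" and b :: real
  assumes e2: "((\<lambda>N. u2 N - A2 ** L - b *\<^sub>R (A2 ** (B ** u2 N) - 4 *\<^sub>R (A1 ** (B ** u1 N)) + 3 *\<^sub>R (A0 ** (B ** u0 N)))) \<longlongrightarrow> 0) F"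
    and e1: "((\<lambda>N. u1 N - A1 ** L - b *\<^sub>R (A2 ** (B ** u1 N) + A1 ** (B ** u2 N) - 2 *\<^sub>R (A1 ** (B ** u1 N))
      - 3 *\<^sub>R (A1 ** (B ** u0 N)) - 3 *\<^sub>R (A0 ** (B ** u1 N)) + 6 *\<^sub>R (A0 ** (B ** u0 N)))) \<longlongrightarrow> 0) F"
    and e0: "((\<lambda>N. u0 N - A0 ** L - b *\<^sub>R (A2 ** (B ** u0 N) + 4 *\<^sub>R (A1 ** (B ** u1 N)) + A0 ** (B ** u2 N)
      - 8 *\<^sub>R (A1 ** (B ** u0 N)) - 8 *\<^sub>R (A0 ** (B ** u1 N)) + 10 *\<^sub>R (A0 ** (B ** u0 N)))) \<longlongrightarrow> 0) F"
    and G: "G = A2 - 2 *\<^sub>R A1 + A0" and G': "G' = A2 - 4 *\<^sub>R A1 + 3 *\<^sub>R A0"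
    and inv: "invertible (mat 1 - b *\<^sub>R (G ** B))" "invertible (mat 1 - b *\<^sub>R (B ** G))"
    and inv': "invertible (mat 1 - b *\<^sub>R (G' ** B))" "invertible (mat 1 - b *\<^sub>R (B ** G'))"
  obtains S0 S1 S2 where "(u0 \<longlongrightarrow> S0) F" "(u1 \<longlongrightarrow> S1) F" "(u2 \<longlongrightarrow> S2) F"
    "S0 - 2 *\<^sub>R S1 + S2 = G ** matrix_inv (mat 1 - b *\<^sub>R (B ** G)) ** L"
    "3 *\<^sub>R S0 - 4 *\<^sub>R S1 + S2 = G' ** matrix_inv (mat 1 - b *\<^sub>R (B ** G')) ** L"
proof -
  let ?T = "mat 1 - b *\<^sub>R (G ** B)" and ?T' = "mat 1 - b *\<^sub>R (G' ** B)"
  define x y where "x = (\<lambda>N. u0 N - 2 *\<^sub>R u1 N + u2 N)" and "y = (\<lambda>N. 3 *\<^sub>R u0 N - 4 *\<^sub>R u1 N + u2 N)"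
  have "((\<lambda>N. ?T ** x N - G ** L) \<longlongrightarrow> 0 - 2 *\<^sub>R 0 + 0) F"
    by (rule tendsto_eq_rhs[OF Lim_transform_eventually[OF tendsto_add[OF tendsto_diff[OF e0 tendsto_scaleR[OF tendsto_const[of 2] e1]] e2]]])
       (auto simp: x_def G matrix_mult_simps vec_eq_iff algebra_simps)
  then have "((\<lambda>N. ?T ** x N) \<longlongrightarrow> G ** L) F" by (simp add: LIM_zero_iff)
  note x = tendsto_invertible_system[OF inv(1) this]
  have "((\<lambda>N. ?T' ** y N - G' ** L) \<longlongrightarrow> 3 *\<^sub>R 0 - 4 *\<^sub>R 0 + 0) F"
    by (rule tendsto_eq_rhs[OF Lim_transform_eventually[OF tendsto_add[OF tendsto_diff[OF tendsto_scaleR[OF tendsto_const[of 3] e0] tendsto_scaleR[OF tendsto_const[of 4] e1]] e2]]])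
       (auto simp: y_def G' matrix_mult_simps vec_eq_iff algebra_simps)
  then have "((\<lambda>N. ?T' ** y N) \<longlongrightarrow> G' ** L) F" by (simp add: LIM_zero_iff)
  note y = tendsto_invertible_system[OF inv'(1) this]
  let ?x = "matrix_inv ?T ** (G ** L)" and ?y = "matrix_inv ?T' ** (G' ** L)"
  \<comment> \<open>The part of the equation for \<open>u0\<close> that is known once \<open>x\<close> and \<open>y\<close> are, after the substitutions \<open>u1\<close> and \<open>u2\<close> below.\<close>
  define z where "z = (\<lambda>x y. A0 ** L + b *\<^sub>R ((2 *\<^sub>R A1 - 4 *\<^sub>R A0) ** (B ** (x - y)) + A0 ** (B ** (2 *\<^sub>R x - y))))"
  have z: "((\<lambda>N. z (x N) (y N)) \<longlongrightarrow> z ?x ?y) F"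
    unfolding z_def by (intro tendsto_intros matrix_mult.tendsto x y)
  have u1: "u1 N = u0 N + (1 / 2) *\<^sub>R (x N - y N)" and u2: "u2 N = u0 N + (2 *\<^sub>R x N - y N)" for N
    by (simp_all add: x_def y_def vec_eq_iff field_simps)
  have "((\<lambda>N. ?T' ** u0 N - z (x N) (y N)) \<longlongrightarrow> 0) F"
    by (rule Lim_transform_eventually[OF e0], rule always_eventually, rule allI)
       (simp add: u1 u2 z_def G' matrix_mult_simps vec_eq_iff algebra_simps)
  from tendsto_add[OF this z] have "((\<lambda>N. ?T' ** u0 N) \<longlongrightarrow> z ?x ?y) F" by simp
  note u0 = tendsto_invertible_system[OF inv'(1) this]
  let ?u = "matrix_inv ?T' ** z ?x ?y"
  show thesis
  proof (rule that[OF u0])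
    show "(u1 \<longlongrightarrow> ?u + (1 / 2) *\<^sub>R (?x - ?y)) F" "(u2 \<longlongrightarrow> ?u + (2 *\<^sub>R ?x - ?y)) F"
      unfolding u1 u2 by (intro tendsto_intros u0 x y)+
    have "?x = G ** matrix_inv (mat 1 - b *\<^sub>R (B ** G)) ** L"
      by (simp add: matrix_mul_assoc matrix_inv_push_through[OF inv])
    then show "?u - 2 *\<^sub>R (?u + (1 / 2) *\<^sub>R (?x - ?y)) + (?u + (2 *\<^sub>R ?x - ?y)) = G ** matrix_inv (mat 1 - b *\<^sub>R (B ** G)) ** L"
      by (simp add: vec_eq_iff field_simps)
    have "?y = G' ** matrix_inv (mat 1 - b *\<^sub>R (B ** G')) ** L"
      by (simp add: matrix_mul_assoc matrix_inv_push_through[OF inv'])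
    then show "3 *\<^sub>R ?u - 4 *\<^sub>R (?u + (1 / 2) *\<^sub>R (?x - ?y)) + (?u + (2 *\<^sub>R ?x - ?y)) = G' ** matrix_inv (mat 1 - b *\<^sub>R (B ** G')) ** L"
      by (simp add: vec_eq_iff field_simps)
  qed
qed

section \<open>High temperature\<close>

lemma beta_c_subcritical:
  assumes "0 \<le> spectral_radius (D ** diagonal lam)" "0 < c" "c < beta_c D lam"
  shows "c\<^sup>2 * spectral_radius (D ** diagonal lam) < 1"
proof -
  let ?r = "spectral_radius (D ** diagonal lam)"
  have r: "0 < ?r" using assms by (cases "?r = 0") (auto simp: beta_c_def)
  have "c\<^sup>2 < (?r powr (- 1 / 2))\<^sup>2" using assms(2,3) unfolding beta_c_def by (intro power_strict_mono) auto
  also have "\<dots> = ?r powr (- 1)" by (simp add: power2_eq_square powr_add[symmetric])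
  also have "\<dots> = 1 / ?r" using r by (simp add: powr_minus_divide)
  finally show ?thesis using r by (simp add: field_simps)
qed

lemma beta_0_subcritical:
  assumes "0 \<le> spectral_radius (D ** diagonal lam)" "0 < \<beta>" "\<beta> < beta_0 D lam"
  shows "4 * alpha D * \<beta>\<^sup>2 * spectral_radius (D ** diagonal lam) < 1"
proof -
  have a: "0 < alpha D" by (simp add: alpha_def)
  have "(\<beta> * sqrt (4 * alpha D))\<^sup>2 * spectral_radius (D ** diagonal lam) < 1"
    by (rule beta_c_subcritical) (use assms a in \<open>auto simp: beta_0_def field_simps\<close>)
  then show ?thesis using a by (simp add: power_mult_distrib mult_ac)
qed

lemma species_variance_eq:
  "((D ** diagonal lam) *v q) $ s = field_variance D lam q s"
  by (simp add: matrix_vector_mult_def matrix_matrix_mult_def diagonal_def field_variance_def if_distrib cong: if_cong)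

text \<open>The combination is the expectation of a quadratic polynomial in \<open>tanh\<^sup>2\<close>, whose values lie in \<open>[0, 1]\<close>. It yields
\<open>|gam| \<le> 1\<close> from \<open>(1 - u)\<^sup>2\<close> and \<open>|gam'| \<le> 1\<close> from \<open>1 - 4 u + 3 u\<^sup>2\<close>.\<close>

lemma tanh_moment_combination_le:
  fixes a b c h :: real
  assumes "\<And>u. 0 \<le> u \<Longrightarrow> u \<le> 1 \<Longrightarrow> \<bar>1 + b * u + c * u\<^sup>2\<bar> \<le> 1"
  shows "\<bar>1 + b * gauss_expectation (\<lambda>x. tanh (a * x * r + h) ^ 2) + c * gauss_expectation (\<lambda>x. tanh (a * x * r + h) ^ 4)\<bar> \<le> 1"
proof -
  define T where "T = (\<lambda>x. (tanh (a * x * r + h))\<^sup>2)"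
  have m: "T \<in> borel_measurable borel" unfolding T_def by measurable
  have T: "0 \<le> T x" "T x \<le> 1" for x using tanh_sq_le by (auto simp: T_def)
  have i: "integrable std_normal_distribution T" "integrable std_normal_distribution (\<lambda>x. (T x)\<^sup>2)"
    by (rule std_normal.integrable_const_bound[of _ 1]; use m T in \<open>auto simp: power_le_one abs_square_le_1\<close>)+
  have e: "gauss_expectation (\<lambda>x. tanh (a * x * r + h) ^ 4) = (\<integral>x. (T x)\<^sup>2 \<partial>std_normal_distribution)"
    unfolding gauss_expectation_def T_def by (simp flip: power_mult)
  have "1 + b * gauss_expectation T + c * (\<integral>x. (T x)\<^sup>2 \<partial>std_normal_distribution) = (\<integral>x. 1 + b * T x + c * (T x)\<^sup>2 \<partial>std_normal_distribution)"
    using i std_normal.prob_space by (simp add: gauss_expectation_def)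
  moreover have "\<bar>\<integral>x. 1 + b * T x + c * (T x)\<^sup>2 \<partial>std_normal_distribution\<bar> \<le> 1"
  proof -
    have "\<bar>\<integral>x. 1 + b * T x + c * (T x)\<^sup>2 \<partial>std_normal_distribution\<bar> \<le> (\<integral>x. \<bar>1 + b * T x + c * (T x)\<^sup>2\<bar> \<partial>std_normal_distribution)"
      by (rule integral_abs_bound)
    also have "\<dots> \<le> 1" using i by (intro std_normal.integral_le_const AE_I2 assms T) auto
    finally show ?thesis .
  qed
  ultimately show ?thesis unfolding e by (simp add: T_def)
qed

lemma tanh_sq_le_square: "(tanh (x::real))\<^sup>2 \<le> x\<^sup>2"
proof -
  have "tanh y \<le> y" if "0 \<le> y" for y :: real
  proof -
    have "0 - tanh 0 \<le> y - tanh y"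
    proof (rule DERIV_nonneg_imp_nondecreasing[OF that])
      fix z :: real
      have "((\<lambda>z. z - tanh z) has_real_derivative 1 - (1 - (tanh z)\<^sup>2)) (at z)"
        using cosh_real_pos[of z] by (auto intro!: derivative_eq_intros)
      then show "\<exists>d. ((\<lambda>z. z - tanh z) has_real_derivative d) (at z) \<and> 0 \<le> d" by force
    qed
    then show ?thesis by simp
  qed
  from this[of "\<bar>x\<bar>"] show ?thesis by (simp add: abs_le_square_iff[symmetric])
qed

text \<open>As \<open>tanh\<^sup>2 x \<le> x\<^sup>2\<close>, the vector \<open>q\<close> is dominated by its own image under \<open>\<beta>\<^sup>2 D \<Lambda>\<close>, whose spectral radius is below \<open>1\<close>.\<close>

lemma no_field_overlap_zero:
  fixes D :: "real^'m^'m" and lam q :: "real^'m"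
  assumes sym: "\<And>s t. D $ s $ t = D $ t $ s" and lam: "\<And>s. lam $ s > 0" and D: "\<And>s t. D $ s $ t \<ge> 0"
    and sub: "\<beta>\<^sup>2 * spectral_radius (D ** diagonal lam) < 1" and q: "\<And>s. 0 \<le> q $ s"
    and fp: "\<And>s. q $ s = gauss_expectation (\<lambda>x. tanh (\<beta> * x * sqrt (field_variance D lam q s) + 0) ^ 2)"
  shows "q = 0"
proof (rule subcritical_vector_zero[OF sym lam zero_le_power2 sub])
  fix s
  have v: "0 \<le> field_variance D lam q s" unfolding field_variance_def using D lam q by (intro sum_nonneg mult_nonneg_nonneg) (auto intro: less_imp_le)
  have i: "integrable std_normal_distribution (\<lambda>x. \<beta>\<^sup>2 * field_variance D lam q s * x\<^sup>2)"
    using integrable_std_normal_distribution_moment[of 2] by simp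
  have "q $ s \<le> (\<integral>x. \<beta>\<^sup>2 * field_variance D lam q s * x\<^sup>2 \<partial>std_normal_distribution)"
    unfolding fp[of s] gauss_expectation_def
  proof (rule integral_mono)
    show "integrable std_normal_distribution (\<lambda>x. (tanh (\<beta> * x * sqrt (field_variance D lam q s) + 0))\<^sup>2)"
      by (rule std_normal.integrable_const_bound[of _ 1]) (use tanh_sq_le in auto)
    show "(tanh (\<beta> * x * sqrt (field_variance D lam q s) + 0))\<^sup>2 \<le> \<beta>\<^sup>2 * field_variance D lam q s * x\<^sup>2" for x
      using tanh_sq_le_square[of "\<beta> * x * sqrt (field_variance D lam q s) + 0"] v by (simp add: power_mult_distrib mult_ac)
  qed (rule i)
  also have "\<dots> = \<beta>\<^sup>2 * field_variance D lam q s" using std_normal_distribution_even_moments(1)[of 1] by simp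
  finally show "\<bar>q $ s\<bar> \<le> \<beta>\<^sup>2 * (\<Sum>t\<in>UNIV. D $ s $ t * lam $ t * \<bar>q $ t\<bar>)"
    using q by (simp add: field_variance_def)
qed

text \<open>The form takes a positive value at the vector of ones, so a matrix that is not indefinite takes no negative value.\<close>

lemma definite_quadratic_form_nonneg:
  fixes D :: "real^'m^'m"
  assumes D: "\<And>s t. 0 \<le> D $ s $ t" "D \<noteq> 0" and "\<not> indefinite D"
  shows "0 \<le> y \<bullet> (D *v y)"
proof -
  have form: "(\<chi> s. 1) \<bullet> (D *v (\<chi> s. 1)) = (\<Sum>s\<in>UNIV. \<Sum>t\<in>UNIV. D $ s $ t)"
    by (simp add: inner_vec_def matrix_vector_mult_def)
  have "(\<Sum>s\<in>UNIV. \<Sum>t\<in>UNIV. D $ s $ t) \<noteq> 0"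
    using D by (auto simp: sum_nonneg_eq_0_iff sum_nonneg vec_eq_iff)
  moreover have "0 \<le> (\<Sum>s\<in>UNIV. \<Sum>t\<in>UNIV. D $ s $ t)" using D by (simp add: sum_nonneg)
  ultimately have "0 < (\<chi> s. 1) \<bullet> (D *v (\<chi> s. 1))" unfolding form by linarith
  then have "\<not> (\<exists>y. y \<bullet> (D *v y) < 0)" using assms(3) unfolding indefinite_def by blast
  then show ?thesis using not_less by blast
qed

context spin_glass
begin

lemma X_eq_quadratic_form:
  "X \<sigma> \<tau> = (\<chi> s. lam $ s * Rbar s \<sigma> \<tau>) \<bullet> (D *v (\<chi> s. lam $ s * Rbar s \<sigma> \<tau>))"
  by (simp add: X_def inner_vec_def matrix_vector_mult_def sum_distrib_left mult_ac)

text \<open>The rate \<open>\<kappa> = 2 \<alpha> \<beta>\<^sup>2 \<rho>\<close> meets the requirements of \<open>overlap_moment_interpolation\<close> in both cases of \<open>\<alpha>\<close>.\<close>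

lemma overlap_second_moment_field:
  assumes sub: "4 * alpha D * \<beta>\<^sup>2 * \<rho> < 1" and D0: "D \<noteq> 0"
  defines "\<delta> \<equiv> (1 / 2 - 2 * alpha D * \<beta>\<^sup>2 * \<rho>) / 2"
  shows "F.E (pi / 2) {1, 2} (\<lambda>\<tau>. (real N * Y (\<tau> 1) (\<tau> 2))\<^sup>2) \<le> 2 / \<delta>\<^sup>2 * (1 / sqrt (2 * \<delta>)) ^ CARD('m)"
proof -
  define \<kappa> where "\<kappa> = 2 * alpha D * \<beta>\<^sup>2 * \<rho>"
  have a: "1 \<le> alpha D" by (simp add: alpha_def)
  have br: "0 \<le> \<beta>\<^sup>2 * \<rho>" using rho_nonneg by simp
  have \<delta>: "0 < \<delta>" using sub by (simp add: \<delta>_def)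
  have "2 * \<beta>\<^sup>2 * \<rho> \<le> \<kappa>" using mult_right_mono[OF a br] by (simp add: \<kappa>_def)
  moreover have "0 \<le> \<kappa>" using mult_nonneg_nonneg[OF _ br, of "alpha D"] a by (simp add: \<kappa>_def mult_ac)
  moreover have "\<kappa> < 1 / 2" using sub by (simp add: \<kappa>_def)
  moreover have "(\<forall>\<sigma> \<tau>. 0 \<le> X \<sigma> \<tau>) \<or> 4 * \<beta>\<^sup>2 * \<rho> \<le> \<kappa>"
  proof (cases "indefinite D")
    case True
    then show ?thesis by (simp add: \<kappa>_def alpha_def)
  next
    case False
    then show ?thesis using definite_quadratic_form_nonneg[OF D_nonneg D0] by (simp add: X_eq_quadratic_form)
  qed
  ultimately have e: "F.E (pi / 2) {1, 2} (\<lambda>\<tau>. exp (\<delta> * real N * Y (\<tau> 1) (\<tau> 2))) \<le> (1 / sqrt (2 * \<delta>)) ^ CARD('m)"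
    using overlap_moment_interpolation[of \<kappa>] unfolding \<delta>_def \<kappa>_def by blast
  have "F.E (pi / 2) {1, 2} (\<lambda>\<tau>. (real N * Y (\<tau> 1) (\<tau> 2))\<^sup>2) \<le> F.E (pi / 2) {1, 2} (\<lambda>\<tau>. 2 / \<delta>\<^sup>2 * exp (\<delta> * real N * Y (\<tau> 1) (\<tau> 2)))"
  proof (rule F.E_mono)
    fix \<tau> :: "nat \<Rightarrow> nat \<Rightarrow> real"
    have "(\<delta> * real N * Y (\<tau> 1) (\<tau> 2))\<^sup>2 \<le> 2 * exp (\<delta> * real N * Y (\<tau> 1) (\<tau> 2))"
      using \<delta> Y_nonneg[of "\<tau> 1" "\<tau> 2"] by (intro square_le_exp mult_nonneg_nonneg) auto
    then show "(real N * Y (\<tau> 1) (\<tau> 2))\<^sup>2 \<le> 2 / \<delta>\<^sup>2 * exp (\<delta> * real N * Y (\<tau> 1) (\<tau> 2))"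
      using \<delta> by (simp add: power_mult_distrib field_simps)
  qed simp
  also have "\<dots> \<le> 2 / \<delta>\<^sup>2 * (1 / sqrt (2 * \<delta>)) ^ CARD('m)"
    unfolding F.E_cmult using e by (intro mult_left_mono) auto
  finally show ?thesis .
qed

end

text \<open>The moment bounds do not depend on the system size or on the partition into species, which is what the limit needs.\<close>

lemma spin_glass_moment_uniform:
  fixes D :: "real^'m^'m" and lam q qh :: "real^'m"
  assumes sg: "\<And>N. N \<in> A \<Longrightarrow> spin_glass D lam q \<beta> h N (I N)"
    and D0: "D \<noteq> 0" and r: "0 \<le> spectral_radius (D ** diagonal lam)"
    and temp: "(h \<ge> 0 \<and> 0 < \<beta> \<and> \<beta> < beta_0 D lam) \<or> (h = 0 \<and> 0 < \<beta> \<and> \<beta> < beta_c D lam)"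
    and qh: "\<And>s. qh $ s = gauss_expectation (\<lambda>x. tanh (\<beta> * x * sqrt (field_variance D lam q s) + h) ^ 4)"
  obtains C4 where "\<And>N. N \<in> A \<Longrightarrow> spin_glass_moment D lam q \<beta> h N (I N) C4 qh"
  using temp
proof (elim disjE conjE)
  assume b: "0 < \<beta>" "\<beta> < beta_0 D lam"
  note sub = beta_0_subcritical[OF r b]
  show thesis
    by (rule that, intro spin_glass_moment.intro spin_glass_moment_axioms.intro,
        erule sg, erule spin_glass.overlap_second_moment_field[OF sg sub D0], rule qh)
next
  assume h: "h = 0" and b: "0 < \<beta>" "\<beta> < beta_c D lam"
  note sub = beta_c_subcritical[OF r b]
  have q: "q $ s = 0" if N: "N \<in> A" for N s
  proof -
    interpret spin_glass D lam q \<beta> h N "I N" by (rule sg[OF N])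
    have "q = 0" by (rule no_field_overlap_zero[OF D_sym lam_pos D_nonneg sub q_nonneg fixpoint[unfolded h]])
    then show ?thesis by simp
  qed
  show thesis
    by (rule that, intro spin_glass_moment.intro spin_glass_moment_axioms.intro,
        erule sg, rule spin_glass.overlap_second_moment_no_field[OF sg h q sub], assumption, assumption, rule qh)
qed

section \<open>Convergence of the rescaled covariances\<close>

lemma diagonal_mult_nth:
  "(diagonal a ** X) $ s $ t = a $ s * X $ s $ t"
  by (simp add: matrix_matrix_mult_def diagonal_def if_distrib[of "\<lambda>x. x * _"] cong: if_cong)

lemma matrix_inv_diagonal:
  fixes lam :: "real^'m"
  assumes "\<And>s. lam $ s \<noteq> 0"
  shows "matrix_inv (diagonal lam) = diagonal (\<chi> s. 1 / lam $ s)"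
proof -
  have 1: "diagonal lam ** diagonal (\<chi> s. 1 / lam $ s) = mat 1" "diagonal (\<chi> s. 1 / lam $ s) ** diagonal lam = mat 1"
    using assms by (simp_all add: vec_eq_iff diagonal_mult_nth mat_def) (simp_all add: diagonal_def)
  then have "invertible (diagonal lam)" unfolding invertible_def by blast
  from matrix_inv(2)[OF this] have "matrix_inv (diagonal lam) ** (diagonal lam ** diagonal (\<chi> s. 1 / lam $ s)) = diagonal (\<chi> s. 1 / lam $ s)"
    by (simp add: matrix_mul_assoc)
  then show ?thesis unfolding 1 by simp
qed

context spin_glass_moment
begin

definition overlap_cov :: "nat \<Rightarrow> real^'a^'a" where
  "overlap_cov m = real N *\<^sub>R (\<chi> s t. overlap_moment m s t)"

lemma overlap_cov_mult:
  "(diagonal (\<chi> s. spin_cov s m) ** ((D ** diagonal lam) ** overlap_cov m')) $ s $ t = real N * (spin_cov s m * species_field_cov s t m')"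
proof -
  have "((D ** diagonal lam) ** overlap_cov m') $ s $ t = real N * species_field_cov s t m'"
    unfolding overlap_cov_def species_field_cov_def matrix_mult.scaleR_right
    by (simp add: matrix_matrix_mult_def diagonal_def if_distrib sum_distrib_left cong: if_cong)
  then show ?thesis by (simp add: diagonal_mult_nth)
qed

lemma overlap_cov_equation:
  assumes a: "a \<in> {0, 1, 2}"
  shows "\<bar>(overlap_cov a - diagonal (\<chi> s. spin_cov s a) ** diagonal (\<chi> s. 1 / lam $ s)) $ s $ t - real N * (\<beta>\<^sup>2 * pair_combination a s t)\<bar>
    \<le> cavity_moment.c_err D lam \<beta> C4 / sqrt (real N)"
proof -
  have N0: "0 < real N" using N by simp
  have "(overlap_cov a - diagonal (\<chi> s. spin_cov s a) ** diagonal (\<chi> s. 1 / lam $ s)) $ s $ t - real N * (\<beta>\<^sup>2 * pair_combination a s t)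
    = real N * (overlap_moment a s t - ((if t = s then spin_cov s a / real (card (I t)) else 0) + \<beta>\<^sup>2 * pair_combination a s t))"
    using N0 lam_pos[of t] unfolding vector_minus_component diagonal_mult_nth by (simp add: overlap_cov_def diagonal_def card_I algebra_simps)
  then have "\<bar>(overlap_cov a - diagonal (\<chi> s. spin_cov s a) ** diagonal (\<chi> s. 1 / lam $ s)) $ s $ t - real N * (\<beta>\<^sup>2 * pair_combination a s t)\<bar>
    = real N * \<bar>overlap_moment a s t - ((if t = s then spin_cov s a / real (card (I t)) else 0) + \<beta>\<^sup>2 * pair_combination a s t)\<bar>"
    by (simp add: abs_mult)
  also have "\<dots> \<le> real N * (cavity_moment.c_err D lam \<beta> C4 * eta)"
    by (intro mult_left_mono species_equation[OF a]) simp
  also have "\<dots> = cavity_moment.c_err D lam \<beta> C4 / sqrt (real N)" using N0 by (simp add: eta_def)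
  finally show ?thesis .
qed

text \<open>The three equations of a finite system in the shape of \<open>overlap_system_limit\<close>.\<close>

lemma overlap_system:
  fixes s t :: 'a
  defines "A \<equiv> (\<lambda>m. diagonal (\<chi> s. spin_cov s m))" and "B \<equiv> D ** diagonal lam" and "L \<equiv> diagonal (\<chi> s. 1 / lam $ s)"
    and "u \<equiv> overlap_cov" and "e \<equiv> cavity_moment.c_err D lam \<beta> C4 / sqrt (real N)"
  shows "\<bar>(u 2 - A 2 ** L - \<beta>\<^sup>2 *\<^sub>R (A 2 ** (B ** u 2) - 4 *\<^sub>R (A 1 ** (B ** u 1)) + 3 *\<^sub>R (A 0 ** (B ** u 0)))) $ s $ t\<bar> \<le> e" (is ?t2)
    and "\<bar>(u 1 - A 1 ** L - \<beta>\<^sup>2 *\<^sub>R (A 2 ** (B ** u 1) + A 1 ** (B ** u 2) - 2 *\<^sub>R (A 1 ** (B ** u 1))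
      - 3 *\<^sub>R (A 1 ** (B ** u 0)) - 3 *\<^sub>R (A 0 ** (B ** u 1)) + 6 *\<^sub>R (A 0 ** (B ** u 0)))) $ s $ t\<bar> \<le> e" (is ?t1)
    and "\<bar>(u 0 - A 0 ** L - \<beta>\<^sup>2 *\<^sub>R (A 2 ** (B ** u 0) + 4 *\<^sub>R (A 1 ** (B ** u 1)) + A 0 ** (B ** u 2)
      - 8 *\<^sub>R (A 1 ** (B ** u 0)) - 8 *\<^sub>R (A 0 ** (B ** u 1)) + 10 *\<^sub>R (A 0 ** (B ** u 0)))) $ s $ t\<bar> \<le> e" (is ?t0)
proof -
  have e: "(A m ** (B ** u m')) $ s $ t = real N * (spin_cov s m * species_field_cov s t m')" for m m'
    unfolding A_def B_def u_def by (rule overlap_cov_mult)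
  have eq: "\<bar>(u a - A a ** L) $ s $ t - real N * (\<beta>\<^sup>2 * pair_combination a s t)\<bar> \<le> e" if "a \<in> {0, 1, 2}" for a
    unfolding A_def L_def u_def e_def by (rule overlap_cov_equation[OF that])
  have P: "\<bar>(X - Y) $ s $ t\<bar> \<le> e" if "\<bar>X $ s $ t - p\<bar> \<le> e" "Y $ s $ t = p" for X Y :: "real^'a^'a" and p
    using that by simp
  show ?t2 by (rule P[OF eq[of 2]]) (simp_all add: pair_combination_def e algebra_simps)
  show ?t1 by (rule P[OF eq[of 1]]) (simp_all add: pair_combination_def e algebra_simps)
  show ?t0 by (rule P[OF eq[of 0]]) (simp_all add: pair_combination_def e algebra_simps)
qed

end

lemma matrix_tendsto_zero:
  fixes X :: "nat \<Rightarrow> real^'m^'m"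
  assumes "\<And>N s t. N \<in> A \<Longrightarrow> \<bar>X N $ s $ t\<bar> \<le> c / sqrt (real N)"
  shows "(X \<longlongrightarrow> 0) (inf sequentially (principal A))"
proof (intro vec_tendstoI)
  fix s t
  have c: "((\<lambda>N. c / sqrt (real N)) \<longlongrightarrow> 0) (inf sequentially (principal A))"
    by (rule tendsto_mono[OF inf_le1]) real_asymp
  show "((\<lambda>N. X N $ s $ t) \<longlongrightarrow> 0 $ s $ t) (inf sequentially (principal A))"
    unfolding zero_index
    by (rule Lim_null_comparison[OF _ c]) (simp add: eventually_inf_principal assms)
qed

theorem theorem1p13:
  fixes D :: "real^'m^'m" and lam :: "real^'m" and \<beta> h :: real
    and I :: "nat \<Rightarrow> 'm \<Rightarrow> nat set"
    and M :: "nat \<Rightarrow> 'w measure" and g :: "nat \<Rightarrow> nat \<Rightarrow> nat \<Rightarrow> 'w \<Rightarrow> real"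
    and q qhat gam gam' :: "real^'m"
    and Lam Gam Gam' :: "real^'m^'m"
  assumes "CARD('m) \<ge> 2"
    and "transpose D = D" and "invertible D" and "D \<noteq> 0" and "\<forall>s t. D $ s $ t \<ge> 0"
    and "\<forall>s. 0 < lam $ s \<and> lam $ s < 1"
    and "infinite (system_sizes lam)"
    and "\<forall>N\<in>system_sizes lam. species_partition lam N (I N)"
    and "\<forall>N\<in>system_sizes lam. gaussian_disorder D N (I N) (M N) (g N)"
    and "(h \<ge> 0 \<and> 0 < \<beta> \<and> \<beta> < beta_0 D lam) \<or> (h = 0 \<and> 0 < \<beta> \<and> \<beta> < beta_c D lam)"
    and "\<forall>s. 0 \<le> q $ s \<and> q $ s \<le> 1" and "q = tanh_moment \<beta> h D lam 2 q"
    and "qhat = tanh_moment \<beta> h D lam 4 q"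
    and "\<forall>s. gam $ s = 1 - 2 * q $ s + qhat $ s"
    and "\<forall>s. gam' $ s = 1 - 4 * q $ s + 3 * qhat $ s"
    and "Lam = diagonal lam" and "Gam = diagonal gam" and "Gam' = diagonal gam'"
  shows "\<exists>\<Sigma> :: nat \<Rightarrow> real^'m^'m.
      (\<forall>i\<in>{0, 1, 2}.
         ((\<lambda>N. real N *\<^sub>R U \<beta> h q N (I N) (M N) (g N) i) \<longlongrightarrow> \<Sigma> i)
           (inf sequentially (principal (system_sizes lam)))) \<and>
      invertible (mat 1 - \<beta>\<^sup>2 *\<^sub>R (D ** Lam ** Gam)) \<and>
      invertible (mat 1 - \<beta>\<^sup>2 *\<^sub>R (D ** Lam ** Gam')) \<and>
      \<Sigma> 0 - 2 *\<^sub>R \<Sigma> 1 + \<Sigma> 2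
        = Gam ** matrix_inv (mat 1 - \<beta>\<^sup>2 *\<^sub>R (D ** Lam ** Gam)) ** matrix_inv Lam \<and>
      3 *\<^sub>R \<Sigma> 0 - 4 *\<^sub>R \<Sigma> 1 + \<Sigma> 2
        = Gam' ** matrix_inv (mat 1 - \<beta>\<^sup>2 *\<^sub>R (D ** Lam ** Gam')) ** matrix_inv Lam"
proof -
  have sym: "D $ s $ t = D $ t $ s" for s t
    using arg_cong[OF assms(2), of "\<lambda>A. A $ s $ t"] by (simp add: transpose_def)
  have D: "0 \<le> D $ s $ t" and lam: "0 < lam $ s" "lam $ s < 1" for s t using assms(5,6) by auto
  have q: "0 \<le> q $ s" "q $ s \<le> 1" for s using assms(11) by auto
  have beta: "0 < \<beta>" using assms(10) by auto
  have fp: "q $ s = gauss_expectation (\<lambda>x. tanh (\<beta> * x * sqrt (field_variance D lam q s) + h) ^ 2)" for s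
    using arg_cong[OF assms(12), of "\<lambda>w. w $ s"] by (simp add: tanh_moment_def species_variance_eq)
  have qh: "qhat $ s = gauss_expectation (\<lambda>x. tanh (\<beta> * x * sqrt (field_variance D lam q s) + h) ^ 4)" for s
    using arg_cong[OF assms(13), of "\<lambda>w. w $ s"] by (simp add: tanh_moment_def species_variance_eq)
  have sg: "spin_glass D lam q \<beta> h N (I N)" if "N \<in> system_sizes lam" for N
    using that assms(8) by unfold_locales (auto simp: sym D lam beta q fp[symmetric] system_sizes_def)
  obtain N0 where "N0 \<in> system_sizes lam" using infinite_imp_nonempty[OF assms(7)] by blast
  then have r: "0 \<le> spectral_radius (D ** diagonal lam)" by (rule spin_glass.rho_nonneg[OF sg])
  obtain C4 where m: "\<And>N. N \<in> system_sizes lam \<Longrightarrow> spin_glass_moment D lam q \<beta> h N (I N) C4 qhat"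
    by (rule spin_glass_moment_uniform[OF sg assms(4) r assms(10) qh]) auto
  have sub: "\<beta>\<^sup>2 * spectral_radius (D ** diagonal lam) < 1"
    using assms(10)
  proof (elim disjE conjE)
    assume b: "0 < \<beta>" "\<beta> < beta_0 D lam"
    have "\<beta>\<^sup>2 * spectral_radius (D ** diagonal lam) \<le> 4 * alpha D * (\<beta>\<^sup>2 * spectral_radius (D ** diagonal lam))"
      using r mult_right_mono[of 1 "4 * alpha D" "\<beta>\<^sup>2 * spectral_radius (D ** diagonal lam)"] by (simp add: alpha_def)
    then show ?thesis using beta_0_subcritical[OF r b] by simp
  qed (rule beta_c_subcritical[OF r])
  have "\<bar>1 + (- 2) * u + 1 * u\<^sup>2\<bar> \<le> 1" if "0 \<le> u" "u \<le> 1" for u :: real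
  proof -
    have "1 + (- 2) * u + 1 * u\<^sup>2 = (1 - u)\<^sup>2" by (simp add: power2_eq_square algebra_simps)
    then show ?thesis using that by (simp add: abs_square_le_1)
  qed
  from tanh_moment_combination_le[OF this] have gam: "\<bar>gam $ s\<bar> \<le> 1" for s
    using assms(14) fp[of s] qh[of s] by simp
  have "\<bar>1 + (- 4) * u + 3 * u\<^sup>2\<bar> \<le> 1" if "0 \<le> u" "u \<le> 1" for u :: real
  proof -
    have "0 \<le> 3 * (u - 2 / 3)\<^sup>2" "0 \<le> u * (1 - u)" using that by auto
    then show ?thesis using that by (simp add: power2_eq_square algebra_simps abs_le_iff)
  qed
  from tanh_moment_combination_le[OF this] have gam': "\<bar>gam' $ s\<bar> \<le> 1" for s
    using assms(15) fp[of s] qh[of s] by simp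
  note inv = invertible_subcritical[OF sym lam(1) D zero_le_power2 sub]
  define A where "A = (\<lambda>m. diagonal (\<chi> s. spin_glass_moment.spin_cov q qhat s m))"
  define u where "u = (\<lambda>a N. real N *\<^sub>R U \<beta> h q N (I N) (M N) (g N) a)"
  \<comment> \<open>Since all \<open>lam $ s\<close> lie strictly between 0 and 1, a system of admissible size has at least two sites.\<close>
  have u: "u a N = spin_glass_moment.overlap_cov D lam q \<beta> h N (I N) a" if mem: "N \<in> system_sizes lam" for a N
  proof -
    interpret spin_glass_moment D lam q \<beta> h N "I N" C4 qhat by (rule m[OF mem])
    have "N \<noteq> 1"
    proof
      fix s :: 'm
      assume "N = 1"
      then have "lam $ s \<in> \<nat>" using mem by (simp add: system_sizes_def)
      then show False using lam[of s] by (auto elim!: Nats_cases)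
    qed
    then have N2: "2 \<le> N" using mem by (simp add: system_sizes_def)
    have "gaussian_disorder D N (I N) (M N) (g N)" using assms(9) mem by blast
    from U_eq_overlap_moment[OF this N2] show ?thesis by (simp add: u_def overlap_cov_def vec_eq_iff)
  qed
  have spin_cov: "A 2 = diagonal (\<chi> s. 1 - (q $ s)\<^sup>2)" "A 1 = diagonal (\<chi> s. q $ s - (q $ s)\<^sup>2)" "A 0 = diagonal (\<chi> s. qhat $ s - (q $ s)\<^sup>2)"
    by (simp_all add: A_def spin_glass_moment.spin_cov_def[OF m[OF \<open>N0 \<in> system_sizes lam\<close>]])
  have Gam: "Gam = A 2 - 2 *\<^sub>R A 1 + A 0" "Gam' = A 2 - 4 *\<^sub>R A 1 + 3 *\<^sub>R A 0"
    using assms(14,15) unfolding spin_cov assms(17,18) by (simp_all add: vec_eq_iff diagonal_def)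
  let ?F = "inf sequentially (principal (system_sizes lam))"
  let ?B = "D ** diagonal lam" and ?L = "diagonal (\<chi> s. 1 / lam $ s)"
  have e2: "((\<lambda>N. u 2 N - A 2 ** ?L - \<beta>\<^sup>2 *\<^sub>R (A 2 ** (?B ** u 2 N) - 4 *\<^sub>R (A 1 ** (?B ** u 1 N)) + 3 *\<^sub>R (A 0 ** (?B ** u 0 N)))) \<longlongrightarrow> 0) ?F"
    by (rule matrix_tendsto_zero, unfold A_def, simp only: u, rule spin_glass_moment.overlap_system(1)[OF m])
  have e1: "((\<lambda>N. u 1 N - A 1 ** ?L - \<beta>\<^sup>2 *\<^sub>R (A 2 ** (?B ** u 1 N) + A 1 ** (?B ** u 2 N) - 2 *\<^sub>R (A 1 ** (?B ** u 1 N))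
      - 3 *\<^sub>R (A 1 ** (?B ** u 0 N)) - 3 *\<^sub>R (A 0 ** (?B ** u 1 N)) + 6 *\<^sub>R (A 0 ** (?B ** u 0 N)))) \<longlongrightarrow> 0) ?F"
    by (rule matrix_tendsto_zero, unfold A_def, simp only: u, rule spin_glass_moment.overlap_system(2)[OF m])
  have e0: "((\<lambda>N. u 0 N - A 0 ** ?L - \<beta>\<^sup>2 *\<^sub>R (A 2 ** (?B ** u 0 N) + 4 *\<^sub>R (A 1 ** (?B ** u 1 N)) + A 0 ** (?B ** u 2 N)
      - 8 *\<^sub>R (A 1 ** (?B ** u 0 N)) - 8 *\<^sub>R (A 0 ** (?B ** u 1 N)) + 10 *\<^sub>R (A 0 ** (?B ** u 0 N)))) \<longlongrightarrow> 0) ?F"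
    by (rule matrix_tendsto_zero, unfold A_def, simp only: u, rule spin_glass_moment.overlap_system(3)[OF m])
  obtain S0 S1 S2 where S: "(u 0 \<longlongrightarrow> S0) ?F" "(u 1 \<longlongrightarrow> S1) ?F" "(u 2 \<longlongrightarrow> S2) ?F"
    "S0 - 2 *\<^sub>R S1 + S2 = Gam ** matrix_inv (mat 1 - \<beta>\<^sup>2 *\<^sub>R (?B ** Gam)) ** ?L"
    "3 *\<^sub>R S0 - 4 *\<^sub>R S1 + S2 = Gam' ** matrix_inv (mat 1 - \<beta>\<^sup>2 *\<^sub>R (?B ** Gam')) ** ?L"
    using overlap_system_limit[OF e2 e1 e0 Gam] inv[of gam] inv[of gam'] gam gam' unfolding assms(17,18) by metis
  have L: "matrix_inv Lam = ?L" unfolding assms(16) by (rule matrix_inv_diagonal) (use lam in \<open>simp add: less_imp_neq[symmetric]\<close>)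
  show ?thesis
  proof (intro exI[of _ "\<lambda>i. if i = 0 then S0 else if i = 1 then S1 else S2"] conjI ballI)
    show "invertible (mat 1 - \<beta>\<^sup>2 *\<^sub>R (D ** Lam ** Gam))" "invertible (mat 1 - \<beta>\<^sup>2 *\<^sub>R (D ** Lam ** Gam'))"
      unfolding assms(16-18) by (rule inv(1), rule gam gam')+
  qed (use S in \<open>auto simp: u_def L[unfolded assms(16)] assms(16)\<close>)
qed

end
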